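(* Let $(A,\rho)$ be a C*-probability space with $A\subseteq\mathbb{B}(H)$ for a Hilbert space $H$, and let $B\subset A$ be a C*-subalgebra. If the inclusion $B\subset(A,\rho)$ (with $A\subseteq\mathbb{B}(H)$) has the PHP property, then $B\subset(A,\rho)$ is a selfless inclusion.
   Context: **C*-probability spaces.** A C*-probability space $(A,\rho)$ is a unital C*-algebra $A$ with a state $\rho$ whose GNS representation is faithful (standing assumption on all states, except ultrapower states). Morphisms are unital state-preserving *-homomorphisms. An inclusion $B\subset(A,\rho)$ consists of a C*-probability space $(A,\rho)$ and a unital C*-subalgebra $B$ of $A$ with the restricted state $\rho|_B$. For an ultrafilter $\omega$ on a set $I$, $A^\omega=\ell^\infty(I,A)/\{(a_i):\lim_{i\to\omega}\|a_i\|=0\}$, with state $\rho^\omega((a_i)_i)=\lim_{i\to\omega}\rho(a_i)$; $B^\omega\subseteq A^\omega$ naturally. The symbol $*$ denotes the reduced free product of C*-probability spaces, with the free product state. **Selfless inclusions.** $B\subset(A,\rho)$ is selfless if there exist a free ultrafilter $\omega$, a C*-probability space $(C,\kappa)$ with $C\ne\mathbb{C}$, and a state-preserving unital embedding of C*-algebras $\sigma\colon A*C\to A^\omega$ such that the restriction of $\sigma$ to the first factor $A$ is the diagonal inclusion $A\to A^\omega$ and $\sigma(B*C)\subseteq B^\omega$ (equivalently $\sigma(C)\subseteq B^\omega$). **PHP property.** Let $A\subseteq\mathbb{B}(H)$ be faithfully and unitally represented. The inclusion $B\subset(A,\rho)$ has the PHP (Powers–Haagerup–Pisier) property if for all finite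 sets $F\subset\ker(\rho)$, all $\epsilon>0$ and all $n\in\mathbb{N}$, there exist unitaries $u_1,\dots,u_n\in U(B)$ and projections $P_i,P_i^+\in\mathbb{B}(H)$ with $P_i^+\le P_i$, $i=1,\ldots,n$, such that: 1. $(P_i)_{i=1}^n$ is a pairwise orthogonal family; 2. $u_iP_i^+u_i^*\le P_i^+$ and $u_i(1-P_i)u_i^*\le P_i^+$ for all $i$; 3. $\|P_ixP_j\|<\epsilon$ for all $x\in F$ and all $i,j$. *)

theory Defs
  imports "HOL-Analysis.Analysis" "HOL-Algebra.QuotRing" "HOL-Algebra.Subrings"
begin

section \<open>Unital C*-algebras\<close>

text \<open>
  Ultrapowers and free products depend on terms (an ultrafilter, two states), so C*-algebras are
  records with an explicit carrier, extending the rings of HOL-Algebra.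
\<close>

record 'a star_alg = "'a ring" +
  scl :: "complex \<Rightarrow> 'a \<Rightarrow> 'a"
  str :: "'a \<Rightarrow> 'a"

record 'a cstar = "'a star_alg" +
  nrm :: "'a \<Rightarrow> real"

definition cauchy_seqs :: "('a, 'm) cstar_scheme \<Rightarrow> (nat \<Rightarrow> 'a) set" where
  "cauchy_seqs M = {f. (\<forall>n. f n \<in> carrier M) \<and>
     (\<forall>e>0. \<exists>N. \<forall>m\<ge>N. \<forall>n\<ge>N. nrm M (f m \<ominus>\<^bsub>M\<^esub> f n) < e)}"

definition converges_to :: "('a, 'm) cstar_scheme \<Rightarrow> (nat \<Rightarrow> 'a) \<Rightarrow> 'a \<Rightarrow> bool" where
  "converges_to M f x \<longleftrightarrow> (\<lambda>n. nrm M (f n \<ominus>\<^bsub>M\<^esub> x)) \<longlonglongrightarrow> 0"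

locale cstar_algebra = ring M for M :: "('a, 'm) cstar_scheme" (structure) +
  assumes scl_closed: "x \<in> carrier M \<Longrightarrow> scl M c x \<in> carrier M"
    and scl_add_right: "\<lbrakk>x \<in> carrier M; y \<in> carrier M\<rbrakk> \<Longrightarrow> scl M c (x \<oplus> y) = scl M c x \<oplus> scl M c y"
    and scl_add_left: "x \<in> carrier M \<Longrightarrow> scl M (c + d) x = scl M c x \<oplus> scl M d x"
    and scl_scl: "x \<in> carrier M \<Longrightarrow> scl M c (scl M d x) = scl M (c * d) x"
    and scl_one: "x \<in> carrier M \<Longrightarrow> scl M 1 x = x"
    and scl_mult_left: "\<lbrakk>x \<in> carrier M; y \<in> carrier M\<rbrakk> \<Longrightarrow> scl M c x \<otimes> y = scl M c (x \<otimes> y)"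
    and scl_mult_right: "\<lbrakk>x \<in> carrier M; y \<in> carrier M\<rbrakk> \<Longrightarrow> x \<otimes> scl M c y = scl M c (x \<otimes> y)"
    and str_closed: "x \<in> carrier M \<Longrightarrow> str M x \<in> carrier M"
    and str_str: "x \<in> carrier M \<Longrightarrow> str M (str M x) = x"
    and str_add: "\<lbrakk>x \<in> carrier M; y \<in> carrier M\<rbrakk> \<Longrightarrow> str M (x \<oplus> y) = str M x \<oplus> str M y"
    and str_scl: "x \<in> carrier M \<Longrightarrow> str M (scl M c x) = scl M (cnj c) (str M x)"
    and str_mult: "\<lbrakk>x \<in> carrier M; y \<in> carrier M\<rbrakk> \<Longrightarrow> str M (x \<otimes> y) = str M y \<otimes> str M x"
    and nrm_nonneg: "x \<in> carrier M \<Longrightarrow> 0 \<le> nrm M x"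
    and nrm_eq_0: "x \<in> carrier M \<Longrightarrow> nrm M x = 0 \<longleftrightarrow> x = \<zero>"
    and nrm_add: "\<lbrakk>x \<in> carrier M; y \<in> carrier M\<rbrakk> \<Longrightarrow> nrm M (x \<oplus> y) \<le> nrm M x + nrm M y"
    and nrm_scl: "x \<in> carrier M \<Longrightarrow> nrm M (scl M c x) = cmod c * nrm M x"
    and nrm_mult: "\<lbrakk>x \<in> carrier M; y \<in> carrier M\<rbrakk> \<Longrightarrow> nrm M (x \<otimes> y) \<le> nrm M x * nrm M y"
    and cstar_identity: "x \<in> carrier M \<Longrightarrow> nrm M (str M x \<otimes> x) = (nrm M x)\<^sup>2"
    and complete: "f \<in> cauchy_seqs M \<Longrightarrow> \<exists>x\<in>carrier M. converges_to M f x"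

definition cstar_subalgebra :: "('a, 'm) cstar_scheme \<Rightarrow> 'a set \<Rightarrow> bool" where
  "cstar_subalgebra M B \<longleftrightarrow> subring B M \<and>
     (\<forall>x\<in>B. (\<forall>c. scl M c x \<in> B) \<and> str M x \<in> B) \<and>
     (\<forall>f. \<forall>x\<in>carrier M. (\<forall>n. f n \<in> B) \<and> converges_to M f x \<longrightarrow> x \<in> B)"

definition cstar_generated :: "('a, 'm) cstar_scheme \<Rightarrow> 'a set \<Rightarrow> 'a set" where
  "cstar_generated M S = carrier M \<inter> \<Inter>{B. cstar_subalgebra M B \<and> S \<subseteq> B}"

definition cstar_hom :: "('a, 'm) star_alg_scheme \<Rightarrow> ('b, 'n) star_alg_scheme \<Rightarrow> ('a \<Rightarrow> 'b) set" where
  "cstar_hom M N = {h \<in> ring_hom M N. \<forall>x\<in>carrier M.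
     (\<forall>c. h (scl M c x) = scl N c (h x)) \<and> h (str M x) = str N (h x)}"

definition cstar_unitary :: "('a, 'm) star_alg_scheme \<Rightarrow> 'a \<Rightarrow> bool" where
  "cstar_unitary M u \<longleftrightarrow> u \<in> carrier M \<and>
     str M u \<otimes>\<^bsub>M\<^esub> u = \<one>\<^bsub>M\<^esub> \<and> u \<otimes>\<^bsub>M\<^esub> str M u = \<one>\<^bsub>M\<^esub>"

section \<open>States and C*-probability spaces\<close>

definition cstar_state :: "('a, 'm) star_alg_scheme \<Rightarrow> ('a \<Rightarrow> complex) \<Rightarrow> bool" where
  "cstar_state M \<rho> \<longleftrightarrow>
     (\<forall>x\<in>carrier M. \<forall>y\<in>carrier M. \<rho> (x \<oplus>\<^bsub>M\<^esub> y) = \<rho> x + \<rho> y) \<and>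
     (\<forall>x\<in>carrier M. \<forall>c. \<rho> (scl M c x) = c * \<rho> x) \<and>
     (\<forall>x\<in>carrier M. \<rho> (str M x \<otimes>\<^bsub>M\<^esub> x) \<in> \<real>\<^sub>\<ge>\<^sub>0) \<and>
     \<rho> \<one>\<^bsub>M\<^esub> = 1"

text \<open>
  \<open>gns_vec M \<rho> b\<close> is the vector of \<open>b\<close> in the quotient of \<open>M\<close> by \<open>{x. \<rho> (x\<^sup>* x) = 0}\<close>, the dense
  subspace of the GNS Hilbert space on which the GNS representation acts by left multiplication.
  A bounded operator is determined on this subspace, so the completion does not affect injectivity
  or operator norms.
\<close>

definition gns_vec :: "('a, 'm) star_alg_scheme \<Rightarrow> ('a \<Rightarrow> complex) \<Rightarrow> 'a \<Rightarrow> 'a set" where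
  "gns_vec M \<rho> b =
     {b' \<in> carrier M. \<rho> (str M (b' \<ominus>\<^bsub>M\<^esub> b) \<otimes>\<^bsub>M\<^esub> (b' \<ominus>\<^bsub>M\<^esub> b)) = 0}"

definition gns_rep :: "('a, 'm) star_alg_scheme \<Rightarrow> ('a \<Rightarrow> complex) \<Rightarrow> 'a \<Rightarrow> 'a set \<Rightarrow> 'a set" where
  "gns_rep M \<rho> a = (\<lambda>X\<in>gns_vec M \<rho> ` carrier M. \<Union>b\<in>X. gns_vec M \<rho> (a \<otimes>\<^bsub>M\<^esub> b))"

definition gns_norm :: "('a, 'm) star_alg_scheme \<Rightarrow> ('a \<Rightarrow> complex) \<Rightarrow> 'a \<Rightarrow> real" where
  "gns_norm M \<rho> a =
     (SUP b\<in>{b \<in> carrier M. Re (\<rho> (str M b \<otimes>\<^bsub>M\<^esub> b)) \<le> 1}.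
        sqrt (Re (\<rho> (str M (a \<otimes>\<^bsub>M\<^esub> b) \<otimes>\<^bsub>M\<^esub> (a \<otimes>\<^bsub>M\<^esub> b)))))"

definition cstar_probability_space :: "('a, 'm) cstar_scheme \<Rightarrow> ('a \<Rightarrow> complex) \<Rightarrow> bool" where
  "cstar_probability_space M \<rho> \<longleftrightarrow>
     cstar_algebra M \<and> cstar_state M \<rho> \<and> inj_on (gns_rep M \<rho>) (carrier M)"

section \<open>Sequence algebras modulo null sequences\<close>

definition pointwise :: "('a, 'm) cstar_scheme \<Rightarrow> ('i \<Rightarrow> 'a) set \<Rightarrow> ('i \<Rightarrow> 'a) cstar" where
  "pointwise M S = \<lparr>carrier = S,
     mult = \<lambda>f g i. f i \<otimes>\<^bsub>M\<^esub> g i, one = \<lambda>_. \<one>\<^bsub>M\<^esub>,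
     zero = \<lambda>_. \<zero>\<^bsub>M\<^esub>, add = \<lambda>f g i. f i \<oplus>\<^bsub>M\<^esub> g i,
     scl = \<lambda>c f i. scl M c (f i), str = \<lambda>f i. str M (f i),
     nrm = \<lambda>f. SUP i. nrm M (f i)\<rparr>"

definition cstar_quot :: "('a, 'm) cstar_scheme \<Rightarrow> 'a set \<Rightarrow> 'a set cstar" where
  "cstar_quot M J = \<lparr>carrier = carrier (M Quot J),
     mult = mult (M Quot J), one = one (M Quot J),
     zero = zero (M Quot J), add = add (M Quot J),
     scl = \<lambda>c X. \<Union>x\<in>X. J +>\<^bsub>M\<^esub> scl M c x, str = \<lambda>X. \<Union>x\<in>X. J +>\<^bsub>M\<^esub> str M x,
     nrm = \<lambda>X. INF x\<in>X. nrm M x\<rparr>"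

definition null_seqs :: "'i filter \<Rightarrow> ('a, 'm) cstar_scheme \<Rightarrow> ('i \<Rightarrow> 'a) set \<Rightarrow> ('i \<Rightarrow> 'a) set" where
  "null_seqs F M S = {f \<in> S. ((\<lambda>i. nrm M (f i)) \<longlongrightarrow> 0) F}"

definition seq_class ::
  "'i filter \<Rightarrow> ('a, 'm) cstar_scheme \<Rightarrow> ('i \<Rightarrow> 'a) set \<Rightarrow> ('i \<Rightarrow> 'a) \<Rightarrow> ('i \<Rightarrow> 'a) set" where
  "seq_class F M S f = null_seqs F M S +>\<^bsub>pointwise M S\<^esub> f"

definition lim_state :: "'i filter \<Rightarrow> ('a \<Rightarrow> complex) \<Rightarrow> ('i \<Rightarrow> 'a) set \<Rightarrow> complex" where
  "lim_state F \<rho> X = (THE z. \<forall>f\<in>X. ((\<lambda>i. \<rho> (f i)) \<longlongrightarrow> z) F)"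

definition free_ultrafilter :: "'i filter \<Rightarrow> bool" where
  "free_ultrafilter F \<longleftrightarrow> F \<noteq> bot \<and>
     (\<forall>P. eventually P F \<or> eventually (\<lambda>i. \<not> P i) F) \<and>
     (\<forall>j. eventually (\<lambda>i. i \<noteq> j) F)"

definition bounded_seqs :: "('a, 'm) cstar_scheme \<Rightarrow> ('i \<Rightarrow> 'a) set" where
  "bounded_seqs M = {f. (\<forall>i. f i \<in> carrier M) \<and> (\<exists>K. \<forall>i. nrm M (f i) \<le> K)}"

definition ultrapower :: "'i filter \<Rightarrow> ('a, 'm) cstar_scheme \<Rightarrow> ('i \<Rightarrow> 'a) set cstar" where
  "ultrapower \<omega> M =
     cstar_quot (pointwise M (bounded_seqs M)) (null_seqs \<omega> M (bounded_seqs M))"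

definition ultrapower_diag :: "'i filter \<Rightarrow> ('a, 'm) cstar_scheme \<Rightarrow> 'a \<Rightarrow> ('i \<Rightarrow> 'a) set" where
  "ultrapower_diag \<omega> M a = seq_class \<omega> M (bounded_seqs M) (\<lambda>_. a)"

text \<open>The copy of the ultrapower of a subalgebra \<open>B\<close> inside the ultrapower of \<open>M\<close>.\<close>

definition ultrapower_sub :: "'i filter \<Rightarrow> ('a, 'm) cstar_scheme \<Rightarrow> 'a set \<Rightarrow> ('i \<Rightarrow> 'a) set set" where
  "ultrapower_sub \<omega> M B =
     seq_class \<omega> M (bounded_seqs M) ` {f \<in> bounded_seqs M. \<forall>i. f i \<in> B}"

text \<open>Separated completion; here \<open>nrm M\<close> may be only a seminorm.\<close>

definition completion :: "('a, 'm) cstar_scheme \<Rightarrow> (nat \<Rightarrow> 'a) set cstar" where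
  "completion M =
     cstar_quot (pointwise M (cauchy_seqs M)) (null_seqs sequentially M (cauchy_seqs M))"

definition completion_embed :: "('a, 'm) cstar_scheme \<Rightarrow> 'a \<Rightarrow> (nat \<Rightarrow> 'a) set" where
  "completion_embed M a = seq_class sequentially M (cauchy_seqs M) (\<lambda>_. a)"

section \<open>Reduced free products\<close>

text \<open>
  The reduced free product of \<open>(M, \<rho>)\<close> and \<open>(N, \<kappa>)\<close> is obtained from the free product state
  \<open>\<rho> * \<kappa>\<close> on the algebraic free product of \<open>M\<close> and \<open>N\<close>: it is the C*-algebra generated by the
  image of the GNS representation, that is, the separated completion in the GNS operator norm.

  We work with finitely supported combinations of words in letters from \<open>M\<close> and \<open>N\<close>. The
  relations of the algebraic free product (for instance \<open>[Inl a, Inl b] = [Inl (a \<otimes> b)]\<close>) are not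
  divided out beforehand; the free product state respects them, so their GNS seminorm vanishes
  and they disappear in the separated completion.

  The value of the free product state on a word is its vacuum expectation in Voiculescu's free
  product representation: a letter \<open>x\<close> is multiplied into a reduced word \<open>r\<close> (a product of
  alternating centred letters), merging it with the first letter of \<open>r\<close> if that comes from the
  same algebra; the resulting first letter \<open>y\<close> is then split into its scalar part and its centred
  part. In \<open>free_vac xs r\<close> the letters of \<open>xs\<close> are applied to \<open>r\<close> from first to last, and the
  coefficient of the empty word is returned.
\<close>

definition centre :: "('a, 'm) star_alg_scheme \<Rightarrow> ('a \<Rightarrow> complex) \<Rightarrow> 'a \<Rightarrow> 'a" where
  "centre M \<rho> x = x \<ominus>\<^bsub>M\<^esub> scl M (\<rho> x) \<one>\<^bsub>M\<^esub>"

fun free_merge :: "('a, 'm) star_alg_scheme \<Rightarrow> ('b, 'n) star_alg_scheme \<Rightarrow>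
    'a + 'b \<Rightarrow> ('a + 'b) list \<Rightarrow> ('a + 'b) \<times> ('a + 'b) list" where
  "free_merge M N (Inl a) (Inl b # r) = (Inl (a \<otimes>\<^bsub>M\<^esub> b), r)"
| "free_merge M N (Inr a) (Inr b # r) = (Inr (a \<otimes>\<^bsub>N\<^esub> b), r)"
| "free_merge M N x r = (x, r)"

primrec free_vac :: "('a, 'm) star_alg_scheme \<Rightarrow> ('a \<Rightarrow> complex) \<Rightarrow>
    ('b, 'n) star_alg_scheme \<Rightarrow> ('b \<Rightarrow> complex) \<Rightarrow>
    ('a + 'b) list \<Rightarrow> ('a + 'b) list \<Rightarrow> complex" where
  "free_vac M \<rho> N \<kappa> [] r = (if r = [] then 1 else 0)"
| "free_vac M \<rho> N \<kappa> (x # xs) r = (let (y, r') = free_merge M N x r in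
     case_sum \<rho> \<kappa> y * free_vac M \<rho> N \<kappa> xs r' +
     free_vac M \<rho> N \<kappa> xs (map_sum (centre M \<rho>) (centre N \<kappa>) y # r'))"

text \<open>The rightmost factor of a product of operators is applied first, hence \<open>rev\<close>.\<close>

definition free_moment :: "('a, 'm) star_alg_scheme \<Rightarrow> ('a \<Rightarrow> complex) \<Rightarrow>
    ('b, 'n) star_alg_scheme \<Rightarrow> ('b \<Rightarrow> complex) \<Rightarrow> ('a + 'b) list \<Rightarrow> complex" where
  "free_moment M \<rho> N \<kappa> w = free_vac M \<rho> N \<kappa> (rev w) []"

text \<open>Alternating products of centred letters have moment zero, which is freeness.\<close>

lemma free_vac_alternating:
  assumes "\<And>x. x \<in> set w \<Longrightarrow>
      case_sum \<rho> \<kappa> x = 0 \<and> map_sum (centre M \<rho>) (centre N \<kappa>) x = x"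
    and "\<And>i. Suc i < length w \<Longrightarrow> isl (w ! i) \<noteq> isl (w ! Suc i)"
    and "w \<noteq> [] \<Longrightarrow> r \<noteq> [] \<Longrightarrow> isl (hd w) \<noteq> isl (hd r)"
  shows "free_vac M \<rho> N \<kappa> w r = (if w = [] \<and> r = [] then 1 else 0)"
  using assms
proof (induction w arbitrary: r)
  case (Cons x xs)
  have m: "free_merge M N x r = (x, r)"
    using Cons.prems(3) by (cases x; cases r rule: list.exhaust; cases "hd r") auto
  have "free_vac M \<rho> N \<kappa> xs (x # r) = (if xs = [] \<and> x # r = [] then 1 else 0)"
  proof (rule Cons.IH)
    show "isl (xs ! i) \<noteq> isl (xs ! Suc i)" if "Suc i < length xs" for i
      using Cons.prems(2)[of "Suc i"] that by simp
    show "isl (hd xs) \<noteq> isl (hd (x # r))" if "xs \<noteq> []"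
      using Cons.prems(2)[of 0] that by (cases xs) auto
  qed (use Cons.prems(1) in auto)
  then show ?case using Cons.prems(1)[of x] m by simp
qed simp

lemma free_moment_alternating:
  assumes "w \<noteq> []"
    and "\<And>x. x \<in> set w \<Longrightarrow>
      case_sum \<rho> \<kappa> x = 0 \<and> map_sum (centre M \<rho>) (centre N \<kappa>) x = x"
    and "\<And>i. Suc i < length w \<Longrightarrow> isl (w ! i) \<noteq> isl (w ! Suc i)"
  shows "free_moment M \<rho> N \<kappa> w = 0"
proof -
  have "isl (rev w ! i) \<noteq> isl (rev w ! Suc i)" if "Suc i < length (rev w)" for i
  proof -
    have "Suc (length w - Suc (Suc i)) = length w - Suc i" using that by simp
    then show ?thesis
      using assms(3)[of "length w - Suc (Suc i)"] that by (simp add: rev_nth)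
  qed
  then have "free_vac M \<rho> N \<kappa> (rev w) [] = 0"
    using assms(1,2) by (subst free_vac_alternating) auto
  then show ?thesis by (simp add: free_moment_def)
qed

definition free_words ::
  "('a, 'm) star_alg_scheme \<Rightarrow> ('b, 'n) star_alg_scheme \<Rightarrow> ('a + 'b) list set" where
  "free_words M N = lists (carrier M <+> carrier N)"

definition word_vec :: "'l list \<Rightarrow> 'l list \<Rightarrow> complex" where
  "word_vec w = (\<lambda>v. if v = w then 1 else 0)"

definition free_word_algebra :: "('a, 'm) star_alg_scheme \<Rightarrow> ('b, 'n) star_alg_scheme \<Rightarrow>
    (('a + 'b) list \<Rightarrow> complex) star_alg" where
  "free_word_algebra M N = \<lparr>
     carrier = {x. finite {w. x w \<noteq> 0} \<and> {w. x w \<noteq> 0} \<subseteq> free_words M N},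
     mult = \<lambda>x y w. \<Sum>k\<le>length w. x (take k w) * y (drop k w),
     one = word_vec [],
     zero = \<lambda>_. 0,
     add = \<lambda>x y w. x w + y w,
     scl = \<lambda>c x w. c * x w,
     str = \<lambda>x w. if w \<in> free_words M N
       then cnj (x (rev (map (map_sum (str M) (str N)) w))) else 0\<rparr>"

definition free_functional :: "('a, 'm) star_alg_scheme \<Rightarrow> ('a \<Rightarrow> complex) \<Rightarrow>
    ('b, 'n) star_alg_scheme \<Rightarrow> ('b \<Rightarrow> complex) \<Rightarrow> (('a + 'b) list \<Rightarrow> complex) \<Rightarrow> complex" where
  "free_functional M \<rho> N \<kappa> x = (\<Sum>w | x w \<noteq> 0. x w * free_moment M \<rho> N \<kappa> w)"

definition free_normed_algebra :: "('a, 'm) star_alg_scheme \<Rightarrow> ('a \<Rightarrow> complex) \<Rightarrow>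
    ('b, 'n) star_alg_scheme \<Rightarrow> ('b \<Rightarrow> complex) \<Rightarrow> (('a + 'b) list \<Rightarrow> complex) cstar" where
  "free_normed_algebra M \<rho> N \<kappa> = (let W = free_word_algebra M N in
     \<lparr>carrier = carrier W, mult = mult W, one = one W, zero = zero W, add = add W,
      scl = scl W, str = str W, nrm = gns_norm W (free_functional M \<rho> N \<kappa>)\<rparr>)"

definition free_product :: "('a, 'm) star_alg_scheme \<Rightarrow> ('a \<Rightarrow> complex) \<Rightarrow>
    ('b, 'n) star_alg_scheme \<Rightarrow> ('b \<Rightarrow> complex) \<Rightarrow>
    (nat \<Rightarrow> ('a + 'b) list \<Rightarrow> complex) set cstar" where
  "free_product M \<rho> N \<kappa> = completion (free_normed_algebra M \<rho> N \<kappa>)"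

definition free_product_state :: "('a, 'm) star_alg_scheme \<Rightarrow> ('a \<Rightarrow> complex) \<Rightarrow>
    ('b, 'n) star_alg_scheme \<Rightarrow> ('b \<Rightarrow> complex) \<Rightarrow>
    (nat \<Rightarrow> ('a + 'b) list \<Rightarrow> complex) set \<Rightarrow> complex" where
  "free_product_state M \<rho> N \<kappa> = lim_state sequentially (free_functional M \<rho> N \<kappa>)"

definition free_letter :: "('a, 'm) star_alg_scheme \<Rightarrow> ('a \<Rightarrow> complex) \<Rightarrow>
    ('b, 'n) star_alg_scheme \<Rightarrow> ('b \<Rightarrow> complex) \<Rightarrow>
    'a + 'b \<Rightarrow> (nat \<Rightarrow> ('a + 'b) list \<Rightarrow> complex) set" where
  "free_letter M \<rho> N \<kappa> x = completion_embed (free_normed_algebra M \<rho> N \<kappa>) (word_vec [x])"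

section \<open>Selfless inclusions\<close>

text \<open>
  The existential quantifiers over the index set of \<open>\<omega>\<close> and over \<open>C\<close> must range over fixed types;
  neither choice loses generality.

  \<^item> \<open>C\<close> embeds into the ultrapower of \<open>M\<close> through \<open>\<sigma>\<close>, so it may be assumed to live on the
    elements of the type of that ultrapower.
  \<^item> Ultrafilters on smaller sets push forward along injections. Larger index sets are not needed:
    \<open>C\<close> may be replaced by a separable subalgebra on which the state still has a faithful GNS
    representation, and finitely many elements and a tolerance then determine approximate
    copies of \<open>C\<close> in \<open>B\<close>. There are at most as many such finite data as elements of \<open>M\<close>.
\<close>

type_synonym 'a index = "'a set \<times> nat"

text \<open>
  The subalgebra \<open>B * C\<close> of \<open>M * C\<close> is the C*-subalgebra generated by the copies of \<open>B\<close> and \<open>C\<close>.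
\<close>

definition selfless_inclusion :: "'a cstar \<Rightarrow> ('a \<Rightarrow> complex) \<Rightarrow> 'a set \<Rightarrow> bool" where
  "selfless_inclusion M \<rho> B \<longleftrightarrow>
     (\<exists>(\<omega> :: 'a index filter) (C :: ('a index \<Rightarrow> 'a) set cstar) \<kappa> \<sigma>.
        free_ultrafilter \<omega> \<and>
        cstar_probability_space C \<kappa> \<and>
        carrier C \<noteq> range (\<lambda>z. scl C z \<one>\<^bsub>C\<^esub>) \<and>
        \<sigma> \<in> cstar_hom (free_product M \<rho> C \<kappa>) (ultrapower \<omega> M) \<and>
        inj_on \<sigma> (carrier (free_product M \<rho> C \<kappa>)) \<and>
        (\<forall>x\<in>carrier (free_product M \<rho> C \<kappa>).
           lim_state \<omega> \<rho> (\<sigma> x) = free_product_state M \<rho> C \<kappa> x) \<and>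
        (\<forall>a\<in>carrier M. \<sigma> (free_letter M \<rho> C \<kappa> (Inl a)) = ultrapower_diag \<omega> M a) \<and>
        \<sigma> ` cstar_generated (free_product M \<rho> C \<kappa>) (free_letter M \<rho> C \<kappa> ` (B <+> carrier C))
          \<subseteq> ultrapower_sub \<omega> M B)"

section \<open>Bounded operators on a complex Hilbert space\<close>

text \<open>
  The inner product \<open>cinner\<close> is linear in the second argument; its real part is the library's
  real inner product, so norm, topology and completeness are those of the library.
\<close>

class complex_hilbert = real_inner + complete_space +
  fixes scaleC :: "complex \<Rightarrow> 'a \<Rightarrow> 'a"
    and cinner :: "'a \<Rightarrow> 'a \<Rightarrow> complex"
  assumes scaleC_add_right: "scaleC c (x + y) = scaleC c x + scaleC c y"
    and scaleC_add_left: "scaleC (c + d) x = scaleC c x + scaleC d x"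
    and scaleC_scaleC: "scaleC c (scaleC d x) = scaleC (c * d) x"
    and scaleR_scaleC: "scaleR r x = scaleC (complex_of_real r) x"
    and cinner_commute: "cinner x y = cnj (cinner y x)"
    and cinner_add_right: "cinner x (y + z) = cinner x y + cinner x z"
    and cinner_scaleC_right: "cinner x (scaleC c y) = c * cinner x y"
    and inner_eq_Re_cinner: "inner x y = Re (cinner x y)"

instantiation complex :: complex_hilbert
begin

definition scaleC_complex :: "complex \<Rightarrow> complex \<Rightarrow> complex" where
  "scaleC_complex c x = c * x"

definition cinner_complex :: "complex \<Rightarrow> complex \<Rightarrow> complex" where
  "cinner_complex x y = cnj x * y"

instance
  by standard (auto simp: scaleC_complex_def cinner_complex_def algebra_simps scaleR_conv_of_real
      inner_complex_def)

end

definition cadjoint :: "('h::complex_hilbert \<Rightarrow>\<^sub>L 'h) \<Rightarrow> 'h \<Rightarrow>\<^sub>L 'h" where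
  "cadjoint T = (THE S. \<forall>x y. cinner (blinfun_apply S x) y = cinner x (blinfun_apply T y))"

definition bounded_operators :: "('h::complex_hilbert \<Rightarrow>\<^sub>L 'h) cstar" where
  "bounded_operators = \<lparr>
     carrier = {T. \<forall>c x. blinfun_apply T (scaleC c x) = scaleC c (blinfun_apply T x)},
     mult = (o\<^sub>L), one = id_blinfun, zero = 0, add = (+),
     scl = \<lambda>c T. Blinfun (\<lambda>x. scaleC c (blinfun_apply T x)),
     str = cadjoint, nrm = norm\<rparr>"

definition op_le :: "('h::complex_hilbert \<Rightarrow>\<^sub>L 'h) \<Rightarrow> ('h \<Rightarrow>\<^sub>L 'h) \<Rightarrow> bool" where
  "op_le S T \<longleftrightarrow> (\<forall>x. cinner x (blinfun_apply (T - S) x) \<in> \<real>\<^sub>\<ge>\<^sub>0)"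

definition projection :: "('h::complex_hilbert \<Rightarrow>\<^sub>L 'h) \<Rightarrow> bool" where
  "projection P \<longleftrightarrow> P \<in> carrier bounded_operators \<and> P o\<^sub>L P = P \<and> cadjoint P = P"

section \<open>The Powers--Haagerup--Pisier property\<close>

definition php_property ::
  "('h::complex_hilbert \<Rightarrow>\<^sub>L 'h) set \<Rightarrow> (('h \<Rightarrow>\<^sub>L 'h) \<Rightarrow> complex) \<Rightarrow> ('h \<Rightarrow>\<^sub>L 'h) set \<Rightarrow> bool" where
  "php_property A \<rho> B \<longleftrightarrow>
     (\<forall>F \<epsilon> (n::nat). finite F \<and> F \<subseteq> {x \<in> A. \<rho> x = 0} \<and> \<epsilon> > 0 \<longrightarrow>
       (\<exists>u P Pp.
          (\<forall>i\<in>{1..n}. u i \<in> B \<and> cstar_unitary bounded_operators (u i) \<and>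
             projection (P i) \<and> projection (Pp i) \<and> op_le (Pp i) (P i)) \<and>
          (\<forall>i\<in>{1..n}. \<forall>j\<in>{1..n}. i \<noteq> j \<longrightarrow> P i o\<^sub>L P j = 0) \<and>
          (\<forall>i\<in>{1..n}.
             op_le (u i o\<^sub>L Pp i o\<^sub>L cadjoint (u i)) (Pp i) \<and>
             op_le (u i o\<^sub>L (id_blinfun - P i) o\<^sub>L cadjoint (u i)) (Pp i)) \<and>
          (\<forall>x\<in>F. \<forall>i\<in>{1..n}. \<forall>j\<in>{1..n}. norm (P i o\<^sub>L x o\<^sub>L P j) < \<epsilon>)))"

end

theory Submission
  imports Defs
begin

text \<open>
  Write \<open>g\<^sub>i = u\<^sub>i (1 - P\<^sub>i) + (P\<^sub>i - P\<^sub>i\<^sup>+) u\<^sub>i\<^sup>*\<close> for the unitaries and projections of the PHP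
  property. Each \<open>g\<^sub>i\<close> has its range in \<open>P\<^sub>i\<close>, and \<open>u\<^sub>i + u\<^sub>i\<^sup>*\<close> differs from \<open>g\<^sub>i + g\<^sub>i\<^sup>*\<close>, and
  \<open>g\<^sub>i\<^sup>* g\<^sub>i\<close> from \<open>2\<close>, by a bounded corner of \<open>P\<^sub>i\<close>. Summing \<open>n\<close> of these and dividing by
  \<open>(2n)\<^sup>1\<^sup>/\<^sup>2\<close> gives \<open>s\<close> in \<open>B\<close> and a creation operator \<open>L\<close> with \<open>s\<close> close to \<open>L + L\<^sup>*\<close> and
  \<open>L\<^sup>* x L\<close> close to \<open>\<rho> x\<close>; a further use of the property provides vectors that \<open>L\<^sup>* x\<close> nearly kills
  and whose states nearly agree with \<open>\<rho>\<close> on words in \<open>A\<close> and \<open>s\<close>. In the ultrapower these relations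
  become exact, and they are the relations of the Toeplitz-Pimsner algebra, in which \<open>L + L\<^sup>*\<close> is
  semicircular and free from \<open>A\<close>. It remains to see that the norm of an element of the *-algebra
  generated by \<open>A\<close> and \<open>L + L\<^sup>*\<close> is its norm in the GNS representation of the vacuum state. On an
  element that is homogeneous for the grading by creation degree this can be checked on creation
  words; a product of \<open>N\<close> factors has only linearly many homogeneous components, a loss that
  disappears on taking \<open>N\<close>-th roots.
\<close>

text \<open>Two obstacles shape the proof. The first is accumulation of errors: a sum of corners of
  pairwise orthogonal projections is no larger than its largest term, so the corners stay bounded
  and vanish on division by a multiple of the square root of \<open>n\<close>. The second is the
  norm. No automorphism rotating \<open>L\<close> is at hand, so homogeneous components cannot be
  cut out by averaging over the circle. They are bounded only on creation vectors, where
  orthogonality of the levels isolates them. The passage from such bounds to operator norms rests on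
  \<open>norm (V ^ N) = norm V ^ N\<close> for self-adjoint \<open>V\<close> and
  \<open>N = 2 ^ j\<close>, which makes every factor of subexponential growth in \<open>N\<close>
  disappear. At the bottom of this passage, estimates against \<open>\<rho>\<close> become norms in
  \<open>A\<close> because the GNS representation is faithful. The same theory with the scalars in
  place of \<open>A\<close> handles the C*-algebra of the semicircular element, which serves as
  \<open>C\<close>. The theorem speaks of records with carriers, while the computations take place
  in types; injective *-homomorphisms connect the two.\<close>

text \<open>\<open>0 \<noteq> 1\<close> is not demanded, since the Hilbert space of the operators may be \<open>0\<close>.\<close>

class cstar_alg = real_normed_algebra + monoid_mult +
  fixes csc :: "complex \<Rightarrow> 'a \<Rightarrow> 'a" (infixr "*\<^sub>C" 75)
    and adj :: "'a \<Rightarrow> 'a" ("_\<^sup>\<star>" [1000] 999)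
  assumes csc_add_right: "c *\<^sub>C (x + y) = c *\<^sub>C x + c *\<^sub>C y"
    and csc_add_left: "(c + d) *\<^sub>C x = c *\<^sub>C x + d *\<^sub>C x"
    and csc_csc [simp]: "c *\<^sub>C (d *\<^sub>C x) = (c * d) *\<^sub>C x"
    and scaleR_csc: "scaleR r x = complex_of_real r *\<^sub>C x"
    and csc_mult_left [simp]: "(c *\<^sub>C x) * y = c *\<^sub>C (x * y)"
    and csc_mult_right [simp]: "x * (c *\<^sub>C y) = c *\<^sub>C (x * y)"
    and adj_adj [simp]: "(x\<^sup>\<star>)\<^sup>\<star> = x"
    and adj_add [simp]: "(x + y)\<^sup>\<star> = x\<^sup>\<star> + y\<^sup>\<star>"
    and adj_csc [simp]: "(c *\<^sub>C x)\<^sup>\<star> = cnj c *\<^sub>C x\<^sup>\<star>"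
    and adj_mult [simp]: "(x * y)\<^sup>\<star> = y\<^sup>\<star> * x\<^sup>\<star>"
    and norm_csc [simp]: "norm (c *\<^sub>C x) = cmod c * norm x"
    and norm_adj_mult: "norm (x\<^sup>\<star> * x) = (norm x)\<^sup>2"

section \<open>Elementary rules for scalars, adjoints and norms\<close>

lemma csc_one [simp]: "1 *\<^sub>C x = x"
  using scaleR_csc[of 1 x] by simp

lemma csc_zero_right [simp]: "c *\<^sub>C 0 = 0"
  using csc_add_right[of c 0 0] by simp

lemma csc_zero_left [simp]: "0 *\<^sub>C x = 0"
  using scaleR_csc[of 0 x] by simp

lemma csc_minus_left: "(- c) *\<^sub>C x = - (c *\<^sub>C x)"
  using csc_add_left[of c "- c" x] by (simp add: eq_neg_iff_add_eq_0 add.commute)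

lemma csc_minus_right: "c *\<^sub>C (- x) = - (c *\<^sub>C x)"
  using csc_add_right[of c x "- x"] by (simp add: eq_neg_iff_add_eq_0 add.commute)

lemma minus_csc: "- x = (- 1) *\<^sub>C x"
  by (simp add: csc_minus_left)

lemma csc_diff_right: "c *\<^sub>C (x - y) = c *\<^sub>C x - c *\<^sub>C y"
  using csc_add_right[of c x "- y"] by (simp add: csc_minus_right)

lemma adj_zero [simp]: "0\<^sup>\<star> = 0"
  using adj_add[of 0 0] by (metis add_cancel_right_right add_0)

lemma adj_minus [simp]: "(- x)\<^sup>\<star> = - x\<^sup>\<star>"
  using adj_csc[of "- 1" x] by (simp add: csc_minus_left)

lemma adj_diff [simp]: "(x - y)\<^sup>\<star> = x\<^sup>\<star> - y\<^sup>\<star>"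
  using adj_add[of x "- y"] by simp

lemma adj_one [simp]: "1\<^sup>\<star> = 1"
  by (metis adj_adj adj_mult mult_1_left mult_1_right)

lemma adj_scaleR [simp]: "(scaleR r x)\<^sup>\<star> = scaleR r (x\<^sup>\<star>)"
  by (simp add: scaleR_csc)

lemma adj_sum: "(sum f I)\<^sup>\<star> = (\<Sum>i\<in>I. (f i)\<^sup>\<star>)"
  by (induction I rule: infinite_finite_induct) auto

lemma csc_sum: "c *\<^sub>C (sum f I) = (\<Sum>i\<in>I. c *\<^sub>C f i)"
  by (induction I rule: infinite_finite_induct) (auto simp: csc_add_right)

lemma adj_power: "(x ^ n)\<^sup>\<star> = (x\<^sup>\<star>) ^ n"
  by (induction n) (auto simp: power_commutes)

lemma norm_adj [simp]: "norm (x\<^sup>\<star>) = norm (x :: 'a::cstar_alg)"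
proof -
  have le: "norm x \<le> norm (x\<^sup>\<star>)" for x :: 'a
  proof (cases "norm x = 0")
    case False
    then have "norm x > 0" by simp
    moreover have "norm x * norm x \<le> norm (x\<^sup>\<star>) * norm x"
      using norm_adj_mult[of x] norm_mult_ineq[of "x\<^sup>\<star>" x] by (simp add: power2_eq_square)
    ultimately show ?thesis by simp
  qed simp
  show ?thesis using le[of x] le[of "x\<^sup>\<star>"] by simp
qed

text \<open>By the C*-identity this norm equals its own square. It is 0 in the zero algebra, hence
  only an inequality.\<close>

lemma norm_one_le: "norm (1 :: 'a::cstar_alg) \<le> 1"
proof -
  let ?n = "norm (1 :: 'a)"
  have "?n = ?n\<^sup>2" using norm_adj_mult[of "1 :: 'a"] by simp
  then have "?n * (?n - 1) = 0" by (simp add: power2_eq_square right_diff_distrib)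
  then show ?thesis by auto
qed

lemma norm_power_le: "norm (x ^ n) \<le> norm x ^ n" for x :: "'a::cstar_alg"
proof (induction n)
  case (Suc n)
  have "norm (x * x ^ n) \<le> norm x * norm (x ^ n)" by (rule norm_mult_ineq)
  also have "\<dots> \<le> norm x * norm x ^ n" using Suc by (intro mult_left_mono) auto
  finally show ?case by simp
qed (simp add: norm_one_le)

text \<open>The C*-identity, iterated. Every later removal of a multiplicative constant from a norm
  estimate goes through these dyadic powers.\<close>

lemma norm_selfadj_power: "x\<^sup>\<star> = x \<Longrightarrow> norm (x ^ (2 ^ j)) = norm (x::'a::cstar_alg) ^ (2 ^ j)"
proof (induction j)
  case (Suc j)
  have "x ^ (2 ^ Suc j) = (x ^ (2 ^ j))\<^sup>\<star> * x ^ (2 ^ j)"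
    using Suc.prems by (simp add: adj_power mult_2 power_add)
  then show ?case using Suc by (simp add: norm_adj_mult mult_2 power_add power2_eq_square)
qed simp

section \<open>Unital *-subalgebras and their closures\<close>

definition star_subalgebra :: "'a::cstar_alg set \<Rightarrow> bool" where
  "star_subalgebra A \<longleftrightarrow> 1 \<in> A \<and> (\<forall>x\<in>A. \<forall>y\<in>A. x + y \<in> A \<and> x * y \<in> A) \<and>
     (\<forall>x\<in>A. x\<^sup>\<star> \<in> A \<and> (\<forall>c. c *\<^sub>C x \<in> A))"

context
  fixes A assumes A: "star_subalgebra A"
begin

lemma subalg_one: "1 \<in> A"
  and subalg_add: "x \<in> A \<Longrightarrow> y \<in> A \<Longrightarrow> x + y \<in> A"
  and subalg_mult: "x \<in> A \<Longrightarrow> y \<in> A \<Longrightarrow> x * y \<in> A"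
  and subalg_adj: "x \<in> A \<Longrightarrow> x\<^sup>\<star> \<in> A"
  and subalg_csc: "x \<in> A \<Longrightarrow> c *\<^sub>C x \<in> A"
  using A by (auto simp: star_subalgebra_def)

lemma subalg_zero: "0 \<in> A"
  using subalg_csc[OF subalg_one, of 0] by simp

lemma subalg_minus: "x \<in> A \<Longrightarrow> - x \<in> A"
  by (subst minus_csc) (rule subalg_csc)

lemma subalg_diff: "x \<in> A \<Longrightarrow> y \<in> A \<Longrightarrow> x - y \<in> A"
  using subalg_add[of x "- y"] subalg_minus[of y] by simp

lemma subalg_scaleR: "x \<in> A \<Longrightarrow> scaleR r x \<in> A"
  by (simp add: scaleR_csc subalg_csc)

lemma subalg_power: "x \<in> A \<Longrightarrow> x ^ n \<in> A"
  by (induction n) (auto intro: subalg_one subalg_mult)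

lemma subalg_sum: "(\<And>i. i \<in> I \<Longrightarrow> f i \<in> A) \<Longrightarrow> sum f I \<in> A"
  by (induction I rule: infinite_finite_induct) (auto intro: subalg_zero subalg_add)

end

lemma bounded_linear_adj: "bounded_linear (adj :: 'a::cstar_alg \<Rightarrow> 'a)"
  by (rule bounded_linear_intro[where K = 1]) auto

lemma bounded_linear_csc: "bounded_linear ((*\<^sub>C) c :: 'a::cstar_alg \<Rightarrow> 'a)"
  by (rule bounded_linear_intro[where K = "cmod c"])
    (auto simp: csc_add_right scaleR_csc mult.commute)

lemmas tendsto_adj [tendsto_intros] = bounded_linear.tendsto[OF bounded_linear_adj]
lemmas tendsto_csc [tendsto_intros] = bounded_linear.tendsto[OF bounded_linear_csc]

lemma star_subalgebra_closure:
  fixes A :: "'a::cstar_alg set"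
  assumes A: "star_subalgebra A"
  shows "star_subalgebra (closure A)"
  unfolding star_subalgebra_def
proof (intro conjI ballI allI)
  show "1 \<in> closure A" using subalg_one[OF A] closure_subset by blast
next
  fix x y assume "x \<in> closure A" "y \<in> closure A"
  then obtain f g where "\<forall>n. f n \<in> A" "f \<longlonglongrightarrow> x" "\<forall>n. g n \<in> A" "g \<longlonglongrightarrow> y"
    unfolding closure_sequential by blast
  then have "(\<forall>n. f n + g n \<in> A) \<and> (\<lambda>n. f n + g n) \<longlonglongrightarrow> x + y"
    "(\<forall>n. f n * g n \<in> A) \<and> (\<lambda>n. f n * g n) \<longlonglongrightarrow> x * y"
    using subalg_add[OF A] subalg_mult[OF A] by (auto intro!: tendsto_intros)
  then show "x + y \<in> closure A" "x * y \<in> closure A"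
    unfolding closure_sequential by - (rule exI, assumption)+
next
  fix x assume "x \<in> closure A"
  then obtain f where f: "\<forall>n. f n \<in> A" "f \<longlonglongrightarrow> x"
    unfolding closure_sequential by blast
  then have "(\<forall>n. (f n)\<^sup>\<star> \<in> A) \<and> (\<lambda>n. (f n)\<^sup>\<star>) \<longlonglongrightarrow> x\<^sup>\<star>"
    using subalg_adj[OF A] by (auto intro!: tendsto_intros)
  then show "x\<^sup>\<star> \<in> closure A" unfolding closure_sequential by - (rule exI)
  fix c have "(\<forall>n. c *\<^sub>C f n \<in> A) \<and> (\<lambda>n. c *\<^sub>C f n) \<longlonglongrightarrow> c *\<^sub>C x"
    using f subalg_csc[OF A] by (auto intro!: tendsto_intros)
  then show "c *\<^sub>C x \<in> closure A" unfolding closure_sequential by - (rule exI)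
qed

subsection \<open>Square roots by the binomial series\<close>

text \<open>The Taylor coefficients at 0 of the square root of \<open>1 - t\<close>.\<close>

definition sqrt_coeff :: "nat \<Rightarrow> real" where
  "sqrt_coeff k = (-1) ^ k * (1/2 gchoose k)"

lemma sqrt_coeff_0: "sqrt_coeff 0 = 1" by (simp add: sqrt_coeff_def)

lemma sqrt_coeff_1: "sqrt_coeff (Suc 0) = - 1/2" by (simp add: sqrt_coeff_def)

lemma sqrt_coeff_Suc: "sqrt_coeff (Suc k) = sqrt_coeff k * ((real k - 1/2) / (real k + 1))"
  by (simp add: sqrt_coeff_def gbinomial_rec[of _ k] gbinomial_Suc_rec field_simps)
     
lemma sqrt_coeff_nonpos: "sqrt_coeff (Suc k) \<le> 0"
proof (induction k)
  case (Suc k)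
  show ?case by (subst sqrt_coeff_Suc) (rule mult_nonpos_nonneg[OF Suc], simp)
qed (simp add: sqrt_coeff_1)

text \<open>Summing the coefficients corresponds to dividing the series by \<open>1 - t\<close>: the
  partial sums are the coefficients of the series with exponent -1/2, and those are positive by
  their quotient recursion.\<close>

lemma sqrt_coeff_sum: "(\<Sum>k\<le>n. sqrt_coeff k) \<ge> 0"
proof -
  have eq: "(\<Sum>k\<le>n. sqrt_coeff k) = (-1) ^ n * (1/2 - 1 gchoose n)" for n
    using gbinomial_sum_lower_neg[of "1/2" n] by (simp add: sqrt_coeff_def mult.commute)
  have "(-1) ^ n * ((1/2 - 1 :: real) gchoose n) \<ge> 0"
  proof (induction n)
    case (Suc n)
    have "(-1) ^ Suc n * ((1/2 - 1 :: real) gchoose Suc n)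
        = ((-1) ^ n * ((1/2 - 1 :: real) gchoose n)) * ((real n + 1/2) / (real n + 1))"
      by (simp add: gbinomial_Suc_rec field_simps)
    then show ?case using Suc by simp
  qed simp
  then show ?thesis by (simp only: eq)
qed

text \<open>All terms after the first have the same sign, so bounded partial sums give absolute
  convergence up to the endpoint. This admits \<open>norm t = 1\<close> in
  \<open>cstar_sqrt\<close>, and the total mass 1 yields its bound on \<open>1 - h\<close>.\<close>

lemma sqrt_coeff_summable: "summable (\<lambda>k. sqrt_coeff (Suc k))"
  and sqrt_coeff_suminf: "(\<Sum>k. - sqrt_coeff (Suc k)) \<le> 1"
proof -
  have b: "(\<Sum>k<n. - sqrt_coeff (Suc k)) \<le> 1" for n
    using sqrt_coeff_sum[of n] sum.atMost_shift[of sqrt_coeff n]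
    by (simp add: sum_negf sqrt_coeff_0)
  have s: "summable (\<lambda>k. - sqrt_coeff (Suc k))"
    using sqrt_coeff_nonpos b[of "Suc _", unfolded lessThan_Suc_atMost]
    by (intro bounded_imp_summable[where B = 1]) auto
  then show "summable (\<lambda>k. sqrt_coeff (Suc k))" by (simp add: summable_minus_iff)
  show "(\<Sum>k. - sqrt_coeff (Suc k)) \<le> 1" using s b by (rule suminf_le_const)
qed

text \<open>Vandermonde's convolution with 1/2 + 1/2 = 1: the square of the series is the binomial
  series of exponent 1, which is \<open>1 - t\<close>.\<close>

lemma sqrt_coeff_Cauchy: "(\<Sum>i\<le>n. sqrt_coeff i * sqrt_coeff (n - i)) = (if n = 0 then 1 else if n = 1 then - 1 else 0)"
proof -
  have "(\<Sum>i\<le>n. sqrt_coeff i * sqrt_coeff (n - i)) = (-1) ^ n * (\<Sum>i\<le>n. (1/2 gchoose i) * (1/2 gchoose (n - i)))"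
    unfolding sum_distrib_left sqrt_coeff_def
  proof (rule sum.cong)
    fix i assume "i \<in> {..n}"
    then have "(-1 :: real) ^ i * (-1) ^ (n - i) = (-1) ^ n" by (simp flip: power_add)
    then show "(- 1) ^ i * (1 / 2 gchoose i) * ((- 1) ^ (n - i) * (1 / 2 gchoose (n - i))) =
         (- 1) ^ n * ((1 / 2 gchoose i) * (1 / 2 gchoose (n - i)) :: real)" by (simp add: ac_simps)
  qed simp
  also have "\<dots> = (-1) ^ n * (1 gchoose n)"
    using gbinomial_Vandermonde[of "1/2::real" "1/2" n] by (simp add: atMost_atLeast0)
  also have "(1::real) gchoose n = real (1 choose n)" using binomial_gbinomial[of 1 n, where 'a = real] by simp
  finally show ?thesis by (cases n; cases "n - 1") auto
qed

text \<open>The binomial series converges absolutely, and its partial sums are polynomials in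
  \<open>t\<close>, so the root stays in the closed subalgebra. The bound on \<open>1 - h\<close>
  certifies positivity of \<open>h\<close>: it permits a second root, of \<open>h\<close>
  itself.\<close>

lemma cstar_sqrt:
  fixes A :: "'a::{cstar_alg, banach} set"
  assumes A: "star_subalgebra A" "closed A" and t: "t \<in> A" "t\<^sup>\<star> = t" "norm t \<le> 1"
  obtains h where "h \<in> A" "h\<^sup>\<star> = h" "h * h = 1 - t" "norm (1 - h) \<le> 1" 
proof -
  define f where "f k = scaleR (sqrt_coeff k) (t ^ k)" for k
  have nf: "norm (f (Suc k)) \<le> - sqrt_coeff (Suc k)" for k
  proof -
    have "norm (t ^ Suc k) \<le> 1"
      using norm_power_le[of t "Suc k"] power_le_one[of "norm t" "Suc k"] t by (auto intro: order_trans)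
    then show ?thesis using sqrt_coeff_nonpos[of k]
      unfolding f_def using mult_left_mono[of "norm (t ^ Suc k)" 1 "- sqrt_coeff (Suc k)"] by simp
  qed
  have s1: "summable (\<lambda>k. norm (f (Suc k)))"
    by (rule summable_comparison_test'[where N = 0 and g = "\<lambda>k. - sqrt_coeff (Suc k)"])
       (use nf sqrt_coeff_summable in \<open>auto simp: summable_minus_iff\<close>)
  then have s: "summable (\<lambda>k. norm (f k))" by (subst (asm) summable_Suc_iff)
  define h where "h = (\<Sum>k. f k)"
  have fs: "f sums h" unfolding h_def using s summable_norm_cancel summable_sums by blast
  have lim: "(\<lambda>n. \<Sum>k<n. f k) \<longlonglongrightarrow> h" using fs by (simp add: sums_def)
  have "h \<in> A"
    by (rule closed_sequentially[OF A(2) _ lim])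
       (auto intro!: subalg_sum[OF A(1)] subalg_scaleR[OF A(1)] subalg_power[OF A(1)] t simp: f_def)
  moreover have "h\<^sup>\<star> = h"
  proof -
    have "(\<lambda>n. (\<Sum>k<n. f k)\<^sup>\<star>) \<longlonglongrightarrow> h\<^sup>\<star>" by (intro tendsto_intros lim)
    then have "(\<lambda>n. \<Sum>k<n. f k) \<longlonglongrightarrow> h\<^sup>\<star>" by (simp add: adj_sum f_def adj_power t)
    then show ?thesis using lim LIMSEQ_unique by blast
  qed
  moreover have "h * h = 1 - t"
  proof -
    have "(\<lambda>n. \<Sum>i\<le>n. f i * f (n - i)) sums (h * h)"
      unfolding h_def by (rule Cauchy_product_sums[OF s s])
    moreover have "(\<Sum>i\<le>n. f i * f (n - i)) = scaleR (if n = 0 then 1 else if n = 1 then - 1 else 0) (t ^ n)" for n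
    proof -
      have "(\<Sum>i\<le>n. f i * f (n - i)) = (\<Sum>i\<le>n. scaleR (sqrt_coeff i * sqrt_coeff (n - i)) (t ^ n))"
        by (intro sum.cong) (auto simp: f_def simp flip: power_add)
      then show ?thesis by (simp add: sqrt_coeff_Cauchy flip: scaleR_sum_left)
    qed
    ultimately have 1: "(\<lambda>n. scaleR (if n = 0 then 1 else if n = 1 then - 1 else 0 :: real) (t ^ n)) sums (h * h)" by simp
    have "(\<lambda>n. scaleR (if n = 0 then 1 else if n = 1 then - 1 else 0 :: real) (t ^ n)) sums
      (\<Sum>n\<in>{0,1}. scaleR (if n = 0 then 1 else if n = 1 then - 1 else 0 :: real) (t ^ n))"
      by (rule sums_finite) auto
    then show ?thesis using sums_unique2[OF 1] by simp
  qed
  moreover have "norm (1 - h) \<le> 1"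
  proof -
    have "h = f 0 + (\<Sum>k. f (Suc k))"
      unfolding h_def using suminf_split_head[of f] s summable_norm_cancel by fastforce
    then have "norm (1 - h) = norm (\<Sum>k. f (Suc k))" by (simp add: f_def sqrt_coeff_0)
    also have "\<dots> \<le> (\<Sum>k. norm (f (Suc k)))" by (rule summable_norm[OF s1])
    also have "\<dots> \<le> (\<Sum>k. - sqrt_coeff (Suc k))"
      by (rule suminf_le[OF nf s1]) (simp add: summable_minus_iff sqrt_coeff_summable)
    also have "\<dots> \<le> 1" by (rule sqrt_coeff_suminf)
    finally show ?thesis .
  qed
  ultimately show ?thesis by (rule that)
qed

section \<open>States\<close>

text \<open>The class is not assumed complete, so the boundedness of left multiplication in the GNS
  seminorm is part of the definition. For limits of vector states it is immediate.\<close>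

locale state_on =
  fixes \<phi> :: "'a::cstar_alg \<Rightarrow> complex"
  assumes \<phi>_add: "\<phi> (x + y) = \<phi> x + \<phi> y"
    and \<phi>_csc [simp]: "\<phi> (c *\<^sub>C x) = c * \<phi> x"
    and \<phi>_adj: "\<phi> (x\<^sup>\<star>) = cnj (\<phi> x)"
    and \<phi>_pos: "0 \<le> Re (\<phi> (x\<^sup>\<star> * x))"
    and \<phi>_one [simp]: "\<phi> 1 = 1"
    and \<phi>_bound: "Re (\<phi> ((y * z)\<^sup>\<star> * (y * z))) \<le> (norm y)\<^sup>2 * Re (\<phi> (z\<^sup>\<star> * z))"
begin

lemma \<phi>_zero [simp]: "\<phi> 0 = 0"
  using \<phi>_csc[of 0 0] by simp

lemma \<phi>_minus [simp]: "\<phi> (- x) = - \<phi> x"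
  using \<phi>_csc[of "- 1" x] by (simp add: csc_minus_left)

lemma \<phi>_diff: "\<phi> (x - y) = \<phi> x - \<phi> y"
  using \<phi>_add[of x "- y"] by simp

lemma \<phi>_sum: "\<phi> (sum f I) = (\<Sum>i\<in>I. \<phi> (f i))"
  by (induction I rule: infinite_finite_induct) (auto simp: \<phi>_add)

text \<open>The GNS seminorm. Null vectors are never divided out: equality of the GNS vectors of
  \<open>x\<close> and \<open>y\<close> is expressed by \<open>hn (x - y) = 0\<close>.\<close>

definition hn :: "'a \<Rightarrow> real" where
  "hn x = sqrt (Re (\<phi> (x\<^sup>\<star> * x)))"

lemma hn_nonneg [simp]: "0 \<le> hn x"
  by (simp add: hn_def \<phi>_pos)

lemma hn_power2: "(hn x)\<^sup>2 = Re (\<phi> (x\<^sup>\<star> * x))"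
  by (simp add: hn_def \<phi>_pos)

lemma \<phi>_self: "\<phi> (x\<^sup>\<star> * x) = complex_of_real ((hn x)\<^sup>2)"
proof -
  have "cnj (\<phi> (x\<^sup>\<star> * x)) = \<phi> (x\<^sup>\<star> * x)" using \<phi>_adj[of "x\<^sup>\<star> * x"] by simp
  then have "Im (\<phi> (x\<^sup>\<star> * x)) = 0" by (metis Reals_cnj_iff complex_is_Real_iff)
  then show ?thesis by (simp add: complex_eq_iff hn_power2)
qed

lemma Cauchy_Schwarz: "cmod (\<phi> (x\<^sup>\<star> * y)) \<le> hn x * hn y"
proof -
  define q where "q = \<phi> (x\<^sup>\<star> * y)"
  have yx: "\<phi> (y\<^sup>\<star> * x) = cnj q" using \<phi>_adj[of "x\<^sup>\<star> * y"] by (simp add: q_def)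
  have ineq: "0 \<le> (hn x)\<^sup>2 - 2 * t * (cmod q)\<^sup>2 + t\<^sup>2 * (cmod q)\<^sup>2 * (hn y)\<^sup>2" for t :: real
  proof -
    \<comment> \<open>The phase of \<open>c\<close> turns both mixed terms into the same nonpositive
      multiple of \<open>(cmod q)\<^sup>2\<close> for \<open>t \<ge> 0\<close>.\<close>
    define c where "c = - (complex_of_real t * cnj q)"
    have "\<phi> ((x + c *\<^sub>C y)\<^sup>\<star> * (x + c *\<^sub>C y)) =
        \<phi> (x\<^sup>\<star> * x) + c * q + cnj c * cnj q + cnj c * c * \<phi> (y\<^sup>\<star> * y)"
      by (simp add: \<phi>_add distrib_left distrib_right q_def[symmetric] yx mult.assoc)
    moreover have "c * q = - (complex_of_real (t * (cmod q)\<^sup>2))"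
      using complex_norm_square[of q] by (simp add: c_def mult.commute)
    moreover have "cnj c * cnj q = - (complex_of_real (t * (cmod q)\<^sup>2))"
      using complex_norm_square[of q] by (simp add: c_def)
    moreover have "cnj c * c = complex_of_real (t\<^sup>2 * (cmod q)\<^sup>2)"
      using complex_norm_square[of q] by (simp add: c_def power2_eq_square mult.commute mult.left_commute)
    ultimately have "\<phi> ((x + c *\<^sub>C y)\<^sup>\<star> * (x + c *\<^sub>C y)) =
       complex_of_real ((hn x)\<^sup>2 - 2 * t * (cmod q)\<^sup>2 + t\<^sup>2 * (cmod q)\<^sup>2 * (hn y)\<^sup>2)"
      by (simp add: \<phi>_self)
    then show ?thesis using \<phi>_pos[of "x + c *\<^sub>C y"] by simp
  qed
  have "(cmod q)\<^sup>2 \<le> (hn x)\<^sup>2 * (hn y)\<^sup>2"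
  proof (cases "hn y = 0")
    case True
    have "q = 0"
    proof (rule ccontr)
      assume "q \<noteq> 0"
      then have "(cmod q)\<^sup>2 > 0" by simp
      \<comment> \<open>With \<open>hn y = 0\<close> the right-hand side is linear in
        \<open>t\<close>, and this \<open>t\<close> makes it -1.\<close>
      then show False using ineq[of "((hn x)\<^sup>2 + 1) / (2 * (cmod q)\<^sup>2)"] True by (simp add: field_simps)
    qed
    then show ?thesis by simp
  next
    case False
    then have p: "(hn y)\<^sup>2 > 0" by simp
    have "0 \<le> (hn x)\<^sup>2 - (cmod q)\<^sup>2 / (hn y)\<^sup>2"
    proof -
      have "(1 / (hn y)\<^sup>2)\<^sup>2 * (cmod q)\<^sup>2 * (hn y)\<^sup>2 = (cmod q)\<^sup>2 / (hn y)\<^sup>2"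
      proof -
        have "1 / a * (1 / a) * b * a = b / a" if "a > 0" for a b :: real using that by simp
        from this[OF p] show ?thesis by (simp only: power2_eq_square)
      qed
      then show ?thesis using ineq[of "1 / (hn y)\<^sup>2"] by simp
    qed
    then show ?thesis using p by (simp add: field_simps)
  qed
  then have "(cmod q)\<^sup>2 \<le> (hn x * hn y)\<^sup>2" by (simp add: power_mult_distrib)
  then show ?thesis unfolding q_def by (rule power2_le_imp_le) simp
qed

lemma hn_add: "hn (x + y) \<le> hn x + hn y"
proof -
  have "(hn (x + y))\<^sup>2 = (hn x)\<^sup>2 + (hn y)\<^sup>2 + Re (\<phi> (x\<^sup>\<star> * y)) + Re (\<phi> (y\<^sup>\<star> * x))"
    by (simp add: hn_power2 \<phi>_add distrib_left distrib_right)
  also have "\<dots> \<le> (hn x)\<^sup>2 + (hn y)\<^sup>2 + hn x * hn y + hn y * hn x"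
    by (intro add_mono order_refl order_trans[OF complex_Re_le_cmod] Cauchy_Schwarz)
  also have "\<dots> = (hn x + hn y)\<^sup>2" by (simp add: power2_eq_square algebra_simps)
  finally show ?thesis by (rule power2_le_imp_le) simp
qed

lemma hn_csc [simp]: "hn (c *\<^sub>C x) = cmod c * hn x"
proof -
  have "\<phi> ((c *\<^sub>C x)\<^sup>\<star> * (c *\<^sub>C x)) = complex_of_real ((cmod c)\<^sup>2 * (hn x)\<^sup>2)"
    using complex_norm_square[of c] by (simp add: \<phi>_self mult.commute mult.left_commute)
  then show ?thesis unfolding hn_def[of "c *\<^sub>C x"] by (simp add: real_sqrt_mult)
qed

lemma hn_zero [simp]: "hn 0 = 0" by (simp add: hn_def)

lemma hn_one [simp]: "hn 1 = 1" by (simp add: hn_def)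

lemma hn_minus [simp]: "hn (- x) = hn x" by (simp add: hn_def)

lemma hn_diff: "hn (x - y) \<le> hn x + hn y"
  using hn_add[of x "- y"] by simp

lemma hn_mult: "hn (y * z) \<le> norm y * hn z"
proof -
  have "(hn (y * z))\<^sup>2 \<le> (norm y * hn z)\<^sup>2"
    using \<phi>_bound[of y z] by (simp only: hn_power2 power_mult_distrib)
  then show ?thesis by (rule power2_le_imp_le) simp
qed

lemma hn_le_norm: "hn x \<le> norm x"
  using hn_mult[of x 1] by simp

lemma \<phi>_le_hn: "cmod (\<phi> x) \<le> hn x"
  using Cauchy_Schwarz[of 1 x] by simp

lemma \<phi>_le_norm: "cmod (\<phi> x) \<le> norm x"
  using \<phi>_le_hn[of x] hn_le_norm[of x] by linarith

lemma bounded_linear_\<phi>: "bounded_linear \<phi>"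
  by (rule bounded_linear_intro[where K = 1]) (auto simp: \<phi>_add scaleR_csc scaleR_conv_of_real \<phi>_le_norm)

lemmas tendsto_\<phi> = bounded_linear.tendsto[OF bounded_linear_\<phi>]

lemma hn_mult_null: "hn z = 0 \<Longrightarrow> hn (y * z) = 0"
  using hn_mult[of y z] hn_nonneg[of "y * z"] by (simp del: hn_nonneg)

lemma hn_eqI: "hn (x - y) = 0 \<Longrightarrow> hn x = hn y"
  using hn_add[of "x - y" y] hn_diff[of x "x - y"] by simp

lemma hn_mult_eqI: "hn (x - y) = 0 \<Longrightarrow> hn (z * x) = hn (z * y)"
  using hn_mult_null[of "x - y" z] by (intro hn_eqI) (simp add: right_diff_distrib)

lemma hn_add_null: "hn x = 0 \<Longrightarrow> hn y = 0 \<Longrightarrow> hn (x + y) = 0"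
  using hn_add[of x y] hn_nonneg[of "x + y"] by (simp del: hn_nonneg)

lemma \<phi>_null: "hn x = 0 \<Longrightarrow> \<phi> x = 0"
  using \<phi>_le_hn[of x] by simp

lemma \<phi>_null_right: "hn y = 0 \<Longrightarrow> \<phi> (x * y) = 0"
  by (rule \<phi>_null) (rule hn_mult_null)

lemma \<phi>_null_left: "hn y = 0 \<Longrightarrow> \<phi> (y\<^sup>\<star> * x) = 0"
  using \<phi>_null_right[of y "x\<^sup>\<star>"] \<phi>_adj[of "x\<^sup>\<star> * y"] by simp

text \<open>The inner product depends only on the GNS vectors; this replaces computations in the
  quotient space.\<close>

lemma \<phi>_pair_cong:
  assumes "hn (x - x') = 0" "hn (y - y') = 0"
  shows "\<phi> (x\<^sup>\<star> * y) = \<phi> (x'\<^sup>\<star> * y')"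
proof -
  have "\<phi> (x\<^sup>\<star> * (y - y')) = 0" "\<phi> ((x - x')\<^sup>\<star> * y') = 0"
    using assms by (auto intro: \<phi>_null_right \<phi>_null_left simp del: adj_diff)
  then show ?thesis by (simp add: left_diff_distrib right_diff_distrib \<phi>_diff)
qed

end

section \<open>The covariance algebra of a semicircular element\<close>

text \<open>
  \<open>L\<close> behaves like a creation operator over \<open>A\<close> and the vector of \<open>\<phi>\<close> like a vacuum vector:
  \<open>A\<close> together with \<open>L\<close> is a copy of the Toeplitz-Pimsner algebra with covariance \<open>\<phi>\<close>.
\<close>

locale fock = state_on \<phi> for \<phi> :: "'a::cstar_alg \<Rightarrow> complex" +
  fixes A :: "'a set" and L :: 'a
  assumes A: "star_subalgebra A"
    and covariance: "x \<in> A \<Longrightarrow> L\<^sup>\<star> * (x * L) = \<phi> x *\<^sub>C 1"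
    and vacuum: "x \<in> A \<Longrightarrow> hn (L\<^sup>\<star> * x) = 0"
    and isometric: "X\<^sup>\<star> * X \<in> A \<Longrightarrow> 0 \<le> k \<Longrightarrow> (\<And>c. c \<in> A \<Longrightarrow> hn (X * c) \<le> k * hn c) \<Longrightarrow> norm X \<le> k"
begin

section \<open>Vectors created from the vacuum, and homogeneous operators on them\<close>

lemmas A_rules = subalg_one[OF A] subalg_add[OF A] subalg_mult[OF A] subalg_adj[OF A]
  subalg_csc[OF A] subalg_zero[OF A]

lemma LL: "L\<^sup>\<star> * L = 1"
  using covariance[of 1] A_rules(1) by simp

lemma LL_mult: "L\<^sup>\<star> * (L * x) = x"
  by (simp add: LL flip: mult.assoc)

text \<open>Applied to the vacuum these are the vectors of level \<open>p\<close> of the full Fock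
  module over \<open>A\<close>: sums of words with \<open>p\<close> letters \<open>L\<close> and
  elements of \<open>A\<close> between them. The \<open>A\<close>-valued inner product of the module
  is \<open>X\<^sup>\<star> * Y\<close>.\<close>

inductive cre :: "nat \<Rightarrow> 'a \<Rightarrow> bool" where
  cre_base: "a \<in> A \<Longrightarrow> cre 0 a"
| cre_step: "a \<in> A \<Longrightarrow> cre p X \<Longrightarrow> cre (Suc p) (a * (L * X))"
| cre_add: "cre p X \<Longrightarrow> cre p Y \<Longrightarrow> cre p (X + Y)"

lemma cre_zero: "cre p 0"
proof (induction p)
  case 0 show ?case by (intro cre_base A_rules)
next
  case (Suc p)
  from cre_step[OF A_rules(1) Suc] show ?case by simp
qed

lemma cre_left: "cre p X \<Longrightarrow> b \<in> A \<Longrightarrow> cre p (b * X)"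
proof (induction rule: cre.induct)
  case (cre_step a p X)
  then show ?case using cre.cre_step[of "b * a" p X] by (simp add: A_rules mult.assoc)
qed (auto simp: distrib_left intro: cre.intros A_rules)

lemma cre_mult: "cre p X \<Longrightarrow> cre q Y \<Longrightarrow> cre (p + q) (X * Y)"
  by (induction rule: cre.induct) (auto simp: distrib_right mult.assoc intro: cre.intros cre_left)

lemma cre_right: "cre p X \<Longrightarrow> b \<in> A \<Longrightarrow> cre p (X * b)"
  using cre_mult[of p X 0 b] by (simp add: cre_base)

lemma cre_csc: "cre p X \<Longrightarrow> cre p (c *\<^sub>C X)"
  using cre_left[of p X "c *\<^sub>C 1"] by (simp add: A_rules)

lemma cre_annihilate: "cre (Suc p) Y \<Longrightarrow> b \<in> A \<Longrightarrow> cre p (L\<^sup>\<star> * (b * Y))"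
proof (induction "Suc p" Y arbitrary: b rule: cre.induct)
  case (cre_step a X)
  have "L\<^sup>\<star> * (b * (a * (L * X))) = (L\<^sup>\<star> * (b * a * L)) * X" by (simp add: mult.assoc)
  then show ?case using cre_step covariance[of "b * a"] by (simp add: A_rules cre_csc)
qed (auto simp: distrib_left intro: cre.intros)

text \<open>The \<open>p\<close> annihilators in the adjoint of \<open>X\<close> meet the first
  \<open>p\<close> creators of \<open>Y\<close> and are cancelled one after the other by
  \<open>covariance\<close>.\<close>

lemma cre_pair: "cre p X \<Longrightarrow> cre (p + j) Y \<Longrightarrow> cre j (X\<^sup>\<star> * Y)"
proof (induction arbitrary: Y rule: cre.induct)
  case (cre_step a p X)
  then show ?case using cre_annihilate[of "p + j" Y "a\<^sup>\<star>"] by (simp add: A_rules mult.assoc)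
qed (auto simp: distrib_right intro: cre.intros cre_left A_rules)

lemma cre_0: "cre 0 Z \<Longrightarrow> Z \<in> A"
  by (induction "0::nat" Z rule: cre.induct) (auto intro: A_rules)

lemma cre_pair_A: "cre p X \<Longrightarrow> cre p Y \<Longrightarrow> X\<^sup>\<star> * Y \<in> A"
  using cre_pair[of p X 0 Y] by (simp add: cre_0)

text \<open>The rightmost annihilator of the adjoint word acts first, on an element of
  \<open>A\<close>, and there \<open>vacuum\<close> applies.\<close>

lemma cre_vac: "cre (Suc p) X \<Longrightarrow> c \<in> A \<Longrightarrow> hn (X\<^sup>\<star> * c) = 0"
proof (induction "Suc p" X rule: cre.induct)
  case (cre_step a X)
  then have "hn (X\<^sup>\<star> * (L\<^sup>\<star> * (a\<^sup>\<star> * c))) = 0" by (intro hn_mult_null vacuum A_rules)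
  then show ?case by (simp add: mult.assoc)
qed (auto simp: distrib_right intro: hn_add_null)

text \<open>\<open>Y\<^sup>\<star> * X\<close> is a creation word of positive degree
  \<open>q - p\<close>, so its adjoint kills the vacuum.\<close>

lemma cre_kill: "cre p Y \<Longrightarrow> cre q X \<Longrightarrow> p < q \<Longrightarrow> hn (X\<^sup>\<star> * Y) = 0"
  using cre_pair[of p Y "Suc (q - p - 1)" X] cre_vac[of "q - p - 1" "Y\<^sup>\<star> * X" 1] by (simp add: A_rules)

lemma cre_orth: assumes "cre p X" "cre q Y" "p \<noteq> q" shows "\<phi> (X\<^sup>\<star> * Y) = 0"
proof (cases "q < p")
  case True
  then show ?thesis using cre_kill assms \<phi>_null by blast
next
  case False
  then have "\<phi> (Y\<^sup>\<star> * X) = 0" using cre_kill assms \<phi>_null by (meson linorder_neqE_nat)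
  then show ?thesis using \<phi>_adj[of "Y\<^sup>\<star> * X"] by simp
qed

text \<open>A substitute for the spectral subspaces of the gauge action. The degree is attached to
  expressions, and nothing is claimed about an automorphism that would make it a function of the
  operator.\<close>

inductive hom :: "int \<Rightarrow> 'a \<Rightarrow> bool" where
  hom_word: "cre p X \<Longrightarrow> cre q Y \<Longrightarrow> d = int p - int q \<Longrightarrow> hom d (X * Y\<^sup>\<star>)"
| hom_add: "hom d X \<Longrightarrow> hom d Y \<Longrightarrow> hom d (X + Y)"

lemma hom_zero: "hom d 0"
proof -
  have "hom d (0 * 0\<^sup>\<star>)" by (rule hom_word[OF cre_zero[of "nat d"] cre_zero[of "nat (- d)"]]) simp
  then show ?thesis by simp
qed

lemma hom_adj: "hom d Z \<Longrightarrow> hom (- d) (Z\<^sup>\<star>)"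
  by (induction rule: hom.induct) (auto intro: hom.intros)

text \<open>Of the two inner words \<open>Y\<close> and \<open>X'\<close> the shorter one is
  absorbed into the longer by \<open>cre_pair\<close>; which outer word receives the remainder
  depends on the case.\<close>

lemma hom_word_mult:
  assumes "cre p X" "cre q Y" "cre p' X'" "cre q' Y'"
  shows "hom (int p - int q + (int p' - int q')) (X * Y\<^sup>\<star> * (X' * Y'\<^sup>\<star>))"
proof (cases "q \<le> p'")
  case True
  then have "cre (p' - q) (Y\<^sup>\<star> * X')" using cre_pair[of q Y "p' - q" X'] assms by simp
  then have "hom (int p - int q + (int p' - int q')) ((X * (Y\<^sup>\<star> * X')) * Y'\<^sup>\<star>)"
    using True assms by (intro hom_word[of "p + (p' - q)" _ q'] cre_mult) auto
  then show ?thesis by (simp add: mult.assoc)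
next
  case False
  then have "cre (q - p') (X'\<^sup>\<star> * Y)" using cre_pair[of p' X' "q - p'" Y] assms by simp
  then have "hom (int p - int q + (int p' - int q')) (X * (Y' * (X'\<^sup>\<star> * Y))\<^sup>\<star>)"
    using False assms by (intro hom_word[of p _ "q' + (q - p')"] cre_mult) auto
  then show ?thesis by (simp add: mult.assoc)
qed

lemma hom_mult: "hom d Y \<Longrightarrow> hom e Z \<Longrightarrow> hom (d + e) (Y * Z)"
proof (induction rule: hom.induct)
  case (hom_word p X q Y d)
  from hom_word(4) show ?case
    by (induction rule: hom.induct)
      (use hom_word in \<open>auto simp: distrib_left hom_word_mult intro: hom.hom_add\<close>)
qed (auto simp: distrib_right intro: hom.hom_add)

text \<open>Equality holds only up to null vectors, because a word with more annihilators than
  \<open>z\<close> has creators vanishes merely on the vacuum. In that case \<open>z'\<close> is 0;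
  otherwise it is the word obtained by cancelling.\<close>

lemma hom_act: "hom d Y \<Longrightarrow> cre j z \<Longrightarrow>
  \<exists>z'. hn (Y * z - z') = 0 \<and> (if 0 \<le> int j + d then cre (nat (int j + d)) z' else z' = 0)"
proof (induction rule: hom.induct)
  case (hom_word p X q Y d)
  show ?case
  proof (cases "q \<le> j")
    case True
    then have "cre (j - q) (Y\<^sup>\<star> * z)" using cre_pair[of q Y "j - q" z] hom_word by simp
    then have "cre (p + (j - q)) (X * (Y\<^sup>\<star> * z))" using hom_word by (intro cre_mult) auto
    moreover have "nat (int j + d) = p + (j - q)" "0 \<le> int j + d" using hom_word True by auto
    ultimately show ?thesis by (intro exI[of _ "X * (Y\<^sup>\<star> * z)"]) (simp add: mult.assoc)
  next
    case False
    then have "hn (X * (Y\<^sup>\<star> * z)) = 0" using hom_word by (intro hn_mult_null cre_kill) auto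
    then show ?thesis by (intro exI[of _ 0]) (simp add: mult.assoc cre_zero)
  qed
next
  case (hom_add d X Y)
  then obtain z1 z2 where z: "hn (X * z - z1) = 0" "hn (Y * z - z2) = 0"
     "if 0 \<le> int j + d then cre (nat (int j + d)) z1 else z1 = 0"
     "if 0 \<le> int j + d then cre (nat (int j + d)) z2 else z2 = 0" by blast
  then have "hn ((X + Y) * z - (z1 + z2)) = 0"
    using hn_add_null[OF z(1,2)] by (simp add: algebra_simps)
  then show ?case using z by (intro exI[of _ "z1 + z2"]) (auto intro: cre_add)
qed

text \<open>The bound is asked on each level separately. This is the form that passes to homogeneous
  components.\<close>

definition cre_bounded :: "real \<Rightarrow> 'a \<Rightarrow> bool" where
  "cre_bounded k Y \<longleftrightarrow> 0 \<le> k \<and> (\<forall>j z. cre j z \<longrightarrow> hn (Y * z) \<le> k * hn z)"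

lemma cre_boundedD: "cre_bounded k Y \<Longrightarrow> cre j z \<Longrightarrow> hn (Y * z) \<le> k * hn z"
  by (auto simp: cre_bounded_def)

lemma hom_act': assumes "hom d Y" "cre j z"
  obtains z' j' where "cre j' z'" "hn (Y * z - z') = 0"
  using hom_act[OF assms] cre_zero by (metis (full_types))

text \<open>The usual argument estimates \<open>Y * (Y\<^sup>\<star> * z)\<close>, to which the
  bound applies only if \<open>Y\<^sup>\<star> * z\<close> lies on a single level up to a null
  vector; homogeneity provides that.\<close>

lemma cre_bounded_adj:
  assumes Y: "hom d Y" and b: "cre_bounded k Y"
  shows "cre_bounded k (Y\<^sup>\<star>)"
  unfolding cre_bounded_def
proof (intro conjI allI impI)
  fix j z assume z: "cre j z"
  obtain z' j' where z': "cre j' z'" "hn (Y\<^sup>\<star> * z - z') = 0"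
    using hom_act'[OF hom_adj[OF Y] z] by blast
  have "(hn (Y\<^sup>\<star> * z))\<^sup>2 \<le> cmod (\<phi> (z\<^sup>\<star> * (Y * (Y\<^sup>\<star> * z))))"
    unfolding hn_power2 by (simp add: mult.assoc complex_Re_le_cmod)
  also have "\<dots> \<le> hn z * hn (Y * (Y\<^sup>\<star> * z))" by (rule Cauchy_Schwarz)
  also have "hn (Y * (Y\<^sup>\<star> * z)) = hn (Y * z')" by (rule hn_mult_eqI[OF z'(2)])
  also have "hn z * hn (Y * z') \<le> hn z * (k * hn z')"
    by (intro mult_left_mono cre_boundedD[OF b z'(1)]) simp
  also have "hn z' = hn (Y\<^sup>\<star> * z)" using hn_eqI[OF z'(2)] by simp
  finally have "hn (Y\<^sup>\<star> * z) * hn (Y\<^sup>\<star> * z) \<le> (k * hn z) * hn (Y\<^sup>\<star> * z)"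
    by (simp add: power2_eq_square algebra_simps)
  then show "hn (Y\<^sup>\<star> * z) \<le> k * hn z"
    using b by (cases "hn (Y\<^sup>\<star> * z) = 0") (auto simp: cre_bounded_def mult_le_cancel_right less_le)
qed (use b in \<open>simp add: cre_bounded_def\<close>)

lemma cre_bounded_mult:
  assumes Y: "hom d Y" and b: "cre_bounded k Y" "cre_bounded k' Z"
  shows "cre_bounded (k' * k) (Z * Y)"
  unfolding cre_bounded_def
proof (intro conjI allI impI)
  fix j z assume z: "cre j z"
  obtain z' j' where z': "cre j' z'" "hn (Y * z - z') = 0" using hom_act'[OF Y z] by blast
  have "hn (Z * Y * z) = hn (Z * z')" unfolding mult.assoc by (rule hn_mult_eqI[OF z'(2)])
  also have "\<dots> \<le> k' * hn z'" by (rule cre_boundedD[OF b(2) z'(1)])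
  also have "hn z' = hn (Y * z)" using hn_eqI[OF z'(2)] by simp
  also have "k' * hn (Y * z) \<le> k' * (k * hn z)"
    using b by (intro mult_left_mono cre_boundedD[OF b(1) z]) (simp add: cre_bounded_def)
  finally show "hn (Z * Y * z) \<le> k' * k * hn z" by (simp add: mult.assoc)
qed (use b in \<open>simp add: cre_bounded_def\<close>)

lemma hom_one: "hom 0 1"
  using hom_word[OF cre_base cre_base, of 1 1 0] A_rules by simp

lemma hom_power: "hom 0 V \<Longrightarrow> hom 0 (V ^ n)"
  using hom_mult[of 0 V 0] by (induction n) (auto simp: hom_one)

lemma cre_bounded_power: "hom 0 V \<Longrightarrow> cre_bounded k V \<Longrightarrow> cre_bounded (k ^ n) (V ^ n)"
proof (induction n)
  case 0 then show ?case by (simp add: cre_bounded_def)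
next
  case (Suc n)
  then show ?case using cre_bounded_mult[OF hom_power[OF Suc.prems(1), of n], of "k ^ n" k V] by simp
qed

end

text \<open>If \<open>k < x\<close>, then 1 would be at most \<open>c + d * N\<close> times
  \<open>(k / x) ^ N\<close> along \<open>N = 2 ^ j\<close>, and a geometric sequence beats a linear
  one. The term \<open>d\<close> accommodates the number of homogeneous components of an
  \<open>N\<close>-th power.\<close>

lemma le_of_dyadic_power_bound:
  fixes x k c d :: real
  assumes "0 \<le> x" "0 < k" and le: "\<And>j. x ^ (2 ^ j) \<le> (c + d * 2 ^ j) * k ^ (2 ^ j)"
  shows "x \<le> k"
proof (rule ccontr)
  assume "\<not> x \<le> k"
  then have q: "0 \<le> k / x" "k / x < 1" "x > 0" using assms by auto
  define r where "r = k / x"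
  have one: "1 \<le> c * r ^ (2 ^ j) + d * (of_nat (2 ^ j) * r ^ (2 ^ j))" for j :: nat
    using le[of j] q by (simp add: r_def power_divide field_simps)
  have f: "filterlim (\<lambda>j::nat. 2 ^ j :: nat) at_top sequentially"
    by (rule filterlim_at_top_mono[OF filterlim_ident]) (simp add: less_imp_le)
  have "(\<lambda>n. c * r ^ n + d * (of_nat n * r ^ n)) \<longlonglongrightarrow> c * 0 + d * 0"
    using q unfolding r_def[symmetric]
    by (intro tendsto_intros LIMSEQ_realpow_zero powser_times_n_limit_0) auto
  from filterlim_compose[OF this f] have "(\<lambda>j. c * r ^ (2 ^ j) + d * (of_nat (2 ^ j) * r ^ (2 ^ j))) \<longlonglongrightarrow> 0"
    by simp
  then have "1 \<le> (0::real)" by (rule LIMSEQ_le_const) (use one in auto)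
  then show False by simp
qed

section \<open>Norms of operators of degree zero\<close>

context fock begin

text \<open>The finite-rank operators on the Hilbert module of level \<open>p\<close>, a word
  \<open>X * Y\<^sup>\<star>\<close> being an operator of rank one.\<close>

inductive diag :: "nat \<Rightarrow> 'a \<Rightarrow> bool" where
  diag_word: "cre p X \<Longrightarrow> cre p Y \<Longrightarrow> diag p (X * Y\<^sup>\<star>)"
| diag_add: "diag p X \<Longrightarrow> diag p Y \<Longrightarrow> diag p (X + Y)"

lemma diag_cre: "diag p Z \<Longrightarrow> cre p W \<Longrightarrow> cre p (Z * W)"
proof (induction rule: diag.induct)
  case (diag_word p X Y)
  then have "cre p (X * (Y\<^sup>\<star> * W))" by (intro cre_right cre_pair_A)
  then show ?case by (simp add: mult.assoc)
qed (auto simp: distrib_right intro: cre_add)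

lemma diag_zero: "diag p 0"
  using diag_word[OF cre_zero cre_zero, of p] by simp

lemma diag_adj: "diag p Z \<Longrightarrow> diag p (Z\<^sup>\<star>)"
  by (induction rule: diag.induct) (auto intro: diag.intros)

lemma diag_left: "diag p Z \<Longrightarrow> (\<And>W. cre p W \<Longrightarrow> cre p (V * W)) \<Longrightarrow> diag p (V * Z)"
  by (induction rule: diag.induct) (auto simp: distrib_left simp flip: mult.assoc intro: diag.intros)

text \<open>For one way of writing \<open>V\<close> as a sum of words, \<open>C\<close> is the sum
  of the products \<open>norm X * norm Y\<close>. It has no relation to the norm of
  \<open>V\<close>, but it is uniform in \<open>T\<close>, so that \<open>T\<close> may be a high
  power of \<open>V\<close>.\<close>

lemma diag_finite_rank_bound: "diag p V \<Longrightarrow>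
  \<exists>C\<ge>0. \<forall>T r. 0 \<le> r \<longrightarrow> (\<forall>W. cre p W \<longrightarrow> norm (T * W) \<le> r * norm W) \<longrightarrow> norm (T * V) \<le> r * C"
proof (induction rule: diag.induct)
  case (diag_word p X Y)
  have "norm (T * (X * Y\<^sup>\<star>)) \<le> r * (norm X * norm Y)"
    if "\<forall>W. cre p W \<longrightarrow> norm (T * W) \<le> r * norm W" for T r
  proof -
    have "norm ((T * X) * Y\<^sup>\<star>) \<le> norm (T * X) * norm Y" using norm_mult_ineq[of "T * X" "Y\<^sup>\<star>"] by simp
    also have "\<dots> \<le> (r * norm X) * norm Y" using that diag_word by (intro mult_right_mono) auto
    finally show ?thesis by (simp add: mult.assoc)
  qed
  then show ?case by (intro exI[of _ "norm X * norm Y"]) auto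
next
  case (diag_add p X Y)
  then obtain C1 C2 where C: "C1 \<ge> 0" "C2 \<ge> 0"
    "\<forall>T r. 0 \<le> r \<longrightarrow> (\<forall>W. cre p W \<longrightarrow> norm (T * W) \<le> r * norm W) \<longrightarrow> norm (T * X) \<le> r * C1"
    "\<forall>T r. 0 \<le> r \<longrightarrow> (\<forall>W. cre p W \<longrightarrow> norm (T * W) \<le> r * norm W) \<longrightarrow> norm (T * Y) \<le> r * C2"
    by blast
  have "norm (T * (X + Y)) \<le> r * (C1 + C2)"
    if "0 \<le> r" "\<forall>W. cre p W \<longrightarrow> norm (T * W) \<le> r * norm W" for T r
    using C(3,4)[rule_format, OF that(1), of T] that norm_triangle_ineq[of "T * X" "T * Y"]
    by (simp add: distrib_left)
  then show ?case using C(1,2) by (intro exI[of _ "C1 + C2"]) auto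
qed

text \<open>
  On a single level the operator norm is attained on the Hilbert module \<open>cre p\<close>: the constant of
  \<open>diag_finite_rank_bound\<close> disappears when passing to high powers.
\<close>

lemma diag_norm_le:
  assumes Z: "diag p Z" and k: "0 < k" and b: "\<And>W. cre p W \<Longrightarrow> norm (Z * W) \<le> k * norm W"
  shows "norm Z \<le> k"
proof -
  define V where "V = Z\<^sup>\<star> * Z"
  have V: "diag p V" unfolding V_def by (intro diag_left Z diag_cre[OF diag_adj[OF Z]])
  have Vsa: "V\<^sup>\<star> = V" by (simp add: V_def)
  have b': "norm (Z\<^sup>\<star> * W) \<le> k * norm W" if W: "cre p W" for W
  proof -
    have c: "cre p (Z\<^sup>\<star> * W)" by (rule diag_cre[OF diag_adj[OF Z] W])
    have "(norm (Z\<^sup>\<star> * W))\<^sup>2 = norm (W\<^sup>\<star> * (Z * (Z\<^sup>\<star> * W)))"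
      using norm_adj_mult[of "Z\<^sup>\<star> * W"] by (simp add: mult.assoc)
    also have "\<dots> \<le> norm W * norm (Z * (Z\<^sup>\<star> * W))" using norm_mult_ineq[of "W\<^sup>\<star>"] by simp
    also have "\<dots> \<le> norm W * (k * norm (Z\<^sup>\<star> * W))" by (intro mult_left_mono b c) simp
    finally have "norm (Z\<^sup>\<star> * W) * norm (Z\<^sup>\<star> * W) \<le> (k * norm W) * norm (Z\<^sup>\<star> * W)"
      by (simp add: power2_eq_square algebra_simps)
    then show ?thesis
      using k by (cases "norm (Z\<^sup>\<star> * W) = 0") (auto simp: mult_le_cancel_right)
  qed
  have Vb: "norm (V * W) \<le> k\<^sup>2 * norm W" if W: "cre p W" for W
  proof -
    have "norm (V * W) \<le> k * norm (Z * W)"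
      unfolding V_def mult.assoc by (intro b' diag_cre Z W)
    also have "\<dots> \<le> k * (k * norm W)" using k by (intro mult_left_mono b W) auto
    finally show ?thesis by (simp add: power2_eq_square mult.assoc)
  qed
  have Vp: "cre p (V ^ n * W) \<and> norm (V ^ n * W) \<le> (k\<^sup>2) ^ n * norm W" if W: "cre p W" for W n
  proof (induction n)
    case (Suc n)
    have "norm (V * (V ^ n * W)) \<le> k\<^sup>2 * norm (V ^ n * W)" using Suc by (intro Vb) simp
    also have "\<dots> \<le> k\<^sup>2 * ((k\<^sup>2) ^ n * norm W)" using Suc by (intro mult_left_mono) auto
    finally show ?case using Suc diag_cre[OF V] by (simp add: mult.assoc)
  qed (simp add: W)
  obtain C where C: "C \<ge> 0"
    "\<And>T r. 0 \<le> r \<Longrightarrow> (\<forall>W. cre p W \<longrightarrow> norm (T * W) \<le> r * norm W) \<Longrightarrow> norm (T * V) \<le> r * C"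
    using diag_finite_rank_bound[OF V] by blast
  have le: "norm (V ^ Suc n) \<le> (k\<^sup>2) ^ n * C" for n
    using C(2)[of "(k\<^sup>2) ^ n" "V ^ n"] Vp by (simp add: power_commutes)
  have "norm V \<le> k\<^sup>2"
  \<comment> \<open>One factor \<open>V\<close> is spent on the finite-rank bound, so the power
    \<open>N\<close> carries only \<open>N - 1\<close> factors \<open>k\<^sup>2\<close>; the
    quotient in \<open>c\<close> restores the exponent.\<close>
  proof (rule le_of_dyadic_power_bound[where c = "C / k\<^sup>2" and d = 0])
    fix j
    obtain n where n: "2 ^ j = Suc n" by (metis not0_implies_Suc power_not_zero zero_neq_numeral)
    have "norm V ^ (2 ^ j) = norm (V ^ Suc n)" using norm_selfadj_power[OF Vsa, of j] n by simp
    also have "\<dots> \<le> (k\<^sup>2) ^ n * C" by (rule le)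
    also have "\<dots> = C / k\<^sup>2 * (k\<^sup>2) ^ Suc n" using k by (simp only: power_Suc) simp
    finally show "norm V ^ (2 ^ j) \<le> (C / k\<^sup>2 + 0 * 2 ^ j) * (k\<^sup>2) ^ (2 ^ j)" by (simp only: n) simp
  qed (use k in auto)
  then have "(norm Z)\<^sup>2 \<le> k\<^sup>2" by (simp add: V_def norm_adj_mult)
  then show ?thesis using k by (simp add: power2_le_iff_abs_le)
qed

text \<open>The finite levels of the fixed-point algebra of the gauge action. For fixed
  \<open>q\<close> this set is closed under products, so a constant depending on \<open>q\<close>
  alone survives all powers.\<close>

inductive core :: "nat \<Rightarrow> 'a \<Rightarrow> bool" where
  core_diag: "diag p X \<Longrightarrow> p \<le> q \<Longrightarrow> core q X"
| core_add: "core q X \<Longrightarrow> core q Y \<Longrightarrow> core q (X + Y)"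

lemma core_mono: "core q X \<Longrightarrow> q \<le> q' \<Longrightarrow> core q' X"
proof (induction rule: core.induct)
  case (core_diag p X q)
  then show ?case by (intro core.core_diag[of p]) auto
qed (auto intro: core.core_add)

lemma core_adj: "core q Z \<Longrightarrow> core q (Z\<^sup>\<star>)"
  by (induction rule: core.induct) (auto intro: core.intros diag_adj)

lemma diag_hom: "diag p Z \<Longrightarrow> hom 0 Z"
  by (induction rule: diag.induct) (auto intro: hom.intros)

lemma core_hom: "core q Z \<Longrightarrow> hom 0 Z"
  by (induction rule: core.induct) (auto intro: hom.intros diag_hom)

lemma hom_core: "hom 0 Z \<Longrightarrow> \<exists>q. core q Z"
proof (induction "0::int" Z rule: hom.induct)
  case (hom_word p X q Y)
  then have "diag p (X * Y\<^sup>\<star>)" by (intro diag_word) auto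
  then show ?case using core_diag by blast
next
  case (hom_add X Y)
  then obtain q1 q2 where "core q1 X" "core q2 Y" by blast
  then have "core (max q1 q2) X" "core (max q1 q2) Y" by (auto elim: core_mono)
  then show ?case using core_add by blast
qed

text \<open>The inner pairing of words of lengths \<open>p\<close> and \<open>r\<close> leaves a
  creation word of degree \<open>r - p\<close>, or the adjoint of one of degree
  \<open>p - r\<close>; it prolongs the outer word on the side of the lower level.\<close>

lemma diag_word_mult:
  assumes "cre p X" "cre p Y" "cre r X'" "cre r Y'"
  shows "diag (max p r) (X * Y\<^sup>\<star> * (X' * Y'\<^sup>\<star>))"
proof (cases "p \<le> r")
  case True
  then have "cre (p + (r - p)) (X * (Y\<^sup>\<star> * X'))"
    using cre_pair[of p Y "r - p" X'] assms by (intro cre_mult) auto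
  then have "diag r ((X * (Y\<^sup>\<star> * X')) * Y'\<^sup>\<star>)" using assms True by (intro diag_word) auto
  then show ?thesis using True by (simp add: mult.assoc max_def)
next
  case False
  then have "cre (r + (p - r)) (Y' * (X'\<^sup>\<star> * Y))"
    using cre_pair[of r X' "p - r" Y] assms by (intro cre_mult) auto
  then have "diag p (X * (Y' * (X'\<^sup>\<star> * Y))\<^sup>\<star>)" using assms False by (intro diag_word) auto
  then show ?thesis using False by (simp add: mult.assoc max_def)
qed

lemma diag_mult: "diag p Y \<Longrightarrow> diag r Z \<Longrightarrow> diag (max p r) (Y * Z)"
proof (induction rule: diag.induct)
  case (diag_word p X Y)
  from diag_word(3) show ?case
    by (induction rule: diag.induct)
      (use diag_word in \<open>auto simp: distrib_left diag_word_mult intro: diag.diag_add\<close>)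
qed (auto simp: distrib_right intro: diag.diag_add)

lemma core_mult: "core q Y \<Longrightarrow> core q Z \<Longrightarrow> core q (Y * Z)"
proof (induction rule: core.induct)
  case (core_diag p X q)
  from core_diag(3) core_diag(2) show ?case
  proof (induction rule: core.induct)
    case (core_diag r X' q)
    then show ?case using diag_mult[OF core_diag.hyps(1)] \<open>diag p X\<close> diag_mult[of p X r X']
      by (intro core.core_diag[of "max p r"]) auto
  qed (auto simp: distrib_left intro: core.core_add)
qed (auto simp: distrib_right intro: core.core_add)

lemma core_power: "core q V \<Longrightarrow> core q (V ^ Suc n)"
  by (induction n) (auto intro: core_mult)

lemma core_decompose: "core q Z \<Longrightarrow> \<exists>f. (\<forall>p. diag p (f p)) \<and> Z = (\<Sum>p\<le>q. f p)"
proof (induction rule: core.induct)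
  case (core_diag p X q)
  then show ?case by (intro exI[of _ "\<lambda>p'. if p' = p then X else 0"]) (auto simp: diag_zero)
next
  case (core_add q X Y)
  then obtain f g where "\<forall>p. diag p (f p)" "X = (\<Sum>p\<le>q. f p)" "\<forall>p. diag p (g p)" "Y = (\<Sum>p\<le>q. g p)" by blast
  then show ?case by (intro exI[of _ "\<lambda>p. f p + g p"]) (auto simp: sum.distrib intro: diag_add)
qed

lemma diag_kill: "diag p Z \<Longrightarrow> cre j z \<Longrightarrow> j < p \<Longrightarrow> hn (Z * z) = 0"
proof (induction rule: diag.induct)
  case (diag_word p X Y)
  then have "hn (X * (Y\<^sup>\<star> * z)) = 0" by (intro hn_mult_null cre_kill) auto
  then show ?case by (simp add: mult.assoc)
qed (auto simp: distrib_right intro: hn_add_null)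

lemma hn_sum_null: "(\<And>i. i \<in> I \<Longrightarrow> hn (f i) = 0) \<Longrightarrow> hn (sum f I) = 0"
  by (induction I rule: infinite_finite_induct) (auto intro: hn_add_null)

text \<open>Induction from the bottom: on vectors of level \<open>n\<close> the higher summands
  vanish and the lower ones are bounded already, so \<open>f n\<close> is bounded there by
  \<open>(1 + 3 ^ n) * k\<close>. Then \<open>isometric\<close> and \<open>diag_norm_le\<close> turn
  this into a bound of its operator norm. The factor 3 absorbs
  \<open>3 ^ n + (1 + 3 ^ n)\<close>.\<close>

lemma core_levels_bound:
  assumes f: "\<And>p. diag p (f p)" and b: "cre_bounded k (\<Sum>p\<le>q. f p)" and k: "0 < k" and n: "n \<le> Suc q"
  shows "norm (\<Sum>p<n. f p) \<le> 3 ^ n * k"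
  using n
proof (induction n)
  case 0 then show ?case using k by simp
next
  case (Suc n)
  let ?S = "\<Sum>p<n. f p"
  let ?m = "(1 + 3 ^ n) * k"
  have split: "(\<Sum>p\<le>q. f p) = ?S + f n + (\<Sum>p\<in>{Suc n..q}. f p)"
  proof -
    have "{..q} = {..<n} \<union> {n} \<union> {Suc n..q}" using Suc.prems by auto
    moreover have "sum f ({..<n} \<union> {n} \<union> {Suc n..q}) = ?S + f n + (\<Sum>p\<in>{Suc n..q}. f p)"
      by (subst sum.union_disjoint) auto
    ultimately show ?thesis by simp
  qed
  have "norm (f n) \<le> ?m"
  proof (rule diag_norm_le[OF f])
    show "0 < ?m" using k by (simp add: add_pos_pos)
    fix W assume W: "cre n W"
    show "norm (f n * W) \<le> ?m * norm W"
    \<comment> \<open>The test vectors \<open>W * c\<close> with \<open>c\<close> in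
      \<open>A\<close> all lie on level \<open>n\<close>, where \<open>b\<close> and
      \<open>diag_kill\<close> can be used.\<close>
    proof (rule isometric)
      show "(f n * W)\<^sup>\<star> * (f n * W) \<in> A" by (rule cre_pair_A[OF diag_cre[OF f W] diag_cre[OF f W]])
      show "0 \<le> ?m * norm W" using k by simp
      fix c assume c: "c \<in> A"
      let ?z = "W * c"
      have z: "cre n ?z" by (rule cre_right[OF W c])
      have "f n * ?z = (\<Sum>p\<le>q. f p) * ?z - (?S * ?z + (\<Sum>p\<in>{Suc n..q}. f p) * ?z)"
        unfolding split by (simp add: algebra_simps)
      then have "hn (f n * ?z) \<le> hn ((\<Sum>p\<le>q. f p) * ?z) + (hn (?S * ?z) + hn ((\<Sum>p\<in>{Suc n..q}. f p) * ?z))"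
        using hn_diff[of "(\<Sum>p\<le>q. f p) * ?z"] hn_add[of "?S * ?z" "(\<Sum>p\<in>{Suc n..q}. f p) * ?z"]
        by (smt (verit))
      moreover have "hn ((\<Sum>p\<in>{Suc n..q}. f p) * ?z) = 0"
        unfolding sum_distrib_right by (rule hn_sum_null) (auto intro: diag_kill[OF f z])
      moreover have "hn ((\<Sum>p\<le>q. f p) * ?z) \<le> k * hn ?z" by (rule cre_boundedD[OF b z])
      moreover have "hn (?S * ?z) \<le> 3 ^ n * k * hn ?z"
        using hn_mult[of ?S ?z] Suc mult_right_mono[of "norm ?S" "3 ^ n * k" "hn ?z"] by simp
      ultimately have "hn (f n * ?z) \<le> ?m * hn ?z" by (simp add: algebra_simps)
      also have "\<dots> \<le> ?m * (norm W * hn c)" using k by (intro mult_left_mono hn_mult) auto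
      finally show "hn (f n * W * c) \<le> ?m * norm W * hn c" by (simp add: mult.assoc)
    qed
  qed
  then have "norm (?S + f n) \<le> 3 ^ n * k + ?m"
    using Suc norm_triangle_ineq[of ?S "f n"] by simp
  also have "\<dots> \<le> 3 ^ Suc n * k" using k one_le_power[of "3::real" n] by (simp add: algebra_simps)
  finally show ?case by (simp add: add.commute)
qed

text \<open>All powers of \<open>V\<close> stay in \<open>core q\<close>, so the exponential
  constant of \<open>core_levels_bound\<close> is one fixed number and disappears with the
  roots.\<close>

lemma core_norm_le:
  assumes Z: "core q Z" and b: "cre_bounded k Z" and k: "0 < k"
  shows "norm Z \<le> k"
proof -
  define V where "V = Z\<^sup>\<star> * Z"
  have V: "core q V" unfolding V_def by (intro core_mult core_adj Z)
  have Vsa: "V\<^sup>\<star> = V" by (simp add: V_def)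
  have Vb: "cre_bounded (k\<^sup>2) V"
    unfolding V_def power2_eq_square
    by (rule cre_bounded_mult[OF core_hom[OF Z] b cre_bounded_adj[OF core_hom[OF Z] b]])
  have "norm V \<le> k\<^sup>2"
  proof (rule le_of_dyadic_power_bound[where c = "3 ^ Suc q" and d = 0])
    fix j
    have "core q (V ^ (2 ^ j))" using core_power[OF V, of "2 ^ j - 1"] by simp
    then obtain f where f: "\<And>p. diag p (f p)" "V ^ (2 ^ j) = (\<Sum>p\<le>q. f p)"
      using core_decompose by blast
    have "norm (\<Sum>p<Suc q. f p) \<le> 3 ^ Suc q * (k\<^sup>2) ^ (2 ^ j)"
      by (rule core_levels_bound[OF f(1)])
        (use cre_bounded_power[OF core_hom[OF V] Vb, of "2 ^ j"] f k in auto)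
    then show "norm V ^ (2 ^ j) \<le> (3 ^ Suc q + 0 * 2 ^ j) * (k\<^sup>2) ^ (2 ^ j)"
      using f(2) norm_selfadj_power[OF Vsa, of j] by (simp add: lessThan_Suc_atMost)
  qed (use k in auto)
  then have "(norm Z)\<^sup>2 \<le> k\<^sup>2" by (simp add: V_def norm_adj_mult)
  then show ?thesis using k by (simp add: power2_le_iff_abs_le)
qed

text \<open>The C*-identity moves the question to \<open>Y\<^sup>\<star> * Y\<close>, which has
  degree 0 and therefore lies in some \<open>core q\<close>.\<close>

lemma hom_norm_le:
  assumes Y: "hom d Y" and b: "cre_bounded k Y" and k: "0 < k"
  shows "norm Y \<le> k"
proof -
  have "hom 0 (Y\<^sup>\<star> * Y)" using hom_mult[OF hom_adj[OF Y] Y] by simp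
  then obtain q where "core q (Y\<^sup>\<star> * Y)" using hom_core by blast
  moreover have "cre_bounded (k\<^sup>2) (Y\<^sup>\<star> * Y)"
    unfolding power2_eq_square by (rule cre_bounded_mult[OF Y b cre_bounded_adj[OF Y b]])
  ultimately have "norm (Y\<^sup>\<star> * Y) \<le> k\<^sup>2" using k by (intro core_norm_le) auto
  then have "(norm Y)\<^sup>2 \<le> k\<^sup>2" by (simp add: norm_adj_mult)
  then show ?thesis using k by (simp add: power2_le_iff_abs_le)
qed

section \<open>Finite sums of homogeneous operators, and the norm on \<open>gen\<close>\<close>

inductive graded :: "nat \<Rightarrow> 'a \<Rightarrow> bool" where
  graded_hom: "hom d X \<Longrightarrow> \<bar>d\<bar> \<le> int m \<Longrightarrow> graded m X"
| graded_add: "graded m X \<Longrightarrow> graded m Y \<Longrightarrow> graded m (X + Y)"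

lemma graded_mono: "graded m X \<Longrightarrow> m \<le> n \<Longrightarrow> graded n X"
  by (induction rule: graded.induct) (auto intro: graded.intros)

lemma graded_mult: "graded m Y \<Longrightarrow> graded n Z \<Longrightarrow> graded (m + n) (Y * Z)"
proof (induction rule: graded.induct)
  case (graded_hom d X m)
  from graded_hom(3) graded_hom(1,2) show ?case
  proof (induction rule: graded.induct)
    case (graded_hom e X' n)
    then show ?case using hom_mult[of d X e X'] by (intro graded.graded_hom[of "d + e"]) auto
  qed (auto simp: distrib_left intro: graded.graded_add)
qed (auto simp: distrib_right intro: graded.graded_add)

lemma graded_power: "graded m V \<Longrightarrow> graded (m * n) (V ^ n)"
proof (induction n)
  case 0 show ?case using graded_hom[OF hom_one] by simp
next
  case (Suc n) then show ?case using graded_mult[of m V "m * n" "V ^ n"] by simp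
qed

lemma graded_decompose: "graded m Z \<Longrightarrow> \<exists>f. (\<forall>d. hom d (f d)) \<and> Z = (\<Sum>d\<in>{- int m..int m}. f d)"
proof (induction rule: graded.induct)
  case (graded_hom d X m)
  then have "d \<in> {- int m..int m}" by auto
  with graded_hom show ?case
    by (intro exI[of _ "\<lambda>d'. if d' = d then X else 0"]) (auto simp: hom_zero)
next
  case (graded_add m X Y)
  then obtain f g where "\<forall>d. hom d (f d)" "X = (\<Sum>d\<in>{- int m..int m}. f d)"
     "\<forall>d. hom d (g d)" "Y = (\<Sum>d\<in>{- int m..int m}. g d)" by blast
  then show ?case by (intro exI[of _ "\<lambda>d. f d + g d"]) (auto simp: sum.distrib intro: hom_add)
qed

lemma hom_orth:
  assumes "hom d X" "hom e Y" "d \<noteq> e" "cre j z"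
  shows "\<phi> ((X * z)\<^sup>\<star> * (Y * z)) = 0"
proof -
  obtain x' y' where *: "hn (X * z - x') = 0" "if 0 \<le> int j + d then cre (nat (int j + d)) x' else x' = 0"
     "hn (Y * z - y') = 0" "if 0 \<le> int j + e then cre (nat (int j + e)) y' else y' = 0"
    using hom_act[OF assms(1,4)] hom_act[OF assms(2,4)] by blast
  have "\<phi> ((X * z)\<^sup>\<star> * (Y * z)) = \<phi> (x'\<^sup>\<star> * y')" by (rule \<phi>_pair_cong) (use * in auto)
  also have "\<dots> = 0"
  proof (cases "0 \<le> int j + d \<and> 0 \<le> int j + e")
    case True
    then show ?thesis using * assms(3) by (intro cre_orth[of "nat (int j + d)" _ "nat (int j + e)"]) auto
  qed (use * in auto)
  finally show ?thesis .
qed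

text \<open>The components send a vector of one level to pairwise orthogonal levels. Pairing
  \<open>f e * z\<close> with the whole sum applied to \<open>z\<close> therefore leaves only
  \<open>(hn (f e * z))\<^sup>2\<close>, and Cauchy-Schwarz finishes. This replaces the averaging
  over the circle.\<close>

lemma component_bounded:
  assumes f: "\<And>d. hom d (f d)" and I: "finite I" "e \<in> I" and b: "cre_bounded k (\<Sum>d\<in>I. f d)"
  shows "cre_bounded k (f e)"
  unfolding cre_bounded_def
proof (intro conjI allI impI)
  fix j z assume z: "cre j z"
  let ?y = "(\<Sum>d\<in>I. f d) * z"
  have "\<phi> ((f e * z)\<^sup>\<star> * ?y) = (\<Sum>d\<in>I. \<phi> ((f e * z)\<^sup>\<star> * (f d * z)))"
    by (simp only: sum_distrib_right sum_distrib_left \<phi>_sum)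
  also have "\<dots> = (\<Sum>d\<in>I. if d = e then \<phi> ((f e * z)\<^sup>\<star> * (f e * z)) else 0)"
    using hom_orth[OF f f _ z] by (intro sum.cong refl) (auto simp del: adj_mult)
  also have "\<dots> = complex_of_real ((hn (f e * z))\<^sup>2)" using I by (simp only: \<phi>_self) (simp add: sum.delta)
  finally have "(hn (f e * z))\<^sup>2 = cmod (\<phi> ((f e * z)\<^sup>\<star> * ?y))" by (simp add: norm_power)
  also have "\<dots> \<le> hn (f e * z) * hn ?y" by (rule Cauchy_Schwarz)
  finally have "hn (f e * z) * hn (f e * z) \<le> hn ?y * hn (f e * z)"
    by (simp add: power2_eq_square mult.commute)
  then have "hn (f e * z) \<le> hn ?y"
    by (cases "hn (f e * z) = 0") (auto simp: mult_le_cancel_right less_le)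
  then show "hn (f e * z) \<le> k * hn z" using cre_boundedD[OF b z] by simp
qed (use b in \<open>simp add: cre_bounded_def\<close>)

inductive_set gen :: "'a set" where
  gen_A: "a \<in> A \<Longrightarrow> a \<in> gen"
| gen_S: "L + L\<^sup>\<star> \<in> gen"
| gen_add: "x \<in> gen \<Longrightarrow> y \<in> gen \<Longrightarrow> x + y \<in> gen"
| gen_mult: "x \<in> gen \<Longrightarrow> y \<in> gen \<Longrightarrow> x * y \<in> gen"

lemma gen_adj: "x \<in> gen \<Longrightarrow> x\<^sup>\<star> \<in> gen"
proof (induction rule: gen.induct)
  case gen_S then show ?case using gen.gen_S by (simp add: add.commute)
qed (auto intro: gen.intros A_rules)

lemma star_subalgebra_gen: "star_subalgebra gen"
  unfolding star_subalgebra_def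
proof (intro conjI ballI allI)
  fix x c assume "x \<in> gen"
  then show "c *\<^sub>C x \<in> gen" using gen_mult[of "c *\<^sub>C 1" x] by (simp add: A_rules gen_A)
qed (auto intro: gen.intros A_rules gen_adj)

lemma graded_gen: "x \<in> gen \<Longrightarrow> \<exists>m. graded m x"
proof (induction rule: gen.induct)
  case (gen_A a)
  then have "hom 0 (a * 1\<^sup>\<star>)" by (intro hom_word[OF cre_base cre_base] A_rules) auto
  then show ?case using graded_hom[of 0 a 0] by auto
next
  case gen_S
  have "cre (Suc 0) (1 * (L * 1))" by (intro cre_step cre_base A_rules)
  then have "hom 1 (L * 1\<^sup>\<star>)" by (intro hom_word[OF _ cre_base] A_rules) auto
  then have h: "hom 1 L" by simp
  then have "graded 1 L" "graded 1 (L\<^sup>\<star>)" using graded_hom[of 1 L 1] graded_hom[OF hom_adj[OF h], of 1] by auto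
  then show ?case using graded_add by blast
next
  case (gen_add x y)
  then obtain m n where "graded m x" "graded n y" by blast
  then have "graded (max m n) x" "graded (max m n) y" by (auto elim: graded_mono)
  then show ?case using graded_add by blast
qed (use graded_mult in blast)

text \<open>The vacuum is cyclic for \<open>gen\<close>, although \<open>L\<close> alone is not
  among its generators: \<open>L * X\<close> is \<open>(L + L\<^sup>\<star>) * X\<close> minus
  \<open>L\<^sup>\<star> * X\<close>, and the latter lies one level lower.\<close>

lemma cre_gen: "cre p z \<Longrightarrow> \<exists>w\<in>gen. hn (z - w) = 0"
proof -
  \<comment> \<open>The claim is made for all levels up to \<open>p\<close> at once, since the step
    to \<open>p + 1\<close> uses both \<open>p\<close> and \<open>p - 1\<close>.\<close>
  have "\<forall>q\<le>p. \<forall>z. cre q z \<longrightarrow> (\<exists>w\<in>gen. hn (z - w) = 0)" for p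
  proof (induction p)
    case 0
    then show ?case using cre_0 gen_A by force
  next
    case (Suc p)
    have "\<exists>w\<in>gen. hn (z - w) = 0" if "cre (Suc p) z" for z
      using that
    proof (induction "Suc p" z rule: cre.induct)
      case (cre_step a X)
      obtain w where w: "w \<in> gen" "hn (X - w) = 0" using Suc cre_step by blast
      \<comment> \<open>On level 0 there is nothing below, and \<open>vacuum\<close> allows
        \<open>v = 0\<close>.\<close>
      obtain v where v: "v \<in> gen" "hn (L\<^sup>\<star> * X - v) = 0"
      proof (cases p)
        case 0
        then have "X \<in> A" using cre_step cre_0 by simp
        then show ?thesis using that[of 0] vacuum[of X] gen_A A_rules by simp
      next
        case (Suc p')
        then have "cre p' (L\<^sup>\<star> * (1 * X))" using cre_step by (intro cre_annihilate A_rules) simp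
        then have "cre p' (L\<^sup>\<star> * X)" "p' \<le> p" using Suc by auto
        then show ?thesis using that \<open>\<forall>q\<le>p. \<forall>z. cre q z \<longrightarrow> (\<exists>w\<in>gen. hn (z - w) = 0)\<close> by blast
      qed
      let ?w = "a * ((L + L\<^sup>\<star>) * w - v)"
      have "?w \<in> gen"
        by (rule gen_mult[OF gen_A[OF cre_step(1)] subalg_diff[OF star_subalgebra_gen gen_mult[OF gen_S w(1)] v(1)]])
      moreover have "hn (a * (L * X) - ?w) = 0"
      proof -
        have "hn (a * ((L + L\<^sup>\<star>) * (X - w) + - (L\<^sup>\<star> * X - v))) = 0"
          using w v hn_minus[of "L\<^sup>\<star> * X - v"]
          by (intro hn_mult_null hn_add_null) (auto simp del: minus_diff_eq)
        moreover have "a * ((L + L\<^sup>\<star>) * (X - w) + - (L\<^sup>\<star> * X - v)) = a * (L * X) - ?w"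
          by (simp add: algebra_simps)
        ultimately show ?thesis by simp
      qed
      ultimately show ?case by blast
    next
      case (cre_add X Y)
      then obtain v w where "v \<in> gen" "hn (X - v) = 0" "w \<in> gen" "hn (Y - w) = 0" by blast
      then have "v + w \<in> gen" "hn ((X + Y) - (v + w)) = 0"
        using hn_add_null[of "X - v" "Y - w"] by (auto intro: gen_add simp: algebra_simps)
      then show ?case by blast
    qed
    then show ?case using Suc by (simp add: le_Suc_eq)
  qed
  then show "cre p z \<Longrightarrow> \<exists>w\<in>gen. hn (z - w) = 0" by blast
qed

text \<open>The norm on \<open>gen\<close> is thereby determined by the vacuum state alone. No bound
  for sums over several levels survives the splitting into components, so the powers of
  \<open>V\<close> are estimated component by component.\<close>

theorem gen_norm_le:
  assumes y: "y \<in> gen" and b: "\<And>z. z \<in> gen \<Longrightarrow> hn (y * z) \<le> k * hn z" and k: "0 < k"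
  shows "norm y \<le> k"
proof -
  note G = star_subalgebra_gen
  define V where "V = y\<^sup>\<star> * y"
  have V: "V \<in> gen" unfolding V_def by (intro gen_mult gen_adj y)
  have Vsa: "V\<^sup>\<star> = V" by (simp add: V_def)
  have b': "hn (y\<^sup>\<star> * z) \<le> k * hn z" if z: "z \<in> gen" for z
  proof -
    have "(hn (y\<^sup>\<star> * z))\<^sup>2 \<le> cmod (\<phi> (z\<^sup>\<star> * (y * (y\<^sup>\<star> * z))))"
      unfolding hn_power2 by (simp add: mult.assoc complex_Re_le_cmod)
    also have "\<dots> \<le> hn z * hn (y * (y\<^sup>\<star> * z))" by (rule Cauchy_Schwarz)
    also have "\<dots> \<le> hn z * (k * hn (y\<^sup>\<star> * z))"
      by (intro mult_left_mono b gen_mult gen_adj y z) simp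
    finally have "hn (y\<^sup>\<star> * z) * hn (y\<^sup>\<star> * z) \<le> (k * hn z) * hn (y\<^sup>\<star> * z)"
      by (simp add: power2_eq_square algebra_simps)
    then show ?thesis using k by (cases "hn (y\<^sup>\<star> * z) = 0") (auto simp: mult_le_cancel_right less_le)
  qed
  have Vb: "hn (V ^ n * z) \<le> (k\<^sup>2) ^ n * hn z" if z: "z \<in> gen" for n z
    using z
  proof (induction n arbitrary: z)
    case (Suc n)
    have "hn (V ^ n * (V * z)) \<le> (k\<^sup>2) ^ n * hn (V * z)" by (intro Suc gen_mult V)
    also have "\<dots> \<le> (k\<^sup>2) ^ n * (k\<^sup>2 * hn z)"
    proof (rule mult_left_mono)
      have "hn (V * z) \<le> k * hn (y * z)"
        unfolding V_def mult.assoc by (intro b' gen_mult y Suc)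
      also have "\<dots> \<le> k * (k * hn z)" using k by (intro mult_left_mono b Suc) auto
      finally show "hn (V * z) \<le> k\<^sup>2 * hn z" by (simp add: power2_eq_square mult.assoc)
    qed simp
    finally show ?case by (simp only: power_Suc2 mult.assoc)
  qed simp
  \<comment> \<open>The bound is known on vectors from \<open>gen\<close>; by \<open>cre_gen\<close>
    every creation vector is one of these up to a null vector.\<close>
  have Vc: "cre_bounded ((k\<^sup>2) ^ n) (V ^ n)" for n
    unfolding cre_bounded_def
  proof (intro conjI allI impI)
    fix j z assume "cre j z"
    then obtain w where w: "w \<in> gen" "hn (z - w) = 0" using cre_gen by blast
    then show "hn (V ^ n * z) \<le> (k\<^sup>2) ^ n * hn z"
      using Vb[OF w(1), of n] hn_mult_eqI[OF w(2), of "V ^ n"] hn_eqI[OF w(2)] by simp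
  qed simp
  obtain m where m: "graded m V" using graded_gen V by blast
  have "norm V \<le> k\<^sup>2"
  proof (rule le_of_dyadic_power_bound[where c = 1 and d = "2 * real m"])
    fix j
    let ?N = "2 ^ j :: nat"
    obtain f where f: "\<And>d. hom d (f d)" "V ^ ?N = (\<Sum>d\<in>{- int (m * ?N)..int (m * ?N)}. f d)"
      using graded_decompose[OF graded_power[OF m]] by blast
    have "norm (V ^ ?N) \<le> (\<Sum>d\<in>{- int (m * ?N)..int (m * ?N)}. (k\<^sup>2) ^ ?N)"
      unfolding f(2)
    proof (rule sum_norm_le)
      fix d assume d: "d \<in> {- int (m * ?N)..int (m * ?N)}"
      show "norm (f d) \<le> (k\<^sup>2) ^ ?N"
        by (rule hom_norm_le[OF f(1) component_bounded[OF f(1) _ d]]) (use Vc[of ?N] f k in auto)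
    qed
    \<comment> \<open>The number of integers between \<open>- m * N\<close> and
      \<open>m * N\<close>: the linear loss that \<open>le_of_dyadic_power_bound\<close>
      tolerates.\<close>
    also have "\<dots> = (1 + 2 * real m * 2 ^ j) * (k\<^sup>2) ^ ?N"
      by simp
    finally show "norm V ^ ?N \<le> (1 + 2 * real m * 2 ^ j) * (k\<^sup>2) ^ ?N"
      using norm_selfadj_power[OF Vsa, of j] by simp
  qed (use k in auto)
  then have "(norm y)\<^sup>2 \<le> k\<^sup>2" by (simp add: V_def norm_adj_mult)
  then show ?thesis using k by (simp add: power2_le_iff_abs_le)
qed

end

context state_on begin

lemma hn_diff_abs: "\<bar>hn x - hn y\<bar> \<le> norm (x - y)"
  using hn_add[of "x - y" y] hn_diff[of x "x - y"] hn_le_norm[of "x - y"] by simp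

lemma tendsto_hn:
  assumes "(f \<longlongrightarrow> x) F" shows "((\<lambda>i. hn (f i)) \<longlongrightarrow> hn x) F"
proof -
  have n: "((\<lambda>i. norm (f i - x)) \<longlongrightarrow> 0) F" using assms by (simp add: tendsto_norm_zero_iff Lim_null[symmetric])
  have "((\<lambda>i. hn (f i) - hn x) \<longlongrightarrow> 0) F"
    by (rule Lim_null_comparison[OF _ n]) (simp add: hn_diff_abs)
  then show ?thesis by (simp add: Lim_null[symmetric])
qed

end

section \<open>The closure of \<open>gen\<close>, and the algebra of the semicircular
  element\<close>

context fock begin

text \<open>The slack \<open>e\<close> also admits \<open>k = 0\<close>, and this case is the
  faithfulness of the GNS representation used in \<open>semi_faithful\<close>.\<close>

lemma closure_gen_norm_le:
  assumes y: "y \<in> closure gen" and b: "\<And>z. z \<in> gen \<Longrightarrow> hn (y * z) \<le> k * hn z" and k: "0 \<le> k"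
  shows "norm y \<le> k"
proof (rule field_le_epsilon)
  fix e :: real assume e: "0 < e"
  obtain y' where y': "y' \<in> gen" "norm (y - y') < e / 2"
    using y e unfolding closure_approachable by (metis dist_norm norm_minus_commute half_gt_zero)
  have "norm y' \<le> k + e / 2"
  proof (rule gen_norm_le[OF y'(1)])
    fix z assume z: "z \<in> gen"
    have "y' * z = y * z - (y - y') * z" by (simp add: algebra_simps)
    then have "hn (y' * z) \<le> hn (y * z) + hn ((y - y') * z)" using hn_diff by metis
    also have "\<dots> \<le> k * hn z + e / 2 * hn z"
      using y' by (intro add_mono b z order_trans[OF hn_mult] mult_right_mono) auto
    finally show "hn (y' * z) \<le> (k + e / 2) * hn z" by (simp add: algebra_simps)
  qed (use e k in auto)
  then show "norm y \<le> k + e" using y' norm_triangle_ineq[of "y - y'" y'] by simp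
qed

abbreviation scalars :: "'a set" where "scalars \<equiv> range (\<lambda>c. c *\<^sub>C 1)"

text \<open>The same \<open>L\<close> over the scalars is again a Fock situation, so the norm
  formula holds for polynomials in \<open>L + L\<^sup>\<star>\<close> tested only on such
  polynomials.\<close>

lemma fock_scalars: "fock \<phi> scalars L"
proof (unfold_locales)
  show "star_subalgebra scalars"
    unfolding star_subalgebra_def
    by (auto simp flip: csc_add_left intro: range_eqI[of _ _ "1"])
  show "L\<^sup>\<star> * (x * L) = \<phi> x *\<^sub>C 1" if "x \<in> scalars" for x using that by (auto simp: LL)
  show "hn (L\<^sup>\<star> * x) = 0" if "x \<in> scalars" for x
    using that vacuum[of 1] A_rules by auto
  fix X k assume X: "X\<^sup>\<star> * X \<in> scalars" and k: "0 \<le> k" and b: "\<And>c. c \<in> scalars \<Longrightarrow> hn (X * c) \<le> k * hn c"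
  obtain c where c: "X\<^sup>\<star> * X = c *\<^sub>C 1" using X by auto
  have "1 \<in> scalars" by (rule range_eqI[of _ _ 1]) simp
  then have "hn X \<le> k" using b[of 1] by simp
  \<comment> \<open>When \<open>X\<^sup>\<star> * X\<close> is a scalar, the vacuum alone detects
    the norm of \<open>X\<close>.\<close>
  have "c = complex_of_real ((hn X)\<^sup>2)" using \<phi>_self[of X] by (simp add: c)
  then have "(norm X)\<^sup>2 = (hn X)\<^sup>2 * norm (1::'a)"
    using norm_adj_mult[of X] by (simp add: c norm_power)
  also have "\<dots> \<le> k\<^sup>2 * 1" using \<open>hn X \<le> k\<close> norm_one_le by (intro mult_mono power_mono) auto
  finally show "norm X \<le> k" using k by (simp add: power2_le_iff_abs_le)
qed

definition semi :: "'a set" where "semi = fock.gen scalars L"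

lemma star_subalgebra_semi: "star_subalgebra semi"
  unfolding semi_def by (rule fock.star_subalgebra_gen[OF fock_scalars])

lemma semi_gen: "semi \<subseteq> gen"
proof
  fix x assume "x \<in> semi"
  then show "x \<in> gen" unfolding semi_def
    by (induction rule: fock.gen.induct[OF fock_scalars, consumes 1])
      (auto intro: gen.intros A_rules)
qed

lemma S_semi: "L + L\<^sup>\<star> \<in> semi"
  unfolding semi_def by (rule fock.gen.gen_S[OF fock_scalars])

text \<open>The vacuum expectation of \<open>L + L\<^sup>\<star>\<close> is 0, so the scalar could
  only be 0; but \<open>L\<^sup>\<star> * (L + L\<^sup>\<star>)\<close> has expectation 1.\<close>

lemma S_not_scalar: "L + L\<^sup>\<star> \<noteq> c *\<^sub>C 1"
proof
  assume eq: "L + L\<^sup>\<star> = c *\<^sub>C 1"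
  have z: "\<phi> (x * L\<^sup>\<star>) = 0" for x using vacuum[of 1] A_rules by (intro \<phi>_null_right) simp
  have "\<phi> (L\<^sup>\<star>) = 0" using z[of 1] by simp
  then have c: "c = 0" using arg_cong[OF eq, of \<phi>] \<phi>_adj[of L] by (simp add: \<phi>_add)
  then have "L\<^sup>\<star> * (L + L\<^sup>\<star>) = 0" using eq by simp
  then have "\<phi> (1 + L\<^sup>\<star> * L\<^sup>\<star>) = 0" by (simp add: distrib_left LL)
  then show False using z[of "L\<^sup>\<star>"] by (simp add: \<phi>_add)
qed

lemma semi_faithful:
  assumes "c \<in> closure semi" and "\<And>z. z \<in> semi \<Longrightarrow> hn (c * z) = 0"
  shows "c = 0"
  using fock.closure_gen_norm_le[OF fock_scalars, of c 0] assms by (auto simp: semi_def)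

subsection \<open>Freeness\<close>

text \<open>Combinations of normally ordered words, creators to the left of annihilators. The
  relation \<open>L\<^sup>\<star> * L = 1\<close> suffices to reorder every polynomial in the
  two.\<close>

inductive normal :: "'a \<Rightarrow> bool" where
  normal_one: "normal (c *\<^sub>C 1)"
| normal_L: "normal x \<Longrightarrow> normal (L * x)"
| normal_R: "normal (c *\<^sub>C (L\<^sup>\<star>) ^ Suc n)"
| normal_add: "normal x \<Longrightarrow> normal y \<Longrightarrow> normal (x + y)"

lemma normal_csc: "normal x \<Longrightarrow> normal (c *\<^sub>C x)"
proof (induction rule: normal.induct)
  case (normal_L x) then show ?case using normal.normal_L by fastforce
qed (auto simp: csc_add_right simp del: power_Suc intro: normal.intros)

lemma normal_Ladj: "normal x \<Longrightarrow> normal (L\<^sup>\<star> * x)"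
proof (induction rule: normal.induct)
  case (normal_one c)
  show ?case using normal_R[of c 0] by simp
next
  case (normal_L x) then show ?case by (simp add: LL_mult)
next
  case (normal_R c n)
  show ?case using normal.normal_R[of c "Suc n"] by simp
qed (auto simp: distrib_left intro: normal.intros)

lemma normal_semi_mult: "x \<in> semi \<Longrightarrow> normal y \<Longrightarrow> normal (x * y)"
  unfolding semi_def
  by (induction arbitrary: y rule: fock.gen.induct[OF fock_scalars, consumes 1])
    (auto simp: distrib_right mult.assoc intro: normal_csc normal_add normal_L normal_Ladj)

lemma normal_form: "normal x \<Longrightarrow> \<exists>c y z. x = c *\<^sub>C 1 + L * y + z * L\<^sup>\<star>"
proof (induction rule: normal.induct)
  case (normal_one c) then show ?case by (intro exI[of _ c] exI[of _ 0]) simp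
next
  case (normal_L x) then show ?case by (intro exI[of _ 0] exI[of _ x]) simp
next
  case (normal_R c n) then show ?case
    by (intro exI[of _ 0] exI[of _ "c *\<^sub>C (L\<^sup>\<star>) ^ n"]) (simp add: power_commutes)
next
  case (normal_add x y)
  then obtain c1 y1 z1 c2 y2 z2 where "x = c1 *\<^sub>C 1 + L * y1 + z1 * L\<^sup>\<star>" "y = c2 *\<^sub>C 1 + L * y2 + z2 * L\<^sup>\<star>"
    by blast
  then show ?case
    by (intro exI[of _ "c1 + c2"] exI[of _ "y1 + y2"] exI[of _ "z1 + z2"]) (simp add: csc_add_left algebra_simps)
qed

lemma \<phi>_mult_Ladj: "\<phi> (x * L\<^sup>\<star>) = 0"
  using vacuum[of 1] A_rules by (intro \<phi>_null_right) simp

lemma \<phi>_L_mult: "a \<in> A \<Longrightarrow> \<phi> (a * (L * x)) = 0"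
  using \<phi>_null_right[OF vacuum[of "a\<^sup>\<star>"], of "x\<^sup>\<star>"] \<phi>_adj[of "a * (L * x)"] A_rules
  by (simp add: mult.assoc)

text \<open>Normal ordering leaves a scalar, a term starting with \<open>L\<close> and a term ending
  with its adjoint. The state kills the last two, so for a centred element the scalar is 0.\<close>

lemma semi_centred_form:
  assumes "c \<in> semi" "\<phi> c = 0" obtains y z where "c = L * y + z * L\<^sup>\<star>"
proof -
  have "normal (c * (1 *\<^sub>C 1))" using assms(1) by (rule normal_semi_mult[OF _ normal_one])
  then have "normal c" by simp
  then obtain d y z where c: "c = d *\<^sub>C 1 + L * y + z * L\<^sup>\<star>" using normal_form by blast
  then have "d = 0" using assms(2) \<phi>_mult_Ladj[of z] \<phi>_L_mult[of 1 y] A_rules by (simp add: \<phi>_add)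
  then show ?thesis using c that by simp
qed

text \<open>Membership in the range of the creation operator, in a form that is closed under limits.\<close>

definition created :: "'a \<Rightarrow> bool" where "created z \<longleftrightarrow> hn ((1 - L * L\<^sup>\<star>) * z) = 0"

lemma defect_L: "(1 - L * L\<^sup>\<star>) * (L * x) = 0"
  by (simp add: left_diff_distrib mult.assoc LL_mult)

text \<open>Centred elements of \<open>semi\<close> are dense in the centred elements of its
  closure, and \<open>created\<close> is the vanishing of a continuous seminorm.\<close>

lemma created_closed:
  assumes c: "c \<in> closure semi" "\<phi> c = 0"
    and cr: "\<And>c. c \<in> semi \<Longrightarrow> \<phi> c = 0 \<Longrightarrow> created (c * z)"
  shows "created (c * z)"
proof -
  obtain f where f: "\<And>n. f n \<in> semi" "f \<longlonglongrightarrow> c" using c(1) unfolding closure_sequential by blast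
  \<comment> \<open>The approximants are centred again; the correction tends to 0 because
    \<open>\<phi> c = 0\<close>.\<close>
  define g where "g n = f n - \<phi> (f n) *\<^sub>C 1" for n
  have "g n \<in> semi" "\<phi> (g n) = 0" for n unfolding g_def using star_subalgebra_semi f(1)
    by (auto simp: \<phi>_diff intro: subalg_diff subalg_csc subalg_one)
  then have z: "hn ((1 - L * L\<^sup>\<star>) * (g n * z)) = 0" for n using cr by (simp add: created_def)
  have "(\<lambda>n. norm (\<phi> (f n) *\<^sub>C (1::'a))) \<longlonglongrightarrow> cmod (\<phi> c) * norm (1::'a)"
    by (auto intro!: tendsto_intros tendsto_\<phi> f)
  then have "(\<lambda>n. \<phi> (f n) *\<^sub>C (1::'a)) \<longlonglongrightarrow> 0"
    by (intro tendsto_norm_zero_cancel[where f = "\<lambda>n. \<phi> (f n) *\<^sub>C (1::'a)"]) (simp add: c(2))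
  from tendsto_diff[OF f(2) this] have "g \<longlonglongrightarrow> c" by (simp add: g_def[abs_def])
  then have "(\<lambda>n. hn ((1 - L * L\<^sup>\<star>) * (g n * z))) \<longlonglongrightarrow> hn ((1 - L * L\<^sup>\<star>) * (c * z))"
    by (intro tendsto_hn tendsto_intros)
  then show ?thesis by (simp add: z created_def LIMSEQ_const_iff)
qed

lemma created_base:
  assumes "c \<in> closure semi" "\<phi> c = 0" "a \<in> A" shows "created (c * a)"
proof (rule created_closed[OF assms(1,2)])
  fix c assume "c \<in> semi" "\<phi> c = 0"
  then obtain y z where c: "c = L * y + z * L\<^sup>\<star>" by (rule semi_centred_form)
  have "(1 - L * L\<^sup>\<star>) * (c * a) = (1 - L * L\<^sup>\<star>) * (L * (y * a)) + ((1 - L * L\<^sup>\<star>) * z) * (L\<^sup>\<star> * a)"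
    by (simp add: c algebra_simps)
  then show "created (c * a)" using vacuum[OF assms(3)] by (simp add: created_def defect_L hn_mult_null)
qed

text \<open>Up to a null vector \<open>x\<close> is \<open>L * (L\<^sup>\<star> * x)\<close>. Hence
  the annihilating part of \<open>c\<close> meets \<open>L\<^sup>\<star> * (a * L)\<close>, which is
  \<open>\<phi> a\<close> times 1 and thus 0; the creating part of \<open>c\<close> has its range in
  that of \<open>L\<close>.\<close>

lemma created_step:
  assumes "c \<in> closure semi" "\<phi> c = 0" "a \<in> A" "\<phi> a = 0" "created x" shows "created (c * (a * x))"
proof (rule created_closed[OF assms(1,2)])
  fix c assume "c \<in> semi" "\<phi> c = 0"
  then obtain y z where c: "c = L * y + z * L\<^sup>\<star>" by (rule semi_centred_form)
  have 0: "L\<^sup>\<star> * (a * (L * w)) = 0" for w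
  proof -
    have "L\<^sup>\<star> * (a * (L * w)) = (L\<^sup>\<star> * (a * L)) * w" by (simp only: mult.assoc)
    then show ?thesis using covariance[OF assms(3)] assms(4) by simp
  qed
  \<comment> \<open>The second and third summand come from splitting \<open>x\<close> into
    \<open>(1 - L * L\<^sup>\<star>) * x\<close> and
    \<open>L * (L\<^sup>\<star> * x)\<close>.\<close>
  have "(1 - L * L\<^sup>\<star>) * (c * (a * x)) =
     (1 - L * L\<^sup>\<star>) * (L * (y * (a * x))) + ((1 - L * L\<^sup>\<star>) * z * L\<^sup>\<star> * a) * ((1 - L * L\<^sup>\<star>) * x)
     + (1 - L * L\<^sup>\<star>) * z * (L\<^sup>\<star> * (a * (L * (L\<^sup>\<star> * x))))"
    by (simp only: c) (simp add: algebra_simps)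
  then show "created (c * (a * x))"
    using assms(5) by (simp only: created_def defect_L 0) (simp add: hn_mult_null)
qed

lemma \<phi>_mult_created: "a \<in> A \<Longrightarrow> created x \<Longrightarrow> \<phi> (a * x) = 0"
proof -
  assume a: "a \<in> A" and x: "created x"
  have "a * x = a * ((1 - L * L\<^sup>\<star>) * x) + a * (L * (L\<^sup>\<star> * x))" by (simp add: algebra_simps)
  then show "\<phi> (a * x) = 0"
    using x a by (simp only: \<phi>_add \<phi>_L_mult) (simp add: created_def \<phi>_null_right)
qed

definition word_val :: "('a + 'a) list \<Rightarrow> 'a" where
  "word_val w = prod_list (map (case_sum id id) w)"

lemma word_val_simps [simp]: "word_val [] = 1" "word_val (Inl a # w) = a * word_val w"
  "word_val (Inr a # w) = a * word_val w"
  by (simp_all add: word_val_def)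

fun alternating :: "('a + 'a) list \<Rightarrow> bool" where
  "alternating [] = True"
| "alternating (Inl a # w) = (a \<in> A \<and> \<phi> a = 0 \<and> alternating w \<and> (w \<noteq> [] \<longrightarrow> \<not> isl (hd w)))"
| "alternating (Inr c # w) = (c \<in> closure semi \<and> \<phi> c = 0 \<and> alternating w \<and> (w \<noteq> [] \<longrightarrow> isl (hd w)))"

text \<open>A pair consisting of a semicircular letter and the following letter from
  \<open>A\<close> is removed at each step, so the recursive calls always see a word that starts
  with a semicircular letter.\<close>

lemma alternating_created: "alternating (Inr c # w) \<Longrightarrow> created (word_val (Inr c # w))"
proof (induction "length w" arbitrary: c w rule: less_induct)
  case less
  show ?case
  proof (cases w)
    case Nil then show ?thesis using less.prems created_base[of c 1] A_rules by simp
  next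
    case (Cons x v)
    then obtain a where x: "x = Inl a" using less.prems by (cases x) auto
    show ?thesis
    proof (cases v)
      case Nil then show ?thesis using less.prems x Cons created_base[of c a] by simp
    next
      case (Cons x' v')
      then obtain d where d: "x' = Inr d" using less.prems x \<open>w = x # v\<close> by (cases x') auto
      have "created (word_val (Inr d # v'))"
        using less.hyps[of v' d] less.prems x \<open>w = x # v\<close> Cons d by simp
      then show ?thesis using less.prems x \<open>w = x # v\<close> Cons d created_step[of c a "word_val (Inr d # v')"]
        by simp
    qed
  qed
qed

text \<open>After at most one leading letter from \<open>A\<close> the word is created, and vectors
  in the range of \<open>L\<close> are orthogonal to all vectors from \<open>A\<close>.\<close>

theorem \<phi>_alternating: "alternating w \<Longrightarrow> w \<noteq> [] \<Longrightarrow> \<phi> (word_val w) = 0"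
proof (cases w rule: alternating.cases)
  case (2 a v)
  assume w: "alternating w"
  show ?thesis
  proof (cases v)
    case Nil then show ?thesis using w 2 by simp
  next
    case (Cons x' v')
    then obtain d where d: "x' = Inr d" using w 2 by (cases x') auto
    then show ?thesis using w 2 Cons \<phi>_mult_created[of a "word_val v"] alternating_created[of d v'] by simp
  qed
next
  case (3 c v)
  assume "alternating w"
  then show ?thesis using 3 alternating_created[of c v] \<phi>_mult_created[of 1 "word_val w"] A_rules by simp
qed simp

end

section \<open>Operators on a complex Hilbert space\<close>

instance complex_hilbert \<subseteq> banach ..

lemma cinner_add_left: "cinner (x + y) z = cinner x z + cinner y z"
  by (metis cinner_add_right cinner_commute complex_cnj_add)

lemma cinner_scaleC_left: "cinner (scaleC c x) y = cnj c * cinner x y"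
  by (metis cinner_commute cinner_scaleC_right complex_cnj_mult)

lemma cinner_self: "cinner x x = complex_of_real ((norm x)\<^sup>2)"
proof -
  have "Im (cinner x x) = 0" using cinner_commute[of x x] by (metis Reals_cnj_iff complex_is_Real_iff)
  then show ?thesis by (simp add: complex_eq_iff flip: inner_eq_Re_cinner power2_norm_eq_inner)
qed

lemma norm_scaleC [simp]: "norm (scaleC c x) = cmod c * norm x"
proof -
  have "complex_of_real ((norm (scaleC c x))\<^sup>2) = cnj c * c * cinner x x"
    by (simp only: cinner_self[symmetric]) (simp add: cinner_scaleC_left cinner_scaleC_right)
  also have "\<dots> = complex_of_real ((cmod c * norm x)\<^sup>2)"
    using complex_norm_square[of c] by (simp add: cinner_self power_mult_distrib mult.commute)
  finally show ?thesis using of_real_eq_iff power2_eq_iff_nonneg by (metis mult_nonneg_nonneg norm_ge_zero)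
qed

lemma scaleC_one [simp]: "scaleC 1 x = x"
  using scaleR_scaleC[of 1 x] by simp

lemma scaleC_zero_right [simp]: "scaleC c 0 = 0"
  using scaleC_add_right[of c 0 0] by simp

lemma cinner_zero_left [simp]: "cinner 0 x = 0" and cinner_zero_right [simp]: "cinner x 0 = 0"
  using cinner_add_left[of 0 0 x] cinner_add_right[of x 0 0] by auto

lemma cinner_minus_right: "cinner x (- y) = - cinner x y"
  using cinner_add_right[of x y "- y"] by (simp add: eq_neg_iff_add_eq_0 add.commute)

lemma cinner_minus_left: "cinner (- x) y = - cinner x y"
  using cinner_add_left[of x "- x" y] by (simp add: eq_neg_iff_add_eq_0 add.commute)

lemma cinner_diff_right: "cinner x (y - z) = cinner x y - cinner x z"
  using cinner_add_right[of x y "- z"] by (simp add: cinner_minus_right)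

lemma cinner_diff_left: "cinner (x - y) z = cinner x z - cinner y z"
  using cinner_add_left[of x "- y" z] by (simp add: cinner_minus_left)

text \<open>A rotation of \<open>y\<close> makes the inner product a nonnegative real, where the
  real Cauchy-Schwarz inequality applies.\<close>

lemma cinner_norm_le: "cmod (cinner x y) \<le> norm x * norm y"
proof -
  define c where "c = cis (- Arg (cinner x y))"
  have c: "cmod c = 1" by (simp add: c_def)
  have "cinner x y = complex_of_real (cmod (cinner x y)) * cis (Arg (cinner x y))"
    using rcis_cmod_Arg[of "cinner x y"] by (simp add: rcis_def)
  then have "c * cinner x y = complex_of_real (cmod (cinner x y)) * (c * cis (Arg (cinner x y)))"
    by (metis mult.left_commute)
  also have "c * cis (Arg (cinner x y)) = 1" by (simp add: c_def cis_mult)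
  finally have "c * cinner x y = complex_of_real (cmod (cinner x y))" by simp
  then have "cmod (cinner x y) = inner x (scaleC c y)"
    by (simp add: inner_eq_Re_cinner cinner_scaleC_right)
  also have "\<dots> \<le> norm x * norm (scaleC c y)" by (rule norm_cauchy_schwarz)
  finally show ?thesis by (simp add: c)
qed

lemma bounded_linear_scaleC: "bounded_linear (scaleC c :: 'h::complex_hilbert \<Rightarrow> 'h)"
  by (rule bounded_linear_intro[where K = "cmod c"])
    (auto simp: scaleC_add_right scaleR_scaleC scaleC_scaleC mult.commute)

lemma cinner_eq_inner: "cinner x y = Complex (inner x y) (inner x (scaleC (- \<i>) y))"
  by (simp add: complex_eq_iff inner_eq_Re_cinner cinner_scaleC_right)

text \<open>Half the squared norm minus \<open>f\<close> is bounded below; the parallelogram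
  identity makes a minimising sequence Cauchy, and the first variation at the minimum
  \<open>y\<close> identifies \<open>f\<close> with \<open>inner y\<close>.\<close>

lemma Riesz_representation:
  fixes f :: "'h::{real_inner, complete_space} \<Rightarrow> real"
  assumes f: "bounded_linear f"
  shows "\<exists>y. \<forall>x. f x = inner y x"
proof -
  interpret f: bounded_linear f by (rule f)
  obtain K where K: "K > 0" "\<And>x. \<bar>f x\<bar> \<le> norm x * K" using f.pos_bounded by (metis real_norm_def)
  define g where "g x = inner x x / 2 - f x" for x
  have lb: "- (K\<^sup>2 / 2) \<le> g x" for x
  proof -
    have "0 \<le> (norm x - K)\<^sup>2" by simp
    then have "norm x * K \<le> (norm x)\<^sup>2 / 2 + K\<^sup>2 / 2" by (simp add: power2_eq_square algebra_simps)
    then show ?thesis using K(2)[of x] by (simp add: g_def power2_norm_eq_inner)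
  qed
  define m where "m = Inf (range g)"
  have m: "m \<le> g x" for x unfolding m_def by (rule cInf_lower) (auto intro!: bdd_belowI2[OF lb])
  have "\<exists>x. g x < m + 1 / (real n + 1)" for n
    using cInf_lessD[of "range g" "m + 1 / (real n + 1)"] by (auto simp: m_def)
  then obtain X where X: "\<And>n. g (X n) < m + 1 / (real n + 1)" by metis
  have par: "(norm (x - y))\<^sup>2 = 4 * (g x + g y - 2 * g (scaleR (1/2) (x + y)))" for x y
    by (simp add: g_def f.scaleR f.add power2_norm_eq_inner inner_add inner_diff inner_commute algebra_simps)
  have dX: "(norm (X i - X j))\<^sup>2 \<le> 4 * (1 / (real i + 1) + 1 / (real j + 1))" for i j
    unfolding par using X[of i] X[of j] m[of "scaleR (1/2) (X i + X j)"] by (simp add: algebra_simps)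
  have "Cauchy X"
  proof (rule metric_CauchyI)
    fix e :: real assume e: "0 < e"
    obtain N where N: "8 / e\<^sup>2 < real N" using reals_Archimedean2 by blast
    have "dist (X i) (X j) < e" if "i \<ge> N" "j \<ge> N" for i j
    proof -
      have "1 / (real i + 1) \<le> 1 / (real N + 1)" "1 / (real j + 1) \<le> 1 / (real N + 1)"
        using that by (auto intro!: divide_left_mono mult_pos_pos)
      then have "(norm (X i - X j))\<^sup>2 \<le> 8 / (real N + 1)" using dX[of i j] by simp
      also have "\<dots> < e\<^sup>2" using N e by (simp add: field_simps add_strict_increasing)
      finally show ?thesis using e by (simp add: dist_norm power_less_imp_less_base)
    qed
    then show "\<exists>M. \<forall>m\<ge>M. \<forall>n\<ge>M. dist (X m) (X n) < e" by blast
  qed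
  then obtain y where y: "X \<longlonglongrightarrow> y" using Cauchy_convergent convergent_def by blast
  have "(\<lambda>n. g (X n)) \<longlonglongrightarrow> g y" unfolding g_def by (intro tendsto_intros y f.tendsto) simp
  moreover have "(\<lambda>n. m + 1 / (real n + 1)) \<longlonglongrightarrow> m + 0"
    by (intro tendsto_intros) (use LIMSEQ_inverse_real_of_nat in \<open>simp add: inverse_eq_divide add.commute\<close>)
  ultimately have gy: "g y \<le> m" by (auto intro: LIMSEQ_le less_imp_le X)
  have "f x = inner y x" for x
  proof (rule ccontr)
    assume ne: "f x \<noteq> inner y x"
    define d where "d = inner y x - f x"
    have ineq: "0 \<le> t * d + t\<^sup>2 * inner x x / 2" for t
    proof -
      have "g (y + scaleR t x) = g y + (t * d + t\<^sup>2 * inner x x / 2)"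
        by (simp add: g_def d_def f.add f.scaleR inner_add inner_commute power2_eq_square algebra_simps add_divide_distrib)
      then show ?thesis using gy m[of "y + scaleR t x"] by simp
    qed
    \<comment> \<open>The added 1 keeps the denominator positive. With \<open>t = - d / p\<close>
      the quadratic expression is at most \<open>- d\<^sup>2 / (2 * p)\<close>.\<close>
    define p where "p = inner x x + 1"
    define t where "t = - d / p"
    have p: "p > 0" using inner_ge_zero[of x] unfolding p_def by linarith
    have "t * d + t\<^sup>2 * inner x x / 2 \<le> t * d + t\<^sup>2 * p / 2" by (simp add: mult_left_mono p_def)
    also have "\<dots> = - (d\<^sup>2 / p) / 2"
      using p by (simp add: t_def power2_eq_square field_simps)
    also have "\<dots> < 0" using p ne by (simp add: d_def)
    finally show False using ineq[of t] by simp
  qed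
  then show ?thesis by blast
qed

definition clinear_op :: "('h::complex_hilbert \<Rightarrow>\<^sub>L 'h) \<Rightarrow> bool" where
  "clinear_op T \<longleftrightarrow> (\<forall>c x. blinfun_apply T (scaleC c x) = scaleC c (blinfun_apply T x))"

lemma carrier_bounded_operators: "carrier bounded_operators = {T. clinear_op T}"
  by (simp add: bounded_operators_def clinear_op_def)

lemma cinner_eqI: "(\<And>z. cinner x z = cinner y z) \<Longrightarrow> x = (y :: 'h::complex_hilbert)"
proof -
  assume "\<And>z. cinner x z = cinner y z"
  then have "inner (x - y) (x - y) = 0" by (simp add: inner_eq_Re_cinner cinner_diff_left)
  then show "x = y" by simp
qed

lemma cinner_op_eqI:
  fixes S T :: "'h::complex_hilbert \<Rightarrow>\<^sub>L 'h"
  shows "(\<And>x z. cinner (blinfun_apply S x) z = cinner (blinfun_apply T x) z) \<Longrightarrow> S = T"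
  by (rule blinfun_eqI, rule cinner_eqI)

text \<open>Riesz is applied to the real inner product; complex linearity of \<open>T\<close>
  recovers the imaginary part through \<open>cinner_eq_inner\<close>.\<close>

lemma cadjoint_exists:
  fixes T :: "'h::complex_hilbert \<Rightarrow>\<^sub>L 'h"
  assumes T: "clinear_op T"
  shows "\<exists>S. (\<forall>x y. cinner (blinfun_apply S x) y = cinner x (blinfun_apply T y))"
proof -
  have "\<exists>y. \<forall>x. inner u (blinfun_apply T x) = inner y x" for u
    by (rule Riesz_representation) (intro bounded_linear_intros)
  then obtain S where S: "\<And>u x. inner u (blinfun_apply T x) = inner (S u) x" by metis
  have cS: "cinner (S x) y = cinner x (blinfun_apply T y)" for x y
    using T by (subst cinner_eq_inner, subst cinner_eq_inner[of x "blinfun_apply T y"])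
      (simp add: S[symmetric] clinear_op_def)
  have "bounded_linear S"
  proof (rule bounded_linear_intro[where K = "norm T"])
    show "S (x + y) = S x + S y" for x y
      by (rule cinner_eqI) (simp add: cS cinner_add_left)
    show "S (scaleR r x) = scaleR r (S x)" for r x
      by (rule cinner_eqI) (simp add: cS cinner_scaleC_left scaleR_scaleC)
    show "norm (S x) \<le> norm x * norm T" for x
    proof -
      have "norm (S x) * norm (S x) = inner x (blinfun_apply T (S x))"
        by (simp add: S power2_norm_eq_inner[symmetric] power2_eq_square)
      also have "\<dots> \<le> norm x * (norm T * norm (S x))"
        by (intro order_trans[OF norm_cauchy_schwarz] mult_left_mono norm_blinfun) simp
      finally have "norm (S x) * norm (S x) \<le> (norm x * norm T) * norm (S x)" by (simp add: mult.assoc)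
      then show ?thesis by (cases "norm (S x) = 0") (auto simp: mult_le_cancel_right)
    qed
  qed
  then show ?thesis using cS by (intro exI[of _ "Blinfun S"]) (simp add: bounded_linear_Blinfun_apply)
qed

lemma cinner_cadjoint:
  assumes "clinear_op T"
  shows "cinner (blinfun_apply (cadjoint T) x) y = cinner x (blinfun_apply T y)"
proof -
  obtain S where S: "\<forall>x y. cinner (blinfun_apply S x) y = cinner x (blinfun_apply T y)"
    using cadjoint_exists[OF assms] by blast
  have "\<forall>x y. cinner (blinfun_apply (cadjoint T) x) y = cinner x (blinfun_apply T y)"
    unfolding cadjoint_def
  proof (rule theI)
    fix R assume R: "\<forall>x y. cinner (blinfun_apply R x) y = cinner x (blinfun_apply T y)"
    show "R = S" by (intro cinner_op_eqI) (simp add: R S)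
  qed (rule S)
  then show ?thesis by blast
qed

lemma clinear_op_cadjoint: "clinear_op T \<Longrightarrow> clinear_op (cadjoint T)"
  unfolding clinear_op_def[of "cadjoint T"]
  by (rule allI, rule allI, rule cinner_eqI) (simp add: cinner_cadjoint cinner_scaleC_left)

definition scl_op :: "complex \<Rightarrow> ('h::complex_hilbert \<Rightarrow>\<^sub>L 'h) \<Rightarrow> 'h \<Rightarrow>\<^sub>L 'h" where
  "scl_op c T = Blinfun (\<lambda>x. scaleC c (blinfun_apply T x))"

lemma clinear_op_scl: "clinear_op T \<Longrightarrow> clinear_op (scl_op c T)"
  and scl_apply: "blinfun_apply (scl_op c T) x = scaleC c (blinfun_apply T x)"
proof -
  have *: "blinfun_apply (scl_op c T) x = scaleC c (blinfun_apply T x)" for x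
    unfolding scl_op_def
    by (subst bounded_linear_Blinfun_apply)
      (auto intro: bounded_linear_compose[OF bounded_linear_scaleC] blinfun.bounded_linear_right)
  show "blinfun_apply (scl_op c T) x = scaleC c (blinfun_apply T x)" by (rule *)
  show "clinear_op T \<Longrightarrow> clinear_op (scl_op c T)"
    by (simp add: clinear_op_def * scaleC_scaleC mult.commute)
qed

text \<open>Bounded maps of the underlying type are only real linear. The complex linear ones form a
  type of their own, on which adjoint and complex scalars obey the C*-laws without side
  conditions.\<close>

typedef (overloaded) 'h cop = "{T :: 'h::complex_hilbert \<Rightarrow>\<^sub>L 'h. clinear_op T}"
  morphisms blinfun_of_cop cop_of_blinfun
  by (intro exI[of _ 0]) (simp add: clinear_op_def)

setup_lifting type_definition_cop

lemma clinear_op_of_cop: "clinear_op (blinfun_of_cop T)"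
  using blinfun_of_cop by auto

instantiation cop :: (complex_hilbert) cstar_alg
begin

lift_definition zero_cop :: "'a cop" is 0 by (simp add: clinear_op_def)
lift_definition one_cop :: "'a cop" is id_blinfun by (simp add: clinear_op_def)
lift_definition plus_cop :: "'a cop \<Rightarrow> 'a cop \<Rightarrow> 'a cop" is "(+)"
  by (simp add: clinear_op_def blinfun.add_left scaleC_add_right)
lift_definition uminus_cop :: "'a cop \<Rightarrow> 'a cop" is uminus
  by (simp add: clinear_op_def blinfun.minus_left linear_neg[OF bounded_linear.linear[OF bounded_linear_scaleC]])
lift_definition minus_cop :: "'a cop \<Rightarrow> 'a cop \<Rightarrow> 'a cop" is minus
  by (simp add: clinear_op_def blinfun.diff_left linear_diff[OF bounded_linear.linear[OF bounded_linear_scaleC]])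
lift_definition times_cop :: "'a cop \<Rightarrow> 'a cop \<Rightarrow> 'a cop" is blinfun_compose
  by (simp add: clinear_op_def)
lift_definition scaleR_cop :: "real \<Rightarrow> 'a cop \<Rightarrow> 'a cop" is scaleR
  by (simp add: clinear_op_def blinfun.scaleR_left scaleR_scaleC scaleC_scaleC mult.commute)
lift_definition csc_cop :: "complex \<Rightarrow> 'a cop \<Rightarrow> 'a cop" is
  scl_op
  by (rule clinear_op_scl)
lift_definition adj_cop :: "'a cop \<Rightarrow> 'a cop" is cadjoint
  by (rule clinear_op_cadjoint)
lift_definition norm_cop :: "'a cop \<Rightarrow> real" is norm .
definition dist_cop :: "'a cop \<Rightarrow> 'a cop \<Rightarrow> real" where "dist_cop a b = norm (a - b)"
definition sgn_cop :: "'a cop \<Rightarrow> 'a cop" where "sgn_cop x = scaleR (inverse (norm x)) x"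
definition uniformity_cop :: "('a cop \<times> 'a cop) filter" where
  "uniformity_cop = (INF e\<in>{0 <..}. principal {(x, y). dist x y < e})"
definition open_cop :: "'a cop set \<Rightarrow> bool" where
  "open_cop S = (\<forall>x\<in>S. \<forall>\<^sub>F (x', y) in uniformity. x' = x \<longrightarrow> y \<in> S)"

lemma norm_cadjoint_mult:
  fixes T :: "'h::complex_hilbert \<Rightarrow>\<^sub>L 'h"
  assumes T: "clinear_op T"
  shows "norm (cadjoint T o\<^sub>L T) = (norm T)\<^sup>2"
proof (rule antisym)
  have "norm (cadjoint T) \<le> norm T"
  proof (rule norm_blinfun_bound)
    fix x
    let ?y = "blinfun_apply (cadjoint T) x"
    have "(norm ?y)\<^sup>2 = cmod (cinner ?y ?y)" by (simp add: cinner_self norm_power)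
    also have "\<dots> = cmod (cinner x (blinfun_apply T ?y))" by (simp add: cinner_cadjoint[OF T])
    also have "\<dots> \<le> norm x * (norm T * norm ?y)"
      by (intro order_trans[OF cinner_norm_le] mult_left_mono norm_blinfun) simp
    finally have "norm ?y * norm ?y \<le> (norm T * norm x) * norm ?y" by (simp add: power2_eq_square ac_simps)
    then show "norm ?y \<le> norm T * norm x" by (cases "norm ?y = 0") (auto simp: mult_le_cancel_right)
  qed simp
  then show "norm (cadjoint T o\<^sub>L T) \<le> (norm T)\<^sup>2"
    using norm_blinfun_compose[of "cadjoint T" T] mult_right_mono[of "norm (cadjoint T)" "norm T" "norm T"]
    by (simp add: power2_eq_square)
  have "norm T \<le> sqrt (norm (cadjoint T o\<^sub>L T))"
  proof (rule norm_blinfun_bound)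
    fix x
    have "(norm (blinfun_apply T x))\<^sup>2 = cmod (cinner (blinfun_apply T x) (blinfun_apply T x))"
      by (simp add: cinner_self norm_power)
    also have "\<dots> = cmod (cinner x (blinfun_apply (cadjoint T o\<^sub>L T) x))"
      by (subst (1 2) cinner_commute) (simp add: cinner_cadjoint[OF T])
    also have "\<dots> \<le> norm x * (norm (cadjoint T o\<^sub>L T) * norm x)"
      by (intro order_trans[OF cinner_norm_le] mult_left_mono norm_blinfun) simp
    also have "\<dots> = (sqrt (norm (cadjoint T o\<^sub>L T)) * norm x)\<^sup>2"
      by (simp add: power_mult_distrib power2_eq_square[of "norm x"] ac_simps)
    finally show "norm (blinfun_apply T x) \<le> sqrt (norm (cadjoint T o\<^sub>L T)) * norm x"
      by (rule power2_le_imp_le) simp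
  qed simp
  then show "(norm T)\<^sup>2 \<le> norm (cadjoint T o\<^sub>L T)"
    using power_mono[of "norm T" "sqrt (norm (cadjoint T o\<^sub>L T))" 2] by simp
qed

instance
proof
  fix x y z :: "'a cop" and r s :: real and c d :: complex and S :: "'a cop set"
  show "x + y + z = x + (y + z)" by transfer simp
  show "x + y = y + x" by transfer simp
  show "0 + x = x" by transfer simp
  show "- x + x = 0" by transfer simp
  show "x - y = x + - y" by transfer simp
  show "x * y * z = x * (y * z)" by transfer (auto intro!: blinfun_eqI)
  show "(x + y) * z = x * z + y * z" by transfer (auto intro!: blinfun_eqI simp: blinfun.add_left)
  show "x * (y + z) = x * y + x * z" by transfer (auto intro!: blinfun_eqI simp: blinfun.add_left blinfun.add_right)
  show "1 * x = x" "x * 1 = x" by (transfer, auto intro!: blinfun_eqI)+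
  show "scaleR r (x + y) = scaleR r x + scaleR r y" by transfer (rule scaleR_add_right)
  show "scaleR (r + s) x = scaleR r x + scaleR s x" by transfer (rule scaleR_add_left)
  show "scaleR r (scaleR s x) = scaleR (r * s) x" by transfer simp
  show "scaleR 1 x = x" by transfer simp
  show "scaleR r x * y = scaleR r (x * y)" by transfer (auto intro!: blinfun_eqI simp: blinfun.scaleR_left)
  show "x * scaleR r y = scaleR r (x * y)"
    by transfer (auto intro!: blinfun_eqI simp: blinfun.scaleR_left blinfun.scaleR_right)
  show "(norm x = 0) = (x = 0)" by transfer simp
  show "norm (x + y) \<le> norm x + norm y" by transfer (rule norm_triangle_ineq)
  show "norm (scaleR r x) = \<bar>r\<bar> * norm x" by transfer simp
  show "norm (x * y) \<le> norm x * norm y" by transfer (rule norm_blinfun_compose)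
  show "dist x y = norm (x - y)" by (rule dist_cop_def)
  show "sgn x = scaleR (inverse (norm x)) x" by (rule sgn_cop_def)
  show "uniformity = (INF e\<in>{0 <..}. principal {(x :: 'a cop, y). dist x y < e})" by (rule uniformity_cop_def)
  show "open S = (\<forall>x\<in>S. \<forall>\<^sub>F (x', y) in uniformity. x' = x \<longrightarrow> y \<in> S)" by (rule open_cop_def)
  show "c *\<^sub>C (x + y) = c *\<^sub>C x + c *\<^sub>C y"
    by transfer (auto intro!: blinfun_eqI simp: scl_apply blinfun.add_left scaleC_add_right)
  show "(c + d) *\<^sub>C x = c *\<^sub>C x + d *\<^sub>C x"
    by transfer (auto intro!: blinfun_eqI simp: scl_apply blinfun.add_left scaleC_add_left)
  show "c *\<^sub>C (d *\<^sub>C x) = (c * d) *\<^sub>C x"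
    by transfer (auto intro!: blinfun_eqI simp: scl_apply scaleC_scaleC)
  show "scaleR r x = complex_of_real r *\<^sub>C x"
    by transfer (auto intro!: blinfun_eqI simp: scl_apply blinfun.scaleR_left scaleR_scaleC)
  show "(c *\<^sub>C x) * y = c *\<^sub>C (x * y)" by transfer (auto intro!: blinfun_eqI simp: scl_apply)
  show "x * (c *\<^sub>C y) = c *\<^sub>C (x * y)"
    by transfer (auto intro!: blinfun_eqI simp: scl_apply clinear_op_def)
  show "(x\<^sup>\<star>)\<^sup>\<star> = x"
  proof transfer
    fix x :: "'a \<Rightarrow>\<^sub>L 'a" assume "clinear_op x"
    note x = this
    have "cinner (blinfun_apply (cadjoint (cadjoint x)) u) v = cinner (blinfun_apply x u) v" for u v
    proof -
      have "cinner (blinfun_apply (cadjoint (cadjoint x)) u) v = cinner u (blinfun_apply (cadjoint x) v)"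
        by (rule cinner_cadjoint[OF clinear_op_cadjoint[OF x]])
      also have "\<dots> = cnj (cinner v (blinfun_apply x u))"
        by (subst cinner_commute) (simp add: cinner_cadjoint[OF x])
      finally show ?thesis by (simp flip: cinner_commute)
    qed
    then show "cadjoint (cadjoint x) = x" by (intro cinner_op_eqI)
  qed
  show "(x + y)\<^sup>\<star> = x\<^sup>\<star> + y\<^sup>\<star>"
  proof transfer
    fix x y :: "'a \<Rightarrow>\<^sub>L 'a" assume *: "clinear_op x" "clinear_op y"
    then have "clinear_op (x + y)" by (simp add: clinear_op_def blinfun.add_left scaleC_add_right)
    with * show "cadjoint (x + y) = cadjoint x + cadjoint y"
      by (intro cinner_op_eqI)
         (simp add: cinner_cadjoint blinfun.add_left cinner_add_left cinner_add_right)
  qed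
  show "(c *\<^sub>C x)\<^sup>\<star> = cnj c *\<^sub>C x\<^sup>\<star>"
  proof transfer
    fix c and x :: "'a \<Rightarrow>\<^sub>L 'a" assume *: "clinear_op x"
    with clinear_op_scl[OF *, of c] show "cadjoint (scl_op c x) =
       scl_op (cnj c) (cadjoint x)"
      by (intro cinner_op_eqI)
         (simp add: cinner_cadjoint scl_apply cinner_scaleC_left cinner_scaleC_right)
  qed
  show "(x * y)\<^sup>\<star> = y\<^sup>\<star> * x\<^sup>\<star>"
  proof transfer
    fix x y :: "'a \<Rightarrow>\<^sub>L 'a" assume *: "clinear_op x" "clinear_op y"
    then have "clinear_op (x o\<^sub>L y)" by (simp add: clinear_op_def)
    with * show "cadjoint (x o\<^sub>L y) = cadjoint y o\<^sub>L cadjoint x"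
      by (intro cinner_op_eqI) (simp add: cinner_cadjoint)
  qed
  show "norm (c *\<^sub>C x) = cmod c * norm x"
  proof transfer
    fix c and x :: "'a \<Rightarrow>\<^sub>L 'a"
    have "norm (scl_op c x) \<le> cmod c * norm x" for c x
      by (rule norm_blinfun_bound) (auto simp: scl_apply mult.assoc intro!: mult_left_mono norm_blinfun)
    note le = this
    show "norm (scl_op c x) = cmod c * norm x"
    proof (cases "c = 0")
      case True then show ?thesis using le[of c x] by simp
    next
      case False
      then have "scl_op (inverse c) (scl_op c x) = x" by (intro blinfun_eqI) (simp add: scl_apply scaleC_scaleC)
      then have "norm x \<le> inverse (cmod c) * norm (scl_op c x)"
        using le[of "inverse c" "scl_op c x"] by (simp add: norm_inverse)
      then have "cmod c * norm x \<le> norm (scl_op c x)" using False by (simp add: field_simps)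
      then show ?thesis using le[of c x] by (rule antisym[rotated])
    qed
  qed
  show "norm (x\<^sup>\<star> * x) = (norm x)\<^sup>2" by transfer (rule norm_cadjoint_mult)
qed

end

section \<open>Operators acting on vectors\<close>

definition ap :: "'h::complex_hilbert cop \<Rightarrow> 'h \<Rightarrow> 'h" where
  "ap T = blinfun_apply (blinfun_of_cop T)"

lemma ap_plus [simp]: "ap (S + T) x = ap S x + ap T x"
  by (simp add: ap_def plus_cop.rep_eq blinfun.add_left)

lemma ap_minus [simp]: "ap (S - T) x = ap S x - ap T x"
  by (simp add: ap_def minus_cop.rep_eq blinfun.diff_left)

lemma ap_uminus [simp]: "ap (- T) x = - ap T x"
  by (simp add: ap_def uminus_cop.rep_eq blinfun.minus_left)

lemma ap_zero [simp]: "ap 0 x = 0"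
  by (simp add: ap_def zero_cop.rep_eq)

lemma ap_one [simp]: "ap 1 x = x"
  by (simp add: ap_def one_cop.rep_eq)

lemma ap_mult [simp]: "ap (S * T) x = ap S (ap T x)"
  by (simp add: ap_def times_cop.rep_eq)

lemma ap_csc [simp]: "ap (c *\<^sub>C T) x = scaleC c (ap T x)"
  by (simp add: ap_def csc_cop.rep_eq scl_apply)

lemma ap_scaleR [simp]: "ap (scaleR r T) x = scaleR r (ap T x)"
  by (simp add: ap_def scaleR_cop.rep_eq blinfun.scaleR_left)

lemma ap_vec [simp]:
  "ap T (x + y) = ap T x + ap T y" "ap T (x - y) = ap T x - ap T y" "ap T 0 = 0"
  "ap T (scaleR r x) = scaleR r (ap T x)"
  by (simp_all add: ap_def blinfun.add_right blinfun.diff_right blinfun.scaleR_right)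

lemma ap_scaleC [simp]: "ap T (scaleC c x) = scaleC c (ap T x)"
  using clinear_op_of_cop[of T] unfolding clinear_op_def ap_def by blast

lemma ap_sum: "ap (sum f I) x = (\<Sum>i\<in>I. ap (f i) x)"
  by (induction I rule: infinite_finite_induct) auto

lemma cinner_adj: "cinner (ap (T\<^sup>\<star>) x) y = cinner x (ap T y)"
  by (simp add: ap_def adj_cop.rep_eq cinner_cadjoint clinear_op_of_cop)

lemma cinner_adj': "cinner x (ap (T\<^sup>\<star>) y) = cinner (ap T x) y"
  using cinner_adj[of "T\<^sup>\<star>" x y] by simp

lemma norm_ap: "norm (ap T x) \<le> norm T * norm x"
  by (simp add: ap_def norm_cop.rep_eq norm_blinfun)

lemma norm_cop_bound: "0 \<le> k \<Longrightarrow> (\<And>x. norm (ap T x) \<le> k * norm x) \<Longrightarrow> norm T \<le> k"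
  by (simp add: ap_def norm_cop.rep_eq norm_blinfun_bound)

lemma cop_eqI: "(\<And>x. ap S x = ap T x) \<Longrightarrow> S = T"
  by (simp add: ap_def blinfun_eqI flip: blinfun_of_cop_inject)

instance cop :: (complex_hilbert) banach
proof
  fix X :: "nat \<Rightarrow> 'a cop" assume "Cauchy X"
  then have "Cauchy (\<lambda>n. blinfun_of_cop (X n))"
    unfolding Cauchy_def by (simp add: dist_norm norm_cop.rep_eq minus_cop.rep_eq)
  then obtain B where B: "(\<lambda>n. blinfun_of_cop (X n)) \<longlonglongrightarrow> B" using Cauchy_convergent convergent_def by blast
  have "clinear_op B"
    unfolding clinear_op_def
  proof (intro allI)
    fix c x
    have "(\<lambda>n. blinfun_apply (blinfun_of_cop (X n)) (scaleC c x)) \<longlonglongrightarrow> blinfun_apply B (scaleC c x)"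
      by (intro blinfun.tendsto B tendsto_const)
    moreover have "(\<lambda>n. scaleC c (blinfun_apply (blinfun_of_cop (X n)) x)) \<longlonglongrightarrow> scaleC c (blinfun_apply B x)"
      by (intro bounded_linear.tendsto[OF bounded_linear_scaleC] blinfun.tendsto B tendsto_const)
    moreover have "(\<lambda>n. blinfun_apply (blinfun_of_cop (X n)) (scaleC c x)) =
        (\<lambda>n. scaleC c (blinfun_apply (blinfun_of_cop (X n)) x))"
      using clinear_op_of_cop by (auto simp: clinear_op_def)
    ultimately show "blinfun_apply B (scaleC c x) = scaleC c (blinfun_apply B x)"
      using LIMSEQ_unique by metis
  qed
  then have eq: "blinfun_of_cop (cop_of_blinfun B) = B" by (simp add: cop_of_blinfun_inverse)
  have "X \<longlonglongrightarrow> cop_of_blinfun B"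
    using B unfolding tendsto_iff by (simp add: dist_norm norm_cop.rep_eq minus_cop.rep_eq eq)
  then show "convergent X" by (auto simp: convergent_def)
qed

section \<open>Faithful GNS representations are isometric\<close>

text \<open>A positive operator is as large as its quadratic form. Replacing \<open>k\<close> by
  \<open>k + e\<close> keeps the divisor positive when \<open>k = 0\<close>.\<close>

lemma positive_cop_norm_le:
  assumes T: "T\<^sup>\<star> = T" and k: "0 \<le> k"
    and pos: "\<And>x. 0 \<le> Re (cinner x (ap T x))" and le: "\<And>x. Re (cinner x (ap T x)) \<le> k * (norm x)\<^sup>2"
  shows "norm T \<le> k"
proof (rule field_le_epsilon)
  fix e :: real assume e: "0 < e"
  define m where "m = k + e"
  have m: "m > 0" using k e by (simp add: m_def)
  have le': "Re (cinner x (ap T x)) \<le> m * (norm x)\<^sup>2" for x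
    using add_mono[OF le[of x] mult_nonneg_nonneg[of e "(norm x)\<^sup>2"]] e by (simp add: m_def distrib_right add_increasing2)
  have "norm T \<le> m"
  proof (rule norm_cop_bound)
    fix x
    define y where "y = ap T x"
    \<comment> \<open>Positivity of the form at \<open>x - t T x\<close> with this \<open>t\<close>
      gives \<open>t * (norm y)\<^sup>2 \<le> Re (cinner x (ap T x))\<close>.\<close>
    define t where "t = 1 / m"
    have xy: "cinner x (ap T y) = complex_of_real ((norm y)\<^sup>2)"
      using cinner_adj[of T x y] by (simp add: T y_def cinner_self)
    have yy: "cinner y (ap T x) = complex_of_real ((norm y)\<^sup>2)" by (simp add: y_def cinner_self)
    have "0 \<le> Re (cinner (x - scaleC (of_real t) y) (ap T (x - scaleC (of_real t) y)))" by (rule pos)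
    also have "\<dots> = Re (cinner x (ap T x)) - 2 * t * (norm y)\<^sup>2 + t\<^sup>2 * Re (cinner y (ap T y))"
      by (simp add: cinner_diff_left cinner_diff_right cinner_scaleC_left cinner_scaleC_right xy yy
          power2_eq_square algebra_simps)
    also have "\<dots> \<le> Re (cinner x (ap T x)) - 2 * t * (norm y)\<^sup>2 + t\<^sup>2 * (m * (norm y)\<^sup>2)"
      by (intro add_left_mono mult_left_mono le') simp
    also have "t\<^sup>2 * (m * (norm y)\<^sup>2) = t * (norm y)\<^sup>2" using m by (simp add: t_def power2_eq_square)
    finally have "t * (norm y)\<^sup>2 \<le> Re (cinner x (ap T x))" by simp
    also have "\<dots> \<le> m * (norm x)\<^sup>2" by (rule le')
    finally have "(norm y)\<^sup>2 \<le> (m * norm x)\<^sup>2" using m by (simp add: t_def field_simps power2_eq_square)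
    then show "norm (ap T x) \<le> m * norm x"
      unfolding y_def by (rule power2_le_imp_le) (use m in simp)
  qed (use m in simp)
  then show "norm T \<le> k + e" by (simp add: m_def)
qed

text \<open>Faithfulness is that of the GNS representation: \<open>\<tau>\<close> may vanish on
  \<open>a\<^sup>\<star> * a\<close>, but not on all \<open>(a * c)\<^sup>\<star> * (a * c)\<close>
  unless \<open>a = 0\<close>.\<close>

locale gns_faithful =
  fixes A :: "'h::complex_hilbert cop set" and \<tau> :: "'h cop \<Rightarrow> complex"
  assumes A: "star_subalgebra A" and closed_A: "closed A"
    and \<tau>_add: "x \<in> A \<Longrightarrow> y \<in> A \<Longrightarrow> \<tau> (x + y) = \<tau> x + \<tau> y"
    and \<tau>_csc: "x \<in> A \<Longrightarrow> \<tau> (c *\<^sub>C x) = c * \<tau> x"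
    and \<tau>_pos: "x \<in> A \<Longrightarrow> \<tau> (x\<^sup>\<star> * x) \<in> \<real>\<^sub>\<ge>\<^sub>0"
    and \<tau>_one: "\<tau> 1 = 1"
    and \<tau>_faithful: "a \<in> A \<Longrightarrow> (\<And>c. c \<in> A \<Longrightarrow> \<tau> ((a * c)\<^sup>\<star> * (a * c)) = 0) \<Longrightarrow> a = 0"
begin

lemmas A_intros = subalg_one[OF A] subalg_add[OF A] subalg_mult[OF A] subalg_adj[OF A]
  subalg_csc[OF A] subalg_zero[OF A] subalg_diff[OF A] subalg_scaleR[OF A] subalg_minus[OF A]

lemma \<tau>_diff: "x \<in> A \<Longrightarrow> y \<in> A \<Longrightarrow> \<tau> (x - y) = \<tau> x - \<tau> y"
  using \<tau>_add[of x "(- 1) *\<^sub>C y"] \<tau>_csc[of y "- 1"] by (simp add: A_intros csc_minus_left)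

lemma \<tau>_scaleR: "x \<in> A \<Longrightarrow> \<tau> (scaleR r x) = of_real r * \<tau> x"
  by (simp add: scaleR_csc \<tau>_csc)

lemma Re_\<tau>_pos: "x \<in> A \<Longrightarrow> 0 \<le> Re (\<tau> (x\<^sup>\<star> * x))"
  using \<tau>_pos[of x] by (auto simp: complex_nonneg_Reals_iff)

lemma Im_\<tau>_pos: "x \<in> A \<Longrightarrow> Im (\<tau> (x\<^sup>\<star> * x)) = 0"
  using \<tau>_pos[of x] by (auto simp: complex_nonneg_Reals_iff)

text \<open>Polarisation: the values at \<open>1 + c *\<^sub>C x\<close> are real for
  \<open>c = 1\<close> and for \<open>c = \<i>\<close>.\<close>

lemma \<tau>_adj: assumes x: "x \<in> A" shows "\<tau> (x\<^sup>\<star>) = cnj (\<tau> x)"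
proof -
  have "Im (c * \<tau> x + cnj c * \<tau> (x\<^sup>\<star>)) = 0" for c
  proof -
    have "(1 + c *\<^sub>C x)\<^sup>\<star> * (1 + c *\<^sub>C x) = 1 + c *\<^sub>C x + (cnj c *\<^sub>C x\<^sup>\<star> + (cnj c * c) *\<^sub>C (x\<^sup>\<star> * x))"
      by (simp add: algebra_simps csc_add_right)
    then have "\<tau> ((1 + c *\<^sub>C x)\<^sup>\<star> * (1 + c *\<^sub>C x)) = 1 + c * \<tau> x + (cnj c * \<tau> (x\<^sup>\<star>) + (cnj c * c) * \<tau> (x\<^sup>\<star> * x))"
      using x by (simp add: \<tau>_add \<tau>_csc \<tau>_one A_intros)
    moreover have "Im ((cnj c * c) * \<tau> (x\<^sup>\<star> * x)) = 0" using Im_\<tau>_pos[OF x] by simp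
    moreover have "Im (\<tau> ((1 + c *\<^sub>C x)\<^sup>\<star> * (1 + c *\<^sub>C x))) = 0" by (intro Im_\<tau>_pos A_intros x)
    ultimately show ?thesis by (simp only: plus_complex.sel one_complex.sel)
  qed
  from this[of 1] this[of \<i>] show ?thesis by (simp add: complex_eq_iff)
qed

text \<open>After normalisation, \<open>1 - x\<^sup>\<star> * x\<close> is the square of a
  self-adjoint \<open>h\<close> in \<open>A\<close>, and the claim is positivity at
  \<open>h * z\<close>.\<close>

lemma \<tau>_bound:
  assumes x: "x \<in> A" and z: "z \<in> A"
  shows "Re (\<tau> ((x * z)\<^sup>\<star> * (x * z))) \<le> (norm x)\<^sup>2 * Re (\<tau> (z\<^sup>\<star> * z))"
proof (cases "x = 0")
  case True then show ?thesis using \<tau>_csc[OF A_intros(6), of 0] by simp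
next
  case False
  define t where "t = scaleR (1 / (norm x)\<^sup>2) (x\<^sup>\<star> * x)"
  have "norm t \<le> 1" using False by (simp add: t_def norm_adj_mult)
  then obtain h where h: "h \<in> A" "h\<^sup>\<star> = h" "h * h = 1 - t"
    using cstar_sqrt[OF A closed_A, of t] x by (auto simp: t_def A_intros)
  have "(h * z)\<^sup>\<star> * (h * z) = z\<^sup>\<star> * ((h * h) * z)" by (simp only: adj_mult h(2) mult.assoc)
  also have "\<dots> = z\<^sup>\<star> * z - scaleR (1 / (norm x)\<^sup>2) ((x * z)\<^sup>\<star> * (x * z))"
    unfolding h by (simp add: t_def algebra_simps)
  finally have "\<tau> ((h * z)\<^sup>\<star> * (h * z)) = \<tau> (z\<^sup>\<star> * z) - of_real (1 / (norm x)\<^sup>2) * \<tau> ((x * z)\<^sup>\<star> * (x * z))"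
    using x z by (simp only: \<tau>_diff \<tau>_scaleR A_intros)
  then have "Re (\<tau> ((h * z)\<^sup>\<star> * (h * z))) = Re (\<tau> (z\<^sup>\<star> * z)) - 1 / (norm x)\<^sup>2 * Re (\<tau> ((x * z)\<^sup>\<star> * (x * z)))"
    by (simp only: minus_complex.sel Re_complex_of_real Im_complex_of_real times_complex.sel mult_zero_left diff_zero)
  moreover have "0 \<le> Re (\<tau> ((h * z)\<^sup>\<star> * (h * z)))" by (intro Re_\<tau>_pos A_intros h z)
  ultimately have "Re (\<tau> ((x * z)\<^sup>\<star> * (x * z))) / (norm x)\<^sup>2 \<le> Re (\<tau> (z\<^sup>\<star> * z))" by simp
  then show ?thesis using False by (simp add: pos_divide_le_eq mult.commute)
qed

text \<open>The variance of \<open>x\<close> is nonnegative.\<close>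

lemma \<tau>_le_norm: assumes x: "x \<in> A" shows "cmod (\<tau> x) \<le> norm x"
proof -
  define y where "y = x - \<tau> x *\<^sub>C 1"
  have "y\<^sup>\<star> * y = x\<^sup>\<star> * x - \<tau> x *\<^sub>C x\<^sup>\<star> - (cnj (\<tau> x) *\<^sub>C x - (cnj (\<tau> x) * \<tau> x) *\<^sub>C 1)"
    by (simp add: y_def algebra_simps csc_diff_right)
  then have "\<tau> (y\<^sup>\<star> * y) = \<tau> (x\<^sup>\<star> * x) - \<tau> x * cnj (\<tau> x)"
    using x by (simp add: \<tau>_diff \<tau>_csc A_intros \<tau>_one \<tau>_adj)
  moreover have "0 \<le> Re (\<tau> (y\<^sup>\<star> * y))" unfolding y_def by (intro Re_\<tau>_pos A_intros x)
  moreover have "Re (\<tau> x * cnj (\<tau> x)) = (cmod (\<tau> x))\<^sup>2" by (simp flip: complex_norm_square)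
  ultimately have "(cmod (\<tau> x))\<^sup>2 \<le> Re (\<tau> (x\<^sup>\<star> * x))" by simp
  also have "\<dots> \<le> (norm x)\<^sup>2" using \<tau>_bound[OF x A_intros(1)] by (simp add: \<tau>_one)
  finally show ?thesis by (rule power2_le_imp_le) simp
qed

lemma form_positive_square:
  assumes h: "h \<in> A" "h\<^sup>\<star> = h" "norm (1 - h) \<le> 1" and c: "c \<in> A"
  shows "0 \<le> Re (\<tau> (c\<^sup>\<star> * (h * c)))"
proof -
  obtain k where k: "k \<in> A" "k\<^sup>\<star> = k" "k * k = 1 - (1 - h)"
    using cstar_sqrt[OF A closed_A, of "1 - h"] h by (auto simp: A_intros)
  then have "(k * c)\<^sup>\<star> * (k * c) = c\<^sup>\<star> * (h * c)" by (simp add: mult.assoc flip: mult.assoc[of k k])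
  then show ?thesis using Re_\<tau>_pos[of "k * c"] k c by (simp add: A_intros)
qed

text \<open>
  A self-adjoint \<open>g\<close> with nonnegative image in the GNS representation equals the square root
  of \<open>g\<^sup>2\<close>: the difference \<open>d\<close> satisfies \<open>d * (h + g) * d = 0\<close>.
\<close>

lemma gns_positive_imp_positive:
  assumes g: "g \<in> A" "g\<^sup>\<star> = g" and pos: "\<And>c. c \<in> A \<Longrightarrow> 0 \<le> Re (\<tau> (c\<^sup>\<star> * (g * c)))"
  shows "0 \<le> Re (cinner x (ap g x))"
proof (cases "g = 0")
  case False
  define M where "M = norm g"
  have M: "M > 0" using False by (simp add: M_def)
  define b where "b = scaleR (1 / M\<^sup>2) (g * g)"
  \<comment> \<open>The root is taken within the commutant of \<open>g\<close>, so that it commutes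
    with \<open>g\<close>.\<close>
  define A' where "A' = A \<inter> {z. z * g = g * z}"
  have A': "star_subalgebra A'"
    unfolding star_subalgebra_def A'_def
  proof (intro conjI ballI allI)
    fix z assume z: "z \<in> A \<inter> {z. z * g = g * z}"
    then have "(z * g)\<^sup>\<star> = (g * z)\<^sup>\<star>" by simp
    then show "z\<^sup>\<star> \<in> A \<inter> {z. z * g = g * z}" using z by (simp add: g A_intros)
    fix y assume y: "y \<in> A \<inter> {z. z * g = g * z}"
    have "z * y * g = g * (z * y)" using y z by simp (metis mult.assoc)
    then show "z * y \<in> A \<inter> {z. z * g = g * z}" using y z by (simp add: A_intros)
  qed (auto simp: A_intros algebra_simps)
  have "closed {z. z * g = g * z}" by (intro closed_Collect_eq continuous_intros)
  then have cl: "closed A'" unfolding A'_def by (intro closed_Int closed_A)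
  have tA: "1 - b \<in> A'" using g by (simp add: A'_def b_def A_intros algebra_simps)
  have tsa: "(1 - b)\<^sup>\<star> = 1 - b" by (simp add: b_def g)
  \<comment> \<open>The triangle inequality gives only 2; the bound 1 comes from the quadratic form,
    which lies between 0 and that of the identity.\<close>
  have tn: "norm (1 - b) \<le> 1"
  proof (rule positive_cop_norm_le[OF tsa])
    fix x
    have eq: "Re (cinner x (ap (1 - b) x)) = (norm x)\<^sup>2 - (norm (ap g x))\<^sup>2 / M\<^sup>2"
    proof -
      have "Re (cinner x (ap g (ap g x))) = (norm (ap g x))\<^sup>2"
        using cinner_adj[of g x "ap g x"] by (metis cinner_self g(2) Re_complex_of_real)
      then show ?thesis
        by (simp add: b_def g cinner_diff_right scaleR_scaleC cinner_scaleC_right cinner_self)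
    qed
    have "(norm (ap g x))\<^sup>2 \<le> (M * norm x)\<^sup>2" unfolding M_def by (intro power_mono norm_ap) simp
    then show "0 \<le> Re (cinner x (ap (1 - b) x))" unfolding eq using M by (simp add: field_simps)
    show "Re (cinner x (ap (1 - b) x)) \<le> 1 * (norm x)\<^sup>2" unfolding eq by simp
  qed simp
  obtain h where h: "h \<in> A'" "h\<^sup>\<star> = h" "h * h = 1 - (1 - b)" "norm (1 - h) \<le> 1"
    using cstar_sqrt[OF A' cl tA tsa tn] by blast
  have hA: "h \<in> A" and hg: "h * g = g * h" using h(1) by (auto simp: A'_def)
  define k where "k = scaleR M h"
  define d where "d = k - g"
  have k: "k \<in> A" "k\<^sup>\<star> = k" "k * g = g * k" "k * k = g * g"
    using h hA hg M by (auto simp: k_def A_intros b_def power2_eq_square)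
  have d: "d \<in> A" "d\<^sup>\<star> = d" using k g by (auto simp: d_def A_intros)
  have d0: "(k + g) * d = 0" using k(3,4) by (simp add: d_def algebra_simps)
  have kpos: "0 \<le> Re (\<tau> (c\<^sup>\<star> * (k * c)))" if "c \<in> A" for c
    using form_positive_square[OF hA h(2,4) that] M that hA by (simp add: k_def \<tau>_scaleR A_intros)
  \<comment> \<open>The forms of \<open>k\<close> and of \<open>g\<close> at \<open>d * c\<close>
    are nonnegative, the first since \<open>k\<close> has a root, the second by assumption, and they
    add up to 0. So both vanish, and with them their difference, the form of the cube of
    \<open>d\<close>.\<close>
  have form: "Re (\<tau> (c\<^sup>\<star> * (d * (d * (d * c))))) = 0" if c: "c \<in> A" for c
  proof -
    have dc: "d * c \<in> A" using d c by (simp add: A_intros)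
    have "\<tau> ((d * c)\<^sup>\<star> * (k * (d * c))) + \<tau> ((d * c)\<^sup>\<star> * (g * (d * c))) = \<tau> ((d * c)\<^sup>\<star> * (((k + g) * d) * c))"
      using k g d c by (simp add: A_intros distrib_right distrib_left mult.assoc flip: \<tau>_add)
    then have "Re (\<tau> ((d * c)\<^sup>\<star> * (k * (d * c)))) + Re (\<tau> ((d * c)\<^sup>\<star> * (g * (d * c)))) = 0"
      using \<tau>_csc[OF A_intros(6), of 0] by (simp add: d0 flip: plus_complex.sel)
    with kpos[OF dc] pos[OF dc] have "Re (\<tau> ((d * c)\<^sup>\<star> * (k * (d * c)))) = 0" "Re (\<tau> ((d * c)\<^sup>\<star> * (g * (d * c)))) = 0"
      by linarith+
    moreover have "c\<^sup>\<star> * (d * (d * (d * c))) = (d * c)\<^sup>\<star> * (k * (d * c)) - (d * c)\<^sup>\<star> * (g * (d * c))"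
    proof -
      have "(d * c)\<^sup>\<star> * (k * (d * c)) - (d * c)\<^sup>\<star> * (g * (d * c)) = (d * c)\<^sup>\<star> * (d * (d * c))"
        by (subst (5) d_def) (simp only: left_diff_distrib right_diff_distrib)
      then show ?thesis by (simp only: adj_mult d(2) mult.assoc)
    qed
    ultimately show ?thesis using k g d c by (simp add: \<tau>_diff A_intros del: adj_mult)
  qed
  have "d * d = 0"
  proof (rule \<tau>_faithful)
    fix c assume c: "c \<in> A"
    define e where "e = d * (d * d)"
    \<comment> \<open>At \<open>c + d * c\<close> the two mixed terms of the form of
      \<open>e\<close> are both the form of the fourth power of \<open>d\<close>, that is, the
      square of \<open>d * d * c\<close>.\<close>
    define c' where "c' = c + d * c"
    have dc: "d * c \<in> A" using d c by (simp add: A_intros)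
    have "c'\<^sup>\<star> * (e * c') = c\<^sup>\<star> * (e * c) + (d * c)\<^sup>\<star> * (e * (d * c)) + scaleR 2 ((d * d * c)\<^sup>\<star> * (d * d * c))"
      using d by (simp add: c'_def e_def scaleR_2 algebra_simps)
    then have "\<tau> (c'\<^sup>\<star> * (e * c')) = \<tau> (c\<^sup>\<star> * (e * c)) + \<tau> ((d * c)\<^sup>\<star> * (e * (d * c))) + of_real 2 * \<tau> ((d * d * c)\<^sup>\<star> * (d * d * c))"
      using d c dc by (simp only: \<tau>_add \<tau>_scaleR A_intros e_def)
    moreover have "Re (\<tau> (c'\<^sup>\<star> * (e * c'))) = 0" "Re (\<tau> (c\<^sup>\<star> * (e * c))) = 0" "Re (\<tau> ((d * c)\<^sup>\<star> * (e * (d * c)))) = 0"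
      using form[of c'] form[OF c] form[OF dc] d c by (simp_all add: c'_def e_def A_intros mult.assoc)
    ultimately have "Re (\<tau> ((d * d * c)\<^sup>\<star> * (d * d * c))) = 0" by simp
    moreover have "Im (\<tau> ((d * d * c)\<^sup>\<star> * (d * d * c))) = 0" by (intro Im_\<tau>_pos A_intros d c)
    ultimately show "\<tau> ((d * d * c)\<^sup>\<star> * (d * d * c)) = 0" by (simp add: complex_eq_iff)
  qed (use d in \<open>simp add: A_intros\<close>)
  then have "d = 0" using norm_adj_mult[of d] d by simp
  then have gk: "g = k" by (simp add: d_def)
  have "Re (cinner x (ap (1 - h) x)) \<le> (norm x)\<^sup>2"
  proof -
    have "Re (cinner x (ap (1 - h) x)) \<le> norm x * norm (ap (1 - h) x)"
      using complex_Re_le_cmod cinner_norm_le order_trans by blast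
    also have "\<dots> \<le> norm x * (1 * norm x)"
      using h(4) by (intro mult_left_mono order_trans[OF norm_ap] mult_right_mono) auto
    finally show ?thesis by (simp add: power2_eq_square)
  qed
  then have "0 \<le> Re (cinner x (ap h x))" by (simp add: cinner_diff_right cinner_self)
  then show ?thesis using M by (simp add: gk k_def scaleR_scaleC cinner_scaleC_right)
qed simp

text \<open>Both \<open>a\<close> and \<open>r - a\<close> have nonnegative image in the GNS
  representation, hence are positive operators.\<close>

theorem gns_isometric:
  assumes a: "a \<in> A" "a\<^sup>\<star> = a" and r: "0 \<le> r"
    and pos: "\<And>c. c \<in> A \<Longrightarrow> 0 \<le> Re (\<tau> (c\<^sup>\<star> * (a * c)))"
    and le: "\<And>c. c \<in> A \<Longrightarrow> Re (\<tau> (c\<^sup>\<star> * (a * c))) \<le> r * Re (\<tau> (c\<^sup>\<star> * c))"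
  shows "norm a \<le> r"
proof (rule positive_cop_norm_le[OF a(2) r])
  fix x
  show "0 \<le> Re (cinner x (ap a x))" by (rule gns_positive_imp_positive[OF a pos])
  have "0 \<le> Re (cinner x (ap (scaleR r 1 - a) x))"
  proof (rule gns_positive_imp_positive)
    fix c assume c: "c \<in> A"
    have "c\<^sup>\<star> * ((scaleR r 1 - a) * c) = scaleR r (c\<^sup>\<star> * c) - c\<^sup>\<star> * (a * c)" by (simp add: algebra_simps)
    then show "0 \<le> Re (\<tau> (c\<^sup>\<star> * ((scaleR r 1 - a) * c)))"
      using le[OF c] a c by (simp add: \<tau>_diff \<tau>_scaleR A_intros)
  qed (use a in \<open>auto simp: A_intros\<close>)
  then show "Re (cinner x (ap a x)) \<le> r * (norm x)\<^sup>2"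
    by (simp add: cinner_diff_right scaleR_scaleC cinner_scaleC_right cinner_self)
qed

end

section \<open>Ultrapowers\<close>

text \<open>An index consists of a set of operators to be controlled and a number governing
  tolerance and word length. Along an ultrafilter containing all cones, every fixed finite
  requirement is eventually met.\<close>

definition index_cone :: "'a set \<Rightarrow> nat \<Rightarrow> 'a index set" where
  "index_cone G k = {(H, m). finite H \<and> G \<subseteq> H \<and> k \<le> m}"

text \<open>Zorn's lemma gives a maximal family with the finite intersection property that contains
  \<open>E\<close>; the filter it generates decides every predicate.\<close>

lemma ultrafilter_exists:
  fixes E :: "'i set set"
  assumes E: "\<And>T. finite T \<Longrightarrow> T \<subseteq> E \<Longrightarrow> \<Inter>T \<noteq> {}"
  shows "\<exists>F. F \<noteq> bot \<and> (\<forall>P. eventually P F \<or> eventually (\<lambda>i. \<not> P i) F) \<and> (\<forall>S\<in>E. eventually (\<lambda>i. i \<in> S) F)"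
proof -
  define fip where "fip S \<longleftrightarrow> (\<forall>T. finite T \<and> T \<subseteq> S \<longrightarrow> \<Inter>T \<noteq> {})" for S :: "'i set set"
  have "\<exists>M\<in>{S. E \<subseteq> S \<and> fip S}. \<forall>X\<in>{S. E \<subseteq> S \<and> fip S}. M \<subseteq> X \<longrightarrow> X = M"
  proof (rule subset_Zorn_nonempty)
    have "fip E" unfolding fip_def using E by simp
    then have "E \<in> {S. E \<subseteq> S \<and> fip S}" by simp
    then show "{S. E \<subseteq> S \<and> fip S} \<noteq> {}" by fast
    fix C assume C: "C \<noteq> {}" "subset.chain {S. E \<subseteq> S \<and> fip S} C"
    have "fip (\<Union>C)"
      unfolding fip_def
    proof (intro allI impI)
      fix T assume T: "finite T \<and> T \<subseteq> \<Union>C"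
      then obtain S where S: "S \<in> C" "T \<subseteq> S"
        using finite_subset_Union_chain[OF _ _ C(1) C(2)] by blast
      then have "fip S" using C(2) by (auto simp: subset.chain_def)
      then show "\<Inter>T \<noteq> {}" using T S by (simp add: fip_def)
    qed
    moreover have "E \<subseteq> \<Union>C" using C unfolding subset.chain_def by fast
    ultimately show "\<Union>C \<in> {S. E \<subseteq> S \<and> fip S}" by blast
  qed
  then obtain M where "M \<in> {S. E \<subseteq> S \<and> fip S}" and max': "\<forall>X\<in>{S. E \<subseteq> S \<and> fip S}. M \<subseteq> X \<longrightarrow> X = M"
    by (rule bexE)
  then have M: "E \<subseteq> M" "fip M" by simp_all
  have max: "X = M" if "E \<subseteq> X" "fip X" "M \<subseteq> X" for X
    using bspec[OF max', of X] that by simp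
  \<comment> \<open>If both were missing, maximality would give one finite subfamily with
    intersection disjoint from \<open>S\<close> and another for the complement; together they
    violate the finite intersection property.\<close>
  have ultra: "S \<in> M \<or> - S \<in> M" for S
  proof (rule ccontr)
    assume n: "\<not> (S \<in> M \<or> - S \<in> M)"
    have key: "\<exists>T. finite T \<and> T \<subseteq> M \<and> \<Inter>T \<inter> U = {}" if "U \<notin> M" for U
    proof -
      have "\<not> fip (insert U M)"
      proof
        assume "fip (insert U M)"
        then have "insert U M = M" using M(1) by (intro max) auto
        then show False using that by auto
      qed
      then obtain T where T: "finite T" "T \<subseteq> insert U M" "\<Inter>T = {}"
        unfolding fip_def not_all not_imp not_not by (elim exE conjE)
      then have "finite (T - {U})" "T - {U} \<subseteq> M" "\<Inter>(T - {U}) \<inter> U = {}" by auto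
      then show ?thesis by (intro exI[of _ "T - {U}"]) simp
    qed
    have "S \<notin> M" "- S \<notin> M" using n by simp_all
    from key[OF this(1)] key[OF this(2)] obtain T1 T2 where
      T: "finite T1" "T1 \<subseteq> M" "\<Inter>T1 \<inter> S = {}" "finite T2" "T2 \<subseteq> M" "\<Inter>T2 \<inter> - S = {}"
      by (elim exE conjE)
    have "\<Inter>(T1 \<union> T2) = {}" unfolding Inter_Un_distrib using T(3,6) by blast
    moreover have "finite (T1 \<union> T2)" "T1 \<union> T2 \<subseteq> M" using T by simp_all
    ultimately show False using M(2) unfolding fip_def by simp
  qed
  define F where "F = (INF S\<in>M. principal S)"
  have ev: "eventually P F \<longleftrightarrow> (\<exists>T\<subseteq>M. finite T \<and> (\<forall>x\<in>\<Inter>T. P x))" for P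
  proof -
    have "eventually P (INF S\<in>T. principal S) \<longleftrightarrow> (\<forall>x\<in>\<Inter>T. P x)" if "finite T" for T
      using INF_principal_finite[OF that, of "\<lambda>S. S"] by (simp add: eventually_principal)
    then show ?thesis unfolding F_def by (subst eventually_INF) (intro ex_cong1 conj_cong refl, simp)
  qed
  have "F \<noteq> bot"
  proof
    assume "F = bot"
    then have "eventually (\<lambda>_. False) F" by simp
    then obtain T where T: "T \<subseteq> M" "finite T" "\<forall>x\<in>\<Inter>T. False" unfolding ev by (elim exE conjE)
    have "\<Inter>T = {}" using T(3) by blast
    then show False using M(2) T(1,2) unfolding fip_def by simp
  qed
  moreover have mem: "eventually (\<lambda>i. i \<in> S) F" if "S \<in> M" for S
    unfolding ev using that by (intro exI[of _ "{S}"]) simp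
  moreover have "eventually P F \<or> eventually (\<lambda>i. \<not> P i) F" for P
    using ultra[of "Collect P"] mem[of "Collect P"] mem[of "- Collect P"] by (elim disjE) simp_all
  ultimately show ?thesis using M(1) by (intro exI[of _ F] conjI allI ballI) (simp_all add: subset_iff)
qed

lemma index_cone_fip:
  assumes "finite T" "T \<subseteq> {index_cone G k | G k. finite G}"
  shows "\<exists>G k. finite G \<and> index_cone G k \<subseteq> \<Inter>T"
  using assms
proof (induction T rule: finite_induct)
  case empty then show ?case by (intro exI[of _ "{}"]) auto
next
  case (insert S T)
  then obtain G k H m where *: "finite G" "index_cone G k \<subseteq> \<Inter>T" "finite H" "S = index_cone H m" by auto
  have "index_cone (G \<union> H) (max k m) \<subseteq> index_cone G k" "index_cone (G \<union> H) (max k m) \<subseteq> S"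
    unfolding *(4) by (auto simp: index_cone_def)
  then have "index_cone (G \<union> H) (max k m) \<subseteq> \<Inter>(insert S T)" using *(2) by simp
  then show ?case using * by (intro exI[of _ "G \<union> H"] exI[of _ "max k m"]) simp
qed

definition omega :: "'a index filter" where
  "omega = (SOME F. F \<noteq> bot \<and> (\<forall>P. eventually P F \<or> eventually (\<lambda>i. \<not> P i) F) \<and>
     (\<forall>S\<in>{index_cone G k | G k. finite G}. eventually (\<lambda>i. i \<in> S) F))"

lemma omega:
  shows omega_not_bot [simp]: "(omega :: 'a index filter) \<noteq> bot"
    and omega_ultra: "eventually P (omega :: 'a index filter) \<or> eventually (\<lambda>i. \<not> P i) omega"
    and omega_cone: "finite G \<Longrightarrow> eventually (\<lambda>i. i \<in> index_cone G k) (omega :: 'a index filter)"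
proof -
  have "\<exists>F. F \<noteq> bot \<and> (\<forall>P. eventually P F \<or> eventually (\<lambda>i. \<not> P i) F) \<and>
     (\<forall>S\<in>{index_cone G k | (G :: 'a set) k. finite G}. eventually (\<lambda>i. i \<in> S) F)"
  proof (rule ultrafilter_exists)
    fix T assume "finite T" "T \<subseteq> {index_cone G k | (G :: 'a set) k. finite G}"
    from index_cone_fip[OF this] obtain G :: "'a set" and k where "finite G" "index_cone G k \<subseteq> \<Inter>T"
      by (elim exE conjE)
    then have "(G, k) \<in> \<Inter>T" by (simp add: index_cone_def subset_iff)
    then show "\<Inter>T \<noteq> {}" by fast
  qed
  note o = someI_ex[OF this, folded omega_def]
  show "(omega :: 'a index filter) \<noteq> bot" using o by simp
  show "eventually P (omega :: 'a index filter) \<or> eventually (\<lambda>i. \<not> P i) omega" using o by simp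
  assume "finite G"
  then have "index_cone G k \<in> {index_cone G k | (G :: 'a set) k. finite G}" by (simp, metis)
  then show "eventually (\<lambda>i. i \<in> index_cone G k) (omega :: 'a index filter)" using o by (elim conjE) (rule bspec)
qed

lemma free_ultrafilter_omega: "free_ultrafilter omega"
  unfolding free_ultrafilter_def
proof (intro conjI allI)
  fix j :: "'a index"
  \<comment> \<open>The successor excludes \<open>j\<close> itself from the cone.\<close>
  have "eventually (\<lambda>i. i \<in> index_cone {} (Suc (snd j))) (omega :: 'a index filter)" by (rule omega_cone) simp
  then show "eventually (\<lambda>i. i \<noteq> j) omega" by eventually_elim (auto simp: index_cone_def)
qed (use omega_ultra in auto)

lemma omega_tendsto_0:
  fixes f :: "'a index \<Rightarrow> real"
  assumes "finite G" and le: "\<And>i. i \<in> index_cone G k \<Longrightarrow> \<bar>f i\<bar> \<le> C / (real (snd i) + 1)"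
  shows "(f \<longlongrightarrow> 0) omega"
proof (rule tendstoI)
  fix e :: real assume e: "0 < e"
  obtain m where m: "\<bar>C\<bar> / e < real m" using reals_Archimedean2 by blast
  have "eventually (\<lambda>i. i \<in> index_cone G (max k m)) omega" by (rule omega_cone) fact
  then show "eventually (\<lambda>i. dist (f i) 0 < e) omega"
  proof eventually_elim
    case (elim i)
    have i: "i \<in> index_cone G k" "m \<le> snd i" using elim by (auto simp: index_cone_def)
    have "\<bar>C\<bar> < e * real m" using m e by (simp add: field_simps)
    also have "\<dots> \<le> e * (real (snd i) + 1)" using i e by (intro mult_left_mono) auto
    finally have "C / (real (snd i) + 1) < e" by (simp add: pos_divide_less_eq)
    then show ?case using le[OF i(1)] by simp
  qed
qed

text \<open>Compactness provides a cluster point, and an ultrafilter converges to each of its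
  cluster points.\<close>

lemma omega_convergent:
  fixes f :: "'a index \<Rightarrow> 'b::heine_borel"
  assumes "bounded (range f)"
  shows "\<exists>l. (f \<longlongrightarrow> l) omega"
proof -
  have c: "compact (closure (range f))" using assms by simp
  have nb: "filtermap f omega \<noteq> bot" by (simp add: filtermap_bot_iff)
  have "eventually (\<lambda>x. x \<in> closure (range f)) (filtermap f omega)"
    by (simp add: eventually_filtermap closure_subset[THEN subsetD])
  with c nb obtain l where l: "inf (nhds l) (filtermap f omega) \<noteq> bot"
    unfolding compact_filter by blast
  have "(f \<longlongrightarrow> l) omega"
  proof (rule topological_tendstoI)
    fix S assume S: "open S" "l \<in> S"
    show "eventually (\<lambda>i. f i \<in> S) omega"
    proof (rule ccontr)
      assume "\<not> ?thesis"
      then have "eventually (\<lambda>i. f i \<notin> S) omega" using omega_ultra by blast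
      then have "eventually (\<lambda>x. False) (inf (nhds l) (filtermap f omega))"
        unfolding eventually_inf using S
        by (intro exI[of _ "\<lambda>x. x \<in> S"] exI[of _ "\<lambda>x. x \<notin> S"])
           (auto simp: eventually_filtermap eventually_nhds)
      then show False using l by (simp add: trivial_limit_def)
    qed
  qed
  then show ?thesis by blast
qed

section \<open>Bounded families modulo null families, as a type\<close>

definition bd :: "('i \<Rightarrow> 'b::real_normed_vector) \<Rightarrow> bool" where
  "bd f \<longleftrightarrow> (\<exists>K. \<forall>i. norm (f i) \<le> K)"

definition ultra_rel :: "('a index \<Rightarrow> 'b::cstar_alg) \<Rightarrow> ('a index \<Rightarrow> 'b) \<Rightarrow> bool" where
  "ultra_rel f g \<longleftrightarrow> bd f \<and> bd g \<and> ((\<lambda>i. norm (f i - g i)) \<longlongrightarrow> 0) omega"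

lemma bdI: "(\<And>i. norm (f i) \<le> K) \<Longrightarrow> bd f" by (auto simp: bd_def)

lemma bd_const [simp]: "bd (\<lambda>_. c)" by (rule bdI[of _ "norm c"]) simp

lemma bd_add [intro]: "bd f \<Longrightarrow> bd g \<Longrightarrow> bd (\<lambda>i. f i + g i)"
  unfolding bd_def by (metis norm_triangle_mono)

lemma bd_scaleR [intro]: "bd f \<Longrightarrow> bd (\<lambda>i. scaleR r (f i))"
  unfolding bd_def by (metis abs_ge_zero mult_left_mono norm_scaleR)

lemma bd_uminus [intro]: "bd f \<Longrightarrow> bd (\<lambda>i. - f i)"
  unfolding bd_def by simp

lemma bd_diff [intro]: "bd f \<Longrightarrow> bd g \<Longrightarrow> bd (\<lambda>i. f i - g i)"
  using bd_add[of f "\<lambda>i. - g i"] bd_uminus[of g] by simp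

lemma bd_mult [intro]: "bd f \<Longrightarrow> bd g \<Longrightarrow> bd (\<lambda>i. f i * g i :: 'b::real_normed_algebra)"
proof -
  assume "bd f" "bd g"
  then obtain K M where "\<And>i. norm (f i) \<le> K" "\<And>i. norm (g i) \<le> M" by (auto simp: bd_def)
  then have "norm (f i * g i) \<le> K * M" for i
    by (intro order_trans[OF norm_mult_ineq] mult_mono) (auto intro: order_trans[OF norm_ge_zero])
  then show ?thesis by (rule bdI)
qed

lemma bd_csc [intro]: "bd f \<Longrightarrow> bd (\<lambda>i. c *\<^sub>C f i)"
  unfolding bd_def by (metis norm_ge_zero mult_left_mono norm_csc)

lemma bd_adj [intro]: "bd f \<Longrightarrow> bd (\<lambda>i. (f i)\<^sup>\<star>)"
  unfolding bd_def by simp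

lemma bd_norm_convergent: "bd f \<Longrightarrow> \<exists>l. ((\<lambda>i. norm (f i)) \<longlongrightarrow> l) omega"
  by (rule omega_convergent) (auto simp: bd_def bounded_iff)

\<comment> \<open>The quotient is partial since only bounded families are related to themselves.
  Being a type of class \<open>cstar_alg\<close>, the ultrapower of all operators is a place where
  the abstract Fock theory can be applied.\<close>
quotient_type (overloaded) ('a, 'b) ultra = "'a index \<Rightarrow> 'b::cstar_alg" / partial: ultra_rel
proof (rule part_equivpI)
  show "\<exists>f :: 'a index \<Rightarrow> 'b. ultra_rel f f" by (intro exI[of _ "\<lambda>_. 0"]) (simp add: ultra_rel_def)
  show "symp (ultra_rel :: ('a index \<Rightarrow> 'b) \<Rightarrow> _)"
    by (auto simp: symp_def ultra_rel_def norm_minus_commute)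
  show "transp (ultra_rel :: ('a index \<Rightarrow> 'b) \<Rightarrow> _)"
  proof (rule transpI)
    fix f g h :: "'a index \<Rightarrow> 'b"
    assume *: "ultra_rel f g" "ultra_rel g h"
    have lim: "((\<lambda>i. norm (f i - g i) + norm (g i - h i)) \<longlongrightarrow> 0) omega"
      using * tendsto_add[of "\<lambda>i. norm (f i - g i)" 0 omega "\<lambda>i. norm (g i - h i)" 0]
      by (simp add: ultra_rel_def)
    have "norm (norm (f i - h i)) \<le> norm (f i - g i) + norm (g i - h i)" for i
      using norm_triangle_ineq[of "f i - g i" "g i - h i"] by simp
    then have "((\<lambda>i. norm (f i - h i)) \<longlongrightarrow> 0) omega"
      by (intro Lim_null_comparison[OF always_eventually lim] allI)
    then show "ultra_rel f h" using * by (simp add: ultra_rel_def)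
  qed
qed

abbreviation (input) "uabs \<equiv> abs_ultra"
abbreviation (input) "urep \<equiv> rep_ultra"

lemma bd_urep [simp]: "bd (urep u)"
  using Quotient3_rep_reflp[OF Quotient3_ultra, of u] by (simp add: ultra_rel_def)

lemma uabs_urep [simp]: "uabs (urep u) = u"
  by (rule Quotient3_abs_rep[OF Quotient3_ultra])

lemma uabs_eq_iff:
  assumes "bd f" "bd g"
  shows "uabs f = uabs g \<longleftrightarrow> ((\<lambda>i. norm (f i - g i)) \<longlongrightarrow> 0) omega"
  using Quotient3_rel[OF Quotient3_ultra, of f g] assms by (simp add: ultra_rel_def)

lemma urep_uabs: "bd f \<Longrightarrow> ((\<lambda>i. norm (urep (uabs f) i - f i)) \<longlongrightarrow> 0) omega"
  by (subst uabs_eq_iff[symmetric]) auto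

lemma ultra_cases: obtains f where "bd f" "u = uabs f"
  using bd_urep uabs_urep by metis

lemma omega_null_le:
  assumes "(g \<longlongrightarrow> 0) omega" "\<And>i. \<bar>f i\<bar> \<le> g i" shows "(f \<longlongrightarrow> (0::real)) omega"
  by (rule Lim_null_comparison[OF _ assms(1)]) (use assms(2) in auto)

text \<open>Operations on classes are defined through chosen representatives. A Lipschitz estimate
  allows them to be exchanged for given ones.\<close>

lemma uabs_cong2:
  assumes f: "bd f" and g: "bd g" and b: "bd (\<lambda>i. F (f i) (g i))" "bd (\<lambda>i. F (urep (uabs f) i) (urep (uabs g) i))"
    and le: "\<And>i. norm (F (urep (uabs f) i) (urep (uabs g) i) - F (f i) (g i)) \<le>
       C * (norm (urep (uabs f) i - f i) + norm (urep (uabs g) i - g i))"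
  shows "uabs (\<lambda>i. F (urep (uabs f) i) (urep (uabs g) i)) = uabs (\<lambda>i. F (f i) (g i))"
proof -
  define e where "e i = C * (norm (urep (uabs f) i - f i) + norm (urep (uabs g) i - g i))" for i
  have "(e \<longlongrightarrow> C * (0 + 0)) omega"
    unfolding e_def by (rule tendsto_mult_left[OF tendsto_add[OF urep_uabs[OF f] urep_uabs[OF g]]])
  then have e: "(e \<longlongrightarrow> 0) omega" by simp
  have "((\<lambda>i. norm (F (urep (uabs f) i) (urep (uabs g) i) - F (f i) (g i))) \<longlongrightarrow> 0) omega"
    by (rule omega_null_le[OF e]) (simp only: abs_norm_cancel e_def le)
  then show ?thesis by (simp only: uabs_eq_iff[OF b(2,1)])
qed

instantiation ultra :: (type, cstar_alg) cstar_alg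
begin

definition zero_ultra :: "('a, 'b) ultra" where "0 = uabs (\<lambda>_. 0)"
definition one_ultra :: "('a, 'b) ultra" where "1 = uabs (\<lambda>_. 1)"
definition plus_ultra :: "('a, 'b) ultra \<Rightarrow> ('a, 'b) ultra \<Rightarrow> ('a, 'b) ultra" where
  "u + v = uabs (\<lambda>i. urep u i + urep v i)"
definition uminus_ultra :: "('a, 'b) ultra \<Rightarrow> ('a, 'b) ultra" where "- u = uabs (\<lambda>i. - urep u i)"
definition minus_ultra :: "('a, 'b) ultra \<Rightarrow> ('a, 'b) ultra \<Rightarrow> ('a, 'b) ultra" where "u - v = u + - (v :: ('a, 'b) ultra)"
definition times_ultra :: "('a, 'b) ultra \<Rightarrow> ('a, 'b) ultra \<Rightarrow> ('a, 'b) ultra" where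
  "u * v = uabs (\<lambda>i. urep u i * urep v i)"
definition csc_ultra :: "complex \<Rightarrow> ('a, 'b) ultra \<Rightarrow> ('a, 'b) ultra" where
  "c *\<^sub>C u = uabs (\<lambda>i. c *\<^sub>C urep u i)"
definition scaleR_ultra :: "real \<Rightarrow> ('a, 'b) ultra \<Rightarrow> ('a, 'b) ultra" where
  "scaleR_ultra r u = complex_of_real r *\<^sub>C u"
definition adj_ultra :: "('a, 'b) ultra \<Rightarrow> ('a, 'b) ultra" where "u\<^sup>\<star> = uabs (\<lambda>i. (urep u i)\<^sup>\<star>)"
definition norm_ultra :: "('a, 'b) ultra \<Rightarrow> real" where "norm u = (THE l. ((\<lambda>i. norm (urep u i)) \<longlongrightarrow> l) omega)"
definition dist_ultra :: "('a, 'b) ultra \<Rightarrow> ('a, 'b) ultra \<Rightarrow> real" where "dist u v = norm (u - v :: ('a, 'b) ultra)"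
definition sgn_ultra :: "('a, 'b) ultra \<Rightarrow> ('a, 'b) ultra" where "sgn_ultra u = scaleR (inverse (norm u)) u"
definition uniformity_ultra :: "(('a, 'b) ultra \<times> ('a, 'b) ultra) filter" where
  "uniformity_ultra = (INF e\<in>{0 <..}. principal {(x, y). dist x y < e})"
definition open_ultra :: "('a, 'b) ultra set \<Rightarrow> bool" where
  "open_ultra S = (\<forall>x\<in>S. \<forall>\<^sub>F (x', y) in uniformity. x' = x \<longrightarrow> y \<in> S)"

lemma uabs_plus: "bd f \<Longrightarrow> bd g \<Longrightarrow> uabs f + uabs g = uabs (\<lambda>i. f i + g i)"
  unfolding plus_ultra_def
  by (rule uabs_cong2[where F = "(+)" and C = 1]) (auto intro: norm_diff_triangle_ineq)

lemma uabs_uminus: "bd f \<Longrightarrow> - uabs f = uabs (\<lambda>i. - f i)"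
  unfolding uminus_ultra_def
  by (rule uabs_cong2[where F = "\<lambda>x y. - x" and C = 1 and g = f])
     (auto simp: norm_minus_commute)

lemma uabs_csc: "bd f \<Longrightarrow> c *\<^sub>C uabs f = uabs (\<lambda>i. c *\<^sub>C f i)"
  unfolding csc_ultra_def
  by (rule uabs_cong2[where F = "\<lambda>x y. c *\<^sub>C x" and C = "cmod c" and g = f])
     (auto simp: mult_left_mono simp flip: csc_diff_right)

lemma uabs_adj: "bd f \<Longrightarrow> (uabs f)\<^sup>\<star> = uabs (\<lambda>i. (f i)\<^sup>\<star>)"
  unfolding adj_ultra_def
  by (rule uabs_cong2[where F = "\<lambda>x y. x\<^sup>\<star>" and C = 1 and g = f])
     (auto simp flip: adj_diff)

lemma uabs_times: assumes "bd f" "bd g" shows "uabs f * uabs g = uabs (\<lambda>i. f i * g i)"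
proof -
  obtain K where K: "\<And>i. norm (f i) \<le> K" using assms by (auto simp: bd_def)
  obtain M where M: "\<And>i. norm (urep (uabs g) i) \<le> M" using bd_urep[of "uabs g"] unfolding bd_def by blast
  have le: "norm (a * b - f i * g i) \<le> (K + M) * (norm (a - f i) + norm (b - g i))" if "norm b \<le> M" for a b i
  proof -
    have "a * b - f i * g i = (a - f i) * b + f i * (b - g i)" by (simp add: algebra_simps)
    then have "norm (a * b - f i * g i) \<le> norm (a - f i) * norm b + norm (f i) * norm (b - g i)"
      using norm_triangle_ineq[of "(a - f i) * b" "f i * (b - g i)"] norm_mult_ineq[of "a - f i" b]
        norm_mult_ineq[of "f i" "b - g i"] by simp
    also have "\<dots> \<le> norm (a - f i) * M + K * norm (b - g i)"
      using that K by (intro add_mono mult_left_mono mult_right_mono) auto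
    also have "\<dots> \<le> (K + M) * (norm (a - f i) + norm (b - g i))"
    proof -
      have "0 \<le> K" using K[of i] norm_ge_zero[of "f i"] by linarith
      moreover have "0 \<le> M" using that norm_ge_zero[of b] by linarith
      ultimately show ?thesis by (simp add: distrib_left distrib_right mult.commute)
    qed
    finally show ?thesis .
  qed
  show ?thesis unfolding times_ultra_def using assms
    by (intro uabs_cong2[where F = "(*)" and C = "K + M"] le M) auto
qed

lemma uabs_norm: assumes f: "bd f" shows "((\<lambda>i. norm (f i)) \<longlongrightarrow> norm (uabs f)) omega"
proof -
  obtain l where l: "((\<lambda>i. norm (urep (uabs f) i)) \<longlongrightarrow> l) omega"
    using bd_norm_convergent[OF bd_urep] by blast
  then have n: "norm (uabs f) = l"
    unfolding norm_ultra_def using tendsto_unique[OF omega_not_bot] by (intro the_equality) auto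
  have "((\<lambda>i. norm (f i) - norm (urep (uabs f) i)) \<longlongrightarrow> 0) omega"
    by (rule omega_null_le[OF urep_uabs[OF f]])
      (metis norm_minus_commute norm_triangle_ineq3)
  from tendsto_add[OF this l] show ?thesis by (simp add: n)
qed

lemma uabs_norm_eq: "bd f \<Longrightarrow> ((\<lambda>i. norm (f i)) \<longlongrightarrow> l) omega \<Longrightarrow> norm (uabs f) = l"
  using tendsto_unique[OF omega_not_bot uabs_norm] by blast

lemma uabs_diff: "bd f \<Longrightarrow> bd g \<Longrightarrow> uabs f - uabs g = uabs (\<lambda>i. f i - g i)"
  by (simp add: minus_ultra_def uabs_uminus uabs_plus bd_uminus)

lemma uabs_scaleR: "bd f \<Longrightarrow> scaleR r (uabs f) = uabs (\<lambda>i. scaleR r (f i))"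
  by (simp add: scaleR_ultra_def uabs_csc scaleR_csc)

lemmas uabs_ops = uabs_plus uabs_uminus uabs_csc uabs_adj uabs_times uabs_diff uabs_scaleR
  zero_ultra_def one_ultra_def

instance
proof
  fix x y z :: "('a, 'b) ultra" and r s :: real and c d :: complex and S :: "('a, 'b) ultra set"
  obtain f g h where b: "bd f" "bd g" "bd h" and xyz: "x = uabs f" "y = uabs g" "z = uabs h"
    by (metis ultra_cases)
  note * = xyz uabs_ops b bd_add bd_uminus bd_csc bd_mult bd_adj bd_diff bd_scaleR
  show "x + y + z = x + (y + z)" by (simp add: * add.assoc)
  show "x + y = y + x" by (simp add: * add.commute)
  show "0 + x = x" by (simp add: *)
  show "- x + x = 0" by (simp add: *)
  show "x - y = x + - y" by (simp add: *)
  show "x * y * z = x * (y * z)" by (simp add: * mult.assoc)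
  show "(x + y) * z = x * z + y * z" by (simp add: * distrib_right)
  show "x * (y + z) = x * y + x * z" by (simp add: * distrib_left)
  show "1 * x = x" "x * 1 = x" by (simp_all add: *)
  show "scaleR r (x + y) = scaleR r x + scaleR r y" by (simp add: * scaleR_add_right)
  show "scaleR (r + s) x = scaleR r x + scaleR s x" by (simp add: * scaleR_add_left)
  show "scaleR r (scaleR s x) = scaleR (r * s) x" by (simp add: *)
  show "scaleR 1 x = x" by (simp add: *)
  show "scaleR r x * y = scaleR r (x * y)" by (simp add: *)
  show "x * scaleR r y = scaleR r (x * y)" by (simp add: *)
  show "dist x y = norm (x - y)" by (rule dist_ultra_def)
  show "sgn x = scaleR (inverse (norm x)) x" by (rule sgn_ultra_def)
  show "uniformity = (INF e\<in>{0 <..}. principal {(x :: ('a, 'b) ultra, y). dist x y < e})" by (rule uniformity_ultra_def)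
  show "open S = (\<forall>x\<in>S. \<forall>\<^sub>F (x', y) in uniformity. x' = x \<longrightarrow> y \<in> S)" by (rule open_ultra_def)
  show "(norm x = 0) = (x = 0)"
    using uabs_eq_iff[OF b(1) bd_const[of 0]] uabs_norm[OF b(1)] uabs_norm_eq[OF b(1), of 0]
    by (auto simp: xyz zero_ultra_def)
  show "norm (x + y) \<le> norm x + norm y"
    unfolding xyz uabs_plus[OF b(1,2)]
    by (rule tendsto_le[OF omega_not_bot tendsto_add[OF uabs_norm uabs_norm] uabs_norm])
      (use b in \<open>auto simp: norm_triangle_ineq\<close>)
  show "norm (c *\<^sub>C x) = cmod c * norm x"
    unfolding xyz uabs_csc[OF b(1)]
    by (rule uabs_norm_eq) (use b in \<open>auto intro!: tendsto_intros uabs_norm\<close>)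
  show "norm (scaleR r x) = \<bar>r\<bar> * norm x"
    unfolding xyz uabs_scaleR[OF b(1)]
    by (rule uabs_norm_eq) (use b in \<open>auto intro!: tendsto_intros uabs_norm\<close>)
  show "norm (x * y) \<le> norm x * norm y"
    unfolding xyz uabs_times[OF b(1,2)]
    by (rule tendsto_le[OF omega_not_bot tendsto_mult[OF uabs_norm uabs_norm] uabs_norm])
      (use b in \<open>auto simp: norm_mult_ineq\<close>)
  show "norm (x\<^sup>\<star> * x) = (norm x)\<^sup>2"
    unfolding xyz uabs_adj[OF b(1)] uabs_times[OF bd_adj[OF b(1)] b(1)]
    by (rule uabs_norm_eq) (use b in \<open>auto simp: norm_adj_mult intro!: tendsto_intros uabs_norm\<close>)
  show "c *\<^sub>C (x + y) = c *\<^sub>C x + c *\<^sub>C y" by (simp add: * csc_add_right)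
  show "(c + d) *\<^sub>C x = c *\<^sub>C x + d *\<^sub>C x" by (simp add: * csc_add_left)
  show "c *\<^sub>C (d *\<^sub>C x) = (c * d) *\<^sub>C x" by (simp add: *)
  show "scaleR r x = complex_of_real r *\<^sub>C x" by (rule scaleR_ultra_def)
  show "(c *\<^sub>C x) * y = c *\<^sub>C (x * y)" by (simp add: *)
  show "x * (c *\<^sub>C y) = c *\<^sub>C (x * y)" by (simp add: *)
  show "(x\<^sup>\<star>)\<^sup>\<star> = x" by (simp add: *)
  show "(x + y)\<^sup>\<star> = x\<^sup>\<star> + y\<^sup>\<star>" by (simp add: *)
  show "(c *\<^sub>C x)\<^sup>\<star> = cnj c *\<^sub>C x\<^sup>\<star>" by (simp add: *)
  show "(x * y)\<^sup>\<star> = y\<^sup>\<star> * x\<^sup>\<star>" by (simp add: *)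
qed

end

definition ultra_set :: "'b::cstar_alg set \<Rightarrow> ('a, 'b) ultra set" where
  "ultra_set V = uabs ` {f. bd f \<and> range f \<subseteq> V}"

lemma ultra_setI: "bd f \<Longrightarrow> (\<And>i. f i \<in> V) \<Longrightarrow> uabs f \<in> ultra_set V"
  by (auto simp: ultra_set_def)

lemma ultra_setE: assumes "u \<in> ultra_set V" obtains f where "bd f" "\<And>i. f i \<in> V" "u = uabs f"
  using assms by (auto simp: ultra_set_def)

text \<open>Values of norm above \<open>e\<close> are replaced by 0. Since \<open>norm u < e\<close>
  is strict, this happens only on a set that \<open>omega\<close> neglects.\<close>

lemma ultra_set_small_rep:
  assumes u: "u \<in> ultra_set V" and V: "0 \<in> V" and lt: "norm u < e"
  obtains f where "\<And>i. norm (f i) \<le> e" "\<And>i. f i \<in> V" "u = uabs f"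
proof -
  obtain g where g: "bd g" "\<And>i. g i \<in> V" "u = uabs g" using u by (rule ultra_setE) blast
  define f where "f i = (if norm (g i) \<le> e then g i else 0)" for i
  have e: "0 \<le> e" using lt norm_ge_zero[of u] by linarith
  then have fe: "norm (f i) \<le> e" for i by (simp add: f_def)
  have "eventually (\<lambda>i. norm (g i) < e) omega"
    using uabs_norm[OF g(1)] lt g(3) order_tendstoD(2) by blast
  then have "eventually (\<lambda>i. norm (g i - f i) = 0) omega"
    by eventually_elim (simp add: f_def)
  then have "((\<lambda>i. norm (g i - f i)) \<longlongrightarrow> 0) omega" by (rule tendsto_eventually)
  then have "u = uabs f" using uabs_eq_iff[OF g(1) bdI[of f, OF fe]] g(3) by simp
  moreover have "f i \<in> V" for i using g V by (simp add: f_def)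
  ultimately show ?thesis using that fe by blast
qed

lemma norm_uabs_le: "(\<And>i. norm (f i) \<le> K) \<Longrightarrow> norm (uabs f) \<le> K"
  by (rule tendsto_upperbound[OF uabs_norm[OF bdI] _ omega_not_bot, of f K]) auto

text \<open>Along a subsequence with geometrically decreasing differences, each difference is lifted
  to a uniformly small family with values in \<open>V\<close>. The lifted series converges in every
  coordinate, uniformly, to a representative of the limit.\<close>

lemma ultra_set_complete:
  fixes X :: "nat \<Rightarrow> ('a, 'b::{cstar_alg, banach}) ultra"
  assumes V: "closed V" "star_subalgebra V" and X: "\<And>n. X n \<in> ultra_set V" "Cauchy X"
  shows "\<exists>x\<in>ultra_set V. X \<longlonglongrightarrow> x"
proof -
  have V0: "0 \<in> V" by (rule subalg_zero[OF V(2)])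
  have "\<exists>N. \<forall>m\<ge>N. \<forall>n\<ge>N. norm (X m - X n) < (1/2) ^ k" for k
    using X(2) unfolding Cauchy_def dist_norm by auto
  then obtain N where N: "\<And>k m n. m \<ge> N k \<Longrightarrow> n \<ge> N k \<Longrightarrow> norm (X m - X n) < (1/2) ^ k" by metis
  \<comment> \<open>The sum lies above \<open>N n\<close> and so does its successor; a monotone
    choice of \<open>N\<close> is thereby avoided.\<close>
  define r where "r n = (\<Sum>k\<le>n. N k)" for n
  have rN: "N n \<le> r n" for n unfolding r_def by (rule member_le_sum) auto
  have rS: "N n \<le> r (Suc n)" for n using rN[of n] by (simp add: r_def)
  have "\<exists>f. (\<forall>i. norm (f i) \<le> (1/2) ^ n \<and> f i \<in> V) \<and> X (r (Suc n)) - X (r n) = uabs f" for n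
  proof -
    have "X (r (Suc n)) - X (r n) \<in> ultra_set V"
    proof -
      obtain f g where "bd f" "\<And>i. f i \<in> V" "X (r (Suc n)) = uabs f" "bd g" "\<And>i. g i \<in> V" "X (r n) = uabs g"
        by (metis X(1) ultra_setE)
      then show ?thesis by (auto simp: uabs_diff intro!: ultra_setI subalg_diff[OF V(2)])
    qed
    then show ?thesis using ultra_set_small_rep[OF _ V0 N[OF rS rN]] by metis
  qed
  then obtain d where d: "\<And>n i. norm (d n i) \<le> (1/2) ^ n" "\<And>n i. d n i \<in> V"
    "\<And>n. X (r (Suc n)) - X (r n) = uabs (d n)" by metis
  obtain x0 where x0: "bd x0" "\<And>i. x0 i \<in> V" "X (r 0) = uabs x0" using X(1) ultra_setE by metis
  have geo: "summable (\<lambda>n. (1/2::real) ^ n)" by simp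
  have sum: "summable (\<lambda>n. norm (d n i))" for i
    by (rule summable_comparison_test'[OF geo, of 0]) (simp add: d)
  have sumd: "summable (\<lambda>n. d n i)" for i using summable_norm_cancel[OF sum] .
  define g where "g i = x0 i + (\<Sum>n. d n i)" for i
  have tail: "norm (g i - (x0 i + (\<Sum>k<n. d k i))) \<le> 2 * (1/2) ^ n" for i n
  proof -
    have "g i - (x0 i + (\<Sum>k<n. d k i)) = (\<Sum>k. d (k + n) i)"
      using suminf_split_initial_segment[OF sumd, of i n] by (simp add: g_def)
    also have "norm \<dots> \<le> (\<Sum>k. norm (d (k + n) i))"
      by (rule summable_norm) (use sum summable_iff_shift[of "\<lambda>n. norm (d n i)" n] in simp)
    also have "\<dots> \<le> (\<Sum>k. (1/2) ^ n * (1/2) ^ k)"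
      by (rule suminf_le)
        (use d(1)[of "_ + n" i] sum[of i] summable_iff_shift[of "\<lambda>n. norm (d n i)" n]
          in \<open>auto simp: power_add mult.commute intro!: summable_mult2\<close>)
    also have "\<dots> = 2 * (1/2) ^ n" by (subst suminf_mult) (auto simp: suminf_geometric)
    finally show ?thesis .
  qed
  have bd_part: "bd (\<lambda>i. x0 i + (\<Sum>k<n. d k i))" for n
  proof (induction n)
    case (Suc n)
    then have "bd (\<lambda>i. (x0 i + (\<Sum>k<n. d k i)) + d n i)" by (rule bd_add[OF _ bdI[OF d(1)]])
    then show ?case by (simp add: add.assoc)
  qed (use x0 in simp)
  have "bd (\<lambda>i. (g i - (x0 i + (\<Sum>k<0. d k i))) + x0 i)" by (intro bd_add bdI[OF tail] x0)
  then have bg: "bd g" by simp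
  have gV: "g i \<in> V" for i
  proof -
    have "(\<Sum>n. d n i) \<in> V"
      by (rule closed_sequentially[OF V(1) _ summable_LIMSEQ[OF sumd]]) (intro subalg_sum[OF V(2)] d)
    then show ?thesis unfolding g_def by (intro subalg_add[OF V(2)] x0)
  qed
  have part: "X (r n) = uabs (\<lambda>i. x0 i + (\<Sum>k<n. d k i))" for n
  proof (induction n)
    case (Suc n)
    have "X (r (Suc n)) = X (r n) + uabs (d n)" using d(3)[of n] by (simp add: algebra_simps)
    also have "\<dots> = uabs (\<lambda>i. (x0 i + (\<Sum>k<n. d k i)) + d n i)"
      unfolding Suc by (rule uabs_plus[OF bd_part bdI[OF d(1)]])
    finally show ?case by (simp add: add.assoc)
  qed (simp add: x0)
  have close: "norm (uabs g - X (r n)) \<le> 2 * (1/2) ^ n" for n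
    unfolding part uabs_diff[OF bg bd_part] by (rule norm_uabs_le) (rule tail)
  have "X \<longlonglongrightarrow> uabs g"
  proof (rule LIMSEQ_I)
    fix e :: real assume "0 < e"
    then obtain n where n: "(1/2) ^ n < e / 3" using real_arch_pow_inv[of "e/3" "1/2"] by auto
    have "norm (X m - uabs g) < e" if "m \<ge> N n" for m
    proof -
      have "X m - uabs g = (X m - X (r n)) - (uabs g - X (r n))" by simp
      then have "norm (X m - uabs g) \<le> norm (X m - X (r n)) + norm (uabs g - X (r n))"
        by (metis norm_triangle_ineq4)
      then show ?thesis using N[OF that rN] close[of n] n by linarith
    qed
    then show "\<exists>no. \<forall>m\<ge>no. norm (X m - uabs g) < e" by blast
  qed
  moreover have "uabs g \<in> ultra_set V" using bg gV by (rule ultra_setI)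
  ultimately show ?thesis by blast
qed

instance ultra :: (type, "{cstar_alg, banach}") banach
proof
  fix X :: "nat \<Rightarrow> ('a, 'b) ultra" assume "Cauchy X"
  then have "\<exists>x\<in>ultra_set UNIV. X \<longlonglongrightarrow> x"
    by (intro ultra_set_complete) (auto simp: star_subalgebra_def ultra_set_def intro: ultra_cases)
  then show "convergent X" by (auto simp: convergent_def)
qed

lemma closed_ultra_set:
  fixes V :: "'b::{cstar_alg, banach} set"
  assumes V: "closed V" "star_subalgebra V"
  shows "closed (ultra_set V :: ('a, 'b) ultra set)"
  unfolding closed_sequential_limits
proof (intro allI impI)
  fix X :: "nat \<Rightarrow> ('a, 'b) ultra" and l
  assume X: "(\<forall>n. X n \<in> ultra_set V) \<and> X \<longlonglongrightarrow> l"
  then obtain x where "x \<in> ultra_set V" "X \<longlonglongrightarrow> x"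
    using ultra_set_complete[OF V, of X] LIMSEQ_imp_Cauchy by blast
  then show "l \<in> ultra_set V" using X LIMSEQ_unique by blast
qed

lemma star_subalgebra_ultra_set:
  assumes V: "star_subalgebra V"
  shows "star_subalgebra (ultra_set V :: ('a, 'b::cstar_alg) ultra set)"
  unfolding star_subalgebra_def
proof (intro conjI ballI allI)
  show "1 \<in> (ultra_set V :: ('a, 'b) ultra set)"
    unfolding one_ultra_def by (intro ultra_setI subalg_one[OF V]) simp
next
  fix x y :: "('a, 'b) ultra" assume "x \<in> ultra_set V" "y \<in> ultra_set V"
  then obtain f g where fg: "bd f" "\<And>i. f i \<in> V" "x = uabs f" "bd g" "\<And>i. g i \<in> V" "y = uabs g"
    by (metis ultra_setE)
  then show "x + y \<in> ultra_set V" "x * y \<in> ultra_set V"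
    by (auto simp: uabs_plus uabs_times intro!: ultra_setI subalg_add[OF V] subalg_mult[OF V])
next
  fix x :: "('a, 'b) ultra" and c assume "x \<in> ultra_set V"
  then obtain f where fg: "bd f" "\<And>i. f i \<in> V" "x = uabs f" by (metis ultra_setE)
  then show "x\<^sup>\<star> \<in> ultra_set V" "c *\<^sub>C x \<in> ultra_set V"
    by (auto simp: uabs_adj uabs_csc intro!: ultra_setI subalg_adj[OF V] subalg_csc[OF V])
qed

section \<open>Approximate creation operators from the PHP property\<close>

definition cop_projection :: "'h::complex_hilbert cop \<Rightarrow> bool" where
  "cop_projection P \<longleftrightarrow> P\<^sup>\<star> = P \<and> P * P = P"

lemma norm_cop_projection: "cop_projection P \<Longrightarrow> norm P \<le> 1"
proof -
  assume P: "cop_projection P"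
  then have "norm P * norm P = norm P * 1"
    using norm_adj_mult[of P] by (simp add: cop_projection_def power2_eq_square)
  then show "norm P \<le> 1" by (cases "norm P = 0") auto
qed

text \<open>The hypothesis is tested on vectors \<open>y\<close> in the range of \<open>Q\<close>,
  where the form of \<open>P - Q\<close> is minus the squared norm of
  \<open>y - ap P y\<close>.\<close>

lemma cop_projection_le:
  assumes P: "cop_projection P" "cop_projection Q" and le: "\<And>x. 0 \<le> Re (cinner x (ap (P - Q) x))"
  shows "P * Q = Q"
proof (rule cop_eqI)
  fix x
  define y where "y = ap Q x"
  have Qy: "ap Q y = y" using P(2) unfolding y_def by (metis ap_mult cop_projection_def)
  have Py: "cinner (ap P y) (ap P y) = cinner y (ap P y)"
    using P(1) cinner_adj[of P y "ap P y"] unfolding cop_projection_def by (metis ap_mult)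
  have yP: "cinner (ap P y) y = cinner y (ap P y)"
    using P(1) cinner_adj[of P y y] by (simp add: cop_projection_def)
  have "0 \<le> Re (cinner y (ap P y)) - Re (cinner y y)" using le[of y] by (simp add: Qy cinner_diff_right)
  moreover have "cinner (y - ap P y) (y - ap P y) = cinner y y - cinner y (ap P y)"
    by (simp add: cinner_diff_left cinner_diff_right Py yP)
  ultimately have "(norm (y - ap P y))\<^sup>2 \<le> 0" by (simp add: cinner_self complex_eq_iff)
  then show "ap (P * Q) x = ap Q x" by (simp add: y_def)
qed

definition orthogonal_projections :: "nat set \<Rightarrow> (nat \<Rightarrow> 'h::complex_hilbert cop) \<Rightarrow> bool" where
  "orthogonal_projections I P \<longleftrightarrow> (\<forall>i\<in>I. cop_projection (P i)) \<and> (\<forall>i\<in>I. \<forall>j\<in>I. i \<noteq> j \<longrightarrow> P i * P j = 0)"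

lemma orthogonal_projections_Pythagoras:
  assumes P: "orthogonal_projections I P" and I: "finite I" and v: "\<And>i. i \<in> I \<Longrightarrow> ap (P i) (v i) = v i"
  shows "(norm (\<Sum>i\<in>I. v i))\<^sup>2 = (\<Sum>i\<in>I. (norm (v i))\<^sup>2)"
proof (rule norm_sum_Pythagorean[OF I])
  show "pairwise (\<lambda>i j. orthogonal (v i) (v j)) I"
    unfolding pairwise_def orthogonal_def
  proof (intro ballI impI)
    fix i j assume ij: "i \<in> I" "j \<in> I" "i \<noteq> j"
    have "cinner (v i) (v j) = cinner (ap (P i) (v i)) (ap (P j) (v j))" using v ij by simp
    also have "\<dots> = cinner (v i) (ap (P i * P j) (v j))"
    proof -
      have "(P i)\<^sup>\<star> = P i" using P ij by (simp add: orthogonal_projections_def cop_projection_def)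
      then show ?thesis using cinner_adj[of "P i" "v i" "ap (P j) (v j)"] by simp
    qed
    also have "P i * P j = 0" using P ij by (simp add: orthogonal_projections_def)
    finally have "cinner (v i) (v j) = 0" by simp
    then show "inner (v i) (v j) = 0" by (simp add: inner_eq_Re_cinner)
  qed
qed

text \<open>Bessel's inequality, from the nonnegative squared distance between \<open>x\<close> and
  the sum of its components.\<close>

lemma orthogonal_projections_Bessel:
  assumes P: "orthogonal_projections I P" and I: "finite I"
  shows "(\<Sum>i\<in>I. (norm (ap (P i) x))\<^sup>2) \<le> (norm x)\<^sup>2"
proof -
  let ?y = "\<Sum>i\<in>I. ap (P i) x"
  have P2: "ap (P i) (ap (P i) x) = ap (P i) x" if "i \<in> I" for i
    using P that unfolding orthogonal_projections_def cop_projection_def by (metis ap_mult)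
  have y: "(norm ?y)\<^sup>2 = (\<Sum>i\<in>I. (norm (ap (P i) x))\<^sup>2)"
    by (rule orthogonal_projections_Pythagoras[OF P I]) (rule P2)
  have "inner x (ap (P i) x) = (norm (ap (P i) x))\<^sup>2" if i: "i \<in> I" for i
  proof -
    have "cinner x (ap (P i) (ap (P i) x)) = cinner (ap (P i) x) (ap (P i) x)"
      using P i cinner_adj[of "P i" x "ap (P i) x"] by (simp add: orthogonal_projections_def cop_projection_def)
    then show ?thesis using P2[OF i] by (simp add: inner_eq_Re_cinner cinner_self)
  qed
  then have xy: "inner x ?y = (norm ?y)\<^sup>2" by (simp add: inner_sum_right y)
  have "(norm (x - ?y))\<^sup>2 = (norm x)\<^sup>2 - 2 * inner x ?y + (norm ?y)\<^sup>2"
    by (simp add: power2_norm_eq_inner inner_diff_left inner_diff_right inner_commute)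
  then have "(norm ?y)\<^sup>2 \<le> (norm x)\<^sup>2" using zero_le_power2[of "norm (x - ?y)"] unfolding xy by linarith
  then show ?thesis by (simp only: y)
qed

text \<open>A block diagonal operator is no larger than its largest block, whatever the number of
  blocks. This keeps the corner errors bounded while the normalising factor tends to 0.\<close>

lemma norm_block_sum:
  assumes P: "orthogonal_projections I P" and I: "finite I" and C: "0 \<le> C"
    and T: "\<And>i. i \<in> I \<Longrightarrow> P i * T i = T i" "\<And>i. i \<in> I \<Longrightarrow> T i * P i = T i" "\<And>i. i \<in> I \<Longrightarrow> norm (T i) \<le> C"
  shows "norm (\<Sum>i\<in>I. T i) \<le> C"
proof (rule norm_cop_bound[OF C])
  fix x
  have "(norm (ap (\<Sum>i\<in>I. T i) x))\<^sup>2 = (\<Sum>i\<in>I. (norm (ap (T i) x))\<^sup>2)"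
    unfolding ap_sum
    by (rule orthogonal_projections_Pythagoras[OF P I]) (simp add: T(1) flip: ap_mult)
  also have "\<dots> \<le> (\<Sum>i\<in>I. C\<^sup>2 * (norm (ap (P i) x))\<^sup>2)"
  proof (rule sum_mono)
    fix i assume i: "i \<in> I"
    have "norm (ap (T i) x) = norm (ap (T i) (ap (P i) x))" using T(2)[OF i] by (metis ap_mult)
    also have "\<dots> \<le> C * norm (ap (P i) x)"
      using norm_ap[of "T i" "ap (P i) x"] mult_right_mono[OF T(3)[OF i], of "norm (ap (P i) x)"] by simp
    finally have "(norm (ap (T i) x))\<^sup>2 \<le> (C * norm (ap (P i) x))\<^sup>2" by (rule power_mono) simp
    then show "(norm (ap (T i) x))\<^sup>2 \<le> C\<^sup>2 * (norm (ap (P i) x))\<^sup>2" by (simp only: power_mult_distrib)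
  qed
  also have "\<dots> \<le> C\<^sup>2 * (norm x)\<^sup>2"
    unfolding sum_distrib_left[symmetric] by (intro mult_left_mono orthogonal_projections_Bessel P I) simp
  finally have "(norm (ap (\<Sum>i\<in>I. T i) x))\<^sup>2 \<le> (C * norm x)\<^sup>2" by (simp only: power_mult_distrib)
  then show "norm (ap (\<Sum>i\<in>I. T i) x) \<le> C * norm x" by (rule power2_le_imp_le) (use C in simp)
qed

text \<open>The operator inequalities of the PHP property appear as identities: \<open>u i\<close>
  maps the ranges of \<open>Q i\<close> and of \<open>1 - P i\<close> into the range of
  \<open>Q i\<close>. The index set is arbitrary because a subfamily will be selected later.\<close>

definition shift_family :: "nat set \<Rightarrow> (nat \<Rightarrow> 'h::complex_hilbert cop) \<Rightarrow> (nat \<Rightarrow> 'h cop) \<Rightarrow> (nat \<Rightarrow> 'h cop) \<Rightarrow> bool" where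
  "shift_family I u P Q \<longleftrightarrow> orthogonal_projections I P \<and>
     (\<forall>i\<in>I. (u i)\<^sup>\<star> * u i = 1 \<and> u i * (u i)\<^sup>\<star> = 1 \<and> cop_projection (Q i) \<and> P i * Q i = Q i \<and>
        Q i * (u i * Q i) = u i * Q i \<and> Q i * (u i * (1 - P i)) = u i * (1 - P i))"

lemma shift_family_subset: "shift_family I u P Q \<Longrightarrow> J \<subseteq> I \<Longrightarrow> shift_family J u P Q"
  unfolding shift_family_def orthogonal_projections_def by (simp add: subset_iff)

section \<open>The creation operator of a finite shift family\<close>

locale shift =
  fixes I :: "nat set" and u P Q :: "nat \<Rightarrow> 'h::complex_hilbert cop"
  assumes I: "finite I" "I \<noteq> {}" and family: "shift_family I u P Q"
begin

lemma orth: "orthogonal_projections I P"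
  using family by (simp add: shift_family_def)

context
  fixes i assumes i: "i \<in> I"
begin

lemma uu: "(u i)\<^sup>\<star> * u i = 1" "u i * (u i)\<^sup>\<star> = 1"
  and PP: "P i * P i = P i" "(P i)\<^sup>\<star> = P i" and QQ: "Q i * Q i = Q i" "(Q i)\<^sup>\<star> = Q i"
  and PQ: "P i * Q i = Q i" and QuQ: "Q i * (u i * Q i) = u i * Q i"
  and Qu: "Q i * (u i * (1 - P i)) = u i * (1 - P i)"
  using family i by (auto simp: shift_family_def orthogonal_projections_def cop_projection_def)

lemma QP: "Q i * P i = Q i"
  using arg_cong[OF PQ, of adj] by (simp add: PP QQ)

lemma norm_u: "norm (u i) \<le> 1"
proof -
  have "(norm (u i))\<^sup>2 \<le> 1\<^sup>2" using norm_adj_mult[of "u i"] norm_one_le[where 'a = "'h cop"] by (simp add: uu)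
  then show ?thesis by (rule power2_le_imp_le) simp
qed

lemma norm_P: "norm (P i) \<le> 1" "norm (Q i) \<le> 1" "norm (1 - P i) \<le> 1"
  by (rule norm_cop_projection, simp add: cop_projection_def PP QQ algebra_simps)+

definition g where "g = u i * (1 - P i) + (P i - Q i) * (u i)\<^sup>\<star>"

lemma norm_mult_le: "norm (x :: 'h cop) \<le> a \<Longrightarrow> norm (y :: 'h cop) \<le> b \<Longrightarrow> norm (x * y) \<le> a * b"
  by (rule order_trans[OF norm_mult_ineq]) (auto intro!: mult_mono order_trans[OF norm_ge_zero])

lemma norm_g: "norm g \<le> 3"
proof -
  have "norm (u i * (1 - P i)) \<le> 1 * 1" by (intro norm_mult_le norm_u norm_P)
  moreover have "norm (P i - Q i) \<le> 2" using norm_triangle_ineq4[of "P i" "Q i"] norm_P by linarith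
  then have "norm ((P i - Q i) * (u i)\<^sup>\<star>) \<le> 2 * 1" by (intro norm_mult_le) (simp_all add: norm_u)
  ultimately show ?thesis
    using norm_triangle_ineq[of "u i * (1 - P i)" "(P i - Q i) * (u i)\<^sup>\<star>"] by (simp add: g_def)
qed

lemma Pu: "P i * (u i * (1 - P i)) = u i * (1 - P i)"
proof -
  have "P i * (u i * (1 - P i)) = (P i * Q i) * (u i * (1 - P i))" by (simp only: Qu mult.assoc)
  then show ?thesis by (simp only: PQ Qu)
qed

lemma PuQ: "P i * (u i * Q i) = u i * Q i"
proof -
  have "P i * (u i * Q i) = (P i * Q i) * (u i * Q i)" by (simp only: QuQ mult.assoc)
  then show ?thesis by (simp only: PQ QuQ)
qed

lemma P_g: "P i * g = g"
proof -
  have "P i * ((P i - Q i) * (u i)\<^sup>\<star>) = (P i * (P i - Q i)) * (u i)\<^sup>\<star>" by (simp add: mult.assoc)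
  also have "P i * (P i - Q i) = P i - Q i" by (simp add: PP PQ right_diff_distrib)
  finally show ?thesis by (simp add: g_def distrib_left Pu)
qed

lemma g_adj_P: "g\<^sup>\<star> * P i = g\<^sup>\<star>"
  using arg_cong[OF P_g, of adj] by (simp add: PP)

text \<open>\<open>r\<close>, and \<open>d\<close> below, are corners of \<open>P i\<close>: sums of them over different \<open>i\<close> do not grow.\<close>

definition r where "r = u i * Q i + Q i * (u i)\<^sup>\<star>"

text \<open>In the sum of \<open>g\<close> and its adjoint the terms \<open>u i * P i\<close> and
  \<open>P i * (u i)\<^sup>\<star>\<close> cancel; only terms with \<open>Q i\<close>
  remain.\<close>

lemma g_remainder: "u i + (u i)\<^sup>\<star> - (g + g\<^sup>\<star>) = r"
  by (simp add: g_def r_def PP QQ algebra_simps)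

lemma r_block: "P i * r = r" "r * P i = r" "norm r \<le> 2"
proof -
  have 2: "P i * (Q i * (u i)\<^sup>\<star>) = Q i * (u i)\<^sup>\<star>" by (simp only: PQ flip: mult.assoc)
  show a: "P i * r = r" by (simp add: r_def distrib_left PuQ 2)
  have "r\<^sup>\<star> = r" by (simp add: r_def QQ add.commute)
  then show "r * P i = r" using arg_cong[OF a, of adj] by (simp add: PP)
  have "norm (u i * Q i) \<le> 1 * 1" by (intro norm_mult_le norm_u norm_P)
  moreover have "norm (Q i * (u i)\<^sup>\<star>) \<le> 1 * 1" by (intro norm_mult_le) (simp_all add: norm_u norm_P)
  ultimately show "norm r \<le> 2" using norm_triangle_ineq[of "u i * Q i" "Q i * (u i)\<^sup>\<star>"] by (simp add: r_def)
qed

definition d where "d = P i + (u i * ((1 - P i) * (u i)\<^sup>\<star>) + u i * (Q i * (u i)\<^sup>\<star>))"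

text \<open>The summands of \<open>g\<close> have ranges in those of \<open>Q i\<close> and of
  \<open>P i - Q i\<close>, so mixed terms vanish. The diagonal terms are projections that differ
  from 1 only by blocks; this is where the 2 in the normalisation by \<open>2 * card I\<close> comes
  from.\<close>

lemma g_square: "g\<^sup>\<star> * g = 1 + 1 - d"
proof -
  have c: "(P i - Q i) * (u i * (1 - P i)) = 0" by (simp only: left_diff_distrib Pu Qu) simp
  have c': "(1 - P i) * (u i)\<^sup>\<star> * (P i - Q i) = 0"
    using arg_cong[OF c, of adj] by (simp add: PP QQ mult.assoc)
  have e1: "(1 - P i) * (u i)\<^sup>\<star> * (u i * (1 - P i)) = 1 - P i"
  proof -
    have "(1 - P i) * (u i)\<^sup>\<star> * (u i * (1 - P i)) = (1 - P i) * (((u i)\<^sup>\<star> * u i) * (1 - P i))"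
      by (simp only: mult.assoc)
    then show ?thesis by (simp add: uu PP algebra_simps)
  qed
  have pq: "(P i - Q i) * (P i - Q i) = P i - Q i" by (simp add: algebra_simps PP QQ PQ QP)
  have adj: "g\<^sup>\<star> = (1 - P i) * (u i)\<^sup>\<star> + u i * (P i - Q i)" by (simp add: g_def PP QQ)
  have "g\<^sup>\<star> * g = (1 - P i) * (u i)\<^sup>\<star> * (u i * (1 - P i)) + ((1 - P i) * (u i)\<^sup>\<star> * (P i - Q i)) * (u i)\<^sup>\<star>
     + u i * ((P i - Q i) * (u i * (1 - P i))) + u i * (((P i - Q i) * (P i - Q i)) * (u i)\<^sup>\<star>)"
    unfolding adj
    by (subst g_def) (simp only: distrib_left distrib_right mult.assoc add.assoc add.left_commute)
  also have "\<dots> = 1 - P i + u i * ((P i - Q i) * (u i)\<^sup>\<star>)" by (simp add: e1 c c' pq)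
  also have "u i * ((P i - Q i) * (u i)\<^sup>\<star>) = u i * (u i)\<^sup>\<star> - (u i * ((1 - P i) * (u i)\<^sup>\<star>) + u i * (Q i * (u i)\<^sup>\<star>))"
    by (simp add: algebra_simps)
  finally show ?thesis by (simp add: d_def uu algebra_simps)
qed

lemma d_block: "P i * d = d" "d * P i = d" "norm d \<le> 3"
proof -
  have "P i * (u i * (Q i * (u i)\<^sup>\<star>)) = (P i * (u i * Q i)) * (u i)\<^sup>\<star>" by (simp only: mult.assoc)
  then have 1: "P i * (u i * (Q i * (u i)\<^sup>\<star>)) = u i * (Q i * (u i)\<^sup>\<star>)" by (simp only: PuQ mult.assoc)
  have "P i * (u i * ((1 - P i) * (u i)\<^sup>\<star>)) = (P i * (u i * (1 - P i))) * (u i)\<^sup>\<star>" by (simp only: mult.assoc)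
  then have 2: "P i * (u i * ((1 - P i) * (u i)\<^sup>\<star>)) = u i * ((1 - P i) * (u i)\<^sup>\<star>)" by (simp only: Pu mult.assoc)
  show a: "P i * d = d" by (simp only: d_def distrib_left PP 1 2)
  have "d\<^sup>\<star> = d" by (simp add: d_def QQ PP mult.assoc)
  then show "d * P i = d" using arg_cong[OF a, of adj] by (simp add: PP)
  have "norm (u i * ((1 - P i) * (u i)\<^sup>\<star>)) \<le> 1 * (1 * 1)"
    by (intro norm_mult_le norm_u norm_P) (simp add: norm_u)
  moreover have "norm (u i * (Q i * (u i)\<^sup>\<star>)) \<le> 1 * (1 * 1)"
    by (intro norm_mult_le norm_u norm_P) (simp add: norm_u)
  ultimately show "norm d \<le> 3"
    using norm_P(1) norm_triangle_ineq[of "P i" "u i * ((1 - P i) * (u i)\<^sup>\<star>) + u i * (Q i * (u i)\<^sup>\<star>)"]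
      norm_triangle_ineq[of "u i * ((1 - P i) * (u i)\<^sup>\<star>)" "u i * (Q i * (u i)\<^sup>\<star>)"]
    unfolding d_def by linarith
qed

end

definition c where "c = 1 / sqrt (2 * real (card I))"
definition L where "L = scaleR c (\<Sum>i\<in>I. g i)"
definition s where "s = scaleR c (\<Sum>i\<in>I. u i + (u i)\<^sup>\<star>)"

lemma card_pos: "0 < real (card I)"
  using I by (simp add: card_gt_0_iff)

lemma c_pos: "0 < c" using card_pos by (simp add: c_def)

lemma c_square: "c * c = 1 / (2 * real (card I))"
  using card_pos by (simp add: c_def)

lemma s_adj: "s\<^sup>\<star> = s"
  by (simp add: s_def adj_sum add.commute)

lemma s_close: "norm (s - (L + L\<^sup>\<star>)) \<le> 2 * c"
proof -
  have "s - (L + L\<^sup>\<star>) = scaleR c ((\<Sum>i\<in>I. u i + (u i)\<^sup>\<star>) - ((\<Sum>i\<in>I. g i) + (\<Sum>i\<in>I. (g i)\<^sup>\<star>)))"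
    by (simp only: s_def L_def adj_scaleR adj_sum scaleR_diff_right scaleR_add_right)
  also have "(\<Sum>i\<in>I. u i + (u i)\<^sup>\<star>) - ((\<Sum>i\<in>I. g i) + (\<Sum>i\<in>I. (g i)\<^sup>\<star>)) = (\<Sum>i\<in>I. u i + (u i)\<^sup>\<star> - (g i + (g i)\<^sup>\<star>))"
    by (simp only: sum.distrib sum_subtractf)
  also have "\<dots> = (\<Sum>i\<in>I. r i)" by (intro sum.cong refl g_remainder)
  finally have "s - (L + L\<^sup>\<star>) = scaleR c (\<Sum>i\<in>I. r i)" .
  moreover have "norm (\<Sum>i\<in>I. r i) \<le> 2"
    by (rule norm_block_sum[OF orth I(1)]) (simp_all add: r_block)
  ultimately show ?thesis using c_pos by (simp add: mult.commute)
qed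

lemma L_compress: "L\<^sup>\<star> * (x * L) = scaleR (c * c) (\<Sum>i\<in>I. \<Sum>j\<in>I. (g i)\<^sup>\<star> * ((P i * x * P j) * g j))"
proof -
  have "(g i)\<^sup>\<star> * (x * g j) = (g i)\<^sup>\<star> * ((P i * x * P j) * g j)" if "i \<in> I" "j \<in> I" for i j
  proof -
    have "(g i)\<^sup>\<star> * ((P i * x * P j) * g j) = ((g i)\<^sup>\<star> * P i) * (x * (P j * g j))" by (simp only: mult.assoc)
    then show ?thesis using that by (simp add: P_g g_adj_P)
  qed
  then have "(\<Sum>i\<in>I. \<Sum>j\<in>I. (g i)\<^sup>\<star> * ((P i * x * P j) * g j)) = (\<Sum>i\<in>I. \<Sum>j\<in>I. (g i)\<^sup>\<star> * (x * g j))"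
    by (intro sum.cong refl) simp
  also have "\<dots> = (\<Sum>i\<in>I. g i)\<^sup>\<star> * (x * (\<Sum>j\<in>I. g j))"
    by (simp add: adj_sum sum_distrib_left sum_distrib_right)
       (rule sum.swap)
  finally show ?thesis by (simp add: L_def)
qed

text \<open>Off-diagonal terms contain \<open>P i * P j = 0\<close>. The diagonal defects
  \<open>d i\<close> are blocks, so their sum stays below 3 and is multiplied by the square of the
  normalising factor.\<close>

lemma L_isometry: "norm (L\<^sup>\<star> * L - 1) \<le> 3 / (2 * real (card I))"
proof -
  have "L\<^sup>\<star> * (1 * L) = scaleR (c * c) (\<Sum>i\<in>I. \<Sum>j\<in>I. (g i)\<^sup>\<star> * ((P i * 1 * P j) * g j))"
    by (rule L_compress)
  also have "(\<Sum>i\<in>I. \<Sum>j\<in>I. (g i)\<^sup>\<star> * ((P i * 1 * P j) * g j)) = (\<Sum>i\<in>I. \<Sum>j\<in>I. if j = i then 1 + 1 - d i else 0)"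
  proof (intro sum.cong refl)
    fix i j assume ij: "i \<in> I" "j \<in> I"
    show "(g i)\<^sup>\<star> * ((P i * 1 * P j) * g j) = (if j = i then 1 + 1 - d i else 0)"
    proof (cases "i = j")
      case True then show ?thesis using ij by (simp add: PP P_g g_square)
    next
      case False
      then have "P i * P j = 0" using orth ij by (simp add: orthogonal_projections_def)
      then show ?thesis using False by simp
    qed
  qed
  also have "\<dots> = (\<Sum>i\<in>I. 1 + 1 - d i)" using I by (simp add: sum.delta)
  also have "\<dots> = scaleR (2 * real (card I)) 1 - (\<Sum>i\<in>I. d i)"
    by (simp add: sum_subtractf sum.distrib sum_constant_scaleR scaleR_2 flip: scaleR_add_left)
  finally have "L\<^sup>\<star> * L - 1 = - scaleR (c * c) (\<Sum>i\<in>I. d i)"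
    using card_pos by (simp add: scaleR_diff_right c_square)
  moreover have "norm (\<Sum>i\<in>I. d i) \<le> 3"
    by (rule norm_block_sum[OF orth I(1)]) (simp_all add: d_block)
  ultimately show ?thesis using card_pos by (simp add: c_square divide_right_mono)
qed

text \<open>There are \<open>card I\<close> squared terms of size at most \<open>3 * e * 3\<close>,
  and normalisation divides by twice \<open>card I\<close>. The remaining factor
  \<open>card I\<close> forces \<open>e\<close> to be chosen after the number of unitaries.\<close>

lemma L_compress_le:
  assumes x: "\<And>i j. i \<in> I \<Longrightarrow> j \<in> I \<Longrightarrow> norm (P i * x * P j) \<le> e"
  shows "norm (L\<^sup>\<star> * (x * L)) \<le> 5 * real (card I) * e"
proof -
  have "norm ((g i)\<^sup>\<star> * ((P i * x * P j) * g j)) \<le> 3 * (e * 3)" if "i \<in> I" "j \<in> I" for i j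
    using that by (intro norm_mult_le[of i] x) (simp_all add: norm_g)
  then have "norm (\<Sum>i\<in>I. \<Sum>j\<in>I. (g i)\<^sup>\<star> * ((P i * x * P j) * g j)) \<le> (\<Sum>i\<in>I. \<Sum>j\<in>I. 9 * e)"
    by (intro sum_norm_le) (auto intro!: order_trans[OF sum_norm_le])
  also have "\<dots> = 9 * e * real (card I) * real (card I)" by simp
  finally have "norm (L\<^sup>\<star> * (x * L)) \<le> c * c * (9 * e * real (card I) * real (card I))"
    unfolding L_compress using c_pos by (simp add: mult_left_mono)
  also have "\<dots> = 9 / 2 * real (card I) * e" using card_pos by (simp add: c_square)
  also have "\<dots> \<le> 5 * real (card I) * e"
  proof -
    obtain i where "i \<in> I" using I by blast
    then have "0 \<le> e" using x[of i i] norm_ge_zero[of "P i * x * P i"] by linarith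
    then show ?thesis using card_pos by (intro mult_right_mono) auto
  qed
  finally show ?thesis .
qed

lemma L_adj_vector_le:
  assumes v: "\<And>i. i \<in> I \<Longrightarrow> norm (ap (P i) v) \<le> e"
  shows "norm (ap (L\<^sup>\<star>) v) \<le> 3 * real (card I) * e"
proof -
  have le: "norm (ap ((g i)\<^sup>\<star>) v) \<le> 3 * e" if i: "i \<in> I" for i
  proof -
    have "ap ((g i)\<^sup>\<star>) v = ap ((g i)\<^sup>\<star>) (ap (P i) v)" using g_adj_P[OF i] by (metis ap_mult)
    then have "norm (ap ((g i)\<^sup>\<star>) v) \<le> norm ((g i)\<^sup>\<star>) * norm (ap (P i) v)" using norm_ap by metis
    also have "\<dots> \<le> 3 * e" using norm_g[OF i] v[OF i] by (intro mult_mono) auto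
    finally show ?thesis .
  qed
  have c1: "c \<le> 1"
    using card_pos I by (simp add: c_def real_le_rsqrt divide_le_eq_1)
  have "norm (\<Sum>i\<in>I. ap ((g i)\<^sup>\<star>) v) \<le> (\<Sum>i\<in>I. 3 * e)" by (intro sum_norm_le le)
  then have "norm (\<Sum>i\<in>I. ap ((g i)\<^sup>\<star>) v) \<le> 3 * real (card I) * e" by (simp add: mult.assoc)
  moreover have "norm (ap (L\<^sup>\<star>) v) \<le> 1 * norm (\<Sum>i\<in>I. ap ((g i)\<^sup>\<star>) v)"
    unfolding L_def using c1 c_pos by (simp add: adj_sum ap_sum mult_left_le_one_le)
  ultimately show ?thesis by simp
qed

end

section \<open>Choice of the vector and of the unitaries\<close>

locale php = gns_faithful A \<tau> for A :: "'h::complex_hilbert cop set" and \<tau> +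
  fixes B :: "'h cop set"
  assumes B: "star_subalgebra B" and BA: "B \<subseteq> A"
    and php: "finite F \<Longrightarrow> F \<subseteq> {x \<in> A. \<tau> x = 0} \<Longrightarrow> 0 < (e::real) \<Longrightarrow>
      \<exists>u P Q. (\<forall>i\<in>{1..n}. u i \<in> B) \<and> shift_family {1..n} u P Q \<and>
        (\<forall>x\<in>F. \<forall>i\<in>{1..n}. \<forall>j\<in>{1..n}. norm (P i * x * P j) < e)"
begin

text \<open>\<open>None\<close> is a placeholder for the approximate semicircular element, so that
  the same word can be evaluated at all candidates for it.\<close>

definition word_prod :: "'h cop \<Rightarrow> 'h cop option list \<Rightarrow> 'h cop" where
  "word_prod s w = prod_list (map (case_option s id) w)"

lemma word_prod_simps [simp]: "word_prod s [] = 1" "word_prod s (None # w) = s * word_prod s w"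
  "word_prod s (Some x # w) = x * word_prod s w"
  by (simp_all add: word_prod_def)

lemma word_prod_A: "s \<in> A \<Longrightarrow> set w \<subseteq> insert None (Some ` A) \<Longrightarrow> word_prod s w \<in> A"
  by (induction w) (auto intro: A_intros)

lemma one_neq_zero: "(1 :: 'h cop) \<noteq> 0"
  using \<tau>_one \<tau>_csc[OF A_intros(6), of 0] by auto

text \<open>A single unitary is enough: every unit vector fixed by \<open>P 1\<close> works, because
  the corner of \<open>w\<close> minus its expectation is small. \<open>P 1\<close> is not 0, since
  otherwise \<open>Q 1\<close> and then \<open>u 1\<close> would be 0.\<close>

lemma approximate_vector_state:
  assumes W: "finite W" "W \<subseteq> A" and e: "0 < e"
  obtains \<xi> where "norm \<xi> = 1" "\<And>w. w \<in> W \<Longrightarrow> cmod (cinner \<xi> (ap w \<xi>) - \<tau> w) \<le> e"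
proof -
  let ?F = "(\<lambda>w. w - \<tau> w *\<^sub>C 1) ` W"
  have "?F \<subseteq> {x \<in> A. \<tau> x = 0}" using W by (auto simp: \<tau>_diff \<tau>_csc \<tau>_one A_intros)
  from php[OF finite_imageI[OF W(1)] this e, of 1]
  obtain u P Q where f: "shift_family {1..1} u P Q" and
    le: "\<forall>x\<in>?F. \<forall>i\<in>{1..1}. \<forall>j\<in>{1..1}. norm (P i * x * P j) < e" by (elim exE conjE)
  interpret shift "{1..1}" u P Q by unfold_locales (use f in auto)
  have i: "1 \<in> {1..1::nat}" by simp
  have "P 1 \<noteq> 0"
  proof
    assume P: "P 1 = 0"
    then have "Q 1 = 0" using PQ[OF i] by simp
    then have "u 1 = 0" using Qu[OF i] P by simp
    then show False using uu(1)[OF i] one_neq_zero by simp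
  qed
  then obtain x where x: "ap (P 1) x \<noteq> 0" by (metis cop_eqI ap_zero)
  define p where "p = P 1"
  have pp: "p * p = p" "p\<^sup>\<star> = p" using PP[OF i] by (simp_all add: p_def)
  have le': "norm (p * y * p) < e" if "y \<in> ?F" for y
    using bspec[OF bspec[OF bspec[OF le that] i] i] by (simp only: p_def)
  define \<xi> where "\<xi> = scaleR (inverse (norm (ap p x))) (ap p x)"
  have n: "norm \<xi> = 1" using x by (simp add: \<xi>_def p_def)
  have "ap p (ap p x) = ap p x" using pp(1) by (metis ap_mult)
  then have P\<xi>: "ap p \<xi> = \<xi>" by (simp add: \<xi>_def)
  have "cmod (cinner \<xi> (ap w \<xi>) - \<tau> w) \<le> e" if w: "w \<in> W" for w
  proof -
    let ?T = "p * (w - \<tau> w *\<^sub>C 1) * p"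
    have "cinner \<xi> (ap ?T \<xi>) = cinner \<xi> (ap p (ap (w - \<tau> w *\<^sub>C 1) \<xi>))" by (simp only: ap_mult P\<xi>)
    also have "\<dots> = cinner (ap p \<xi>) (ap (w - \<tau> w *\<^sub>C 1) \<xi>)"
      using cinner_adj[of p \<xi> "ap (w - \<tau> w *\<^sub>C 1) \<xi>"] by (simp only: pp(2))
    also have "\<dots> = cinner \<xi> (ap w \<xi>) - \<tau> w"
      by (simp add: P\<xi> cinner_diff_right cinner_scaleC_right cinner_self n)
    finally have "cmod (cinner \<xi> (ap w \<xi>) - \<tau> w) \<le> norm \<xi> * (norm ?T * norm \<xi>)"
      using cinner_norm_le[of \<xi> "ap ?T \<xi>"] mult_left_mono[OF norm_ap[of ?T \<xi>], of "norm \<xi>"] by simp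
    also have "\<dots> \<le> e" using le'[of "w - \<tau> w *\<^sub>C 1"] w n by simp
    finally show ?thesis .
  qed
  with n show ?thesis by (rule that)
qed

text \<open>A Chebyshev count: by Bessel, for each \<open>x\<close> at most
  \<open>M\<^sup>2 / d\<^sup>2\<close> components can exceed \<open>d\<close>. The bound does not
  depend on the size of \<open>I\<close>.\<close>

lemma few_large_components:
  assumes P: "orthogonal_projections I P" and I: "finite I" and F: "finite F" and d: "0 < d"
    and x: "\<And>x. x \<in> F \<Longrightarrow> norm (ap x \<xi>) \<le> M"
  shows "real (card {i \<in> I. \<exists>x\<in>F. d < norm (ap (P i) (ap x \<xi>))}) \<le> real (card F) * (M\<^sup>2 / d\<^sup>2)"
proof -
  have one: "real (card {i \<in> I. d < norm (ap (P i) (ap x \<xi>))}) \<le> M\<^sup>2 / d\<^sup>2" if xF: "x \<in> F" for x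
  proof -
    let ?J = "{i \<in> I. d < norm (ap (P i) (ap x \<xi>))}"
    have "real (card ?J) * d\<^sup>2 = (\<Sum>i\<in>?J. d\<^sup>2)" by simp
    also have "\<dots> \<le> (\<Sum>i\<in>?J. (norm (ap (P i) (ap x \<xi>)))\<^sup>2)"
      using d by (intro sum_mono power_mono) auto
    also have "\<dots> \<le> (\<Sum>i\<in>I. (norm (ap (P i) (ap x \<xi>)))\<^sup>2)" using I by (intro sum_mono2) auto
    also have "\<dots> \<le> (norm (ap x \<xi>))\<^sup>2" by (rule orthogonal_projections_Bessel[OF P I])
    also have "\<dots> \<le> M\<^sup>2" by (intro power_mono x xF) simp
    finally show ?thesis using d by (simp add: pos_le_divide_eq)
  qed
  have "{i \<in> I. \<exists>x\<in>F. d < norm (ap (P i) (ap x \<xi>))} = (\<Union>x\<in>F. {i \<in> I. d < norm (ap (P i) (ap x \<xi>))})" by auto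
  then have "card {i \<in> I. \<exists>x\<in>F. d < norm (ap (P i) (ap x \<xi>))} \<le> (\<Sum>x\<in>F. card {i \<in> I. d < norm (ap (P i) (ap x \<xi>))})"
    using card_UN_le[OF F] by simp
  then have "real (card {i \<in> I. \<exists>x\<in>F. d < norm (ap (P i) (ap x \<xi>))}) \<le> (\<Sum>x\<in>F. real (card {i \<in> I. d < norm (ap (P i) (ap x \<xi>))}))"
    by (simp flip: of_nat_sum)
  also have "\<dots> \<le> (\<Sum>x\<in>F. M\<^sup>2 / d\<^sup>2)" by (intro sum_mono one)
  finally show ?thesis by simp
qed

text \<open>The bounds 6 and 2 do not depend on the data, which makes the resulting families
  bounded. The last clause compares with \<open>\<tau>\<close> on words, because the limit state has
  to agree with the ultrapower state there.\<close>

definition approx_fock :: "'h cop set \<Rightarrow> nat \<Rightarrow> real \<Rightarrow> 'h cop \<Rightarrow> 'h cop \<Rightarrow> 'h \<Rightarrow> bool" where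
  "approx_fock F k e s L \<xi> \<longleftrightarrow> s \<in> B \<and> s\<^sup>\<star> = s \<and> norm s \<le> 6 \<and> norm L \<le> 2 \<and> norm \<xi> = 1 \<and>
     norm (s - (L + L\<^sup>\<star>)) \<le> e \<and>
     (\<forall>x\<in>F. norm (L\<^sup>\<star> * (x * L) - \<tau> x *\<^sub>C 1) \<le> e) \<and>
     (\<forall>x\<in>F. norm (ap (L\<^sup>\<star> * x) \<xi>) \<le> e) \<and>
     (\<forall>w. set w \<subseteq> insert None (Some ` F) \<and> length w \<le> k \<longrightarrow>
        cmod (cinner \<xi> (ap (word_prod s w) \<xi>) - \<tau> (word_prod s w)) \<le> e)"

text \<open>
  The word states must be approximated before the vector is known, so the first application of
  the PHP property produces many more unitaries than needed; the vector then selects \<open>n\<close> of them.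
\<close>

lemma approx_fock_exists:
  assumes F: "finite F" "F \<subseteq> A" and e: "0 < e"
  shows "\<exists>s L \<xi>. approx_fock F k e s L \<xi>"
proof -
  define M where "M = 1 + (\<Sum>x\<in>F. norm x)"
  have M1: "1 \<le> M" by (simp add: M_def sum_nonneg)
  have xM: "norm x \<le> M" if "x \<in> F" for x
    using member_le_sum[OF that, of norm] F that by (simp add: M_def)
  \<comment> \<open>The first threshold gives \<open>2 * c \<le> e\<close>, where
    \<open>(2 * c)\<^sup>2 = 2 / n\<close>; the second gives
    \<open>M * (3 / (2 * n)) \<le> e / 2\<close>, the effect of the isometry defect on
    scalars.\<close>
  obtain n0 :: nat where n0: "4 / e\<^sup>2 + 3 * M / e + 1 < real n0" using reals_Archimedean2 by blast
  define n where "n = Suc n0"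
  have "0 \<le> 3 * M / e" "0 \<le> 4 / e\<^sup>2" using e M1 by simp_all
  then have n: "1 \<le> n" "4 / e\<^sup>2 < real n" "3 * M / e < real n"
    using n0 unfolding n_def of_nat_Suc by linarith+
  \<comment> \<open>Chosen to undo the losses \<open>5 * n\<close> in \<open>L_compress_le\<close>,
    with half of \<open>e\<close> as target, and, for \<open>d\<close>, the loss
    \<open>3 * n\<close> in \<open>L_adj_vector_le\<close>.\<close>
  define \<epsilon> where "\<epsilon> = e / (10 * real n)"
  define d where "d = e / (3 * real n)"
  have pos: "0 < \<epsilon>" "0 < d" and dn: "3 * real n * d = e" using e n by (auto simp: \<epsilon>_def d_def)
  \<comment> \<open>\<open>K\<close> bounds the number of indices that the vector, still unknown,
    may spoil. It is independent of \<open>N\<close>, so \<open>n\<close> usable indices remain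
    among \<open>n + K\<close>.\<close>
  obtain K :: nat where K: "real (card F) * (M\<^sup>2 / d\<^sup>2) \<le> real K" using real_arch_simple by blast
  define N where "N = n + K"
  let ?F0 = "(\<lambda>w. w - \<tau> w *\<^sub>C 1) ` F"
  have "?F0 \<subseteq> {x \<in> A. \<tau> x = 0}" using F by (auto simp: \<tau>_diff \<tau>_csc \<tau>_one A_intros)
  from php[OF finite_imageI[OF F(1)] this pos(1), of N]
  obtain u P Q where uB: "\<forall>i\<in>{1..N}. u i \<in> B" and fam: "shift_family {1..N} u P Q" and
    le: "\<forall>x\<in>?F0. \<forall>i\<in>{1..N}. \<forall>j\<in>{1..N}. norm (P i * x * P j) < \<epsilon>" by (elim exE conjE)
  define S where "S J = shift.s J u" for J
  have sh: "shift J u P Q" if "J \<subseteq> {1..N}" "card J = n" for J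
  proof
    show "finite J" using that finite_subset by blast
    show "J \<noteq> {}" using that n by auto
    show "shift_family J u P Q" by (rule shift_family_subset[OF fam that(1)])
  qed
  have SB: "S J \<in> B" if "J \<subseteq> {1..N}" "card J = n" for J
  proof -
    interpret shift J u P Q by (rule sh[OF that])
    show ?thesis unfolding S_def s_def
      using uB that by (intro subalg_scaleR[OF B] subalg_sum[OF B] subalg_add[OF B] subalg_adj[OF B]) auto
  qed
  \<comment> \<open>All words are included for all possible choices \<open>J\<close>; the set is
    finite, so one vector serves whichever \<open>J\<close> is selected afterwards.\<close>
  define W where "W = (\<lambda>(J, w). word_prod (S J) w) ` ({J. J \<subseteq> {1..N} \<and> card J = n} \<times>
      {w. set w \<subseteq> insert None (Some ` F) \<and> length w \<le> k})"
  have "finite W" unfolding W_def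
    by (intro finite_imageI finite_cartesian_product finite_lists_length_le) (use F in auto)
  moreover have "W \<subseteq> A"
  proof
    fix y assume "y \<in> W"
    then obtain J w where Jw: "J \<subseteq> {1..N}" "card J = n" "set w \<subseteq> insert None (Some ` F)" "y = word_prod (S J) w"
      by (auto simp: W_def)
    have "set w \<subseteq> insert None (Some ` A)" using Jw(3) F(2) by (meson image_mono insert_mono order_trans)
    then show "y \<in> A" unfolding Jw(4) using SB[OF Jw(1,2)] BA by (intro word_prod_A) auto
  qed
  ultimately obtain \<xi> where \<xi>: "norm \<xi> = 1" "\<And>w. w \<in> W \<Longrightarrow> cmod (cinner \<xi> (ap w \<xi>) - \<tau> w) \<le> e"
    using approximate_vector_state[OF _ _ e] by blast
  define bad where "bad = {i \<in> {1..N}. \<exists>x\<in>F. d < norm (ap (P i) (ap x \<xi>))}"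
  have "real (card bad) \<le> real (card F) * (M\<^sup>2 / d\<^sup>2)"
    unfolding bad_def
  proof (rule few_large_components[OF _ _ F(1) pos(2)])
    show "orthogonal_projections {1..N} P" using fam by (simp add: shift_family_def)
    show "norm (ap x \<xi>) \<le> M" if "x \<in> F" for x
      using order_trans[OF norm_ap[of x \<xi>]] xM[OF that] unfolding \<xi>(1) mult_1_right by blast
    show "finite {1..N}" by simp
  qed
  then have "card bad \<le> K" using K by linarith
  moreover have "card ({1..N} - bad) = N - card bad"
  proof -
    have "bad \<subseteq> {1..N}" unfolding bad_def by (rule Collect_restrict)
    then show ?thesis using finite_subset[OF \<open>bad \<subseteq> {1..N}\<close>] by (simp add: card_Diff_subset)
  qed
  ultimately have "n \<le> card ({1..N} - bad)" by (simp add: N_def)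
  then obtain J where J: "J \<subseteq> {1..N} - bad" "card J = n" by (rule obtain_subset_with_card_n)
  then have J': "J \<subseteq> {1..N}" by auto
  interpret shift J u P Q by (rule sh[OF J' J(2)])
  have sS: "s = S J" by (simp add: S_def)
  have c2: "(2 * c)\<^sup>2 = 2 / real n"
    unfolding power_mult_distrib power2_eq_square[of c] c_square J(2) by simp
  have "4 < real n * e\<^sup>2" using n(2) e by (simp add: pos_divide_less_eq)
  then have "(2 * c)\<^sup>2 \<le> e\<^sup>2" unfolding c2 using n(1) by (simp add: pos_divide_le_eq mult.commute)
  then have c_e: "2 * c \<le> e" by (rule power2_le_imp_le) (use e in simp)
  have "(2 * c)\<^sup>2 \<le> 2\<^sup>2" unfolding c2 using n(1) by (simp add: pos_divide_le_eq)
  then have c_1: "2 * c \<le> 2" by (rule power2_le_imp_le) simp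
  have LL: "norm (L\<^sup>\<star> * L - 1) \<le> 3 / (2 * real n)" using L_isometry by (simp add: J)
  have "(norm L)\<^sup>2 \<le> norm (L\<^sup>\<star> * L - 1) + norm (1 :: 'h cop)"
    using norm_triangle_ineq[of "L\<^sup>\<star> * L - 1" 1] by (simp add: norm_adj_mult)
  also have "\<dots> \<le> 2 + 1"
  proof -
    have "3 / (2 * real n) \<le> 2" using n by (simp add: field_simps)
    then show ?thesis using LL norm_one_le[where 'a = "'h cop"] by linarith
  qed
  finally have "(norm L)\<^sup>2 \<le> 2\<^sup>2" by simp
  then have L2: "norm L \<le> 2" by (rule power2_le_imp_le) simp
  have s_e: "norm (s - (L + L\<^sup>\<star>)) \<le> e" using s_close c_e by linarith
  have "s = (s - (L + L\<^sup>\<star>)) + L + L\<^sup>\<star>" by simp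
  then have "norm s \<le> norm (s - (L + L\<^sup>\<star>)) + norm L + norm (L\<^sup>\<star>)"
    using norm_triangle_ineq[of "(s - (L + L\<^sup>\<star>)) + L" "L\<^sup>\<star>"] norm_triangle_ineq[of "s - (L + L\<^sup>\<star>)" L] by simp
  also have "\<dots> \<le> 2 + 2 + 2" using s_close c_1 L2 by (intro add_mono) auto
  finally have s6: "norm s \<le> 6" by simp
  have comp: "norm (L\<^sup>\<star> * (x * L) - \<tau> x *\<^sub>C 1) \<le> e" if x: "x \<in> F" for x
  proof -
    have "norm (L\<^sup>\<star> * ((x - \<tau> x *\<^sub>C 1) * L)) \<le> 5 * real (card J) * \<epsilon>"
    proof (rule L_compress_le)
      fix i j assume "i \<in> J" "j \<in> J"
      then have "i \<in> {1..N}" "j \<in> {1..N}" "x - \<tau> x *\<^sub>C 1 \<in> ?F0" using J' x by auto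
      then show "norm (P i * (x - \<tau> x *\<^sub>C 1) * P j) \<le> \<epsilon>" using le less_imp_le by blast
    qed
    then have 1: "norm (L\<^sup>\<star> * ((x - \<tau> x *\<^sub>C 1) * L)) \<le> e / 2" using n by (simp add: J \<epsilon>_def)
    have "norm (\<tau> x *\<^sub>C (L\<^sup>\<star> * L - 1)) \<le> M * (3 / (2 * real n))"
      using \<tau>_le_norm[of x] xM[OF x] F(2) x LL M1 unfolding norm_csc by (intro mult_mono) auto
    also have "\<dots> \<le> e / 2" using n e by (simp add: field_simps)
    finally have 2: "norm (\<tau> x *\<^sub>C (L\<^sup>\<star> * L - 1)) \<le> e / 2" .
    have "L\<^sup>\<star> * (x * L) - \<tau> x *\<^sub>C 1 = L\<^sup>\<star> * ((x - \<tau> x *\<^sub>C 1) * L) + \<tau> x *\<^sub>C (L\<^sup>\<star> * L - 1)"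
      by (simp add: algebra_simps csc_diff_right)
    then show ?thesis using 1 2 norm_triangle_ineq[of "L\<^sup>\<star> * ((x - \<tau> x *\<^sub>C 1) * L)" "\<tau> x *\<^sub>C (L\<^sup>\<star> * L - 1)"] by simp
  qed
  have vac: "norm (ap (L\<^sup>\<star> * x) \<xi>) \<le> e" if x: "x \<in> F" for x
  proof -
    have "norm (ap (L\<^sup>\<star>) (ap x \<xi>)) \<le> 3 * real (card J) * d"
    proof (rule L_adj_vector_le)
      fix i assume "i \<in> J"
      then have "i \<in> {1..N}" "i \<notin> bad" using J by auto
      then show "norm (ap (P i) (ap x \<xi>)) \<le> d" using x by (auto simp: bad_def not_less)
    qed
    then show ?thesis by (simp add: J dn)
  qed
  have "cmod (cinner \<xi> (ap (word_prod s w) \<xi>) - \<tau> (word_prod s w)) \<le> e"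
    if "set w \<subseteq> insert None (Some ` F)" "length w \<le> k" for w
  proof (rule \<xi>(2))
    show "word_prod s w \<in> W"
      unfolding W_def by (rule image_eqI[of _ _ "(J, w)"]) (use that J' J(2) sS in simp_all)
  qed
  moreover have "s \<in> B" using SB[OF J' J(2)] by (simp only: sS)
  ultimately have "approx_fock F k e s L \<xi>"
    unfolding approx_fock_def using s_adj s6 L2 \<xi>(1) s_e comp vac by simp
  then show ?thesis by (intro exI)
qed

end

section \<open>The limit of the approximate creation operators\<close>

context php begin

lemmas subalgebra_A = A

text \<open>An index may carry an infinite set; such indices are neglected by \<open>omega\<close>
  and receive no letters. The indices are built from the original carrier type, as
  \<open>selfless_inclusion\<close> demands.\<close>

definition letters :: "('h \<Rightarrow>\<^sub>L 'h) index \<Rightarrow> 'h cop set" where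
  "letters i = (if finite (fst i) then A \<inter> blinfun_of_cop -` fst i else {})"

lemma letters_A: "finite (letters i)" "letters i \<subseteq> A"
proof -
  have "inj blinfun_of_cop" by (simp add: inj_def blinfun_of_cop_inject)
  then show "finite (letters i)" by (auto simp: letters_def intro: finite_vimageI)
qed (auto simp: letters_def)

definition approx :: "('h \<Rightarrow>\<^sub>L 'h) index \<Rightarrow> 'h cop \<times> 'h cop \<times> 'h" where
  "approx i = (SOME (s, L, \<xi>). approx_fock (letters i) (snd i) (1 / (real (snd i) + 1)) s L \<xi>)"

definition aS :: "('h \<Rightarrow>\<^sub>L 'h) index \<Rightarrow> 'h cop" where "aS i = fst (approx i)"
definition aL :: "('h \<Rightarrow>\<^sub>L 'h) index \<Rightarrow> 'h cop" where "aL i = fst (snd (approx i))"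
definition vac :: "('h \<Rightarrow>\<^sub>L 'h) index \<Rightarrow> 'h" where "vac i = snd (snd (approx i))"

lemma approx: "approx_fock (letters i) (snd i) (1 / (real (snd i) + 1)) (aS i) (aL i) (vac i)"
proof -
  obtain s L \<xi> where "approx_fock (letters i) (snd i) (1 / (real (snd i) + 1)) s L \<xi>"
    using approx_fock_exists[OF letters_A, of "1 / (real (snd i) + 1)" i "snd i"] by auto
  then have "case (s, L, \<xi>) of (s, L, \<xi>) \<Rightarrow> approx_fock (letters i) (snd i) (1 / (real (snd i) + 1)) s L \<xi>" by simp
  from someI[of "\<lambda>(s, L, \<xi>). approx_fock (letters i) (snd i) (1 / (real (snd i) + 1)) s L \<xi>", OF this]
  show ?thesis by (simp add: approx_def aS_def aL_def vac_def case_prod_unfold)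
qed

lemma aS_B: "aS i \<in> B" and norm_aS: "norm (aS i) \<le> 6"
  and norm_aL: "norm (aL i) \<le> 2" and norm_vac: "norm (vac i) = 1"
  and aS_close: "norm (aS i - (aL i + (aL i)\<^sup>\<star>)) \<le> 1 / (real (snd i) + 1)"
  and aL_compress: "x \<in> letters i \<Longrightarrow> norm ((aL i)\<^sup>\<star> * (x * aL i) - \<tau> x *\<^sub>C 1) \<le> 1 / (real (snd i) + 1)"
  and aL_vac: "x \<in> letters i \<Longrightarrow> norm (ap ((aL i)\<^sup>\<star> * x) (vac i)) \<le> 1 / (real (snd i) + 1)"
  and word_vac: "set w \<subseteq> insert None (Some ` letters i) \<Longrightarrow> length w \<le> snd i \<Longrightarrow>
    cmod (cinner (vac i) (ap (word_prod (aS i) w) (vac i)) - \<tau> (word_prod (aS i) w)) \<le> 1 / (real (snd i) + 1)"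
  using approx[of i] unfolding approx_fock_def by blast+

lemma aS_A: "aS i \<in> A" using aS_B BA by blast

lemma bd_aS [simp]: "bd aS" and bd_aL [simp]: "bd aL"
  by (rule bdI[OF norm_aS] bdI[OF norm_aL])+

definition UL :: "('h \<Rightarrow>\<^sub>L 'h, 'h cop) ultra" where "UL = uabs aL"

definition diagonal :: "'h cop \<Rightarrow> ('h \<Rightarrow>\<^sub>L 'h, 'h cop) ultra" where "diagonal a = uabs (\<lambda>_. a)"

lemma letters_eventually: "finite G \<Longrightarrow> G \<subseteq> A \<Longrightarrow> i \<in> index_cone (blinfun_of_cop ` G) k \<Longrightarrow> G \<subseteq> letters i"
  by (auto simp: index_cone_def letters_def)

text \<open>Every approximation property is available as soon as the letters of the index contain a
  given finite set, and this happens eventually.\<close>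

lemma null_of_letters:
  fixes f :: "('h \<Rightarrow>\<^sub>L 'h) index \<Rightarrow> real"
  assumes G: "finite G" "G \<subseteq> A" and le: "\<And>i. G \<subseteq> letters i \<Longrightarrow> k \<le> snd i \<Longrightarrow> \<bar>f i\<bar> \<le> 1 / (real (snd i) + 1)"
  shows "(f \<longlongrightarrow> 0) omega"
proof (rule omega_tendsto_0[where G = "blinfun_of_cop ` G" and k = k and C = 1])
  fix i assume i: "i \<in> index_cone (blinfun_of_cop ` G) k"
  show "\<bar>f i\<bar> \<le> 1 / (real (snd i) + 1)"
    by (rule le[OF letters_eventually[OF G i]]) (use i in \<open>auto simp: index_cone_def\<close>)
qed (use G in simp)

lemma S_eq: "uabs aS = UL + UL\<^sup>\<star>"
  unfolding UL_def uabs_adj[OF bd_aL] uabs_plus[OF bd_aL bd_adj[OF bd_aL]]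
proof (subst uabs_eq_iff)
  show "((\<lambda>i. norm (aS i - (aL i + (aL i)\<^sup>\<star>))) \<longlongrightarrow> 0) omega"
    by (rule null_of_letters[where G = "{}" and k = 0]) (simp_all add: aS_close)
qed (simp_all add: bd_add bd_adj)

lemma diagonal_ops:
  "diagonal (a + b) = diagonal a + diagonal b" "diagonal (a * b) = diagonal a * diagonal b"
  "diagonal (c *\<^sub>C a) = c *\<^sub>C diagonal a" "diagonal (a\<^sup>\<star>) = (diagonal a)\<^sup>\<star>" "diagonal 1 = 1" "diagonal 0 = 0"
  by (simp_all add: diagonal_def uabs_ops)

lemma norm_diagonal: "norm (diagonal a) = norm a"
  unfolding diagonal_def by (rule uabs_norm_eq) simp_all

lemma diagonal_inj: "diagonal a = diagonal b \<longleftrightarrow> a = b"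
proof -
  have "diagonal a = diagonal b \<longleftrightarrow> norm (diagonal a - diagonal b) = 0" by simp
  also have "diagonal a - diagonal b = diagonal (a - b)" by (simp add: diagonal_def uabs_diff)
  finally show ?thesis by (simp add: norm_diagonal)
qed

lemma compress_UL: assumes x: "x \<in> A" shows "UL\<^sup>\<star> * (diagonal x * UL) = \<tau> x *\<^sub>C 1"
  unfolding UL_def diagonal_def
    uabs_adj[OF bd_aL] uabs_times[OF bd_const bd_aL] uabs_times[OF bd_adj[OF bd_aL] bd_mult[OF bd_const bd_aL]]
    one_ultra_def uabs_csc[OF bd_const]
proof (subst uabs_eq_iff)
  show "((\<lambda>i. norm ((aL i)\<^sup>\<star> * (x * aL i) - \<tau> x *\<^sub>C 1)) \<longlongrightarrow> 0) omega"
    by (rule null_of_letters[where G = "{x}" and k = 0]) (simp_all add: aL_compress x)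
qed (simp_all add: bd_mult bd_adj)

text \<open>The limit of vector states, not of \<open>\<tau>\<close>: it has to be defined on
  \<open>UL\<close> too, which is not assumed to lie in the ultrapower of \<open>A\<close>.\<close>

definition \<Phi> :: "('h \<Rightarrow>\<^sub>L 'h, 'h cop) ultra \<Rightarrow> complex" where
  "\<Phi> u = (THE l. ((\<lambda>i. cinner (vac i) (ap (urep u i) (vac i))) \<longlongrightarrow> l) omega)"

lemma vac_le: "cmod (cinner (vac i) (ap x (vac i))) \<le> norm x"
  using order_trans[OF cinner_norm_le mult_left_mono[OF norm_ap norm_ge_zero]] by (metis mult_1 mult_1_right norm_vac)

lemma tendsto_\<Phi>: assumes f: "bd f"
  shows "((\<lambda>i. cinner (vac i) (ap (f i) (vac i))) \<longlongrightarrow> \<Phi> (uabs f)) omega"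
proof -
  let ?g = "urep (uabs f)"
  obtain K where K: "\<And>i. norm (?g i) \<le> K" using bd_urep[of "uabs f"] unfolding bd_def by blast
  have "bounded (range (\<lambda>i. cinner (vac i) (ap (?g i) (vac i))))"
    unfolding bounded_iff using order_trans[OF vac_le K] by blast
  then obtain l where l: "((\<lambda>i. cinner (vac i) (ap (?g i) (vac i))) \<longlongrightarrow> l) omega"
    using omega_convergent by blast
  then have "\<Phi> (uabs f) = l"
    unfolding \<Phi>_def using tendsto_unique[OF omega_not_bot] by (intro the_equality) auto
  moreover have "((\<lambda>i. cinner (vac i) (ap (f i) (vac i)) - cinner (vac i) (ap (?g i) (vac i))) \<longlongrightarrow> 0) omega"
  proof (rule Lim_null_comparison[OF always_eventually urep_uabs[OF f]], rule allI)
    fix i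
    have "cinner (vac i) (ap (f i) (vac i)) - cinner (vac i) (ap (?g i) (vac i)) = cinner (vac i) (ap (f i - ?g i) (vac i))"
      by (simp add: cinner_diff_right)
    then show "norm (cinner (vac i) (ap (f i) (vac i)) - cinner (vac i) (ap (?g i) (vac i))) \<le> norm (?g i - f i)"
      using vac_le[of i "f i - ?g i"] by (simp add: norm_minus_commute)
  qed
  from tendsto_add[OF this l] have "((\<lambda>i. cinner (vac i) (ap (f i) (vac i))) \<longlongrightarrow> l) omega" by simp
  ultimately show ?thesis by simp
qed

lemma \<Phi>_eqI: "bd f \<Longrightarrow> ((\<lambda>i. cinner (vac i) (ap (f i) (vac i))) \<longlongrightarrow> l) omega \<Longrightarrow> \<Phi> (uabs f) = l"
  using tendsto_unique[OF omega_not_bot tendsto_\<Phi>] by blast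

lemma tendsto_norm_vac: assumes f: "bd f"
  shows "((\<lambda>i. (norm (ap (f i) (vac i)))\<^sup>2) \<longlongrightarrow> Re (\<Phi> ((uabs f)\<^sup>\<star> * uabs f))) omega"
proof -
  have "((\<lambda>i. Re (cinner (vac i) (ap ((f i)\<^sup>\<star> * f i) (vac i)))) \<longlongrightarrow> Re (\<Phi> (uabs (\<lambda>i. (f i)\<^sup>\<star> * f i)))) omega"
    by (rule tendsto_Re[OF tendsto_\<Phi>[OF bd_mult[OF bd_adj[OF f] f]]])
  moreover have "Re (cinner (vac i) (ap ((f i)\<^sup>\<star> * f i) (vac i))) = (norm (ap (f i) (vac i)))\<^sup>2" for i
    by (simp add: cinner_adj' cinner_self)
  ultimately show ?thesis by (simp only: uabs_adj[OF f] uabs_times[OF bd_adj[OF f] f])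
qed

lemma state_\<Phi>: "state_on \<Phi>"
proof
  fix x y z :: "('h \<Rightarrow>\<^sub>L 'h, 'h cop) ultra" and c :: complex
  obtain f g h where b: "bd f" "bd g" "bd h" and xyz: "x = uabs f" "y = uabs g" "z = uabs h"
    by (metis ultra_cases)
  show "\<Phi> (x + y) = \<Phi> x + \<Phi> y"
    unfolding xyz uabs_plus[OF b(1,2)]
    by (rule \<Phi>_eqI[OF bd_add[OF b(1,2)]])
      (use tendsto_add[OF tendsto_\<Phi>[OF b(1)] tendsto_\<Phi>[OF b(2)]] in \<open>simp add: cinner_add_right\<close>)
  show "\<Phi> (c *\<^sub>C x) = c * \<Phi> x"
    unfolding xyz uabs_csc[OF b(1)]
    by (rule \<Phi>_eqI[OF bd_csc[OF b(1)]])
      (use tendsto_mult_left[OF tendsto_\<Phi>[OF b(1)], of c] in \<open>simp add: cinner_scaleC_right\<close>)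
  show "\<Phi> (x\<^sup>\<star>) = cnj (\<Phi> x)"
  proof -
    have "cinner (vac i) (ap ((f i)\<^sup>\<star>) (vac i)) = cnj (cinner (vac i) (ap (f i) (vac i)))" for i
      by (metis cinner_adj' cinner_commute)
    then show ?thesis
      unfolding xyz uabs_adj[OF b(1)]
      by (intro \<Phi>_eqI[OF bd_adj[OF b(1)]]) (simp add: tendsto_cnj[OF tendsto_\<Phi>[OF b(1)]])
  qed
  show "0 \<le> Re (\<Phi> (x\<^sup>\<star> * x))"
    unfolding xyz by (rule tendsto_lowerbound[OF tendsto_norm_vac[OF b(1)]]) simp_all
  show "\<Phi> 1 = 1"
    unfolding one_ultra_def by (rule \<Phi>_eqI) (simp_all add: cinner_self norm_vac)
  show "Re (\<Phi> ((y * z)\<^sup>\<star> * (y * z))) \<le> (norm y)\<^sup>2 * Re (\<Phi> (z\<^sup>\<star> * z))"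
    unfolding xyz uabs_times[OF b(2,3)]
  proof (rule tendsto_le[OF omega_not_bot _ tendsto_norm_vac[OF bd_mult[OF b(2,3)]]])
    show "((\<lambda>i. (norm (g i))\<^sup>2 * (norm (ap (h i) (vac i)))\<^sup>2) \<longlongrightarrow>
      (norm (uabs g))\<^sup>2 * Re (\<Phi> ((uabs h)\<^sup>\<star> * uabs h))) omega"
      by (rule tendsto_mult[OF tendsto_power[OF uabs_norm[OF b(2)]] tendsto_norm_vac[OF b(3)]])
    have "(norm (ap (g i * h i) (vac i)))\<^sup>2 \<le> (norm (g i) * norm (ap (h i) (vac i)))\<^sup>2" for i
      by (intro power_mono) (simp_all add: norm_ap)
    then show "\<forall>\<^sub>F i in omega. (norm (ap (g i * h i) (vac i)))\<^sup>2 \<le> (norm (g i))\<^sup>2 * (norm (ap (h i) (vac i)))\<^sup>2"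
      by (simp add: power_mult_distrib)
  qed
qed

sublocale \<Phi>: state_on \<Phi> by (rule state_\<Phi>)

lemma word_prod_bd: "bd (\<lambda>i. word_prod (aS i) w)"
proof (induction w)
  case (Cons x w)
  then show ?case by (cases x) (auto intro: bd_mult)
qed simp

definition uword :: "'h cop option list \<Rightarrow> ('h \<Rightarrow>\<^sub>L 'h, 'h cop) ultra" where
  "uword w = uabs (\<lambda>i. word_prod (aS i) w)"

text \<open>Both the vector states and \<open>\<tau>\<close> converge along a word to the same
  value, since the word falls under \<open>word_vac\<close> once the index contains its letters and
  exceeds its length.\<close>

lemma uword_state:
  assumes w: "set w \<subseteq> insert None (Some ` A)"
  shows "((\<lambda>i. \<tau> (word_prod (aS i) w)) \<longlongrightarrow> \<Phi> (uword w)) omega"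
proof -
  let ?G = "{x. Some x \<in> set w}"
  have G: "finite ?G" "?G \<subseteq> A"
  proof -
    have "finite (Some -` set w)" by (rule finite_vimageI) auto
    then show "finite ?G" by (simp add: vimage_def)
  qed (use w in auto)
  have "((\<lambda>i. cmod (cinner (vac i) (ap (word_prod (aS i) w) (vac i)) - \<tau> (word_prod (aS i) w))) \<longlongrightarrow> 0) omega"
  proof (rule null_of_letters[OF G, where k = "length w"])
    fix i assume i: "?G \<subseteq> letters i" "length w \<le> snd i"
    have "set w \<subseteq> insert None (Some ` letters i)"
    proof
      fix x assume "x \<in> set w"
      then have "y \<in> letters i" if "x = Some y" for y using i(1) that by (simp add: subset_iff)
      then show "x \<in> insert None (Some ` letters i)" by (cases x) simp_all
    qed
    then show "\<bar>cmod (cinner (vac i) (ap (word_prod (aS i) w) (vac i)) - \<tau> (word_prod (aS i) w))\<bar> \<le> 1 / (real (snd i) + 1)"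
      using word_vac i(2) by simp
  qed
  then have "((\<lambda>i. cinner (vac i) (ap (word_prod (aS i) w) (vac i)) - \<tau> (word_prod (aS i) w)) \<longlongrightarrow> 0) omega"
    by (simp add: tendsto_norm_zero_iff)
  from tendsto_diff[OF tendsto_\<Phi>[OF word_prod_bd[of w]] this] show ?thesis by (simp add: uword_def)
qed

lemma \<Phi>_diagonal: "x \<in> A \<Longrightarrow> \<Phi> (diagonal x) = \<tau> x"
  using uword_state[of "[Some x]"] tendsto_unique[OF omega_not_bot _ tendsto_const[of "\<tau> x"]]
  by (simp add: uword_def diagonal_def)

definition DA :: "('h \<Rightarrow>\<^sub>L 'h, 'h cop) ultra set" where "DA = diagonal ` A"

lemma star_subalgebra_DA: "star_subalgebra DA"
  unfolding star_subalgebra_def DA_def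
  using A_intros by (auto simp flip: diagonal_ops)

lemma vacuum_UL: assumes x: "x \<in> A" shows "\<Phi>.hn (UL\<^sup>\<star> * diagonal x) = 0"
proof -
  let ?f = "\<lambda>i. (aL i)\<^sup>\<star> * x"
  have bf: "bd ?f" by (rule bd_mult[OF bd_adj[OF bd_aL] bd_const])
  have eq: "UL\<^sup>\<star> * diagonal x = uabs ?f"
    unfolding UL_def diagonal_def uabs_adj[OF bd_aL] by (rule uabs_times[OF bd_adj[OF bd_aL] bd_const])
  have "((\<lambda>i. norm (ap (?f i) (vac i))) \<longlongrightarrow> 0) omega"
    by (rule null_of_letters[where G = "{x}" and k = 0]) (use aL_vac x in \<open>simp_all del: ap_mult\<close>)
  from tendsto_power[OF this, of 2] have "((\<lambda>i. (norm (ap (?f i) (vac i)))\<^sup>2) \<longlongrightarrow> 0) omega" by simp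
  from tendsto_unique[OF omega_not_bot tendsto_norm_vac[OF bf] this] show ?thesis
    unfolding \<Phi>.hn_def eq by simp
qed

sublocale fock \<Phi> DA UL
proof unfold_locales
  show "star_subalgebra DA" by (rule star_subalgebra_DA)
  show "UL\<^sup>\<star> * (x * UL) = \<Phi> x *\<^sub>C 1" if "x \<in> DA" for x
    using that by (auto simp: DA_def compress_UL \<Phi>_diagonal)
  show "\<Phi>.hn (UL\<^sup>\<star> * x) = 0" if "x \<in> DA" for x
    using that by (auto simp: DA_def vacuum_UL)
  \<comment> \<open>\<open>X\<close> itself may lie outside the ultrapower of \<open>A\<close>, but
    \<open>X\<^sup>\<star> * X\<close> is a constant family \<open>a\<close>. So the claim is
    \<open>gns_isometric\<close> for \<open>a\<close>; here faithfulness of the GNS representation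
    enters.\<close>
  fix X k assume X: "X\<^sup>\<star> * X \<in> DA" and k: "0 \<le> k" and le: "\<And>c. c \<in> DA \<Longrightarrow> \<Phi>.hn (X * c) \<le> k * \<Phi>.hn c"
  obtain a where a: "a \<in> A" "X\<^sup>\<star> * X = diagonal a" using X by (auto simp: DA_def)
  have "diagonal (a\<^sup>\<star>) = diagonal a" by (simp add: diagonal_ops flip: a(2))
  then have asa: "a\<^sup>\<star> = a" by (simp add: diagonal_inj)
  have form: "Re (\<tau> (c\<^sup>\<star> * (a * c))) = (\<Phi>.hn (X * diagonal c))\<^sup>2" if c: "c \<in> A" for c
  proof -
    have "(X * diagonal c)\<^sup>\<star> * (X * diagonal c) = (diagonal c)\<^sup>\<star> * ((X\<^sup>\<star> * X) * diagonal c)"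
      by (simp add: mult.assoc)
    also have "\<dots> = diagonal (c\<^sup>\<star> * (a * c))" by (simp only: a diagonal_ops)
    finally show ?thesis using a c by (simp only: \<Phi>.hn_power2 \<Phi>_diagonal A_intros)
  qed
  have "norm a \<le> k\<^sup>2"
  proof (rule gns_isometric[OF a(1) asa])
    fix c assume c: "c \<in> A"
    show "0 \<le> Re (\<tau> (c\<^sup>\<star> * (a * c)))" by (simp add: form[OF c])
    have "(\<Phi>.hn (X * diagonal c))\<^sup>2 \<le> (k * \<Phi>.hn (diagonal c))\<^sup>2"
      using c by (intro power_mono le) (auto simp: DA_def)
    moreover have "(\<Phi>.hn (diagonal c))\<^sup>2 = Re (\<tau> (c\<^sup>\<star> * c))"
      using c by (simp add: \<Phi>.hn_power2 \<Phi>_diagonal A_intros flip: diagonal_ops)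
    ultimately show "Re (\<tau> (c\<^sup>\<star> * (a * c))) \<le> k\<^sup>2 * Re (\<tau> (c\<^sup>\<star> * c))"
      by (simp add: form[OF c] power_mult_distrib)
  qed simp
  then have "(norm X)\<^sup>2 \<le> k\<^sup>2" using norm_adj_mult[of X] by (simp add: a norm_diagonal)
  then show "norm X \<le> k" using k by (rule power2_le_imp_le)
qed

text \<open>Linear combinations of words come with explicit representatives in \<open>A\<close>
  along which \<open>\<tau>\<close> is known to converge.\<close>

inductive_set wspan :: "('h \<Rightarrow>\<^sub>L 'h, 'h cop) ultra set" where
  wspan_word: "set w \<subseteq> insert None (Some ` A) \<Longrightarrow> uword w \<in> wspan"
| wspan_csc: "x \<in> wspan \<Longrightarrow> c *\<^sub>C x \<in> wspan"
| wspan_add: "x \<in> wspan \<Longrightarrow> y \<in> wspan \<Longrightarrow> x + y \<in> wspan"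

lemma uword_append: "uword (v @ w) = uword v * uword w"
proof -
  have "word_prod (aS i) (v @ w) = word_prod (aS i) v * word_prod (aS i) w" for i by (simp add: word_prod_def)
  then show ?thesis by (simp only: uword_def uabs_times[OF word_prod_bd word_prod_bd])
qed

lemma wspan_mult: "x \<in> wspan \<Longrightarrow> y \<in> wspan \<Longrightarrow> x * y \<in> wspan"
proof (induction rule: wspan.induct)
  case (wspan_word v)
  from wspan_word(2) show ?case
  proof (induction rule: wspan.induct)
    case (wspan_word w)
    then show ?case using \<open>set v \<subseteq> _\<close> wspan.wspan_word[of "v @ w"] by (simp add: uword_append)
  qed (auto simp: distrib_left intro: wspan.wspan_csc wspan.wspan_add)
qed (auto simp: distrib_right intro: wspan.wspan_csc wspan.wspan_add)

lemma gen_wspan: "u \<in> gen \<Longrightarrow> u \<in> wspan"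
proof (induction rule: gen.induct)
  case (gen_A a)
  then obtain x where "x \<in> A" "a = diagonal x" by (auto simp: DA_def)
  then show ?case using wspan_word[of "[Some x]"] by (simp add: uword_def diagonal_def)
next
  case gen_S
  show ?case using wspan_word[of "[None]"] by (simp add: uword_def S_eq)
qed (auto intro: wspan_add wspan_mult)

lemma wspan_state: "u \<in> wspan \<Longrightarrow> \<exists>f. bd f \<and> range f \<subseteq> A \<and> u = uabs f \<and> ((\<lambda>i. \<tau> (f i)) \<longlongrightarrow> \<Phi> u) omega"
proof (induction rule: wspan.induct)
  case (wspan_word w)
  then show ?case using uword_state[OF wspan_word] word_prod_A[OF aS_A wspan_word]
    by (intro exI[of _ "\<lambda>i. word_prod (aS i) w"]) (auto simp: uword_def word_prod_bd)
next
  case (wspan_csc x c)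
  then obtain f where f: "bd f" "range f \<subseteq> A" "x = uabs f" "((\<lambda>i. \<tau> (f i)) \<longlongrightarrow> \<Phi> x) omega" by blast
  have "\<tau> (c *\<^sub>C f i) = c * \<tau> (f i)" for i using f(2) by (intro \<tau>_csc) auto
  then have "((\<lambda>i. \<tau> (c *\<^sub>C f i)) \<longlongrightarrow> \<Phi> (c *\<^sub>C x)) omega" using tendsto_mult_left[OF f(4), of c] by simp
  moreover have "range (\<lambda>i. c *\<^sub>C f i) \<subseteq> A" using f(2) by (auto intro!: A_intros)
  ultimately show ?case using uabs_csc[OF f(1), of c] bd_csc[OF f(1), of c] f(3)
    by (intro exI[of _ "\<lambda>i. c *\<^sub>C f i"]) simp
next
  case (wspan_add x y)
  then obtain f g where f: "bd f" "range f \<subseteq> A" "x = uabs f" "((\<lambda>i. \<tau> (f i)) \<longlongrightarrow> \<Phi> x) omega"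
     and g: "bd g" "range g \<subseteq> A" "y = uabs g" "((\<lambda>i. \<tau> (g i)) \<longlongrightarrow> \<Phi> y) omega" by blast
  have "\<tau> (f i + g i) = \<tau> (f i) + \<tau> (g i)" for i using f(2) g(2) by (intro \<tau>_add) auto
  then have "((\<lambda>i. \<tau> (f i + g i)) \<longlongrightarrow> \<Phi> (x + y)) omega"
    using tendsto_add[OF f(4) g(4)] by (simp add: \<Phi>.\<phi>_add)
  moreover have "range (\<lambda>i. f i + g i) \<subseteq> A" using f(2) g(2) by (auto intro!: A_intros)
  ultimately show ?case using uabs_plus[OF f(1) g(1)] bd_add[OF f(1) g(1)] f(3) g(3)
    by (intro exI[of _ "\<lambda>i. f i + g i"]) simp
qed

text \<open>An arbitrary representative in \<open>A\<close> is eventually close in norm to one from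
  \<open>wspan\<close>, and \<open>\<tau>\<close> is contractive on \<open>A\<close>.\<close>

theorem closure_gen_state:
  assumes u: "uabs f \<in> closure gen" and f: "bd f" "range f \<subseteq> A"
  shows "((\<lambda>i. \<tau> (f i)) \<longlongrightarrow> \<Phi> (uabs f)) omega"
proof (rule tendstoI)
  fix e :: real assume "0 < e"
  then have e: "0 < e / 3" by simp
  then obtain v where v: "v \<in> gen" "norm (uabs f - v) < e / 3"
    using u unfolding closure_approachable by (metis dist_norm norm_minus_commute)
  obtain g where g: "bd g" "range g \<subseteq> A" "v = uabs g" "((\<lambda>i. \<tau> (g i)) \<longlongrightarrow> \<Phi> v) omega"
    using wspan_state[OF gen_wspan[OF v(1)]] by blast
  have "((\<lambda>i. norm (f i - g i)) \<longlongrightarrow> norm (uabs f - v)) omega"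
    unfolding g(3) uabs_diff[OF f(1) g(1)] by (rule uabs_norm[OF bd_diff[OF f(1) g(1)]])
  then have "eventually (\<lambda>i. norm (f i - g i) < e / 3) omega" using v(2) by (rule order_tendstoD(2))
  moreover have "eventually (\<lambda>i. dist (\<tau> (g i)) (\<Phi> v) < e / 3) omega" using g(4) e by (rule tendstoD)
  ultimately show "eventually (\<lambda>i. dist (\<tau> (f i)) (\<Phi> (uabs f)) < e) omega"
  proof eventually_elim
    case (elim i)
    have A: "f i \<in> A" "g i \<in> A" using f g by auto
    then have "dist (\<tau> (f i)) (\<tau> (g i)) < e / 3"
      using \<tau>_le_norm[of "f i - g i"] elim(1) by (simp add: dist_norm A_intros flip: \<tau>_diff)
    moreover have "dist (\<Phi> v) (\<Phi> (uabs f)) < e / 3"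
      using \<Phi>.\<phi>_le_norm[of "uabs f - v"] v(2) by (simp add: dist_norm \<Phi>.\<phi>_diff norm_minus_commute)
    ultimately show ?case
      using elim(2) dist_triangle[of "\<tau> (f i)" "\<Phi> (uabs f)" "\<tau> (g i)"] dist_triangle[of "\<tau> (g i)" "\<Phi> (uabs f)" "\<Phi> v"]
      by linarith
  qed
qed

lemma closure_gen_subset: "closure gen \<subseteq> ultra_set A"
proof (rule closure_minimal[OF _ closed_ultra_set[OF closed_A subalgebra_A]])
  show "gen \<subseteq> ultra_set A"
    using wspan_state[OF gen_wspan] unfolding ultra_set_def by blast
qed

lemma semi_subset: "semi \<subseteq> ultra_set B"
proof
  fix x assume "x \<in> semi"
  then show "x \<in> ultra_set B" unfolding semi_def
  proof (induction rule: fock.gen.induct[OF fock_scalars, consumes 1])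
    case (1 a)
    then show ?case using star_subalgebra_ultra_set[OF B] by (auto intro: subalg_csc subalg_one)
  next
    case 2
    then show ?case unfolding S_eq[symmetric] by (intro ultra_setI aS_B) simp
  next
    case (3 x y)
    then show ?case using star_subalgebra_ultra_set[OF B] by (auto intro: subalg_add)
  next
    case (4 x y)
    then show ?case using star_subalgebra_ultra_set[OF B] by (auto intro: subalg_mult)
  qed
qed

lemma closure_semi_subset: "closed B \<Longrightarrow> closure semi \<subseteq> ultra_set B"
  by (rule closure_minimal[OF semi_subset closed_ultra_set[OF _ B]])

end

section \<open>Records embedded in a C*-algebra type\<close>

text \<open>The bridge between records with carriers and types: laws are verified by applying the
  injective \<open>v\<close> and computing in the type.\<close>

locale star_embedding =
  fixes Q :: "('a, 'm) star_alg_scheme" and v :: "'a \<Rightarrow> 'u::cstar_alg"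
  assumes v_inj: "inj_on v (carrier Q)" and v_subalgebra: "star_subalgebra (v ` carrier Q)"
    and one_closed: "\<one>\<^bsub>Q\<^esub> \<in> carrier Q" and zero_closed: "\<zero>\<^bsub>Q\<^esub> \<in> carrier Q"
    and add_closed: "x \<in> carrier Q \<Longrightarrow> y \<in> carrier Q \<Longrightarrow> x \<oplus>\<^bsub>Q\<^esub> y \<in> carrier Q"
    and mult_closed: "x \<in> carrier Q \<Longrightarrow> y \<in> carrier Q \<Longrightarrow> x \<otimes>\<^bsub>Q\<^esub> y \<in> carrier Q"
    and scl_closed: "x \<in> carrier Q \<Longrightarrow> scl Q c x \<in> carrier Q"
    and str_closed: "x \<in> carrier Q \<Longrightarrow> str Q x \<in> carrier Q"
    and v_one: "v \<one>\<^bsub>Q\<^esub> = 1" and v_zero: "v \<zero>\<^bsub>Q\<^esub> = 0"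
    and v_add: "x \<in> carrier Q \<Longrightarrow> y \<in> carrier Q \<Longrightarrow> v (x \<oplus>\<^bsub>Q\<^esub> y) = v x + v y"
    and v_mult: "x \<in> carrier Q \<Longrightarrow> y \<in> carrier Q \<Longrightarrow> v (x \<otimes>\<^bsub>Q\<^esub> y) = v x * v y"
    and v_scl: "x \<in> carrier Q \<Longrightarrow> v (scl Q c x) = c *\<^sub>C v x"
    and v_str: "x \<in> carrier Q \<Longrightarrow> v (str Q x) = (v x)\<^sup>\<star>"
begin

lemmas closed_rules = one_closed zero_closed add_closed mult_closed scl_closed str_closed
lemmas v_rules = v_one v_zero v_add v_mult v_scl v_str

lemma v_eqI: "x \<in> carrier Q \<Longrightarrow> y \<in> carrier Q \<Longrightarrow> v x = v y \<Longrightarrow> x = y"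
  using v_inj by (rule inj_onD)

lemma ex_uminus: assumes x: "x \<in> carrier Q" obtains y where "y \<in> carrier Q" "v y = - v x"
proof -
  have "v x \<in> v ` carrier Q" using x by simp
  then have "- v x \<in> v ` carrier Q" by (rule subalg_minus[OF v_subalgebra])
  then obtain y where "y \<in> carrier Q" "- v x = v y" by (rule imageE)
  then show ?thesis by (intro that) simp_all
qed

text \<open>\<open>a_inv\<close> is a definite description in the additive monoid of the record;
  injectivity of \<open>v\<close> gives the uniqueness it requires.\<close>

lemma a_inv_ex1: assumes x: "x \<in> carrier Q"
  shows "a_inv Q x \<in> carrier Q \<and> v (a_inv Q x) = - v x"
proof -
  obtain y where y: "y \<in> carrier Q" "v y = - v x" by (rule ex_uminus[OF x])
  have "a_inv Q x = y"
    unfolding a_inv_def m_inv_def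
  proof (rule the_equality)
    show "y \<in> carrier (add_monoid Q) \<and> x \<otimes>\<^bsub>add_monoid Q\<^esub> y = \<one>\<^bsub>add_monoid Q\<^esub> \<and> y \<otimes>\<^bsub>add_monoid Q\<^esub> x = \<one>\<^bsub>add_monoid Q\<^esub>"
      using x y by (auto intro!: v_eqI simp: closed_rules v_rules)
  next
    fix z assume z: "z \<in> carrier (add_monoid Q) \<and> x \<otimes>\<^bsub>add_monoid Q\<^esub> z = \<one>\<^bsub>add_monoid Q\<^esub> \<and> z \<otimes>\<^bsub>add_monoid Q\<^esub> x = \<one>\<^bsub>add_monoid Q\<^esub>"
    then have "v (x \<oplus>\<^bsub>Q\<^esub> z) = v \<zero>\<^bsub>Q\<^esub>" by (intro arg_cong[where f = v]) simp
    then have "v x + v z = 0" using x z v_add[of x z] v_zero by simp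
    then have "v z = v y" using y by (simp add: add_eq_0_iff)
    then show "z = y" using y z by (intro v_eqI) simp_all
  qed
  with y show ?thesis by simp
qed

lemma a_inv_closed: "x \<in> carrier Q \<Longrightarrow> a_inv Q x \<in> carrier Q"
  and v_a_inv: "x \<in> carrier Q \<Longrightarrow> v (a_inv Q x) = - v x"
  by (simp_all add: a_inv_ex1)

lemma a_minus_closed: "x \<in> carrier Q \<Longrightarrow> y \<in> carrier Q \<Longrightarrow> x \<ominus>\<^bsub>Q\<^esub> y \<in> carrier Q"
  and v_a_minus: "x \<in> carrier Q \<Longrightarrow> y \<in> carrier Q \<Longrightarrow> v (x \<ominus>\<^bsub>Q\<^esub> y) = v x - v y"
  by (simp_all add: a_minus_def a_inv_closed v_a_inv closed_rules v_rules)

lemma ring_Q: "ring Q"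
proof (rule ringI)
  show "abelian_group Q"
  proof (rule abelian_groupI)
    fix x assume "x \<in> carrier Q"
    then show "\<exists>y\<in>carrier Q. y \<oplus>\<^bsub>Q\<^esub> x = \<zero>\<^bsub>Q\<^esub>"
      by (intro bexI[of _ "a_inv Q x"] v_eqI) (simp_all add: a_inv_closed v_a_inv closed_rules v_rules)
  qed (auto intro!: v_eqI simp: closed_rules v_rules algebra_simps)
  show "Group.monoid Q"
    by (rule monoidI) (auto intro!: v_eqI simp: closed_rules v_rules mult.assoc)
qed (auto intro!: v_eqI simp: closed_rules v_rules algebra_simps)

lemma subring_vimage:
  assumes V: "star_subalgebra V"
  shows "subring {x \<in> carrier Q. v x \<in> V} Q"
proof (intro subring.intro subgroup.intro submonoid.intro)
  fix x assume x: "x \<in> {x \<in> carrier Q. v x \<in> V}"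
  have "inv\<^bsub>add_monoid Q\<^esub> x = a_inv Q x" by (simp add: a_inv_def)
  then show "inv\<^bsub>add_monoid Q\<^esub> x \<in> {x \<in> carrier Q. v x \<in> V}"
    using x by (simp add: a_inv_closed v_a_inv subalg_minus[OF V])
qed (auto simp: closed_rules v_rules subalg_add[OF V] subalg_mult[OF V] subalg_one[OF V] subalg_zero[OF V])

lemma restrict: assumes V: "star_subalgebra V" "V \<subseteq> v ` carrier Q"
  shows "star_embedding (Q\<lparr>carrier := {x \<in> carrier Q. v x \<in> V}\<rparr>) v"
proof unfold_locales
  have "v ` {x \<in> carrier Q. v x \<in> V} = V" using V(2) by auto
  then show "star_subalgebra (v ` carrier (Q\<lparr>carrier := {x \<in> carrier Q. v x \<in> V}\<rparr>))" using V(1) by simp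
  show "inj_on v (carrier (Q\<lparr>carrier := {x \<in> carrier Q. v x \<in> V}\<rparr>))"
    using v_inj by (rule inj_on_subset) auto
qed (auto simp: closed_rules v_rules subalg_one[OF V(1)] subalg_zero[OF V(1)] subalg_add[OF V(1)]
    subalg_mult[OF V(1)] subalg_csc[OF V(1)] subalg_adj[OF V(1)])

end

lemma cstar_algebra_of_embedding:
  fixes Q :: "('a, 'm) cstar_scheme" and v :: "'a \<Rightarrow> 'u::{cstar_alg, banach}"
  assumes Q: "star_embedding Q v" and n: "\<And>x. x \<in> carrier Q \<Longrightarrow> nrm Q x = norm (v x)" and cl: "closed (v ` carrier Q)"
  shows "cstar_algebra Q"
proof -
  interpret star_embedding Q v by (rule Q)
  have nm: "nrm Q (x \<ominus>\<^bsub>Q\<^esub> y) = norm (v x - v y)" if "x \<in> carrier Q" "y \<in> carrier Q" for x y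
    using that n[OF a_minus_closed[OF that]] v_a_minus[OF that] by simp
  interpret ring Q by (rule ring_Q)
  show ?thesis
  proof unfold_locales
    fix f assume f: "f \<in> cauchy_seqs Q"
    then have fc: "f n \<in> carrier Q" for n by (simp add: cauchy_seqs_def)
    have "Cauchy (\<lambda>n. v (f n))"
    proof (rule metric_CauchyI)
      fix e :: real assume "0 < e"
      then obtain N where "\<forall>m\<ge>N. \<forall>n\<ge>N. nrm Q (f m \<ominus>\<^bsub>Q\<^esub> f n) < e"
        using f by (auto simp: cauchy_seqs_def)
      then show "\<exists>N. \<forall>m\<ge>N. \<forall>n\<ge>N. dist (v (f m)) (v (f n)) < e"
        by (intro exI[of _ N]) (simp only: nm[OF fc fc] dist_norm)
    qed
    then obtain l where l: "(\<lambda>n. v (f n)) \<longlonglongrightarrow> l" using Cauchy_convergent convergent_def by blast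
    have "l \<in> v ` carrier Q" by (rule closed_sequentially[OF cl _ l]) (use fc in auto)
    then obtain x where x: "x \<in> carrier Q" "l = v x" by (rule imageE)
    have "(\<lambda>n. norm (v (f n) - v x)) \<longlonglongrightarrow> 0"
      using tendsto_norm[OF tendsto_diff[OF l tendsto_const[of l]]] by (simp add: x(2))
    then have "converges_to Q f x"
      unfolding converges_to_def by (simp only: nm[OF fc x(1)])
    then show "\<exists>x\<in>carrier Q. converges_to Q f x" using x(1) by blast
  next
    fix x assume "x \<in> carrier Q"
    then show "nrm Q x = 0 \<longleftrightarrow> x = \<zero>\<^bsub>Q\<^esub>" using v_eqI[OF _ zero_closed] by (auto simp: n v_zero)
  qed (auto intro!: v_eqI simp: closed_rules v_rules n csc_add_right csc_add_left norm_triangle_ineq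
      norm_mult_ineq norm_adj_mult)
qed

text \<open>The common frame of the ultrapower and of the completion, with \<open>\<Lambda>\<close>
  the class in the type \<open>ultra\<close> in the first case and the limit in the second. The map
  \<open>ng\<close> supplies additive inverses before any ring law of the quotient is known.\<close>

locale seq_quotient =
  fixes M :: "('a, 'm) cstar_scheme" and S J :: "('i \<Rightarrow> 'a) set"
    and \<Lambda> :: "('i \<Rightarrow> 'a) \<Rightarrow> 'u::cstar_alg" and ng :: "'a \<Rightarrow> 'a"
  assumes S_carrier: "f \<in> S \<Longrightarrow> f i \<in> carrier M"
    and S_one: "(\<lambda>_. \<one>\<^bsub>M\<^esub>) \<in> S" and S_zero: "(\<lambda>_. \<zero>\<^bsub>M\<^esub>) \<in> S"
    and S_add: "f \<in> S \<Longrightarrow> g \<in> S \<Longrightarrow> (\<lambda>i. f i \<oplus>\<^bsub>M\<^esub> g i) \<in> S"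
    and S_mult: "f \<in> S \<Longrightarrow> g \<in> S \<Longrightarrow> (\<lambda>i. f i \<otimes>\<^bsub>M\<^esub> g i) \<in> S"
    and S_scl: "f \<in> S \<Longrightarrow> (\<lambda>i. scl M c (f i)) \<in> S"
    and S_str: "f \<in> S \<Longrightarrow> (\<lambda>i. str M (f i)) \<in> S"
    and S_ng: "f \<in> S \<Longrightarrow> (\<lambda>i. ng (f i)) \<in> S"
    and \<Lambda>_one: "\<Lambda> (\<lambda>_. \<one>\<^bsub>M\<^esub>) = 1" and \<Lambda>_zero: "\<Lambda> (\<lambda>_. \<zero>\<^bsub>M\<^esub>) = 0"
    and \<Lambda>_add: "f \<in> S \<Longrightarrow> g \<in> S \<Longrightarrow> \<Lambda> (\<lambda>i. f i \<oplus>\<^bsub>M\<^esub> g i) = \<Lambda> f + \<Lambda> g"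
    and \<Lambda>_mult: "f \<in> S \<Longrightarrow> g \<in> S \<Longrightarrow> \<Lambda> (\<lambda>i. f i \<otimes>\<^bsub>M\<^esub> g i) = \<Lambda> f * \<Lambda> g"
    and \<Lambda>_scl: "f \<in> S \<Longrightarrow> \<Lambda> (\<lambda>i. scl M c (f i)) = c *\<^sub>C \<Lambda> f"
    and \<Lambda>_str: "f \<in> S \<Longrightarrow> \<Lambda> (\<lambda>i. str M (f i)) = (\<Lambda> f)\<^sup>\<star>"
    and ng_cancel: "x \<in> carrier M \<Longrightarrow> y \<in> carrier M \<Longrightarrow> (x \<oplus>\<^bsub>M\<^esub> ng y) \<oplus>\<^bsub>M\<^esub> y = x"
    and add_ng: "y \<in> carrier M \<Longrightarrow> y \<oplus>\<^bsub>M\<^esub> ng y = \<zero>\<^bsub>M\<^esub>"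
    and J: "J = {f \<in> S. \<Lambda> f = 0}"
begin

abbreviation "P \<equiv> pointwise M S"
abbreviation "Q \<equiv> cstar_quot P J"

definition cls :: "('i \<Rightarrow> 'a) \<Rightarrow> ('i \<Rightarrow> 'a) set" where "cls f = J +>\<^bsub>P\<^esub> f"

lemma \<Lambda>_ng: assumes "f \<in> S" shows "\<Lambda> (\<lambda>i. ng (f i)) = - \<Lambda> f"
proof -
  have "\<Lambda> f + \<Lambda> (\<lambda>i. ng (f i)) = \<Lambda> (\<lambda>i. f i \<oplus>\<^bsub>M\<^esub> ng (f i))" using assms by (simp only: \<Lambda>_add S_ng)
  also have "\<dots> = 0" using S_carrier[OF assms] by (simp add: add_ng \<Lambda>_zero)
  finally show ?thesis by (simp add: eq_neg_iff_add_eq_0 add.commute)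
qed

text \<open>Cosets are exactly the fibres of \<open>\<Lambda>\<close>, so the quotient operations
  can be read off from its values.\<close>

lemma cls_eq: assumes f: "f \<in> S" shows "cls f = {g \<in> S. \<Lambda> g = \<Lambda> f}"
proof (intro Set.set_eqI iffI)
  fix g assume "g \<in> cls f"
  then obtain h where "h \<in> J" "g = (\<lambda>i. h i \<oplus>\<^bsub>M\<^esub> f i)"
    by (auto simp: cls_def a_r_coset_def' pointwise_def)
  then show "g \<in> {g \<in> S. \<Lambda> g = \<Lambda> f}" using f by (simp add: J S_add \<Lambda>_add)
next
  fix g assume g: "g \<in> {g \<in> S. \<Lambda> g = \<Lambda> f}"
  define h where "h = (\<lambda>i. g i \<oplus>\<^bsub>M\<^esub> ng (f i))"
  have "h \<in> J" using g f by (simp add: h_def J S_add S_ng \<Lambda>_add \<Lambda>_ng)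
  moreover have "g = (\<lambda>i. h i \<oplus>\<^bsub>M\<^esub> f i)"
    using g f S_carrier by (simp add: h_def ng_cancel)
  ultimately show "g \<in> cls f" by (auto simp: cls_def a_r_coset_def' pointwise_def)
qed

lemma mem_cls: "f \<in> S \<Longrightarrow> f \<in> cls f" by (simp add: cls_eq)

lemma cls_eq_iff: "f \<in> S \<Longrightarrow> g \<in> S \<Longrightarrow> cls f = cls g \<longleftrightarrow> \<Lambda> f = \<Lambda> g"
  using mem_cls[of f] by (auto simp: cls_eq)

lemma carrier_Q: "carrier Q = cls ` S"
  by (auto simp: cstar_quot_def FactRing_def A_RCOSETS_def' cls_def pointwise_def)

definition val :: "('i \<Rightarrow> 'a) set \<Rightarrow> 'u" where "val X = \<Lambda> (SOME f. f \<in> X)"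

lemma val_cls: assumes "f \<in> S" shows "val (cls f) = \<Lambda> f"
proof -
  have "(SOME g. g \<in> cls f) \<in> cls f" by (rule someI[of "\<lambda>g. g \<in> cls f", OF mem_cls[OF assms]])
  then show ?thesis unfolding val_def using cls_eq[OF assms] by simp
qed

lemma carrierE: assumes "X \<in> carrier Q" obtains f where "f \<in> S" "X = cls f"
  using assms by (auto simp: carrier_Q)

lemma UN_cls_const: assumes f: "f \<in> S" and F: "\<And>a. a \<in> cls f \<Longrightarrow> F a = c" shows "(\<Union>a\<in>cls f. F a) = c"
  using mem_cls[OF f] F by auto

lemma cls_mult: assumes f: "f \<in> S" and g: "g \<in> S"
  shows "cls f \<otimes>\<^bsub>Q\<^esub> cls g = cls (\<lambda>i. f i \<otimes>\<^bsub>M\<^esub> g i)"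
proof -
  have "cls f \<otimes>\<^bsub>Q\<^esub> cls g = (\<Union>a\<in>cls f. \<Union>b\<in>cls g. cls (\<lambda>i. a i \<otimes>\<^bsub>M\<^esub> b i))"
    by (simp add: cstar_quot_def FactRing_def rcoset_mult_def cls_def pointwise_def)
  also have "\<dots> = cls (\<lambda>i. f i \<otimes>\<^bsub>M\<^esub> g i)"
  proof (intro UN_cls_const f g)
    fix a b assume "a \<in> cls f" "b \<in> cls g"
    then have "a \<in> S" "\<Lambda> a = \<Lambda> f" "b \<in> S" "\<Lambda> b = \<Lambda> g" by (simp_all add: cls_eq f g)
    then show "cls (\<lambda>i. a i \<otimes>\<^bsub>M\<^esub> b i) = cls (\<lambda>i. f i \<otimes>\<^bsub>M\<^esub> g i)"
      using f g by (simp add: cls_eq_iff S_mult \<Lambda>_mult)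
  qed
  finally show ?thesis .
qed

lemma cls_add: assumes f: "f \<in> S" and g: "g \<in> S"
  shows "cls f \<oplus>\<^bsub>Q\<^esub> cls g = cls (\<lambda>i. f i \<oplus>\<^bsub>M\<^esub> g i)"
proof -
  have "cls f \<oplus>\<^bsub>Q\<^esub> cls g = (\<Union>a\<in>cls f. \<Union>b\<in>cls g. {\<lambda>i. a i \<oplus>\<^bsub>M\<^esub> b i})"
    by (simp add: cstar_quot_def FactRing_def set_add_def' pointwise_def)
  also have "\<dots> = cls (\<lambda>i. f i \<oplus>\<^bsub>M\<^esub> g i)"
  proof (intro Set.set_eqI iffI)
    fix c assume "c \<in> (\<Union>a\<in>cls f. \<Union>b\<in>cls g. {\<lambda>i. a i \<oplus>\<^bsub>M\<^esub> b i})"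
    then obtain a b where "a \<in> cls f" "b \<in> cls g" "c = (\<lambda>i. a i \<oplus>\<^bsub>M\<^esub> b i)" by auto
    then show "c \<in> cls (\<lambda>i. f i \<oplus>\<^bsub>M\<^esub> g i)" using f g by (simp add: cls_eq S_add \<Lambda>_add)
  next
    fix c assume c: "c \<in> cls (\<lambda>i. f i \<oplus>\<^bsub>M\<^esub> g i)"
    then have cS: "c \<in> S" "\<Lambda> c = \<Lambda> f + \<Lambda> g" using f g by (simp_all add: cls_eq S_add \<Lambda>_add)
    define a where "a = (\<lambda>i. c i \<oplus>\<^bsub>M\<^esub> ng (g i))"
    have "a \<in> cls f" using cS f g by (simp add: a_def cls_eq S_add S_ng \<Lambda>_add \<Lambda>_ng)
    moreover have "c = (\<lambda>i. a i \<oplus>\<^bsub>M\<^esub> g i)" using S_carrier cS g by (simp add: a_def ng_cancel)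
    ultimately show "c \<in> (\<Union>a\<in>cls f. \<Union>b\<in>cls g. {\<lambda>i. a i \<oplus>\<^bsub>M\<^esub> b i})" using mem_cls[OF g] by blast
  qed
  finally show ?thesis .
qed

lemma cls_one: "\<one>\<^bsub>Q\<^esub> = cls (\<lambda>_. \<one>\<^bsub>M\<^esub>)"
  by (simp add: cstar_quot_def FactRing_def cls_def pointwise_def)

lemma cls_zero: "\<zero>\<^bsub>Q\<^esub> = cls (\<lambda>_. \<zero>\<^bsub>M\<^esub>)"
  unfolding cls_eq[OF S_zero] by (simp add: cstar_quot_def FactRing_def J \<Lambda>_zero)

lemma cls_scl: assumes f: "f \<in> S" shows "scl Q c (cls f) = cls (\<lambda>i. scl M c (f i))"
proof -
  have "scl Q c (cls f) = (\<Union>a\<in>cls f. cls (\<lambda>i. scl M c (a i)))"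
    by (simp add: cstar_quot_def cls_def pointwise_def)
  also have "\<dots> = cls (\<lambda>i. scl M c (f i))"
    by (rule UN_cls_const[OF f]) (use f in \<open>simp add: cls_eq[OF f] cls_eq_iff S_scl \<Lambda>_scl\<close>)
  finally show ?thesis .
qed

lemma cls_str: assumes f: "f \<in> S" shows "str Q (cls f) = cls (\<lambda>i. str M (f i))"
proof -
  have "str Q (cls f) = (\<Union>a\<in>cls f. cls (\<lambda>i. str M (a i)))"
    by (simp add: cstar_quot_def cls_def pointwise_def)
  also have "\<dots> = cls (\<lambda>i. str M (f i))"
    by (rule UN_cls_const[OF f]) (use f in \<open>simp add: cls_eq[OF f] cls_eq_iff S_str \<Lambda>_str\<close>)
  finally show ?thesis .
qed

lemma val_image: "val ` carrier Q = \<Lambda> ` S"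
  by (auto simp: carrier_Q val_cls image_image)

sublocale star_embedding Q val
proof unfold_locales
  show "inj_on val (carrier Q)"
  proof (rule inj_onI)
    fix X Y assume *: "X \<in> carrier Q" "Y \<in> carrier Q" "val X = val Y"
    obtain f g where fg: "f \<in> S" "X = cls f" "g \<in> S" "Y = cls g" using carrierE *(1,2) by metis
    then show "X = Y" using *(3) cls_eq_iff[OF fg(1,3)] by (simp add: val_cls)
  qed
  show "star_subalgebra (val ` carrier Q)"
    unfolding val_image star_subalgebra_def
    by (auto simp flip: \<Lambda>_add \<Lambda>_mult \<Lambda>_str \<Lambda>_scl \<Lambda>_one intro!: imageI S_one S_add S_mult S_str S_scl)
qed (auto elim!: carrierE simp: cls_mult cls_add cls_one cls_zero cls_scl cls_str val_cls S_one S_zero S_add S_mult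
    S_scl S_str \<Lambda>_one \<Lambda>_zero \<Lambda>_add \<Lambda>_mult \<Lambda>_scl \<Lambda>_str carrier_Q intro!: imageI)

lemma nrm_cls: "nrm Q (cls f) = (INF g\<in>cls f. SUP i. nrm M (g i))"
  by (simp add: cstar_quot_def pointwise_def)

end

section \<open>The reduced free product inside the covariance algebra\<close>

text \<open>\<open>N\<close> corresponds to the closure of \<open>semi\<close> because a C*-algebra
  is wanted, while the Fock theory generates with \<open>L + L\<^sup>\<star>\<close> alone. Both
  have the same closed span with \<open>A\<close>, which lets the norm formula be used.\<close>

locale free_embedding = fock \<phi> A L + M: star_embedding M vM + N: star_embedding N vN
  for \<phi> :: "'u::{cstar_alg, banach} \<Rightarrow> complex" and A L
    and M :: "('a, 'm) star_alg_scheme" and vM and N :: "('b, 'n) star_alg_scheme" and vN +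
  fixes \<rho> :: "'a \<Rightarrow> complex" and \<kappa> :: "'b \<Rightarrow> complex"
  assumes vM_image: "vM ` carrier M = A" and vN_image: "vN ` carrier N = closure semi"
    and \<rho>: "a \<in> carrier M \<Longrightarrow> \<rho> a = \<phi> (vM a)" and \<kappa>: "b \<in> carrier N \<Longrightarrow> \<kappa> b = \<phi> (vN b)"
begin

definition letter :: "'a + 'b \<Rightarrow> 'u" where "letter = case_sum vM vN"

definition wv :: "('a + 'b) list \<Rightarrow> 'u" where "wv w = prod_list (map letter w)"

lemma letter_simps [simp]: "letter (Inl a) = vM a" "letter (Inr b) = vN b"
  by (simp_all add: letter_def)

lemma wv_simps [simp]: "wv [] = 1" "wv (x # w) = letter x * wv w" "wv (v @ w) = wv v * wv w"
  by (simp_all add: wv_def)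

abbreviation "FW \<equiv> free_words M N"

lemma FW_Cons: "x # w \<in> FW \<longleftrightarrow> x \<in> carrier M <+> carrier N \<and> w \<in> FW"
  by (simp add: free_words_def)

lemma FW_append: "v @ w \<in> FW \<longleftrightarrow> v \<in> FW \<and> w \<in> FW"
  by (auto simp: free_words_def)

lemma FW_Nil: "[] \<in> FW"
  by (simp add: free_words_def)

subsection \<open>Moments\<close>

fun reduced :: "('a + 'b) list \<Rightarrow> bool" where
  "reduced [] = True"
| "reduced (Inl a # w) = (a \<in> carrier M \<and> \<rho> a = 0 \<and> reduced w \<and> (w \<noteq> [] \<longrightarrow> \<not> isl (hd w)))"
| "reduced (Inr b # w) = (b \<in> carrier N \<and> \<kappa> b = 0 \<and> reduced w \<and> (w \<noteq> [] \<longrightarrow> isl (hd w)))"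

lemma reduced_alternating: "reduced w \<Longrightarrow> alternating (map (map_sum vM vN) w)"
proof (induction w rule: reduced.induct)
  case (2 a w)
  then show ?case using vM_image \<rho>[of a] by (cases w) (auto simp: isl_map_sum)
next
  case (3 b w)
  then show ?case using vN_image \<kappa>[of b] by (cases w) (auto simp: isl_map_sum)
qed simp

lemma word_val_map: "word_val (map (map_sum vM vN) w) = wv w"
proof (induction w)
  case (Cons x w) then show ?case by (cases x) auto
qed simp

lemma \<phi>_reduced: "reduced w \<Longrightarrow> w \<noteq> [] \<Longrightarrow> \<phi> (wv w) = 0"
  using \<phi>_alternating[OF reduced_alternating, of w] by (simp add: word_val_map)

lemma centre_M: assumes a: "a \<in> carrier M"
  shows "centre M \<rho> a \<in> carrier M" "vM (centre M \<rho> a) = vM a - \<rho> a *\<^sub>C 1" "\<rho> (centre M \<rho> a) = 0"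
proof -
  show c: "centre M \<rho> a \<in> carrier M" using a by (simp add: centre_def M.a_minus_closed M.closed_rules)
  show v: "vM (centre M \<rho> a) = vM a - \<rho> a *\<^sub>C 1"
    using a by (simp add: centre_def M.v_a_minus M.closed_rules M.v_rules)
  show "\<rho> (centre M \<rho> a) = 0" using \<rho>[OF c] \<rho>[OF a] by (simp add: v \<phi>_diff)
qed

lemma centre_N: assumes b: "b \<in> carrier N"
  shows "centre N \<kappa> b \<in> carrier N" "vN (centre N \<kappa> b) = vN b - \<kappa> b *\<^sub>C 1" "\<kappa> (centre N \<kappa> b) = 0"
proof -
  show c: "centre N \<kappa> b \<in> carrier N" using b by (simp add: centre_def N.a_minus_closed N.closed_rules)
  show v: "vN (centre N \<kappa> b) = vN b - \<kappa> b *\<^sub>C 1"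
    using b by (simp add: centre_def N.v_a_minus N.closed_rules N.v_rules)
  show "\<kappa> (centre N \<kappa> b) = 0" using \<kappa>[OF c] \<kappa>[OF b] by (simp add: v \<phi>_diff)
qed

text \<open>One step of Voiculescu's action keeps the represented product and separates the new
  first letter \<open>y\<close> from the rest of the word.\<close>

lemma free_merge_reduced:
  assumes x: "x \<in> carrier M <+> carrier N" and r: "reduced r" and m: "free_merge M N x r = (y, r')"
  shows "y \<in> carrier M <+> carrier N \<and> letter x * wv r = letter y * wv r' \<and> reduced r' \<and>
    (r' \<noteq> [] \<longrightarrow> isl (hd r') \<noteq> isl y)"
proof (cases r)
  case Nil
  then show ?thesis using x m by (cases x) auto
next
  case (Cons z r0)
  show ?thesis
  proof (cases x)
    case (Inl a)
    then show ?thesis using x r m Cons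
      by (cases z) (auto simp: M.closed_rules M.v_rules mult.assoc)
  next
    case (Inr b)
    then show ?thesis using x r m Cons
      by (cases z) (auto simp: N.closed_rules N.v_rules mult.assoc)
  qed
qed

lemma reduced_centre:
  assumes y: "y \<in> carrier M <+> carrier N" and r: "reduced r" "r \<noteq> [] \<longrightarrow> isl (hd r) \<noteq> isl y"
  shows "reduced (map_sum (centre M \<rho>) (centre N \<kappa>) y # r)"
    and "letter (map_sum (centre M \<rho>) (centre N \<kappa>) y) = letter y - case_sum \<rho> \<kappa> y *\<^sub>C 1"
  using assms by (cases y; auto simp: centre_M centre_N)+

text \<open>The recursion of \<open>free_vac\<close> splits a letter into scalar and centred part
  exactly as the left factor in \<open>\<phi>\<close> can be split. Freeness is used at the end,
  where a nonempty reduced word has expectation 0; the general \<open>r\<close> carries the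
  induction.\<close>

lemma free_vac_eq: "xs \<in> FW \<Longrightarrow> reduced r \<Longrightarrow> free_vac M \<rho> N \<kappa> xs r = \<phi> (wv (rev xs) * wv r)"
proof (induction xs arbitrary: r)
  case Nil
  then show ?case using \<phi>_reduced by simp
next
  case (Cons x xs)
  obtain y r' where m: "free_merge M N x r = (y, r')" by fastforce
  note * = free_merge_reduced[OF _ Cons.prems(2) m]
  have x: "x \<in> carrier M <+> carrier N" "xs \<in> FW" using Cons.prems by (simp_all add: FW_Cons)
  let ?c = "map_sum (centre M \<rho>) (centre N \<kappa>) y"
  have c: "reduced (?c # r')" "letter ?c = letter y - case_sum \<rho> \<kappa> y *\<^sub>C 1"
    using reduced_centre[of y r'] *[OF x(1)] by blast+
  have "wv (rev (x # xs)) * wv r = wv (rev xs) * (letter x * wv r)" by (simp add: mult.assoc)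
  also have "letter x * wv r = case_sum \<rho> \<kappa> y *\<^sub>C wv r' + letter ?c * wv r'"
    using *[OF x(1)] by (simp add: c(2) left_diff_distrib)
  finally have "\<phi> (wv (rev (x # xs)) * wv r) = case_sum \<rho> \<kappa> y * \<phi> (wv (rev xs) * wv r') + \<phi> (wv (rev xs) * wv (?c # r'))"
    by (simp add: distrib_left \<phi>_add)
  then show ?case using Cons.IH[OF x(2)] c(1) *[OF x(1)] by (simp add: m)
qed

lemma free_moment_eq: "w \<in> FW \<Longrightarrow> free_moment M \<rho> N \<kappa> w = \<phi> (wv w)"
  using free_vac_eq[of "rev w" "[]"] by (simp add: free_moment_def free_words_def lists_eq_set)

subsection \<open>Evaluation of the word algebra\<close>

abbreviation "W \<equiv> free_word_algebra M N"

definition supp :: "(('a + 'b) list \<Rightarrow> complex) \<Rightarrow> ('a + 'b) list set" where "supp x = {w. x w \<noteq> 0}"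

definition ev :: "(('a + 'b) list \<Rightarrow> complex) \<Rightarrow> 'u" where "ev x = (\<Sum>w\<in>supp x. x w *\<^sub>C wv w)"

lemma carrier_W: "x \<in> carrier W \<longleftrightarrow> finite (supp x) \<and> supp x \<subseteq> FW"
  by (simp add: free_word_algebra_def supp_def)

lemma ev_superset: "finite D \<Longrightarrow> supp x \<subseteq> D \<Longrightarrow> ev x = (\<Sum>w\<in>D. x w *\<^sub>C wv w)"
  unfolding ev_def by (intro sum.mono_neutral_left) (auto simp: supp_def)

lemma W_ops:
  "one W = word_vec []" "zero W = (\<lambda>_. 0)" "add W x y = (\<lambda>w. x w + y w)" "scl W c x = (\<lambda>w. c * x w)"
  by (simp_all add: free_word_algebra_def)

lemma W_word_vec: "w \<in> FW \<Longrightarrow> word_vec w \<in> carrier W" and ev_word_vec: "ev (word_vec w) = wv w"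
proof -
  have s: "supp (word_vec w) = {w}" by (auto simp: supp_def word_vec_def)
  then show "w \<in> FW \<Longrightarrow> word_vec w \<in> carrier W" by (simp add: carrier_W)
  show "ev (word_vec w) = wv w" by (simp add: ev_def s) (simp add: word_vec_def)
qed

lemma W_zero: "(\<lambda>_. 0) \<in> carrier W" and ev_zero: "ev (\<lambda>_. 0) = 0"
  by (simp_all add: carrier_W supp_def ev_def)

lemma W_add: assumes "x \<in> carrier W" "y \<in> carrier W"
  shows "(\<lambda>w. x w + y w) \<in> carrier W" "ev (\<lambda>w. x w + y w) = ev x + ev y"
proof -
  let ?D = "supp x \<union> supp y"
  have D: "finite ?D" "?D \<subseteq> FW" "supp (\<lambda>w. x w + y w) \<subseteq> ?D" using assms by (auto simp: carrier_W) (auto simp: supp_def)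
  then show "(\<lambda>w. x w + y w) \<in> carrier W" by (auto simp: carrier_W intro: finite_subset)
  show "ev (\<lambda>w. x w + y w) = ev x + ev y"
    using D(1,3) ev_superset[of ?D x] ev_superset[of ?D y] ev_superset[of ?D "\<lambda>w. x w + y w"]
    by (simp add: csc_add_left sum.distrib)
qed

lemma W_scl: assumes "x \<in> carrier W"
  shows "(\<lambda>w. c * x w) \<in> carrier W" "ev (\<lambda>w. c * x w) = c *\<^sub>C ev x"
proof -
  have D: "finite (supp x)" "supp x \<subseteq> FW" "supp (\<lambda>w. c * x w) \<subseteq> supp x" using assms by (auto simp: carrier_W) (auto simp: supp_def)
  then show "(\<lambda>w. c * x w) \<in> carrier W" by (auto simp: carrier_W intro: finite_subset)
  show "ev (\<lambda>w. c * x w) = c *\<^sub>C ev x"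
    using D(1,3) ev_superset[of "supp x" "\<lambda>w. c * x w"] by (simp add: csc_sum ev_def)
qed

lemma W_uminus: assumes "x \<in> carrier W"
  shows "(\<lambda>w. - x w) \<in> carrier W" "ev (\<lambda>w. - x w) = - ev x"
  using W_scl[OF assms, of "- 1"] by (simp_all add: csc_minus_left)

text \<open>Cutting positions of words correspond to pairs of words; this turns a convolution into a
  double sum.\<close>

lemma sum_splits:
  assumes D: "finite D"
  shows "(\<Sum>w\<in>D. \<Sum>k\<le>length w. h (take k w) (drop k w)) = (\<Sum>(u, v)\<in>{(u, v). u @ v \<in> D}. h u v :: 'u)"
proof -
  have "(\<Sum>w\<in>D. \<Sum>k\<le>length w. h (take k w) (drop k w)) = (\<Sum>(w, k)\<in>Sigma D (\<lambda>w. {..length w}). h (take k w) (drop k w))"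
    using D by (simp add: sum.Sigma)
  also have "\<dots> = (\<Sum>(u, v)\<in>{(u, v). u @ v \<in> D}. h u v)"
    by (rule sum.reindex_bij_witness[where i = "\<lambda>(u, v). (u @ v, length u)" and j = "\<lambda>(w, k). (take k w, drop k w)"])
      (auto split: prod.splits)
  finally show ?thesis .
qed

lemma W_mult: assumes x: "x \<in> carrier W" and y: "y \<in> carrier W"
  shows "mult W x y \<in> carrier W" "ev (mult W x y) = ev x * ev y"
proof -
  let ?D = "(\<lambda>(u, v). u @ v) ` (supp x \<times> supp y)"
  have m: "mult W x y = (\<lambda>w. \<Sum>k\<le>length w. x (take k w) * y (drop k w))" by (simp add: free_word_algebra_def)
  have fin: "finite (supp x)" "finite (supp y)" using x y by (auto simp: carrier_W)
  have D: "finite ?D" using fin by simp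
  have DF: "?D \<subseteq> FW" using x y by (auto simp: carrier_W FW_append)
  have s: "supp (mult W x y) \<subseteq> ?D"
  proof
    fix w assume "w \<in> supp (mult W x y)"
    then have "(\<Sum>k\<le>length w. x (take k w) * y (drop k w)) \<noteq> 0" by (simp add: supp_def m)
    then obtain k where "x (take k w) * y (drop k w) \<noteq> 0" by (meson sum.not_neutral_contains_not_neutral)
    then have "(take k w, drop k w) \<in> supp x \<times> supp y" by (simp add: supp_def)
    then show "w \<in> ?D" by (rule image_eqI[rotated]) simp
  qed
  show "mult W x y \<in> carrier W" using s D DF by (auto simp: carrier_W intro: finite_subset)
  have "ev (mult W x y) = (\<Sum>w\<in>?D. mult W x y w *\<^sub>C wv w)" by (rule ev_superset[OF D s])
  also have "\<dots> = (\<Sum>w\<in>?D. \<Sum>k\<le>length w. (x (take k w) * y (drop k w)) *\<^sub>C (wv (take k w) * wv (drop k w)))"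
  proof (intro sum.cong refl)
    fix w
    have "wv (take k w) * wv (drop k w) = wv w" for k using wv_simps(3)[of "take k w" "drop k w"] by simp
    moreover have "(\<Sum>k\<in>K. c k) *\<^sub>C z = (\<Sum>k\<in>K. c k *\<^sub>C z)" for c :: "nat \<Rightarrow> complex" and K and z :: 'u
      by (induction K rule: infinite_finite_induct) (auto simp: csc_add_left)
    ultimately show "mult W x y w *\<^sub>C wv w = (\<Sum>k\<le>length w. (x (take k w) * y (drop k w)) *\<^sub>C (wv (take k w) * wv (drop k w)))"
      by (simp only: m)
  qed
  also have "\<dots> = (\<Sum>(u, v)\<in>{(u, v). u @ v \<in> ?D}. (x u * y v) *\<^sub>C (wv u * wv v))"
    by (rule sum_splits[OF D])
  also have "\<dots> = (\<Sum>(u, v)\<in>supp x \<times> supp y. (x u * y v) *\<^sub>C (wv u * wv v))"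
  \<comment> \<open>A product word may also be cut at other places, but those pairs lie outside the
    product of the supports and contribute 0.\<close>
  proof (rule sum.mono_neutral_right)
    have "{(u, v). u @ v \<in> ?D} \<subseteq> (\<lambda>(w, k). (take k w, drop k w)) ` (Sigma ?D (\<lambda>w. {..length w}))"
    proof (rule subsetI)
      fix p assume "p \<in> {(u, v). u @ v \<in> ?D}"
      then obtain u v where p: "p = (u, v)" "u @ v \<in> ?D" by (cases p) simp
      then have "(u @ v, length u) \<in> Sigma ?D (\<lambda>w. {..length w})" by simp
      then show "p \<in> (\<lambda>(w, k). (take k w, drop k w)) ` (Sigma ?D (\<lambda>w. {..length w}))"
        by (rule image_eqI[rotated]) (simp add: p(1))
    qed
    then show "finite {(u, v). u @ v \<in> ?D}" by (rule finite_subset) (intro finite_imageI finite_SigmaI D finite_atMost)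
  qed (auto simp: supp_def)
  also have "\<dots> = (\<Sum>u\<in>supp x. \<Sum>v\<in>supp y. (x u *\<^sub>C wv u) * (y v *\<^sub>C wv v))"
    by (simp add: sum.cartesian_product mult.commute)
  also have "\<dots> = ev x * ev y" by (simp only: ev_def sum_product)
  finally show "ev (mult W x y) = ev x * ev y" .
qed

abbreviation "wstar \<equiv> \<lambda>w. rev (map (map_sum (str M) (str N)) w)"

lemma wstar: "w \<in> FW \<Longrightarrow> wstar w \<in> FW \<and> wv (wstar w) = (wv w)\<^sup>\<star> \<and> wstar (wstar w) = w"
proof (induction w)
  case Nil then show ?case by (simp add: FW_Nil)
next
  case (Cons x w)
  have x: "x \<in> carrier M <+> carrier N" "w \<in> FW" using Cons.prems by (simp_all add: FW_Cons)
  have "map_sum (str M) (str N) x \<in> carrier M <+> carrier N \<and> letter (map_sum (str M) (str N) x) = (letter x)\<^sup>\<star> \<and>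
      map_sum (str M) (str N) (map_sum (str M) (str N) x) = x"
    using x(1) by (auto simp: M.closed_rules M.v_rules N.closed_rules N.v_rules intro!: M.v_eqI N.v_eqI)
  then show ?case using Cons.IH[OF x(2)] by (simp add: FW_append FW_Cons FW_Nil rev_map)
qed

lemma W_str: assumes x: "x \<in> carrier W"
  shows "str W x \<in> carrier W" "ev (str W x) = (ev x)\<^sup>\<star>"
proof -
  have sx: "str W x = (\<lambda>w. if w \<in> FW then cnj (x (wstar w)) else 0)" by (simp add: free_word_algebra_def)
  have F: "finite (supp x)" "supp x \<subseteq> FW" using x by (simp_all add: carrier_W)
  have "w \<in> wstar ` supp x" if "w \<in> supp (str W x)" for w
  proof -
    have "w \<in> FW" "wstar w \<in> supp x" using that by (auto simp: supp_def sx split: if_splits)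
    then show ?thesis using wstar[of w] by (intro image_eqI[of _ _ "wstar w"]) simp_all
  qed
  then have s: "supp (str W x) \<subseteq> wstar ` supp x" by blast
  have sF: "wstar ` supp x \<subseteq> FW" using F(2) wstar by blast
  show "str W x \<in> carrier W" using s sF F(1) by (auto simp: carrier_W intro: finite_subset)
  have "ev (str W x) = (\<Sum>w\<in>wstar ` supp x. str W x w *\<^sub>C wv w)" using s F(1) by (intro ev_superset) auto
  also have "\<dots> = (\<Sum>w\<in>supp x. str W x (wstar w) *\<^sub>C wv (wstar w))"
  proof (rule sum.reindex_cong[OF _ refl refl])
    show "inj_on wstar (supp x)"
    proof (rule inj_onI)
      fix v w assume "v \<in> supp x" "w \<in> supp x" and eq: "wstar v = wstar w"
      then have "v \<in> FW" "w \<in> FW" using F(2) by auto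
      then show "v = w" using wstar[of v] wstar[of w] eq by metis
    qed
  qed
  also have "\<dots> = (\<Sum>w\<in>supp x. cnj (x w) *\<^sub>C (wv w)\<^sup>\<star>)"
  proof (intro sum.cong refl)
    fix w assume "w \<in> supp x"
    then have "w \<in> FW" using F(2) by auto
    then show "str W x (wstar w) *\<^sub>C wv (wstar w) = cnj (x w) *\<^sub>C (wv w)\<^sup>\<star>"
      using wstar[of w] by (simp only: sx if_True)
  qed
  also have "\<dots> = (ev x)\<^sup>\<star>" by (simp add: ev_def adj_sum)
  finally show "ev (str W x) = (ev x)\<^sup>\<star>" .
qed

abbreviation "F \<equiv> free_functional M \<rho> N \<kappa>"

lemma F_eq: assumes "x \<in> carrier W" shows "F x = \<phi> (ev x)"
proof -
  have "F x = (\<Sum>w\<in>supp x. x w * \<phi> (wv w))"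
    unfolding free_functional_def supp_def[symmetric]
    by (intro sum.cong refl) (use assms free_moment_eq in \<open>auto simp: carrier_W\<close>)
  then show ?thesis by (simp add: ev_def \<phi>_sum)
qed

lemma closure_semi_gen: "closure semi \<subseteq> closure gen"
  by (rule closure_mono[OF semi_gen])

lemma letter_closure_gen: "x \<in> carrier M <+> carrier N \<Longrightarrow> letter x \<in> closure gen"
  using vM_image vN_image closure_semi_gen gen_A closure_subset[of gen] by auto

lemma wv_closure_gen: "w \<in> FW \<Longrightarrow> wv w \<in> closure gen"
proof (induction w)
  case Nil show ?case by (simp add: subalg_one[OF star_subalgebra_closure[OF star_subalgebra_gen]])
next
  case (Cons x w)
  then show ?case
    by (simp add: FW_Cons letter_closure_gen subalg_mult[OF star_subalgebra_closure[OF star_subalgebra_gen]])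
qed

lemma ev_closure_gen: "x \<in> carrier W \<Longrightarrow> ev x \<in> closure gen"
  unfolding ev_def carrier_W
  by (intro subalg_sum[OF star_subalgebra_closure[OF star_subalgebra_gen]]
      subalg_csc[OF star_subalgebra_closure[OF star_subalgebra_gen]] wv_closure_gen) auto

lemma gen_ev: "z \<in> gen \<Longrightarrow> \<exists>b\<in>carrier W. ev b = z"
proof (induction rule: gen.induct)
  case (gen_A a)
  then obtain a' where "a' \<in> carrier M" "a = vM a'" using vM_image by auto
  then show ?case
    by (intro bexI[of _ "word_vec [Inl a']"] W_word_vec) (simp_all add: ev_word_vec FW_Cons FW_Nil InlI)
next
  case gen_S
  have "L + L\<^sup>\<star> \<in> vN ` carrier N" unfolding vN_image using S_semi closure_subset by blast
  then obtain b where "b \<in> carrier N" "L + L\<^sup>\<star> = vN b" by (rule imageE)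
  then show ?case
    by (intro bexI[of _ "word_vec [Inr b]"] W_word_vec) (simp_all add: ev_word_vec FW_Cons FW_Nil InrI)
next
  case (gen_add x y)
  then obtain a b where "a \<in> carrier W" "ev a = x" "b \<in> carrier W" "ev b = y" by blast
  then show ?case using W_add[of a b] by (intro bexI[of _ "\<lambda>w. a w + b w"]) simp_all
next
  case (gen_mult x y)
  then obtain a b where "a \<in> carrier W" "ev a = x" "b \<in> carrier W" "ev b = y" by blast
  then show ?case using W_mult[of a b] by (intro bexI[of _ "mult W a b"]) simp_all
qed

lemma F_form: assumes "x \<in> carrier W" "b \<in> carrier W"
  shows "sqrt (Re (F (mult W (str W (mult W x b)) (mult W x b)))) = hn (ev x * ev b)"
  using assms by (simp add: F_eq W_mult W_str hn_def)

text \<open>The upper bound is boundedness of left multiplication. The lower bound is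
  \<open>closure_gen_norm_le\<close>: elements of \<open>gen\<close> come from word combinations,
  and normalising them brings them into the unit ball of the supremum.\<close>

theorem gns_norm_eq: assumes x: "x \<in> carrier W" shows "gns_norm W F x = norm (ev x)"
proof -
  let ?B = "{b \<in> carrier W. Re (F (mult W (str W b) b)) \<le> 1}"
  have B: "b \<in> ?B \<longleftrightarrow> b \<in> carrier W \<and> hn (ev b) \<le> 1" for b
    by (auto simp: F_eq W_mult W_str hn_def)
  define g where "g b = hn (ev x * ev b)" for b
  have eq: "gns_norm W F x = (SUP b\<in>?B. g b)"
    unfolding gns_norm_def g_def using x by (intro SUP_cong refl) (auto simp: F_form)
  have ne: "(\<lambda>_. 0) \<in> ?B" unfolding B by (simp add: W_zero ev_zero)
  have le: "g b \<le> norm (ev x)" if "b \<in> ?B" for b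
    using hn_mult[of "ev x" "ev b"] mult_left_mono[of "hn (ev b)" 1 "norm (ev x)"] that unfolding B by (simp add: g_def)
  then have bdd: "bdd_above (g ` ?B)" by (intro bdd_aboveI2)
  show ?thesis
    unfolding eq
  proof (rule antisym)
    show "(SUP b\<in>?B. g b) \<le> norm (ev x)" by (rule cSUP_least) (use ne le in auto)
    have upper: "g b \<le> (SUP b\<in>?B. g b)" if "b \<in> ?B" for b by (rule cSUP_upper[OF that bdd])
    have S0: "0 \<le> (SUP b\<in>?B. g b)" using upper[OF ne] by (simp add: g_def ev_zero)
    show "norm (ev x) \<le> (SUP b\<in>?B. g b)"
    proof (rule closure_gen_norm_le[OF ev_closure_gen[OF x] _ S0])
      fix z assume "z \<in> gen"
      then obtain b where b: "b \<in> carrier W" "ev b = z" using gen_ev by blast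
      show "hn (ev x * z) \<le> (SUP b\<in>?B. g b) * hn z"
      proof (cases "hn z = 0")
        case True then show ?thesis by (simp add: hn_mult_null)
      next
        case False
        define c where "c = complex_of_real (1 / hn z)"
        have c: "cmod c = 1 / hn z" by (simp add: c_def norm_divide)
        let ?b = "\<lambda>w. c * b w"
        have "?b \<in> ?B" unfolding B using W_scl[OF b(1)] False by (simp add: b c)
        from upper[OF this] have "hn (ev x * z) / hn z \<le> (SUP b\<in>?B. g b)"
          using W_scl[OF b(1), of c] by (simp add: g_def b c)
        then show ?thesis using False by (simp add: pos_divide_le_eq less_le)
      qed
    qed
  qed
qed

end

section \<open>The completion of the word algebra\<close>

context free_embedding begin

abbreviation "FN \<equiv> free_normed_algebra M \<rho> N \<kappa>"

lemma FN_simps [simp]: "carrier FN = carrier W" "mult FN = mult W" "one FN = word_vec []" "zero FN = (\<lambda>_. 0)"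
  "add FN x y = (\<lambda>w. x w + y w)" "scl FN c x = (\<lambda>w. c * x w)" "str FN = str W" "nrm FN = gns_norm W F"
  by (simp_all add: free_normed_algebra_def Let_def W_ops)

lemma FN_a_inv: assumes y: "y \<in> carrier W" shows "a_inv FN y = (\<lambda>w. - y w)"
  unfolding a_inv_def m_inv_def
proof (rule the_equality)
  show "(\<lambda>w. - y w) \<in> carrier (add_monoid FN) \<and> y \<otimes>\<^bsub>add_monoid FN\<^esub> (\<lambda>w. - y w) = \<one>\<^bsub>add_monoid FN\<^esub> \<and>
      (\<lambda>w. - y w) \<otimes>\<^bsub>add_monoid FN\<^esub> y = \<one>\<^bsub>add_monoid FN\<^esub>"
    using W_uminus[OF y] by simp
next
  fix z assume "z \<in> carrier (add_monoid FN) \<and> y \<otimes>\<^bsub>add_monoid FN\<^esub> z = \<one>\<^bsub>add_monoid FN\<^esub> \<and> z \<otimes>\<^bsub>add_monoid FN\<^esub> y = \<one>\<^bsub>add_monoid FN\<^esub>"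
  then have "(\<lambda>w. y w + z w) = (\<lambda>_. 0)" by simp
  then have "y w + z w = 0" for w by (rule fun_cong)
  then show "z = (\<lambda>w. - y w)" by (simp add: fun_eq_iff eq_neg_iff_add_eq_0 add.commute)
qed

lemma FN_nrm_diff: assumes "x \<in> carrier W" "y \<in> carrier W" shows "nrm FN (x \<ominus>\<^bsub>FN\<^esub> y) = norm (ev x - ev y)"
  using assms W_add[of x "\<lambda>w. - y w"] W_uminus[of y] by (simp add: a_minus_def FN_a_inv gns_norm_eq)

definition FS :: "(nat \<Rightarrow> ('a + 'b) list \<Rightarrow> complex) set" where "FS = cauchy_seqs FN"

lemma FS_iff: "f \<in> FS \<longleftrightarrow> (\<forall>n. f n \<in> carrier W) \<and> Cauchy (\<lambda>n. ev (f n))"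
proof (cases "\<forall>n. f n \<in> carrier W")
  case True
  have "f \<in> FS \<longleftrightarrow> (\<forall>e>0. \<exists>N'. \<forall>m\<ge>N'. \<forall>n\<ge>N'. norm (ev (f m) - ev (f n)) < e)"
    using True by (simp add: FS_def cauchy_seqs_def FN_nrm_diff del: FN_simps) simp
  then show ?thesis using True by (simp add: Cauchy_def dist_norm)
qed (auto simp: FS_def cauchy_seqs_def)

definition FL :: "(nat \<Rightarrow> ('a + 'b) list \<Rightarrow> complex) \<Rightarrow> 'u" where "FL f = lim (\<lambda>n. ev (f n))"

lemma FL: "f \<in> FS \<Longrightarrow> (\<lambda>n. ev (f n)) \<longlonglongrightarrow> FL f"
  unfolding FL_def FS_iff using Cauchy_convergent_iff convergent_LIMSEQ_iff by blast

lemma FL_eqI: "(\<lambda>n. ev (f n)) \<longlonglongrightarrow> l \<Longrightarrow> FL f = l"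
  unfolding FL_def by (rule limI)

lemma FS_I: "(\<And>n. f n \<in> carrier W) \<Longrightarrow> (\<lambda>n. ev (f n)) \<longlonglongrightarrow> l \<Longrightarrow> f \<in> FS"
  unfolding FS_iff using LIMSEQ_imp_Cauchy by blast

lemma FS_carrier: "f \<in> FS \<Longrightarrow> f n \<in> carrier W"
  by (simp add: FS_iff)

definition FJ :: "(nat \<Rightarrow> ('a + 'b) list \<Rightarrow> complex) set" where "FJ = null_seqs sequentially FN FS"

lemma FJ_eq: "FJ = {f \<in> FS. FL f = 0}"
proof -
  have "((\<lambda>n. nrm FN (f n)) \<longlongrightarrow> 0) sequentially \<longleftrightarrow> FL f = 0" if f: "f \<in> FS" for f
  proof -
    have "((\<lambda>n. nrm FN (f n)) \<longlongrightarrow> 0) sequentially \<longleftrightarrow> (\<lambda>n. norm (ev (f n))) \<longlonglongrightarrow> 0"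
      using FS_carrier[OF f] by (simp add: gns_norm_eq)
    also have "\<dots> \<longleftrightarrow> (\<lambda>n. ev (f n)) \<longlonglongrightarrow> 0" by (rule tendsto_norm_zero_iff)
    also have "\<dots> \<longleftrightarrow> FL f = 0" using FL[OF f] FL_eqI[of f 0] by auto
    finally show ?thesis .
  qed
  then show ?thesis by (auto simp: FJ_def null_seqs_def)
qed

lemma FS_limits:
  assumes f: "f \<in> FS"
  shows "(\<lambda>n. ev (str W (f n))) \<longlonglongrightarrow> (FL f)\<^sup>\<star>" "(\<lambda>n. ev (\<lambda>w. c * f n w)) \<longlonglongrightarrow> c *\<^sub>C FL f"
    "(\<lambda>n. ev (\<lambda>w. - f n w)) \<longlonglongrightarrow> - FL f"
    and "g \<in> FS \<Longrightarrow> (\<lambda>n. ev (\<lambda>w. f n w + g n w)) \<longlonglongrightarrow> FL f + FL g"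
    and "g \<in> FS \<Longrightarrow> (\<lambda>n. ev (mult W (f n) (g n))) \<longlonglongrightarrow> FL f * FL g"
  using f by (simp_all add: W_str W_scl W_uminus W_add W_mult FS_carrier tendsto_adj tendsto_csc tendsto_minus
    tendsto_add tendsto_mult FL)

lemma FS_const: "x \<in> carrier W \<Longrightarrow> (\<lambda>_. x) \<in> FS" and FL_const: "FL (\<lambda>_. x) = ev x"
  by (auto intro: FS_I FL_eqI)

text \<open>By \<open>gns_norm_eq\<close>, Cauchy sequences of the word algebra are those whose
  evaluations are Cauchy in the complete type, so the reduced free product is identified with limits
  there.\<close>

sublocale fp: seq_quotient FN FS FJ FL "\<lambda>x w. - x w"
proof unfold_locales
  show "FJ = {f \<in> FS. FL f = 0}" by (rule FJ_eq)
  show "(\<lambda>_. \<one>\<^bsub>FN\<^esub>) \<in> FS" "(\<lambda>_. \<zero>\<^bsub>FN\<^esub>) \<in> FS" by (simp_all add: FS_const W_word_vec FW_Nil W_zero)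
  show "FL (\<lambda>_. \<one>\<^bsub>FN\<^esub>) = 1" "FL (\<lambda>_. \<zero>\<^bsub>FN\<^esub>) = 0" by (simp_all add: FL_const ev_word_vec ev_zero)
  fix f g assume f: "f \<in> FS" and g: "g \<in> FS"
  show "f i \<in> carrier FN" for i using FS_carrier[OF f] by simp
  show "(\<lambda>i. f i \<oplus>\<^bsub>FN\<^esub> g i) \<in> FS" "FL (\<lambda>i. f i \<oplus>\<^bsub>FN\<^esub> g i) = FL f + FL g"
    using FS_limits(4)[OF f g] FS_carrier[OF f] FS_carrier[OF g] by (simp_all add: FS_I FL_eqI W_add)
  show "(\<lambda>i. f i \<otimes>\<^bsub>FN\<^esub> g i) \<in> FS" "FL (\<lambda>i. f i \<otimes>\<^bsub>FN\<^esub> g i) = FL f * FL g"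
    using FS_limits(5)[OF f g] FS_carrier[OF f] FS_carrier[OF g] by (simp_all add: FS_I FL_eqI W_mult)
  show "(\<lambda>i. scl FN c (f i)) \<in> FS" "FL (\<lambda>i. scl FN c (f i)) = c *\<^sub>C FL f" for c
    using FS_limits(2)[OF f, of c] FS_carrier[OF f] by (simp_all add: FS_I FL_eqI W_scl)
  show "(\<lambda>i. str FN (f i)) \<in> FS" "FL (\<lambda>i. str FN (f i)) = (FL f)\<^sup>\<star>"
    using FS_limits(1)[OF f] FS_carrier[OF f] by (simp_all add: FS_I FL_eqI W_str)
  show "(\<lambda>i w. - f i w) \<in> FS"
    using FS_limits(3)[OF f] FS_carrier[OF f] by (simp add: FS_I W_uminus)
qed simp_all

lemma free_product_eq: "free_product M \<rho> N \<kappa> = fp.Q"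
  by (simp add: free_product_def completion_def FJ_def FS_def)

lemma fp_val_closure_gen: "X \<in> carrier fp.Q \<Longrightarrow> fp.val X \<in> closure gen"
proof (elim fp.carrierE)
  fix f assume f: "f \<in> FS" "X = fp.cls f"
  have "FL f \<in> closure gen"
    by (rule closed_sequentially[OF closed_closure _ FL[OF f(1)]]) (rule ev_closure_gen[OF FS_carrier[OF f(1)]])
  then show "fp.val X \<in> closure gen" using f by (simp add: fp.val_cls)
qed

lemma fp_state: assumes "X \<in> carrier fp.Q" shows "free_product_state M \<rho> N \<kappa> X = \<phi> (fp.val X)"
  using assms
proof (rule fp.carrierE)
  fix f assume f: "f \<in> FS" "X = fp.cls f"
  have lim: "(\<lambda>n. F (g n)) \<longlonglongrightarrow> \<phi> (FL f)" if "g \<in> X" for g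
  proof -
    have g: "g \<in> FS" "FL g = FL f" using that f by (simp_all add: fp.cls_eq)
    show ?thesis using tendsto_\<phi>[OF FL[OF g(1)]] FS_carrier[OF g(1)] by (simp add: F_eq g(2))
  qed
  have mem: "f \<in> X" using f by (simp add: fp.mem_cls)
  have v: "fp.val X = FL f" using f by (simp add: fp.val_cls)
  show "free_product_state M \<rho> N \<kappa> X = \<phi> (fp.val X)"
    unfolding free_product_state_def lim_state_def v
  proof (rule the_equality)
    show "\<forall>g\<in>X. (\<lambda>n. F (g n)) \<longlonglongrightarrow> \<phi> (FL f)" using lim by blast
    fix z assume "\<forall>g\<in>X. (\<lambda>n. F (g n)) \<longlonglongrightarrow> z"
    then have "(\<lambda>n. F (f n)) \<longlonglongrightarrow> z" using mem by (rule bspec)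
    then show "z = \<phi> (FL f)" using lim[OF mem] by (rule LIMSEQ_unique)
  qed
qed

lemma fp_letter: assumes x: "x \<in> carrier M <+> carrier N"
  shows "free_letter M \<rho> N \<kappa> x \<in> carrier fp.Q" "fp.val (free_letter M \<rho> N \<kappa> x) = letter x"
proof -
  have W: "word_vec [x] \<in> carrier W" using x by (simp add: W_word_vec FW_Cons FW_Nil)
  have eq: "free_letter M \<rho> N \<kappa> x = fp.cls (\<lambda>_. word_vec [x])"
    by (simp only: free_letter_def completion_embed_def seq_class_def fp.cls_def) (simp only: FJ_def FS_def)
  show "free_letter M \<rho> N \<kappa> x \<in> carrier fp.Q" unfolding eq fp.carrier_Q by (intro imageI FS_const W)
  show "fp.val (free_letter M \<rho> N \<kappa> x) = letter x"
    unfolding eq fp.val_cls[OF FS_const[OF W]] by (simp add: FL_const ev_word_vec)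
qed

text \<open>For each representative the norms of the terms tend to the norm of the limit, which
  their supremum dominates. This makes \<open>fp.val\<close> continuous.\<close>

lemma fp_norm_le: assumes "X \<in> carrier fp.Q" shows "norm (fp.val X) \<le> nrm fp.Q X"
  using assms
proof (rule fp.carrierE)
  fix f assume f: "f \<in> FS" "X = fp.cls f"
  have "norm (FL f) \<le> (INF g\<in>fp.cls f. SUP i. nrm FN (g i))"
  proof (rule cINF_greatest)
    show "fp.cls f \<noteq> {}" using fp.mem_cls[OF f(1)] by auto
    fix g assume "g \<in> fp.cls f"
    then have g: "g \<in> FS" "FL g = FL f" using f(1) by (simp_all add: fp.cls_eq)
    have eq: "nrm FN (g i) = norm (ev (g i))" for i using FS_carrier[OF g(1)] by (simp add: gns_norm_eq)
    have "Bseq (\<lambda>n. ev (g n))" using FL[OF g(1)] convergent_def convergent_imp_Bseq by blast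
    then obtain K where "\<And>n. norm (ev (g n)) \<le> K" by (auto simp: Bseq_def)
    then have bdd: "bdd_above (range (\<lambda>i. norm (ev (g i))))" by (intro bdd_aboveI2)
    have "norm (FL g) \<le> (SUP i. norm (ev (g i)))"
      by (rule LIMSEQ_le_const2[OF tendsto_norm[OF FL[OF g(1)]]]) (use cSUP_upper[OF _ bdd] in auto)
    then show "norm (FL f) \<le> (SUP i. nrm FN (g i))" by (simp only: eq g(2))
  qed
  then show "norm (fp.val X) \<le> nrm fp.Q X" unfolding f(2) fp.nrm_cls fp.val_cls[OF f(1)] .
qed

text \<open>Preimages of closed *-subalgebras are C*-subalgebras, which traps
  \<open>cstar_generated\<close> inside a preimage once the letters are there.\<close>

lemma fp_subalgebra:
  assumes V: "star_subalgebra V" "closed V"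
  shows "cstar_subalgebra fp.Q {X \<in> carrier fp.Q. fp.val X \<in> V}"
  unfolding cstar_subalgebra_def
proof (intro conjI ballI allI impI)
  show "subring {X \<in> carrier fp.Q. fp.val X \<in> V} fp.Q" by (rule fp.subring_vimage[OF V(1)])
  fix X assume X: "X \<in> {X \<in> carrier fp.Q. fp.val X \<in> V}"
  then show "scl fp.Q c X \<in> {X \<in> carrier fp.Q. fp.val X \<in> V}" for c
    by (simp add: fp.closed_rules fp.v_rules subalg_csc[OF V(1)])
  show "str fp.Q X \<in> {X \<in> carrier fp.Q. fp.val X \<in> V}"
    using X by (simp add: fp.closed_rules fp.v_rules subalg_adj[OF V(1)])
next
  fix f X assume X: "X \<in> carrier fp.Q"
    and f: "(\<forall>n. f n \<in> {X \<in> carrier fp.Q. fp.val X \<in> V}) \<and> converges_to fp.Q f X"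
  then have fc: "f n \<in> carrier fp.Q" and fV: "fp.val (f n) \<in> V" for n by auto
  have le: "norm (fp.val (f n) - fp.val X) \<le> nrm fp.Q (f n \<ominus>\<^bsub>fp.Q\<^esub> X)" for n
    using fp_norm_le[OF fp.a_minus_closed[OF fc X]] by (simp only: fp.v_a_minus[OF fc X])
  have "(\<lambda>n. nrm fp.Q (f n \<ominus>\<^bsub>fp.Q\<^esub> X)) \<longlonglongrightarrow> 0" using f by (simp add: converges_to_def)
  then have "(\<lambda>n. norm (fp.val (f n) - fp.val X)) \<longlonglongrightarrow> 0"
    by (rule Lim_null_comparison[rotated]) (simp add: le)
  then have "(\<lambda>n. fp.val (f n) - fp.val X) \<longlonglongrightarrow> 0" by (rule tendsto_norm_zero_cancel)
  then have "(\<lambda>n. fp.val (f n)) \<longlonglongrightarrow> fp.val X" by (simp only: Lim_null[symmetric])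
  from closed_sequentially[OF V(2) fV this] X show "X \<in> {X \<in> carrier fp.Q. fp.val X \<in> V}" by simp
qed

end

section \<open>Inclusions with the PHP property\<close>

lemma star_embedding_bounded_operators: "star_embedding bounded_operators (cop_of_blinfun :: ('h::complex_hilbert \<Rightarrow>\<^sub>L 'h) \<Rightarrow> _)"
proof -
  have E: "\<exists>t. T = blinfun_of_cop t" if "T \<in> carrier bounded_operators" for T :: "'h \<Rightarrow>\<^sub>L 'h"
    using that cop_of_blinfun_inverse[of T] by (metis carrier_bounded_operators)
  have I: "cop_of_blinfun (blinfun_of_cop t) = t" for t :: "'h cop" by (rule blinfun_of_cop_inverse)
  have C: "blinfun_of_cop t \<in> carrier bounded_operators" for t :: "'h cop"
    by (simp add: carrier_bounded_operators clinear_op_of_cop)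
  have ops: "blinfun_of_cop s \<oplus>\<^bsub>bounded_operators\<^esub> blinfun_of_cop t = blinfun_of_cop (s + t)"
    "blinfun_of_cop s \<otimes>\<^bsub>bounded_operators\<^esub> blinfun_of_cop t = blinfun_of_cop (s * t)"
    "scl bounded_operators c (blinfun_of_cop t) = blinfun_of_cop (c *\<^sub>C t)"
    "str bounded_operators (blinfun_of_cop t) = blinfun_of_cop (t\<^sup>\<star>)"
    "\<one>\<^bsub>bounded_operators\<^esub> = blinfun_of_cop (1 :: 'h cop)" "\<zero>\<^bsub>bounded_operators\<^esub> = blinfun_of_cop (0 :: 'h cop)" for s t :: "'h cop" and c
    by (simp_all add: bounded_operators_def plus_cop.rep_eq times_cop.rep_eq csc_cop.rep_eq adj_cop.rep_eq
      one_cop.rep_eq zero_cop.rep_eq scl_op_def)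
  have UN: "cop_of_blinfun ` carrier (bounded_operators :: ('h \<Rightarrow>\<^sub>L 'h) cstar) = UNIV"
  proof -
    have "t \<in> cop_of_blinfun ` carrier (bounded_operators :: ('h \<Rightarrow>\<^sub>L 'h) cstar)" for t :: "'h cop"
      using imageI[OF C[of t], of cop_of_blinfun] by (simp only: I)
    then show ?thesis by (intro UNIV_eq_I[symmetric])
  qed
  show ?thesis
  proof unfold_locales
    show "inj_on cop_of_blinfun (carrier (bounded_operators :: ('h \<Rightarrow>\<^sub>L 'h) cstar))"
      by (rule inj_onI) (use E I in metis)
    show "star_subalgebra (cop_of_blinfun ` carrier (bounded_operators :: ('h \<Rightarrow>\<^sub>L 'h) cstar))"
      unfolding UN by (simp add: star_subalgebra_def)
    fix x y :: "'h \<Rightarrow>\<^sub>L 'h" and c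
    assume "x \<in> carrier bounded_operators"
    then obtain s where x: "x = blinfun_of_cop s" using E by blast
    show "scl bounded_operators c x \<in> carrier bounded_operators" "str bounded_operators x \<in> carrier bounded_operators"
      "cop_of_blinfun (scl bounded_operators c x) = c *\<^sub>C cop_of_blinfun x"
      "cop_of_blinfun (str bounded_operators x) = (cop_of_blinfun x)\<^sup>\<star>" by (simp_all add: x ops C I)
    assume "y \<in> carrier bounded_operators"
    then obtain t where y: "y = blinfun_of_cop t" using E by blast
    show "x \<oplus>\<^bsub>bounded_operators\<^esub> y \<in> carrier bounded_operators" "x \<otimes>\<^bsub>bounded_operators\<^esub> y \<in> carrier bounded_operators"
      "cop_of_blinfun (x \<oplus>\<^bsub>bounded_operators\<^esub> y) = cop_of_blinfun x + cop_of_blinfun y"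
      "cop_of_blinfun (x \<otimes>\<^bsub>bounded_operators\<^esub> y) = cop_of_blinfun x * cop_of_blinfun y" by (simp_all add: x y ops C I)
  qed (simp_all add: ops C I)
qed

lemma nrm_bounded_operators: "x \<in> carrier bounded_operators \<Longrightarrow> nrm bounded_operators x = norm (cop_of_blinfun x)"
  by (simp add: bounded_operators_def norm_cop.rep_eq cop_of_blinfun_inverse clinear_op_def)

lemma cstar_subalgebra_image:
  fixes Q :: "('a, 'm) cstar_scheme" and v :: "'a \<Rightarrow> 'u::{cstar_alg, banach}"
  assumes Q: "star_embedding Q v" and n: "\<And>x. x \<in> carrier Q \<Longrightarrow> nrm Q x = norm (v x)" and cl: "closed (v ` carrier Q)"
    and B: "cstar_subalgebra Q B"
  shows "B \<subseteq> carrier Q \<and> star_subalgebra (v ` B) \<and> closed (v ` B)"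
proof -
  interpret star_embedding Q v by (rule Q)
  have sr: "subring B Q" using B by (simp add: cstar_subalgebra_def)
  interpret S: subring B Q by (rule sr)
  have sub: "B \<subseteq> carrier Q" by (rule submonoid.subset[OF subring.axioms(2)[OF sr]])
  have ops: "\<one>\<^bsub>Q\<^esub> \<in> B" "x \<in> B \<Longrightarrow> y \<in> B \<Longrightarrow> x \<oplus>\<^bsub>Q\<^esub> y \<in> B" "x \<in> B \<Longrightarrow> y \<in> B \<Longrightarrow> x \<otimes>\<^bsub>Q\<^esub> y \<in> B"
    "x \<in> B \<Longrightarrow> scl Q c x \<in> B" "x \<in> B \<Longrightarrow> str Q x \<in> B" for x y c
    using B subgroup.m_closed[OF subring.axioms(1)[OF sr], of x y] submonoid.m_closed[OF subring.axioms(2)[OF sr], of x y]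
      submonoid.one_closed[OF subring.axioms(2)[OF sr]]
    by (simp_all add: cstar_subalgebra_def)
  have "star_subalgebra (v ` B)"
    unfolding star_subalgebra_def
  proof (intro conjI ballI allI)
    show "1 \<in> v ` B" using imageI[OF ops(1), of v] by (simp add: v_rules)
  next
    fix x y assume "x \<in> v ` B" "y \<in> v ` B"
    then obtain a b where ab: "a \<in> B" "x = v a" "b \<in> B" "y = v b" by auto
    then have "a \<in> carrier Q" "b \<in> carrier Q" using sub by auto
    then show "x + y \<in> v ` B" "x * y \<in> v ` B"
      using imageI[OF ops(2)[OF ab(1,3)], of v] imageI[OF ops(3)[OF ab(1,3)], of v] ab by (simp_all add: v_rules)
  next
    fix x c assume "x \<in> v ` B"
    then obtain a where a: "a \<in> B" "x = v a" by auto
    then have "a \<in> carrier Q" using sub by auto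
    then show "x\<^sup>\<star> \<in> v ` B" "c *\<^sub>C x \<in> v ` B"
      using imageI[OF ops(5)[OF a(1)], of v] imageI[OF ops(4)[OF a(1), of c], of v] a by (simp_all add: v_rules)
  qed
  moreover have "closed (v ` B)"
    unfolding closed_sequential_limits
  proof (intro allI impI)
    fix X l assume X: "(\<forall>n. X n \<in> v ` B) \<and> X \<longlonglongrightarrow> l"
    then have "\<forall>n. \<exists>b. b \<in> B \<and> X n = v b" by blast
    then obtain f where f: "\<And>n. f n \<in> B" "\<And>n. X n = v (f n)" by metis
    have "X n \<in> v ` carrier Q" for n using f sub by auto
    then have "l \<in> v ` carrier Q" using closed_sequentially[OF cl] X by blast
    then obtain x where x: "x \<in> carrier Q" "l = v x" by (rule imageE)
    have fc: "f n \<in> carrier Q" for n using f sub by auto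
    have "X = (\<lambda>n. v (f n))" using f(2) by (rule ext)
    then have "(\<lambda>n. v (f n)) \<longlonglongrightarrow> v x" using X x(2) by simp
    then have "(\<lambda>n. v (f n) - v x) \<longlonglongrightarrow> 0" by (rule Lim_null[THEN iffD1])
    then have "(\<lambda>n. norm (v (f n) - v x)) \<longlonglongrightarrow> 0" by (rule tendsto_norm_zero)
    then have "converges_to Q f x"
      unfolding converges_to_def by (simp only: n[OF a_minus_closed[OF fc x(1)]] v_a_minus[OF fc x(1)])
    moreover have "\<forall>f. \<forall>x\<in>carrier Q. (\<forall>n. f n \<in> B) \<and> converges_to Q f x \<longrightarrow> x \<in> B"
      using B unfolding cstar_subalgebra_def by (elim conjE)
    ultimately have "x \<in> B" using f(1) x(1) by blast
    then show "l \<in> v ` B" using x(2) by simp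
  qed
  ultimately show ?thesis using sub by blast
qed

lemma gns_rep_faithful:
  assumes Q: "star_embedding Q v" and st: "cstar_state Q \<rho>" and inj: "inj_on (gns_rep Q \<rho>) (carrier Q)"
    and a: "a \<in> carrier Q"
    and null: "\<And>c. c \<in> carrier Q \<Longrightarrow> \<rho> (str Q (a \<otimes>\<^bsub>Q\<^esub> c) \<otimes>\<^bsub>Q\<^esub> (a \<otimes>\<^bsub>Q\<^esub> c)) = 0"
  shows "a = \<zero>\<^bsub>Q\<^esub>"
proof -
  interpret star_embedding Q v by (rule Q)
  define q where "q x = \<rho> (str Q x \<otimes>\<^bsub>Q\<^esub> x)" for x
  have q0: "q x \<in> \<real>\<^sub>\<ge>\<^sub>0" if "x \<in> carrier Q" for x using st that by (simp add: cstar_state_def q_def)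
  have add: "\<rho> (x \<oplus>\<^bsub>Q\<^esub> y) = \<rho> x + \<rho> y" if "x \<in> carrier Q" "y \<in> carrier Q" for x y
    using st that by (simp add: cstar_state_def)
  \<comment> \<open>The parallelogram law shows that null elements are closed under sums, in place
    of Cauchy-Schwarz.\<close>
  have par: "q (x \<oplus>\<^bsub>Q\<^esub> y) + q (x \<ominus>\<^bsub>Q\<^esub> y) = (q x + q x) + (q y + q y)" if xy: "x \<in> carrier Q" "y \<in> carrier Q" for x y
  proof -
    let ?s = "\<lambda>x. str Q x \<otimes>\<^bsub>Q\<^esub> x"
    have "?s (x \<oplus>\<^bsub>Q\<^esub> y) \<oplus>\<^bsub>Q\<^esub> ?s (x \<ominus>\<^bsub>Q\<^esub> y) = (?s x \<oplus>\<^bsub>Q\<^esub> ?s x) \<oplus>\<^bsub>Q\<^esub> (?s y \<oplus>\<^bsub>Q\<^esub> ?s y)"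
      using xy by (intro v_eqI) (simp_all add: closed_rules v_rules a_minus_closed v_a_minus algebra_simps)
    then have "\<rho> (?s (x \<oplus>\<^bsub>Q\<^esub> y) \<oplus>\<^bsub>Q\<^esub> ?s (x \<ominus>\<^bsub>Q\<^esub> y)) = \<rho> ((?s x \<oplus>\<^bsub>Q\<^esub> ?s x) \<oplus>\<^bsub>Q\<^esub> (?s y \<oplus>\<^bsub>Q\<^esub> ?s y))" by simp
    then show ?thesis using xy by (simp add: q_def add closed_rules a_minus_closed)
  qed
  have nullsum: "q (x \<oplus>\<^bsub>Q\<^esub> y) = 0" if xy: "x \<in> carrier Q" "y \<in> carrier Q" "q x = 0" "q y = 0" for x y
  proof -
    have "Re (q (x \<oplus>\<^bsub>Q\<^esub> y)) + Re (q (x \<ominus>\<^bsub>Q\<^esub> y)) = 0"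
      using par[OF xy(1,2)] xy(3,4) by (metis add_0 plus_complex.sel(1) zero_complex.sel(1))
    moreover have "q (x \<oplus>\<^bsub>Q\<^esub> y) \<in> \<real>\<^sub>\<ge>\<^sub>0" "q (x \<ominus>\<^bsub>Q\<^esub> y) \<in> \<real>\<^sub>\<ge>\<^sub>0"
      using xy by (simp_all add: q0 closed_rules a_minus_closed)
    ultimately show ?thesis by (auto simp: complex_nonneg_Reals_iff complex_eq_iff)
  qed
  have qneg: "q (a_inv Q x) = q x" if "x \<in> carrier Q" for x
  proof -
    have "str Q (a_inv Q x) \<otimes>\<^bsub>Q\<^esub> a_inv Q x = str Q x \<otimes>\<^bsub>Q\<^esub> x"
      using that by (intro v_eqI) (simp_all add: closed_rules v_rules a_inv_closed v_a_inv)
    then show ?thesis by (simp add: q_def)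
  qed
  have vec: "gns_vec Q \<rho> x = {b \<in> carrier Q. q b = 0}" if x: "x \<in> carrier Q" "q x = 0" for x
  proof (intro Set.set_eqI iffI)
    fix b assume "b \<in> gns_vec Q \<rho> x"
    then have b: "b \<in> carrier Q" "q (b \<ominus>\<^bsub>Q\<^esub> x) = 0" by (simp_all add: gns_vec_def q_def)
    have "b = (b \<ominus>\<^bsub>Q\<^esub> x) \<oplus>\<^bsub>Q\<^esub> x"
      using b x by (intro v_eqI) (simp_all add: closed_rules v_rules a_minus_closed v_a_minus)
    then have "q b = 0" using nullsum[of "b \<ominus>\<^bsub>Q\<^esub> x" x] b x by (simp add: a_minus_closed)
    then show "b \<in> {b \<in> carrier Q. q b = 0}" using b by simp
  next
    fix b assume b: "b \<in> {b \<in> carrier Q. q b = 0}"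
    then have "q (b \<ominus>\<^bsub>Q\<^esub> x) = 0" unfolding a_minus_def using x by (intro nullsum) (simp_all add: a_inv_closed qneg)
    then show "b \<in> gns_vec Q \<rho> x" using b by (simp add: gns_vec_def q_def)
  qed
  have rep: "gns_rep Q \<rho> a' = gns_rep Q \<rho> \<zero>\<^bsub>Q\<^esub>" if a': "a' \<in> carrier Q" "\<And>c. c \<in> carrier Q \<Longrightarrow> q (a' \<otimes>\<^bsub>Q\<^esub> c) = 0" for a'
  proof -
    have z: "q (\<zero>\<^bsub>Q\<^esub> \<otimes>\<^bsub>Q\<^esub> c) = 0" if "c \<in> carrier Q" for c
    proof -
      have "str Q (\<zero>\<^bsub>Q\<^esub> \<otimes>\<^bsub>Q\<^esub> c) \<otimes>\<^bsub>Q\<^esub> (\<zero>\<^bsub>Q\<^esub> \<otimes>\<^bsub>Q\<^esub> c) = scl Q 0 \<one>\<^bsub>Q\<^esub>"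
        using that by (intro v_eqI) (simp_all add: closed_rules v_rules)
      then show ?thesis using st by (simp add: q_def cstar_state_def one_closed)
    qed
    have "(\<Union>b\<in>X. gns_vec Q \<rho> (a' \<otimes>\<^bsub>Q\<^esub> b)) = (\<Union>b\<in>X. gns_vec Q \<rho> (\<zero>\<^bsub>Q\<^esub> \<otimes>\<^bsub>Q\<^esub> b))" if "X \<in> gns_vec Q \<rho> ` carrier Q" for X
    proof (rule SUP_cong[OF refl])
      fix b assume "b \<in> X"
      then have b: "b \<in> carrier Q" using that by (auto simp: gns_vec_def)
      show "gns_vec Q \<rho> (a' \<otimes>\<^bsub>Q\<^esub> b) = gns_vec Q \<rho> (\<zero>\<^bsub>Q\<^esub> \<otimes>\<^bsub>Q\<^esub> b)"
        using vec[of "a' \<otimes>\<^bsub>Q\<^esub> b"] vec[of "\<zero>\<^bsub>Q\<^esub> \<otimes>\<^bsub>Q\<^esub> b"] a' b z by (simp add: closed_rules)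
    qed
    then show ?thesis unfolding gns_rep_def by (rule restrict_ext)
  qed
  have "gns_rep Q \<rho> a = gns_rep Q \<rho> \<zero>\<^bsub>Q\<^esub>" using a null by (intro rep) (simp_all add: q_def)
  then show ?thesis using inj a zero_closed by (simp add: inj_on_eq_iff)
qed

text \<open>Equality of two representations at the vector of \<open>c\<close> says that the
  difference of \<open>a\<close> and \<open>a'\<close> times \<open>c\<close> is null; for all
  \<open>c\<close> this is the premise of \<open>faithful\<close>.\<close>

lemma faithful_gns_rep:
  assumes Q: "star_embedding Q v" and st: "state_on \<phi>" and \<rho>: "\<And>x. x \<in> carrier Q \<Longrightarrow> \<rho> x = \<phi> (v x)"
    and faithful: "\<And>a. a \<in> carrier Q \<Longrightarrow> (\<And>c. c \<in> carrier Q \<Longrightarrow> state_on.hn \<phi> (v a * v c) = 0) \<Longrightarrow> v a = 0"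
  shows "inj_on (gns_rep Q \<rho>) (carrier Q)"
proof (rule inj_onI)
  interpret star_embedding Q v by (rule Q)
  interpret state_on \<phi> by (rule st)
  have vec: "gns_vec Q \<rho> b = {b' \<in> carrier Q. hn (v b' - v b) = 0}" if b: "b \<in> carrier Q" for b
  proof -
    have "\<rho> (str Q (b' \<ominus>\<^bsub>Q\<^esub> b) \<otimes>\<^bsub>Q\<^esub> (b' \<ominus>\<^bsub>Q\<^esub> b)) = complex_of_real ((hn (v b' - v b))\<^sup>2)" if "b' \<in> carrier Q" for b'
    proof -
      let ?d = "b' \<ominus>\<^bsub>Q\<^esub> b"
      have d: "?d \<in> carrier Q" "v ?d = v b' - v b" using that b by (rule a_minus_closed v_a_minus)+
      have "\<rho> (str Q ?d \<otimes>\<^bsub>Q\<^esub> ?d) = \<phi> ((v ?d)\<^sup>\<star> * v ?d)" using d(1) by (simp add: \<rho> closed_rules v_rules)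
      then show ?thesis unfolding d(2) by (simp only: \<phi>_self)
    qed
    then show ?thesis unfolding gns_vec_def by (intro Collect_cong conj_cong refl) simp
  qed
  have rep: "gns_rep Q \<rho> a (gns_vec Q \<rho> b) = gns_vec Q \<rho> (a \<otimes>\<^bsub>Q\<^esub> b)" if ab: "a \<in> carrier Q" "b \<in> carrier Q" for a b
  proof -
    have same: "gns_vec Q \<rho> (a \<otimes>\<^bsub>Q\<^esub> b') = gns_vec Q \<rho> (a \<otimes>\<^bsub>Q\<^esub> b)" if "b' \<in> gns_vec Q \<rho> b" for b'
    proof -
      have b': "b' \<in> carrier Q" "hn (v b' - v b) = 0" using that ab by (simp_all add: vec)
      have n: "hn (v a * v b' - v a * v b) = 0" using hn_mult_null[OF b'(2), of "v a"] by (simp add: right_diff_distrib)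
      have e: "hn (x - v a * v b') = hn (x - v a * v b)" for x
      proof (rule hn_eqI)
        have "x - v a * v b' - (x - v a * v b) = - (v a * v b' - v a * v b)" by (simp add: algebra_simps)
        then show "hn (x - v a * v b' - (x - v a * v b)) = 0" by (simp only: hn_minus n)
      qed
      have "gns_vec Q \<rho> (a \<otimes>\<^bsub>Q\<^esub> b') = {x \<in> carrier Q. hn (v x - v a * v b') = 0}"
        using vec[OF mult_closed[OF ab(1) b'(1)]] v_mult[OF ab(1) b'(1)] by simp
      also have "\<dots> = {x \<in> carrier Q. hn (v x - v a * v b) = 0}" by (simp only: e)
      also have "\<dots> = gns_vec Q \<rho> (a \<otimes>\<^bsub>Q\<^esub> b)"
        using vec[OF mult_closed[OF ab]] v_mult[OF ab] by simp
      finally show ?thesis .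
    qed
    have "b \<in> gns_vec Q \<rho> b" using ab by (simp add: vec)
    then have ne: "gns_vec Q \<rho> b \<noteq> {}" by fast
    have "(\<Union>b'\<in>gns_vec Q \<rho> b. gns_vec Q \<rho> (a \<otimes>\<^bsub>Q\<^esub> b')) = gns_vec Q \<rho> (a \<otimes>\<^bsub>Q\<^esub> b)"
      by (rule SUP_eq_const[OF ne]) (rule same)
    then show ?thesis using ab by (simp add: gns_rep_def)
  qed
  fix a a' assume a: "a \<in> carrier Q" "a' \<in> carrier Q" and eq: "gns_rep Q \<rho> a = gns_rep Q \<rho> a'"
  have "hn (v a * v c - v a' * v c) = 0" if c: "c \<in> carrier Q" for c
  proof -
    have "gns_vec Q \<rho> (a \<otimes>\<^bsub>Q\<^esub> c) = gns_vec Q \<rho> (a' \<otimes>\<^bsub>Q\<^esub> c)" using rep[OF a(1) c] rep[OF a(2) c] eq by simp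
    moreover have "a \<otimes>\<^bsub>Q\<^esub> c \<in> gns_vec Q \<rho> (a \<otimes>\<^bsub>Q\<^esub> c)" using a c by (simp add: vec closed_rules)
    ultimately have "a \<otimes>\<^bsub>Q\<^esub> c \<in> gns_vec Q \<rho> (a' \<otimes>\<^bsub>Q\<^esub> c)" by simp
    then show ?thesis using a c by (simp add: vec closed_rules v_rules)
  qed
  then have "v (a \<ominus>\<^bsub>Q\<^esub> a') = 0"
    using a by (intro faithful) (simp_all add: a_minus_closed v_a_minus left_diff_distrib)
  then have "v a = v a'" using a by (simp add: v_a_minus)
  then show "a = a'" using a by (intro v_eqI)
qed

section \<open>The hypotheses of the theorem, carried over to the type of operators\<close>

locale php_inclusion =
  fixes AA BB :: "('h::complex_hilbert \<Rightarrow>\<^sub>L 'h) set" and \<rho> :: "('h \<Rightarrow>\<^sub>L 'h) \<Rightarrow> complex"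
  assumes AA: "cstar_subalgebra bounded_operators AA"
    and prob: "cstar_probability_space (bounded_operators\<lparr>carrier := AA\<rparr>) \<rho>"
    and BB: "cstar_subalgebra (bounded_operators\<lparr>carrier := AA\<rparr>) BB"
    and php_assm: "php_property AA \<rho> BB"
begin

abbreviation R :: "('h \<Rightarrow>\<^sub>L 'h) cstar" where "R \<equiv> bounded_operators\<lparr>carrier := AA\<rparr>"
abbreviation (input) v :: "('h \<Rightarrow>\<^sub>L 'h) \<Rightarrow> 'h cop" where "v \<equiv> cop_of_blinfun"
definition Ac :: "'h cop set" where "Ac = v ` AA"
definition Bc :: "'h cop set" where "Bc = v ` BB"
definition \<tau> :: "'h cop \<Rightarrow> complex" where "\<tau> t = \<rho> (blinfun_of_cop t)"

sublocale bo: star_embedding "bounded_operators :: ('h \<Rightarrow>\<^sub>L 'h) cstar" v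
  by (rule star_embedding_bounded_operators)

lemma vo: "v (blinfun_of_cop t) = t" by (rule blinfun_of_cop_inverse)

lemma ov: "T \<in> carrier bounded_operators \<Longrightarrow> blinfun_of_cop (v T) = T"
  by (simp add: carrier_bounded_operators cop_of_blinfun_inverse)

lemma of_cop_carrier: "blinfun_of_cop t \<in> carrier bounded_operators"
  by (simp add: carrier_bounded_operators clinear_op_of_cop)

lemma v_UNIV: "v ` carrier bounded_operators = UNIV"
proof -
  have "t \<in> v ` carrier bounded_operators" for t using imageI[OF of_cop_carrier[of t], of v] by (simp only: vo)
  then show ?thesis by (intro UNIV_eq_I[symmetric])
qed

lemma A_facts: "AA \<subseteq> carrier bounded_operators" "star_subalgebra Ac" "closed Ac"
  using cstar_subalgebra_image[OF star_embedding_bounded_operators nrm_bounded_operators _ AA]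
  unfolding v_UNIV Ac_def by simp_all

lemma AA_iff: "T \<in> AA \<longleftrightarrow> T \<in> carrier bounded_operators \<and> v T \<in> Ac"
proof
  assume "T \<in> carrier bounded_operators \<and> v T \<in> Ac"
  then obtain a where a: "a \<in> AA" "v T = v a" "T \<in> carrier bounded_operators" by (auto simp: Ac_def)
  then have "T = a" using A_facts(1) by (intro bo.v_eqI) auto
  then show "T \<in> AA" using a by simp
qed (use A_facts(1) in \<open>auto simp: Ac_def\<close>)

lemma of_cop_AA: "t \<in> Ac \<Longrightarrow> blinfun_of_cop t \<in> AA"
  by (simp add: AA_iff of_cop_carrier vo)

lemma v_Ac: "T \<in> AA \<Longrightarrow> v T \<in> Ac" by (simp add: Ac_def)

lemma ovA: "T \<in> AA \<Longrightarrow> blinfun_of_cop (v T) = T" by (simp add: AA_iff ov)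

lemma embedding_R: "star_embedding R v"
proof -
  have "{x \<in> carrier bounded_operators. v x \<in> Ac} = AA" using AA_iff by blast
  then show ?thesis using bo.restrict[OF A_facts(2)] by (simp add: v_UNIV)
qed

sublocale R: star_embedding R v by (rule embedding_R)

lemma nrm_R: "x \<in> AA \<Longrightarrow> nrm R x = norm (v x)"
  using A_facts(1) nrm_bounded_operators[of x] by auto

lemma B_facts: "BB \<subseteq> AA" "star_subalgebra Bc" "closed Bc"
  using cstar_subalgebra_image[OF embedding_R _ _ BB] nrm_R A_facts(3)
  by (simp_all add: Ac_def Bc_def)

lemma of_cop_BB: "t \<in> Bc \<Longrightarrow> blinfun_of_cop t \<in> BB"
  using B_facts(1) ovA by (auto simp: Bc_def)

lemma state_R: "cstar_state R \<rho>" and inj_R: "inj_on (gns_rep R \<rho>) (carrier R)"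
  using prob by (simp_all add: cstar_probability_space_def)

lemma \<tau>_v: "a \<in> AA \<Longrightarrow> \<tau> (v a) = \<rho> a" by (simp add: \<tau>_def ovA)

lemma AcE: assumes "x \<in> Ac" obtains a where "a \<in> carrier R" "a \<in> AA" "x = v a"
  using assms by (auto simp: Ac_def)

lemma \<tau>_form: assumes "a \<in> AA" shows "\<tau> ((v a)\<^sup>\<star> * v a) = \<rho> (str R a \<otimes>\<^bsub>R\<^esub> a)"
proof -
  have a: "a \<in> carrier R" using assms by simp
  then have "(v a)\<^sup>\<star> * v a = v (str R a \<otimes>\<^bsub>R\<^esub> a)" using R.v_mult[OF R.str_closed[OF a] a] R.v_str[OF a] by simp
  moreover have "str R a \<otimes>\<^bsub>R\<^esub> a \<in> AA" using R.mult_closed[OF R.str_closed[OF a] a] by simp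
  ultimately show ?thesis by (simp only: \<tau>_v)
qed

sublocale gns_faithful Ac \<tau>
proof unfold_locales
  show "star_subalgebra Ac" "closed Ac" by (rule A_facts)+
  fix x c assume "x \<in> Ac"
  then obtain a where a: "a \<in> carrier R" "a \<in> AA" "x = v a" by (rule AcE)
  have "scl R c a \<in> AA" using R.scl_closed[OF a(1)] by simp
  then have "\<tau> (v (scl R c a)) = c * \<rho> a" using state_R a(1) by (simp only: \<tau>_v cstar_state_def)
  then show "\<tau> (c *\<^sub>C x) = c * \<tau> x" using R.v_scl[OF a(1)] a by (simp add: \<tau>_v)
  show "\<tau> (x\<^sup>\<star> * x) \<in> \<real>\<^sub>\<ge>\<^sub>0"
    using state_R a(1) unfolding a(3) \<tau>_form[OF a(2)] by (simp only: cstar_state_def)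
  fix y assume "y \<in> Ac"
  then obtain b where b: "b \<in> carrier R" "b \<in> AA" "y = v b" by (rule AcE)
  have "a \<oplus>\<^bsub>R\<^esub> b \<in> AA" using R.add_closed[OF a(1) b(1)] by simp
  then have "\<tau> (v (a \<oplus>\<^bsub>R\<^esub> b)) = \<rho> a + \<rho> b" using state_R a(1) b(1) by (simp only: \<tau>_v cstar_state_def)
  then show "\<tau> (x + y) = \<tau> x + \<tau> y" using R.v_add[OF a(1) b(1)] a b by (simp add: \<tau>_v)
next
  have "\<one>\<^bsub>R\<^esub> \<in> AA" using R.one_closed by simp
  then have "\<tau> (v \<one>\<^bsub>R\<^esub>) = 1" using state_R by (simp only: \<tau>_v cstar_state_def)
  then show "\<tau> 1 = 1" using R.v_one by simp
next
  fix x assume "x \<in> Ac" and null: "\<And>c. c \<in> Ac \<Longrightarrow> \<tau> ((x * c)\<^sup>\<star> * (x * c)) = 0"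
  then obtain a where a: "a \<in> carrier R" "a \<in> AA" "x = v a" by (metis AcE)
  have "a = \<zero>\<^bsub>R\<^esub>"
  proof (rule gns_rep_faithful[OF embedding_R state_R inj_R a(1)])
    fix c assume c: "c \<in> carrier R"
    have ac: "a \<otimes>\<^bsub>R\<^esub> c \<in> AA" using R.mult_closed[OF a(1) c] by simp
    have "v c \<in> Ac" using c by (simp add: v_Ac)
    from null[OF this] show "\<rho> (str R (a \<otimes>\<^bsub>R\<^esub> c) \<otimes>\<^bsub>R\<^esub> (a \<otimes>\<^bsub>R\<^esub> c)) = 0"
      unfolding \<tau>_form[OF ac, symmetric] R.v_mult[OF a(1) c] a(3) .
  qed
  then show "x = 0" using a(3) R.v_zero by simp
qed

lemma v_ops:
  assumes "S \<in> carrier bounded_operators" "T \<in> carrier bounded_operators"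
  shows "v (S o\<^sub>L T) = v S * v T" "S o\<^sub>L T \<in> carrier bounded_operators"
  using bo.v_mult[OF assms] bo.mult_closed[OF assms] by (simp_all add: bounded_operators_def)

lemma v_cadjoint: "S \<in> carrier bounded_operators \<Longrightarrow> v (cadjoint S) = (v S)\<^sup>\<star>"
  and cadjoint_carrier: "S \<in> carrier bounded_operators \<Longrightarrow> cadjoint S \<in> carrier bounded_operators"
  using bo.v_str[of S] bo.str_closed[of S] by (simp_all add: bounded_operators_def)

lemma v_id: "v id_blinfun = 1" "id_blinfun \<in> carrier bounded_operators" "v 0 = 0"
  using bo.v_one bo.one_closed bo.v_zero by (simp_all add: bounded_operators_def)

lemma v_id_minus: assumes S: "S \<in> carrier bounded_operators"
  shows "v (id_blinfun - S) = 1 - v S" "id_blinfun - S \<in> carrier bounded_operators"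
proof -
  have "id_blinfun - S = blinfun_of_cop (1 - v S)" using S by (simp add: minus_cop.rep_eq one_cop.rep_eq ov)
  then show "v (id_blinfun - S) = 1 - v S" "id_blinfun - S \<in> carrier bounded_operators"
    by (simp_all add: vo of_cop_carrier)
qed

lemma projection_v: "projection P \<Longrightarrow> P \<in> carrier bounded_operators \<and> cop_projection (v P)"
  using v_ops(1)[of P P] v_cadjoint[of P] by (auto simp: projection_def cop_projection_def)

lemma op_le_v:
  assumes "op_le S T" "S \<in> carrier bounded_operators" "T \<in> carrier bounded_operators"
  shows "0 \<le> Re (cinner x (ap (v T - v S) x))"
proof -
  have "ap (v T - v S) x = blinfun_apply (T - S) x"
    using assms by (simp add: ap_def minus_cop.rep_eq ov)
  then show ?thesis using assms(1) by (auto simp: op_le_def complex_nonneg_Reals_iff)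
qed

text \<open>The conjugate of the projection \<open>E\<close> by a unitary is a projection below
  \<open>Q\<close>, hence absorbed by \<open>Q\<close>; multiplication by \<open>u\<close> from the
  right removes the outer adjoint.\<close>

lemma conjugate_le:
  assumes u: "(v u)\<^sup>\<star> * v u = 1" "u \<in> carrier bounded_operators"
    and E: "E \<in> carrier bounded_operators" "cop_projection (v E)" and Q: "projection Q"
    and le: "op_le (u o\<^sub>L E o\<^sub>L cadjoint u) Q"
  shows "v Q * (v u * v E) = v u * v E"
proof -
  let ?F = "v u * v E * (v u)\<^sup>\<star>"
  have F: "v (u o\<^sub>L E o\<^sub>L cadjoint u) = ?F" "u o\<^sub>L E o\<^sub>L cadjoint u \<in> carrier bounded_operators"
    using u E by (simp_all add: v_ops v_cadjoint cadjoint_carrier)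
  have E': "v E * v E = v E" "(v E)\<^sup>\<star> = v E" using E(2) by (simp_all add: cop_projection_def)
  have "?F * ?F = v u * (v E * (((v u)\<^sup>\<star> * v u) * v E)) * (v u)\<^sup>\<star>" by (simp only: mult.assoc)
  then have "?F * ?F = ?F" by (simp add: u(1) E')
  moreover have "?F\<^sup>\<star> = ?F" by (simp add: E' mult.assoc)
  ultimately have "cop_projection ?F" by (simp only: cop_projection_def simp_thms)
  then have "v Q * ?F = ?F"
    using op_le_v[OF le F(2)] projection_v[OF Q] by (intro cop_projection_le) (simp_all add: F(1))
  then have "(v Q * ?F) * v u = ?F * v u" by simp
  then have "v Q * (v u * (v E * ((v u)\<^sup>\<star> * v u))) = v u * (v E * ((v u)\<^sup>\<star> * v u))" by (simp only: mult.assoc)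
  then show ?thesis by (simp add: u(1))
qed

sublocale php Ac \<tau> Bc
proof unfold_locales
  show "star_subalgebra Bc" by (rule B_facts)
  show "Bc \<subseteq> Ac" using B_facts(1) by (auto simp: Ac_def Bc_def)
  fix F :: "'h cop set" and e :: real and n :: nat
  assume F: "finite F" "F \<subseteq> {x \<in> Ac. \<tau> x = 0}" and e: "0 < e"
  have "finite (blinfun_of_cop ` F) \<and> blinfun_of_cop ` F \<subseteq> {x \<in> AA. \<rho> x = 0} \<and> 0 < e"
    using F e of_cop_AA by (auto simp: \<tau>_def)
  note php_assm[unfolded php_property_def, rule_format, OF this, of n]
  then obtain u P Q where
    uPQ: "\<forall>i\<in>{1..n}. u i \<in> BB \<and> cstar_unitary bounded_operators (u i) \<and>
             projection (P i) \<and> projection (Q i) \<and> op_le (Q i) (P i)"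
    and orth: "\<forall>i\<in>{1..n}. \<forall>j\<in>{1..n}. i \<noteq> j \<longrightarrow> P i o\<^sub>L P j = 0"
    and le: "\<forall>i\<in>{1..n}. op_le (u i o\<^sub>L Q i o\<^sub>L cadjoint (u i)) (Q i) \<and>
             op_le (u i o\<^sub>L (id_blinfun - P i) o\<^sub>L cadjoint (u i)) (Q i)"
    and small: "\<forall>x\<in>blinfun_of_cop ` F. \<forall>i\<in>{1..n}. \<forall>j\<in>{1..n}. norm (P i o\<^sub>L x o\<^sub>L P j) < e"
    by (elim exE conjE)
  have U: "u i \<in> BB" "u i \<in> carrier bounded_operators" "(v (u i))\<^sup>\<star> * v (u i) = 1" "v (u i) * (v (u i))\<^sup>\<star> = 1"
    "projection (P i)" "projection (Q i)" "op_le (Q i) (P i)" if i: "i \<in> {1..n}" for i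
  proof -
    show *: "u i \<in> BB" "projection (P i)" "projection (Q i)" "op_le (Q i) (P i)" using uPQ i by blast+
    have c: "cstar_unitary bounded_operators (u i)" using uPQ i by blast
    then show uc: "u i \<in> carrier bounded_operators" by (simp add: cstar_unitary_def)
    have "cadjoint (u i) o\<^sub>L u i = id_blinfun" "u i o\<^sub>L cadjoint (u i) = id_blinfun"
      using c by (simp_all add: cstar_unitary_def bounded_operators_def)
    then have "v (cadjoint (u i) o\<^sub>L u i) = 1" "v (u i o\<^sub>L cadjoint (u i)) = 1" by (simp_all add: v_id)
    then show "(v (u i))\<^sup>\<star> * v (u i) = 1" "v (u i) * (v (u i))\<^sup>\<star> = 1"
      using uc by (simp_all add: v_ops v_cadjoint cadjoint_carrier)
  qed
  have "shift_family {1..n} (\<lambda>i. v (u i)) (\<lambda>i. v (P i)) (\<lambda>i. v (Q i))"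
    unfolding shift_family_def orthogonal_projections_def
  proof (intro conjI ballI impI)
    fix i assume i: "i \<in> {1..n}"
    note P = projection_v[OF U(5)[OF i]] and Q = projection_v[OF U(6)[OF i]]
    show "cop_projection (v (P i))" "cop_projection (v (Q i))" using P Q by simp_all
    show "(v (u i))\<^sup>\<star> * v (u i) = 1" "v (u i) * (v (u i))\<^sup>\<star> = 1" using U[OF i] by simp_all
    show "v (P i) * v (Q i) = v (Q i)"
      using op_le_v[OF U(7)[OF i]] P Q by (intro cop_projection_le) simp_all
    show "v (Q i) * (v (u i) * v (Q i)) = v (u i) * v (Q i)"
      using le i Q by (intro conjugate_le U[OF i]) simp_all
    have E: "v (id_blinfun - P i) = 1 - v (P i)" "id_blinfun - P i \<in> carrier bounded_operators"
      using P by (simp_all add: v_id_minus)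
    have "cop_projection (1 - v (P i))" using P by (simp add: cop_projection_def algebra_simps)
    then have "v (Q i) * (v (u i) * v (id_blinfun - P i)) = v (u i) * v (id_blinfun - P i)"
      using le i E by (intro conjugate_le U[OF i]) simp_all
    then show "v (Q i) * (v (u i) * (1 - v (P i))) = v (u i) * (1 - v (P i))" by (simp only: E)
    fix j assume j: "j \<in> {1..n}" and ne: "i \<noteq> j"
    have "P i o\<^sub>L P j = 0" using orth i j ne by blast
    then have "v (P i o\<^sub>L P j) = 0" by (simp add: v_id)
    then show "v (P i) * v (P j) = 0" using P projection_v[OF U(5)[OF j]] by (simp add: v_ops)
  qed
  moreover have "\<forall>i\<in>{1..n}. v (u i) \<in> Bc" using U(1) by (auto simp: Bc_def)
  moreover have "\<forall>x\<in>F. \<forall>i\<in>{1..n}. \<forall>j\<in>{1..n}. norm (v (P i) * x * v (P j)) < e"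
  proof (intro ballI)
    fix x i j assume x: "x \<in> F" and ij: "i \<in> {1..n}" "j \<in> {1..n}"
    have c: "P i \<in> carrier bounded_operators" "P j \<in> carrier bounded_operators"
      using projection_v U(5) ij by blast+
    have m: "P i o\<^sub>L blinfun_of_cop x o\<^sub>L P j \<in> carrier bounded_operators"
      "v (P i o\<^sub>L blinfun_of_cop x o\<^sub>L P j) = v (P i) * x * v (P j)"
      using c by (simp_all add: v_ops of_cop_carrier vo)
    have "norm (v (P i) * x * v (P j)) = norm (P i o\<^sub>L blinfun_of_cop x o\<^sub>L P j)"
      using m by (simp add: norm_cop.rep_eq ov flip: m(2))
    then show "norm (v (P i) * x * v (P j)) < e" using small x ij by simp
  qed
  ultimately show "\<exists>u P Q. (\<forall>i\<in>{1..n}. u i \<in> Bc) \<and> shift_family {1..n} u P Q \<and>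
        (\<forall>x\<in>F. \<forall>i\<in>{1..n}. \<forall>j\<in>{1..n}. norm (P i * x * P j) < e)"
    by (intro exI[of _ "\<lambda>i. v (u i)"] exI[of _ "\<lambda>i. v (P i)"] exI[of _ "\<lambda>i. v (Q i)"] conjI)
qed

subsection \<open>The ultrapower\<close>

definition US :: "(('h \<Rightarrow>\<^sub>L 'h) index \<Rightarrow> 'h \<Rightarrow>\<^sub>L 'h) set" where "US = bounded_seqs R"
definition UJ :: "(('h \<Rightarrow>\<^sub>L 'h) index \<Rightarrow> 'h \<Rightarrow>\<^sub>L 'h) set" where "UJ = null_seqs omega R US"
definition U\<Lambda> :: "(('h \<Rightarrow>\<^sub>L 'h) index \<Rightarrow> 'h \<Rightarrow>\<^sub>L 'h) \<Rightarrow> ('h \<Rightarrow>\<^sub>L 'h, 'h cop) ultra" where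
  "U\<Lambda> f = abs_ultra (\<lambda>i. v (f i))"

lemma carrier_R: "carrier R = AA" by simp

lemma US_iff: "f \<in> US \<longleftrightarrow> (\<forall>i. f i \<in> AA) \<and> bd (\<lambda>i. v (f i))"
proof (cases "\<forall>i. f i \<in> AA")
  case True
  then have "nrm R (f i) = norm (v (f i))" for i by (simp only: nrm_R)
  then show ?thesis using True unfolding US_def bounded_seqs_def bd_def mem_Collect_eq carrier_R by simp
next
  case False
  then show ?thesis unfolding US_def bounded_seqs_def mem_Collect_eq carrier_R by (simp only: simp_thms)
qed

lemma US_AA: "f \<in> US \<Longrightarrow> f i \<in> AA" and US_bd: "f \<in> US \<Longrightarrow> bd (\<lambda>i. v (f i))"
  unfolding US_iff by (elim conjE; erule spec) (elim conjE)

lemma US_lift: "bd f \<Longrightarrow> (\<And>i. f i \<in> Ac) \<Longrightarrow> (\<lambda>i. blinfun_of_cop (f i)) \<in> US"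
  and U\<Lambda>_lift: "U\<Lambda> (\<lambda>i. blinfun_of_cop (f i)) = abs_ultra f"
  by (simp_all add: US_iff of_cop_AA vo U\<Lambda>_def)

lemma UJ_eq: "UJ = {f \<in> US. U\<Lambda> f = 0}"
proof -
  have "((\<lambda>i. nrm R (f i)) \<longlongrightarrow> 0) omega \<longleftrightarrow> U\<Lambda> f = 0" if f: "f \<in> US" for f
  proof -
    have "(\<lambda>i. nrm R (f i)) = (\<lambda>i. norm (v (f i) - 0))" using US_AA[OF f] by (simp only: nrm_R diff_zero)
    then show ?thesis by (simp only: U\<Lambda>_def zero_ultra_def uabs_eq_iff[OF US_bd[OF f] bd_const])
  qed
  then show ?thesis by (auto simp: UJ_def null_seqs_def)
qed

lemma R_uminus: assumes "x \<in> AA" shows "- x \<in> AA" "v (- x) = - v x"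
proof -
  have e: "- x = blinfun_of_cop (- v x)" using assms by (simp add: uminus_cop.rep_eq ovA)
  show "v (- x) = - v x" unfolding e by (rule vo)
  show "- x \<in> AA" unfolding e using subalg_minus[OF A_facts(2) v_Ac[OF assms]] by (rule of_cop_AA)
qed

lemma v_R:
  assumes "x \<in> AA"
  shows "v (scl R c x) = c *\<^sub>C v x" "v (str R x) = (v x)\<^sup>\<star>" "scl R c x \<in> AA" "str R x \<in> AA"
    and "y \<in> AA \<Longrightarrow> v (x \<oplus>\<^bsub>R\<^esub> y) = v x + v y" "y \<in> AA \<Longrightarrow> v (x \<otimes>\<^bsub>R\<^esub> y) = v x * v y"
    and "y \<in> AA \<Longrightarrow> x \<oplus>\<^bsub>R\<^esub> y \<in> AA" "y \<in> AA \<Longrightarrow> x \<otimes>\<^bsub>R\<^esub> y \<in> AA"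
  using R.v_scl[of x c] R.v_str[of x] R.v_add[of x y] R.v_mult[of x y] R.scl_closed[of x c] R.str_closed[of x]
    R.add_closed[of x y] R.mult_closed[of x y] assms
  by simp_all

lemma R_add: "x \<oplus>\<^bsub>R\<^esub> y = x + y" and R_zero: "\<zero>\<^bsub>R\<^esub> = 0"
  by (simp_all add: bounded_operators_def)

sublocale up: seq_quotient R US UJ U\<Lambda> uminus
proof unfold_locales
  show "UJ = {f \<in> US. U\<Lambda> f = 0}" by (rule UJ_eq)
  have "\<one>\<^bsub>R\<^esub> \<in> AA" "\<zero>\<^bsub>R\<^esub> \<in> AA" using R.one_closed R.zero_closed by simp_all
  then show "(\<lambda>_. \<one>\<^bsub>R\<^esub>) \<in> US" "(\<lambda>_. \<zero>\<^bsub>R\<^esub>) \<in> US" by (simp_all only: US_iff bd_const simp_thms)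
  show "U\<Lambda> (\<lambda>_. \<one>\<^bsub>R\<^esub>) = 1" "U\<Lambda> (\<lambda>_. \<zero>\<^bsub>R\<^esub>) = 0" by (simp_all only: U\<Lambda>_def R.v_one R.v_zero one_ultra_def zero_ultra_def)
  fix f g assume f: "f \<in> US" and g: "g \<in> US"
  note fg = US_AA[OF f] US_AA[OF g] US_bd[OF f] US_bd[OF g]
  show "f i \<in> carrier R" for i using fg by simp
  show "(\<lambda>i. f i \<oplus>\<^bsub>R\<^esub> g i) \<in> US" "U\<Lambda> (\<lambda>i. f i \<oplus>\<^bsub>R\<^esub> g i) = U\<Lambda> f + U\<Lambda> g"
    unfolding US_iff U\<Lambda>_def using fg by (simp_all only: v_R bd_add uabs_plus simp_thms)
  show "(\<lambda>i. f i \<otimes>\<^bsub>R\<^esub> g i) \<in> US" "U\<Lambda> (\<lambda>i. f i \<otimes>\<^bsub>R\<^esub> g i) = U\<Lambda> f * U\<Lambda> g"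
    unfolding US_iff U\<Lambda>_def using fg by (simp_all only: v_R bd_mult uabs_times simp_thms)
  show "(\<lambda>i. scl R c (f i)) \<in> US" "U\<Lambda> (\<lambda>i. scl R c (f i)) = c *\<^sub>C U\<Lambda> f" for c
    unfolding US_iff U\<Lambda>_def using fg by (simp_all only: v_R bd_csc uabs_csc simp_thms)
  show "(\<lambda>i. str R (f i)) \<in> US" "U\<Lambda> (\<lambda>i. str R (f i)) = (U\<Lambda> f)\<^sup>\<star>"
    unfolding US_iff U\<Lambda>_def using fg by (simp_all only: v_R bd_adj uabs_adj simp_thms)
  show "(\<lambda>i. - f i) \<in> US"
    unfolding US_iff using fg by (simp only: R_uminus bd_uminus simp_thms)
qed (simp_all only: R_add R_zero diff_add_cancel right_minus flip: diff_conv_add_uminus)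

lemma ultrapower_eq: "ultrapower omega R = up.Q"
  by (simp only: ultrapower_def UJ_def US_def)

lemma up_image: "up.val ` carrier up.Q = ultra_set Ac"
  unfolding up.val_image
proof (intro Set.set_eqI iffI)
  fix u assume "u \<in> U\<Lambda> ` US"
  then obtain f where "f \<in> US" "u = U\<Lambda> f" by auto
  then show "u \<in> ultra_set Ac" unfolding U\<Lambda>_def by (auto intro!: ultra_setI US_bd v_Ac US_AA)
next
  fix u :: "('h \<Rightarrow>\<^sub>L 'h, 'h cop) ultra" assume "u \<in> ultra_set Ac"
  then obtain f where f: "bd f" "\<And>i. f i \<in> Ac" "u = abs_ultra f" by (rule ultra_setE) blast
  then show "u \<in> U\<Lambda> ` US" using US_lift[OF f(1,2)] U\<Lambda>_lift[of f] by (intro image_eqI[of _ _ "\<lambda>i. blinfun_of_cop (f i)"]) simp_all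
qed

text \<open>The quotient norm is an infimum of suprema, the norm of \<open>ultra\<close> a limit
  along \<open>omega\<close>. Representatives with all values below the limit plus \<open>e\<close>
  exist by \<open>ultra_set_small_rep\<close>.\<close>

lemma up_norm: assumes "X \<in> carrier up.Q" shows "nrm up.Q X = norm (up.val X)"
  using assms
proof (rule up.carrierE)
  fix f assume f: "f \<in> US" "X = up.cls f"
  define N where "N g = (SUP i. nrm R (g i))" for g :: "('h \<Rightarrow>\<^sub>L 'h) index \<Rightarrow> 'h \<Rightarrow>\<^sub>L 'h"
  have bdd: "bdd_above (range (\<lambda>i. nrm R (g i)))" if g: "g \<in> US" for g
  proof -
    obtain K where "\<forall>i. norm (v (g i)) \<le> K" using US_bd[OF g] unfolding bd_def by (rule exE)
    then show ?thesis using US_AA[OF g] by (intro bdd_aboveI2[of _ _ K]) (simp only: nrm_R)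
  qed
  have le: "norm (U\<Lambda> f) \<le> N g" if "g \<in> up.cls f" for g
  proof -
    have g: "g \<in> US" "U\<Lambda> g = U\<Lambda> f" using that f(1) by (simp_all add: up.cls_eq)
    have "norm (v (g i)) \<le> N g" for i
      using cSUP_upper[OF UNIV_I bdd[OF g(1)], of i] nrm_R[OF US_AA[OF g(1)], of i] by (simp only: N_def)
    then have "norm (U\<Lambda> g) \<le> N g" unfolding U\<Lambda>_def by (rule norm_uabs_le)
    then show ?thesis by (simp only: g(2))
  qed
  have "(INF g\<in>up.cls f. N g) = norm (U\<Lambda> f)"
  proof (rule antisym)
    show "norm (U\<Lambda> f) \<le> (INF g\<in>up.cls f. N g)"
      using up.mem_cls[OF f(1)] le by (intro cINF_greatest) auto
    show "(INF g\<in>up.cls f. N g) \<le> norm (U\<Lambda> f)"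
    proof (rule field_le_epsilon)
      fix e :: real assume e: "0 < e"
      have "U\<Lambda> f \<in> ultra_set Ac"
        unfolding U\<Lambda>_def by (intro ultra_setI US_bd[OF f(1)] v_Ac US_AA[OF f(1)])
      moreover have "norm (U\<Lambda> f) < norm (U\<Lambda> f) + e" using e by simp
      ultimately obtain h where h: "\<And>i. norm (h i) \<le> norm (U\<Lambda> f) + e" "\<And>i. h i \<in> Ac" "U\<Lambda> f = abs_ultra h"
        using ultra_set_small_rep[OF _ subalg_zero[OF A_facts(2)]] by metis
      let ?g = "\<lambda>i. blinfun_of_cop (h i)"
      have g: "?g \<in> up.cls f"
        using US_lift[OF bdI[OF h(1)] h(2)] U\<Lambda>_lift[of h] h(3) f(1) by (simp add: up.cls_eq)
      have "nrm R (?g i) \<le> norm (U\<Lambda> f) + e" for i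
        using nrm_R[OF of_cop_AA[OF h(2)], of i] h(1)[of i] by (simp only: vo)
      then have "N ?g \<le> norm (U\<Lambda> f) + e" unfolding N_def by (intro cSUP_least) auto
      moreover have "(INF g\<in>up.cls f. N g) \<le> N ?g"
        using le by (intro cINF_lower[OF _ g] bdd_belowI2[of _ "norm (U\<Lambda> f)"])
      ultimately show "(INF g\<in>up.cls f. N g) \<le> norm (U\<Lambda> f) + e" by linarith
    qed
  qed
  then show "nrm up.Q X = norm (up.val X)" unfolding f(2) up.nrm_cls up.val_cls[OF f(1)] by (simp only: N_def)
qed

text \<open>On the closure of \<open>gen\<close> the ultrapower state and the limit of vector states
  agree, whichever representative in \<open>A\<close> is used; the description in
  \<open>lim_state\<close> is then uniquely satisfied.\<close>

lemma up_state: assumes X: "X \<in> carrier up.Q" "up.val X \<in> closure gen" shows "lim_state omega \<rho> X = \<Phi> (up.val X)"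
  using X(1)
proof (rule up.carrierE)
  fix f assume f: "f \<in> US" "X = up.cls f"
  have val: "up.val X = U\<Lambda> f" using f(1) unfolding f(2) by (rule up.val_cls)
  have lim: "((\<lambda>i. \<rho> (g i)) \<longlongrightarrow> \<Phi> (up.val X)) omega" if "g \<in> X" for g
  proof -
    have g: "g \<in> US" "U\<Lambda> g = up.val X" using that f unfolding val by (simp_all add: up.cls_eq)
    have "((\<lambda>i. \<tau> (v (g i))) \<longlongrightarrow> \<Phi> (abs_ultra (\<lambda>i. v (g i)))) omega"
      using X(2) US_bd[OF g(1)] US_AA[OF g(1)] v_Ac unfolding g(2)[symmetric] U\<Lambda>_def
      by (intro closure_gen_state) auto
    then show ?thesis by (simp only: \<tau>_v[OF US_AA[OF g(1)]] g(2)[symmetric] U\<Lambda>_def)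
  qed
  have mem: "f \<in> X" using f by (simp add: up.mem_cls)
  show "lim_state omega \<rho> X = \<Phi> (up.val X)"
    unfolding lim_state_def
  proof (rule the_equality)
    show "\<forall>g\<in>X. ((\<lambda>i. \<rho> (g i)) \<longlongrightarrow> \<Phi> (up.val X)) omega" using lim by blast
    fix z assume "\<forall>g\<in>X. ((\<lambda>i. \<rho> (g i)) \<longlongrightarrow> z) omega"
    then have "((\<lambda>i. \<rho> (f i)) \<longlongrightarrow> z) omega" using mem by (rule bspec)
    then show "z = \<Phi> (up.val X)" using lim[OF mem] by (rule tendsto_unique[OF omega_not_bot])
  qed
qed

subsection \<open>The algebra of the semicircular element\<close>

text \<open>Realised on elements of the ultrapower record, the type that
  \<open>selfless_inclusion\<close> prescribes; its state is the restriction of the ultrapower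
  state.\<close>

definition C :: "(('h \<Rightarrow>\<^sub>L 'h) index \<Rightarrow> 'h \<Rightarrow>\<^sub>L 'h) set cstar" where
  "C = up.Q\<lparr>carrier := {X \<in> carrier up.Q. up.val X \<in> closure semi}\<rparr>"

lemma carrier_C: "carrier C = {X \<in> carrier up.Q. up.val X \<in> closure semi}"
  by (simp add: C_def)

lemma closure_semi_Ac: "closure semi \<subseteq> ultra_set Ac"
proof -
  have "closure semi \<subseteq> closure gen" by (rule closure_mono[OF semi_gen])
  then show ?thesis using closure_gen_subset by (rule order_trans)
qed

lemma embedding_C: "star_embedding C up.val"
  unfolding C_def
  by (rule up.restrict) (use closure_semi_Ac star_subalgebra_closure[OF star_subalgebra_semi] up_image in auto)

lemma image_C: "up.val ` carrier C = closure semi"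
  using closure_semi_Ac unfolding carrier_C up_image[symmetric] by auto

lemma \<kappa>_eq: "X \<in> carrier C \<Longrightarrow> lim_state omega \<rho> X = \<Phi> (up.val X)"
  using closure_mono[OF semi_gen] by (intro up_state) (auto simp: carrier_C)

lemma nrm_C: "X \<in> carrier C \<Longrightarrow> nrm C X = norm (up.val X)"
  using up_norm[of X] by (simp add: C_def)

sublocale C: star_embedding C up.val by (rule embedding_C)

lemma cstar_algebra_C: "cstar_algebra C"
  by (rule cstar_algebra_of_embedding[OF embedding_C nrm_C]) (simp_all add: image_C)

lemma probability_C: "cstar_probability_space C (lim_state omega \<rho>)"
  unfolding cstar_probability_space_def
proof (intro conjI cstar_algebra_C)
  show "cstar_state C (lim_state omega \<rho>)"
    unfolding cstar_state_def
    by (simp add: \<kappa>_eq C.closed_rules C.v_rules \<Phi>.\<phi>_add \<Phi>.\<phi>_self del: of_real_power)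
  show "inj_on (gns_rep C (lim_state omega \<rho>)) (carrier C)"
  proof (rule faithful_gns_rep[OF embedding_C state_\<Phi> \<kappa>_eq])
    fix a assume a: "a \<in> carrier C" and null: "\<And>c. c \<in> carrier C \<Longrightarrow> \<Phi>.hn (up.val a * up.val c) = 0"
    show "up.val a = 0"
    proof (rule semi_faithful)
      show "up.val a \<in> closure semi" using a by (simp add: carrier_C)
      fix z assume "z \<in> semi"
      then have "z \<in> up.val ` carrier C" unfolding image_C using closure_subset by blast
      then show "\<Phi>.hn (up.val a * z) = 0" using null by auto
    qed
  qed
qed

lemma C_not_scalars: "carrier C \<noteq> range (\<lambda>z. scl C z \<one>\<^bsub>C\<^esub>)"
proof
  assume eq: "carrier C = range (\<lambda>z. scl C z \<one>\<^bsub>C\<^esub>)"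
  have "UL + UL\<^sup>\<star> \<in> up.val ` carrier C" unfolding image_C using S_semi closure_subset by blast
  then obtain X where X: "X \<in> carrier C" "UL + UL\<^sup>\<star> = up.val X" by (rule imageE)
  then obtain z where "X = scl C z \<one>\<^bsub>C\<^esub>" using eq by auto
  then have "UL + UL\<^sup>\<star> = z *\<^sub>C 1" using X(2) by (simp add: C.closed_rules C.v_rules)
  then show False using S_not_scalar by blast
qed

text \<open>\<open>A\<close> enters through constant families and \<open>C\<close> through its own
  inclusion, both into the same type \<open>ultra\<close>. The free product is thus represented by
  elements that already belong to the ultrapower.\<close>

sublocale fe: free_embedding \<Phi> DA UL R "\<lambda>a. diagonal (v a)" C up.val \<rho> "lim_state omega \<rho>"
proof unfold_locales
  show "inj_on (\<lambda>a. diagonal (v a)) (carrier R)"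
    by (rule inj_onI) (use R.v_eqI in \<open>simp add: diagonal_inj\<close>)
  have im: "(\<lambda>a. diagonal (v a)) ` carrier R = DA" unfolding DA_def unfolding Ac_def image_image by simp
  then show "(\<lambda>a. diagonal (v a)) ` carrier R = DA" .
  show "star_subalgebra ((\<lambda>a. diagonal (v a)) ` carrier R)" unfolding im by (rule star_subalgebra_DA)
  show "up.val ` carrier C = closure semi" by (rule image_C)
  show "\<rho> a = \<Phi> (diagonal (v a))" if "a \<in> carrier R" for a
    using that by (simp add: \<Phi>_diagonal v_Ac \<tau>_v)
qed (simp_all only: R.closed_rules R.v_rules diagonal_ops \<kappa>_eq)

subsection \<open>The embedding of the free product\<close>

abbreviation "FP \<equiv> free_product R \<rho> C (lim_state omega \<rho>)"

text \<open>Both records embed into \<open>ultra\<close>; \<open>\<sigma>\<close> is the inclusion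
  of one image into the other, namely of part of the closure of \<open>gen\<close> into
  \<open>ultra_set Ac\<close>.\<close>

definition \<sigma> :: "(nat \<Rightarrow> (('h \<Rightarrow>\<^sub>L 'h) + (('h \<Rightarrow>\<^sub>L 'h) index \<Rightarrow> 'h \<Rightarrow>\<^sub>L 'h) set) list \<Rightarrow> complex) set
     \<Rightarrow> (('h \<Rightarrow>\<^sub>L 'h) index \<Rightarrow> 'h \<Rightarrow>\<^sub>L 'h) set" where
  "\<sigma> X = inv_into (carrier up.Q) up.val (fe.fp.val X)"

lemma \<sigma>: assumes "X \<in> carrier fe.fp.Q"
  shows "\<sigma> X \<in> carrier up.Q" "up.val (\<sigma> X) = fe.fp.val X"
proof -
  have "fe.fp.val X \<in> up.val ` carrier up.Q"
    unfolding up_image using fe.fp_val_closure_gen[OF assms] closure_gen_subset by blast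
  then show "\<sigma> X \<in> carrier up.Q" "up.val (\<sigma> X) = fe.fp.val X"
    unfolding \<sigma>_def by (rule inv_into_into, rule f_inv_into_f)
qed

lemma \<sigma>_eqI: "X \<in> carrier fe.fp.Q \<Longrightarrow> Y \<in> carrier up.Q \<Longrightarrow> up.val Y = fe.fp.val X \<Longrightarrow> \<sigma> X = Y"
  using up.v_eqI \<sigma> by metis

lemma \<sigma>_hom: "\<sigma> \<in> cstar_hom fe.fp.Q up.Q"
  unfolding cstar_hom_def
proof (intro CollectI conjI ballI allI ring_hom_memI)
  fix X Y assume X: "X \<in> carrier fe.fp.Q" and Y: "Y \<in> carrier fe.fp.Q"
  show "\<sigma> X \<in> carrier up.Q" using X by (rule \<sigma>)
  show "\<sigma> (X \<otimes>\<^bsub>fe.fp.Q\<^esub> Y) = \<sigma> X \<otimes>\<^bsub>up.Q\<^esub> \<sigma> Y" "\<sigma> (X \<oplus>\<^bsub>fe.fp.Q\<^esub> Y) = \<sigma> X \<oplus>\<^bsub>up.Q\<^esub> \<sigma> Y"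
    using \<sigma>[OF X] \<sigma>[OF Y] X Y
    by (intro \<sigma>_eqI; simp add: fe.fp.closed_rules fe.fp.v_rules up.closed_rules up.v_rules)+
next
  show "\<sigma> \<one>\<^bsub>fe.fp.Q\<^esub> = \<one>\<^bsub>up.Q\<^esub>"
    by (intro \<sigma>_eqI; simp add: fe.fp.closed_rules fe.fp.v_rules up.closed_rules up.v_rules)
next
  fix X assume X: "X \<in> carrier fe.fp.Q"
  show "\<sigma> (scl fe.fp.Q c X) = scl up.Q c (\<sigma> X)" for c
    using \<sigma>[OF X] X by (intro \<sigma>_eqI; simp add: fe.fp.closed_rules fe.fp.v_rules up.closed_rules up.v_rules)
  show "\<sigma> (str fe.fp.Q X) = str up.Q (\<sigma> X)"
    using \<sigma>[OF X] X by (intro \<sigma>_eqI; simp add: fe.fp.closed_rules fe.fp.v_rules up.closed_rules up.v_rules)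
qed

lemma \<sigma>_sub: assumes X: "X \<in> carrier fe.fp.Q" "fe.fp.val X \<in> ultra_set Bc" shows "\<sigma> X \<in> ultrapower_sub omega R BB"
proof -
  obtain h where h: "bd h" "\<And>i. h i \<in> Bc" "fe.fp.val X = abs_ultra h" using X(2) by (rule ultra_setE) blast
  have "Bc \<subseteq> Ac" unfolding Ac_def Bc_def by (rule image_mono[OF B_facts(1)])
  then have hA: "h i \<in> Ac" for i using h(2) by (rule subsetD)
  let ?g = "\<lambda>i. blinfun_of_cop (h i)"
  have g: "?g \<in> US" "U\<Lambda> ?g = fe.fp.val X" using US_lift[OF h(1) hA] U\<Lambda>_lift[of h] h(3) by simp_all
  have "\<sigma> X = up.cls ?g" by (rule \<sigma>_eqI[OF X(1)]) (simp_all add: up.carrier_Q g up.val_cls)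
  also have "\<dots> = seq_class omega R (bounded_seqs R) ?g"
    unfolding seq_class_def up.cls_def unfolding UJ_def US_def by (rule refl)
  finally show ?thesis
    unfolding ultrapower_sub_def using g(1) of_cop_BB[OF h(2)] by (auto simp: US_def)
qed

theorem selfless: "selfless_inclusion R \<rho> BB"
proof -
  have sub: "\<sigma> ` cstar_generated FP (free_letter R \<rho> C (lim_state omega \<rho>) ` (BB <+> carrier C)) \<subseteq> ultrapower_sub omega R BB"
  proof (rule image_subsetI)
    let ?V = "{X \<in> carrier fe.fp.Q. fe.fp.val X \<in> ultra_set Bc}"
    fix X assume X: "X \<in> cstar_generated FP (free_letter R \<rho> C (lim_state omega \<rho>) ` (BB <+> carrier C))"
    \<comment> \<open>\<open>cstar_generated\<close> is an intersection, so it is contained in this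
      one C*-subalgebra as soon as the letters from \<open>BB\<close> and \<open>C\<close>
      are.\<close>
    have "cstar_subalgebra fe.fp.Q ?V"
      by (rule fe.fp_subalgebra[OF star_subalgebra_ultra_set[OF B_facts(2)] closed_ultra_set[OF B_facts(3,2)]])
    moreover have "free_letter R \<rho> C (lim_state omega \<rho>) ` (BB <+> carrier C) \<subseteq> ?V"
    proof (rule image_subsetI)
      fix x assume x: "x \<in> BB <+> carrier C"
      then have x': "x \<in> carrier R <+> carrier C" using B_facts(1) by auto
      have "fe.letter x \<in> ultra_set Bc"
      proof (cases x)
        case (Inl b)
        then have "v b \<in> Bc" using x by (auto simp: Bc_def)
        then show ?thesis unfolding Inl fe.letter_simps unfolding diagonal_def by (intro ultra_setI) simp_all
      next
        case (Inr c)
        then show ?thesis using x closure_semi_subset[OF B_facts(3)] by (auto simp: carrier_C)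
      qed
      then show "free_letter R \<rho> C (lim_state omega \<rho>) x \<in> ?V" using fe.fp_letter[OF x'] by simp
    qed
    ultimately have "X \<in> ?V" using X unfolding cstar_generated_def fe.free_product_eq by blast
    then show "\<sigma> X \<in> ultrapower_sub omega R BB" by (intro \<sigma>_sub) simp_all
  qed
  have inj: "inj_on \<sigma> (carrier FP)"
    unfolding fe.free_product_eq
    by (rule inj_onI) (metis \<sigma>(2) fe.fp.v_eqI)
  have state: "\<forall>x\<in>carrier FP. lim_state omega \<rho> (\<sigma> x) = free_product_state R \<rho> C (lim_state omega \<rho>) x"
    unfolding fe.free_product_eq
    using \<sigma> fe.fp_val_closure_gen by (simp add: fe.fp_state up_state)
  have diag: "\<forall>a\<in>carrier R. \<sigma> (free_letter R \<rho> C (lim_state omega \<rho>) (Inl a)) = ultrapower_diag omega R a"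
  proof
    fix a assume a: "a \<in> carrier R"
    have l: "Inl a \<in> carrier R <+> carrier C" using a by (rule InlI)
    have aS: "(\<lambda>_. a) \<in> US" using a by (simp add: US_iff)
    have eq: "ultrapower_diag omega R a = up.cls (\<lambda>_. a)"
      unfolding ultrapower_diag_def seq_class_def up.cls_def unfolding UJ_def US_def by (rule refl)
    show "\<sigma> (free_letter R \<rho> C (lim_state omega \<rho>) (Inl a)) = ultrapower_diag omega R a"
      unfolding eq
    proof (rule \<sigma>_eqI[OF fe.fp_letter(1)[OF l]])
      show "up.cls (\<lambda>_. a) \<in> carrier up.Q" using aS by (simp add: up.carrier_Q)
      show "up.val (up.cls (\<lambda>_. a)) = fe.fp.val (free_letter R \<rho> C (lim_state omega \<rho>) (Inl a))"
        unfolding up.val_cls[OF aS] fe.fp_letter(2)[OF l] fe.letter_simps unfolding U\<Lambda>_def diagonal_def by (rule refl)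
    qed
  qed
  have hom: "\<sigma> \<in> cstar_hom FP (ultrapower omega R)"
    unfolding fe.free_product_eq ultrapower_eq by (rule \<sigma>_hom)
  show ?thesis
    unfolding selfless_inclusion_def
    by (rule exI[of _ omega], rule exI[of _ C], rule exI[of _ "lim_state omega \<rho>"], rule exI[of _ \<sigma>])
      (intro conjI free_ultrafilter_omega probability_C C_not_scalars hom inj state diag sub)
qed

end

theorem theorem3p3:
  fixes A B :: "('h::complex_hilbert \<Rightarrow>\<^sub>L 'h) set"
    and \<rho> :: "('h \<Rightarrow>\<^sub>L 'h) \<Rightarrow> complex"
  assumes "cstar_subalgebra bounded_operators A"
    and "cstar_probability_space (bounded_operators\<lparr>carrier := A\<rparr>) \<rho>"
    and "cstar_subalgebra (bounded_operators\<lparr>carrier := A\<rparr>) B"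
    and "php_property A \<rho> B"
  shows "selfless_inclusion (bounded_operators\<lparr>carrier := A\<rparr>) \<rho> B"
  by (rule php_inclusion.selfless[OF php_inclusion.intro[OF assms]])

end
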